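(* Let $p>5$ be an integer, and let $(U^A)_{A\in\mathbb{R}}$ be the family of special solutions of $\partial_t u+\partial_x^3u+\partial_x(u^p)=0$ described in the context. Up to translations in time and in space, there are only three special solutions: $U^1$, $U^{-1}$ and $Q(\cdot-t)$. More precisely, one has (for $t$ large enough in each case): (a) If $A>0$, then $U^A(t)=U^1(t+t_A,\cdot+t_A)$ for some $t_A\in\mathbb{R}$. (b) If $A=0$, then $U^0(t)=Q(\cdot-t)$. (c) If $A<0$, then $U^A(t)=U^{-1}(t+t_A,\cdot+t_A)$ for some $t_A\in\mathbb{R}$.
   Context: The equation is the generalized Korteweg-de Vries equation (gKdV), $u$ real valued. "Solution" means $H^1$ solution in the sense of Kenig–Ponce–Vega: the Cauchy problem is locally well posed in $H^1(\mathbb{R})$, the solution is continuous in time with values in $H^1(\mathbb{R})$ and unique in some class $Y_T\subset C^0([0,T],H^1(\mathbb{R}))$. $Q(x)=\left(\frac{p+1}{2\cosh^2\left(\frac{p-1}{2}x\right)}\right)^{\frac1{p-1}}$ is the unique positive even $H^1$ solution of $Q''+Q^p=Q$. Set $La=-\partial_x^2a+a-pQ^{p-1}a$ and $\mathcal{L}a=-\partial_x(La)$ on $L^2(\mathbb{R})$. By a result of Pego and Weinstein, for $p>5$, $\sigma(\mathcal{L})\cap\mathbb{R}=\{-e_0,0,e_0\}$ with $e_0>0$, and $e_0$ is a simple eigenvalue with real eigenfunction $\mathcal{Y}_+$ (fixed once and for all), $\mathcal{L}\mathcal{Y}_+=e_0\mathcal{Y}_+$. Family of special solutions: for each $A\in\mathbb{R}$,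 $U^A$ is a solution of (gKdV), defined on $[t_0(A),+\infty)$ for some $t_0(A)\in\mathbb{R}$, such that for all $s\in\mathbb{R}$ there is $C>0$ with $\|U^A(t,\cdot+t)-Q-Ae^{-e_0t}\mathcal{Y}_+\|_{H^s}\le Ce^{-2e_0t}$ for all $t\ge t_0(A)$. The paper proves that such a family exists and that every solution $u$ with $\inf_{y\in\mathbb{R}}\|u(t)-Q(\cdot-y)\|_{H^1}\to0$ as $t\to+\infty$ coincides for large $t$ with $U^A(t,\cdot-x_0)$ for some $A,x_0\in\mathbb{R}$. *)

theory Defs
  imports "HOL-Analysis.Analysis"
begin

text \<open>
  Elements of \<open>L\<^sup>2(\<real>)\<close> and of the Sobolev spaces are represented by Borel functions on the real
  line; equality of two elements is almost everywhere equality.  Real-valued functions are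
  regarded as complex-valued ones through \<open>cplx\<close>.
\<close>

abbreviation cplx :: "(real \<Rightarrow> real) \<Rightarrow> real \<Rightarrow> complex" where
  "cplx f \<equiv> (\<lambda>x. complex_of_real (f x))"

definition L2 :: "(real \<Rightarrow> complex) set" where
  "L2 = {f \<in> borel_measurable lborel. integrable lborel (\<lambda>x. (cmod (f x))\<^sup>2)}"

definition L2_norm :: "(real \<Rightarrow> complex) \<Rightarrow> real" where
  "L2_norm f = sqrt (LINT x|lborel. (cmod (f x))\<^sup>2)"


section \<open>Sobolev spaces\<close>

text \<open>
  The Fourier--Plancherel transform of \<open>f \<in> L\<^sup>2\<close>, with the unitary normalisation: the limit in
  \<open>L\<^sup>2\<close>, as \<open>R\<close> tends to infinity, of the Fourier integrals of \<open>f\<close> truncated to \<open>[-R, R]\<close>.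
  By Plancherel's theorem it exists and is unique up to a null set for every \<open>f \<in> L\<^sup>2\<close>.
\<close>

definition truncated_fourier :: "(real \<Rightarrow> complex) \<Rightarrow> real \<Rightarrow> real \<Rightarrow> complex" where
  "truncated_fourier f R \<xi> =
     complex_of_real (1 / sqrt (2 * pi)) * (LINT x:{-R..R}|lborel. f x * cis (- (x * \<xi>)))"

definition is_fourier :: "(real \<Rightarrow> complex) \<Rightarrow> (real \<Rightarrow> complex) \<Rightarrow> bool" where
  "is_fourier f F \<longleftrightarrow> F \<in> L2 \<and>
     ((\<lambda>R. \<integral>\<^sup>+ \<xi>. ennreal ((cmod (F \<xi> - truncated_fourier f R \<xi>))\<^sup>2) \<partial>lborel) \<longlongrightarrow> 0) at_top"

definition fourier :: "(real \<Rightarrow> complex) \<Rightarrow> real \<Rightarrow> complex" where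
  "fourier f = (SOME F. is_fourier f F)"

text \<open>
  \<open>Sob s\<close> is \<open>H\<^sup>s \<inter> L\<^sup>2\<close>, which is \<open>H\<^sup>s\<close> for \<open>s \<ge> 0\<close>.  For \<open>s < 0\<close> the elements of \<open>H\<^sup>s\<close>
  that are not in \<open>L\<^sup>2\<close> are left out; below, the \<open>H\<^sup>s\<close> norm is only ever applied to functions
  that are in \<open>L\<^sup>2\<close>.
\<close>

definition Sob :: "real \<Rightarrow> (real \<Rightarrow> complex) set" where
  "Sob s = {f \<in> L2. integrable lborel (\<lambda>\<xi>. (1 + \<xi>\<^sup>2) powr s * (cmod (fourier f \<xi>))\<^sup>2)}"

definition Sob_norm :: "real \<Rightarrow> (real \<Rightarrow> complex) \<Rightarrow> real" where
  "Sob_norm s f = sqrt (LINT \<xi>|lborel. (1 + \<xi>\<^sup>2) powr s * (cmod (fourier f \<xi>))\<^sup>2)"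


section \<open>Weak derivatives\<close>

definition test_functions :: "(real \<Rightarrow> real) set" where
  "test_functions = {\<phi>. (\<forall>n x. (deriv ^^ n) \<phi> differentiable (at x)) \<and>
                        (\<exists>R. \<forall>x. R < \<bar>x\<bar> \<longrightarrow> \<phi> x = 0)}"

definition locally_integrable :: "(real \<Rightarrow> complex) \<Rightarrow> bool" where
  "locally_integrable f \<longleftrightarrow> f \<in> borel_measurable lborel \<and> (\<forall>R. set_integrable lborel {-R..R} f)"

definition has_weak_deriv :: "(real \<Rightarrow> complex) \<Rightarrow> (real \<Rightarrow> complex) \<Rightarrow> bool" where
  "has_weak_deriv f g \<longleftrightarrow> locally_integrable f \<and> locally_integrable g \<and>
     (\<forall>\<phi>\<in>test_functions.
        (LINT x|lborel. f x * complex_of_real (deriv \<phi> x)) =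
        - (LINT x|lborel. g x * complex_of_real (\<phi> x)))"

definition weak_deriv :: "(real \<Rightarrow> complex) \<Rightarrow> real \<Rightarrow> complex" where
  "weak_deriv f = (SOME g. has_weak_deriv f g)"


section \<open>The soliton and the linearised operator\<close>

definition Q :: "nat \<Rightarrow> real \<Rightarrow> real" where
  "Q p x = ((real p + 1) / (2 * (cosh ((real p - 1) / 2 * x))\<^sup>2)) powr (1 / (real p - 1))"

definition op_L :: "nat \<Rightarrow> (real \<Rightarrow> complex) \<Rightarrow> real \<Rightarrow> complex" where
  "op_L p a = (\<lambda>x. - weak_deriv (weak_deriv a) x + a x
                    - of_nat p * complex_of_real (Q p x ^ (p - 1)) * a x)"

definition lin_op :: "nat \<Rightarrow> (real \<Rightarrow> complex) \<Rightarrow> real \<Rightarrow> complex" where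
  "lin_op p a = (\<lambda>x. - weak_deriv (op_L p a) x)"

text \<open>
  \<open>lin_op p\<close> is an unbounded operator on the complex space \<open>L\<^sup>2\<close> with domain \<open>H\<^sup>3 = Sob 3\<close>.  A point
  \<open>\<mu>\<close> is in its resolvent set iff \<open>lin_op p - \<mu>\<close> maps \<open>H\<^sup>3\<close> onto \<open>L\<^sup>2\<close> and has a bounded inverse;
  the estimate below also expresses injectivity.
\<close>

definition lin_resolvent_set :: "nat \<Rightarrow> complex set" where
  "lin_resolvent_set p = {\<mu>.
     (\<forall>f\<in>L2. \<exists>a\<in>Sob 3. AE x in lborel. lin_op p a x - \<mu> * a x = f x) \<and>
     (\<exists>C. \<forall>a\<in>Sob 3. L2_norm a \<le> C * L2_norm (\<lambda>x. lin_op p a x - \<mu> * a x))}"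

definition lin_spectrum :: "nat \<Rightarrow> complex set" where
  "lin_spectrum p = - lin_resolvent_set p"

definition eigenfunction :: "nat \<Rightarrow> complex \<Rightarrow> (real \<Rightarrow> complex) \<Rightarrow> bool" where
  "eigenfunction p \<mu> y \<longleftrightarrow> y \<in> Sob 3 \<and> \<not> (AE x in lborel. y x = 0) \<and>
     (AE x in lborel. lin_op p y x = \<mu> * y x)"

text \<open>
  Simplicity is algebraic: the eigenspace is spanned by one function \<open>y\<close>, and there is no Jordan
  chain above \<open>y\<close>.
\<close>

definition simple_eigenvalue :: "nat \<Rightarrow> complex \<Rightarrow> bool" where
  "simple_eigenvalue p \<mu> \<longleftrightarrow> (\<exists>y. eigenfunction p \<mu> y \<and>
     (\<forall>z. eigenfunction p \<mu> z \<longrightarrow> (\<exists>c. AE x in lborel. z x = c * y x)) \<and>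
     \<not> (\<exists>a\<in>Sob 3. AE x in lborel. lin_op p a x - \<mu> * a x = y x))"


section \<open>Solutions of gKdV\<close>

text \<open>
  \<open>u\<close> is an \<open>H\<^sup>1\<close> solution of \<open>\<partial>\<^sub>t u + \<partial>\<^sub>x\<^sup>3 u + \<partial>\<^sub>x (u\<^sup>p) = 0\<close> on \<open>[t0, \<infinity>)\<close>: it is continuous in time
  with values in \<open>H\<^sup>1\<close>, and the equation holds at each time in the sense of distributions in \<open>x\<close>
  (one-sided time derivative at \<open>t0\<close>).  The values \<open>u t\<close> for \<open>t < t0\<close> are irrelevant.
\<close>

definition gkdv_solution :: "nat \<Rightarrow> real \<Rightarrow> (real \<Rightarrow> real \<Rightarrow> real) \<Rightarrow> bool" where
  "gkdv_solution p t0 u \<longleftrightarrow>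
     (\<forall>t\<ge>t0. cplx (u t) \<in> Sob 1) \<and>
     (\<forall>t\<ge>t0. ((\<lambda>s. Sob_norm 1 (cplx (\<lambda>x. u s x - u t x))) \<longlongrightarrow> 0) (at t within {t0..})) \<and>
     (\<forall>\<phi>\<in>test_functions. \<forall>t\<ge>t0.
        ((\<lambda>s. LINT x|lborel. u s x * \<phi> x) has_real_derivative
           (LINT x|lborel. u t x * (deriv ^^ 3) \<phi> x + u t x ^ p * deriv \<phi> x))
        (at t within {t0..}))"

text \<open>
  \<open>U A t x\<close> is the value at \<open>(t, x)\<close> of the special solution with parameter \<open>A\<close>, which is defined
  for \<open>t \<ge> t0 A\<close>.
\<close>

definition special_family ::
  "nat \<Rightarrow> real \<Rightarrow> (real \<Rightarrow> real) \<Rightarrow> (real \<Rightarrow> real) \<Rightarrow> (real \<Rightarrow> real \<Rightarrow> real \<Rightarrow> real) \<Rightarrow> bool" where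
  "special_family p e0 Yp t0 U \<longleftrightarrow> (\<forall>A.
     gkdv_solution p (t0 A) (U A) \<and>
     (\<forall>s. \<exists>C>0. \<forall>t\<ge>t0 A.
        (let r = cplx (\<lambda>x. U A t (x + t) - Q p x - A * exp (- e0 * t) * Yp x)
         in r \<in> Sob s \<and> Sob_norm s r \<le> C * exp (- 2 * e0 * t))))"

end

theory Submission
  imports Defs "HOL-Probability.Probability" "HOL-Real_Asymp.Real_Asymp"
begin

text \<open>
  In the frame moving with the soliton, \<open>v(t, x) = U(t, x + t)\<close>, a time shift by \<open>\<tau>\<close> multiplies the parameter \<open>A\<close>
  by \<open>exp (- e\<^sub>0 \<tau>)\<close>, and the soliton has parameter \<open>0\<close>.  So everything follows once two solutions with the
  same parameter are shown to agree for large times.  Their difference \<open>w = O(exp (- 2 e\<^sub>0 t))\<close> solves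
  \<open>w\<^sub>t = \<partial>\<^sub>x (L w - g w)\<close> with \<open>g = O(exp (- e\<^sub>0 t))\<close>.  Suppose that \<open>w\<close> has size at most \<open>M exp (- 2 e\<^sub>0 t)\<close> in \<open>H\<^sup>1\<close>.
  Both \<open>(w, L Y)\<close> and the energy \<open>(L w, w)\<close> satisfy ordinary differential equations in time whose error
  terms are smaller by a factor \<open>exp (- e\<^sub>0 t)\<close>, so they are \<open>O(M exp (- 3 e\<^sub>0 t))\<close> and \<open>O(M\<^sup>2 exp (- 5 e\<^sub>0 t))\<close>.
  As \<open>Y(0) \<noteq> 0\<close>, subtracting a multiple \<open>b Y\<close> from \<open>w\<close> gives \<open>z\<close> with \<open>z(0) = 0\<close>, and \<open>(L z, z) = O(M\<^sup>2 exp (- 5 e\<^sub>0 t))\<close>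
  because \<open>(L Y, Y) = 0\<close>.  On functions vanishing at the origin the quadratic form is a sum over the two half
  lines of squares whose kernel is spanned by \<open>Q'\<close>, so \<open>w\<close> is close to \<open>b Y + c\<^sub>\<plusminus> Q'\<close> there.  Pairing with test
  functions supported in a half line yields equations for \<open>b\<close> and \<open>c\<^sub>\<plusminus>\<close>, and in total \<open>w\<close> is at most
  \<open>C M exp (- 5/2 e\<^sub>0 t)\<close> with \<open>C\<close> independent of \<open>M\<close>.  Iterating forces \<open>w = 0\<close> for large \<open>t\<close>.
\<close>

section \<open>Real square integrable functions\<close>

text \<open>The obstacle is that the form \<open>(L w, w)\<close> has a negative direction and a
  kernel. Positivity is not taken from orthogonality conditions but from a pointwise one:
  \<open>Q'\<close> is annihilated by L and vanishes only at 0, so factorising the form by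
  \<open>Q'\<close> makes it a square on either side of 0, provided the function vanishes there. The
  price is that the kernel coefficients on the two sides are unrelated, hence three numbers to
  recover, each with a test function of its own. The exponent 5/2 is half of 5: the energy is
  quadratic in w and gains one factor exp(-e0 t) over the square of exp(-2 e0 t). The gain exp(-e0
  t/2) beats the constant C from a time on that does not depend on M, so a single time serves all
  iterations. Each differential equation is integrated from t = infinity, where the decay exp(-2 e0
  t) excludes the homogeneous solutions. The second obstacle is that solutions are weak: regularity
  in x is taken from the H^s estimate of the remainder with s = 5, and time derivatives exist only
  for pairings, from which the derivative of the energy has to be built.\<close>

definition sqint :: "(real \<Rightarrow> real) \<Rightarrow> bool" where
  "sqint f \<longleftrightarrow> f \<in> borel_measurable borel \<and> integrable lborel (\<lambda>x. (f x)\<^sup>2)"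

definition ip :: "(real \<Rightarrow> real) \<Rightarrow> (real \<Rightarrow> real) \<Rightarrow> real" where
  "ip f g = (LINT x|lborel. f x * g x)"

definition nrm :: "(real \<Rightarrow> real) \<Rightarrow> real" where
  "nrm f = sqrt (ip f f)"

lemma sqint_meas: "sqint f \<Longrightarrow> f \<in> borel_measurable borel"
  by (simp add: sqint_def)

lemma sqint_integrable_mult:
  assumes "sqint f" "sqint g"
  shows "integrable lborel (\<lambda>x. f x * g x)"
proof (rule Bochner_Integration.integrable_bound)
  show "integrable lborel (\<lambda>x. (f x)\<^sup>2 + (g x)\<^sup>2)"
    using assms by (simp add: sqint_def)
  show "(\<lambda>x. f x * g x) \<in> borel_measurable lborel"
    using assms[THEN sqint_meas] by simp
  have "\<bar>a * b\<bar> \<le> a\<^sup>2 + b\<^sup>2" for a b :: real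
  proof -
    have "0 \<le> (\<bar>a\<bar> - \<bar>b\<bar>)\<^sup>2" by simp
    hence "2 * (\<bar>a\<bar> * \<bar>b\<bar>) \<le> a\<^sup>2 + b\<^sup>2" by (simp add: power2_diff)
    moreover have "0 \<le> \<bar>a\<bar> * \<bar>b\<bar>" by simp
    ultimately show ?thesis unfolding abs_mult by linarith
  qed
  then show "AE x in lborel. norm (f x * g x) \<le> norm ((f x)\<^sup>2 + (g x)\<^sup>2)"
    by auto
qed

lemma sqint_add: "sqint f \<Longrightarrow> sqint g \<Longrightarrow> sqint (\<lambda>x. f x + g x)"
  using sqint_integrable_mult[of f g]
  by (auto simp: sqint_def power2_sum mult.assoc intro!: Bochner_Integration.integrable_add)

lemma sqint_cmult: "sqint f \<Longrightarrow> sqint (\<lambda>x. c * f x)"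
  by (auto simp: sqint_def power_mult_distrib)

lemma sqint_uminus: "sqint f \<Longrightarrow> sqint (\<lambda>x. - f x)"
  by (auto simp: sqint_def)

lemma sqint_diff: "sqint f \<Longrightarrow> sqint g \<Longrightarrow> sqint (\<lambda>x. f x - g x)"
  using sqint_add[OF _ sqint_uminus, of f g] by simp

lemma sqint_zero: "sqint (\<lambda>x. 0)"
  by (simp add: sqint_def)

lemma sqint_bound:
  assumes "sqint f" "g \<in> borel_measurable borel" "\<And>x. \<bar>g x\<bar> \<le> B * \<bar>f x\<bar>"
  shows "sqint g"
  unfolding sqint_def
proof
  show "integrable lborel (\<lambda>x. (g x)\<^sup>2)"
  proof (rule Bochner_Integration.integrable_bound)
    show "integrable lborel (\<lambda>x. (B * f x)\<^sup>2)"
      using sqint_cmult[OF assms(1)] by (simp add: sqint_def)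
    show "(\<lambda>x. (g x)\<^sup>2) \<in> borel_measurable lborel" using assms by simp
    have "(g x)\<^sup>2 \<le> (B * f x)\<^sup>2" for x
    proof -
      have "\<bar>g x\<bar> \<le> \<bar>B * f x\<bar>"
        using order_trans[OF assms(3)[of x] mult_right_mono[of B "\<bar>B\<bar>" "\<bar>f x\<bar>"]]
        by (simp add: abs_mult)
      thus ?thesis by (simp add: abs_le_square_iff)
    qed
    thus "AE x in lborel. norm ((g x)\<^sup>2) \<le> norm ((B * f x)\<^sup>2)" by simp
  qed
qed (use assms in auto)

lemma sqint_mult_bounded:
  assumes "sqint f" "m \<in> borel_measurable borel" "\<And>x. \<bar>m x\<bar> \<le> B"
  shows "sqint (\<lambda>x. m x * f x)"
proof (rule sqint_bound[OF assms(1), where B = B])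
  show "(\<lambda>x. m x * f x) \<in> borel_measurable borel" using sqint_meas[OF assms(1)] assms(2) by simp
  show "\<bar>m x * f x\<bar> \<le> B * \<bar>f x\<bar>" for x
    using assms(3)[of x] by (simp add: abs_mult mult_right_mono)
qed

lemma sqint_abs: "sqint f \<Longrightarrow> sqint (\<lambda>x. \<bar>f x\<bar>)"
  by (auto simp: sqint_def)

lemma ip_commute: "ip f g = ip g f"
  by (simp add: ip_def mult.commute)

lemma ip_add_left: "sqint f \<Longrightarrow> sqint g \<Longrightarrow> sqint h \<Longrightarrow> ip (\<lambda>x. f x + g x) h = ip f h + ip g h"
  by (simp add: ip_def distrib_right sqint_integrable_mult)

lemma ip_diff_left: "sqint f \<Longrightarrow> sqint g \<Longrightarrow> sqint h \<Longrightarrow> ip (\<lambda>x. f x - g x) h = ip f h - ip g h"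
  by (simp add: ip_def left_diff_distrib sqint_integrable_mult)

lemma ip_cmult_left: "ip (\<lambda>x. c * f x) h = c * ip f h"
  by (simp add: ip_def mult.assoc)

lemma ip_uminus_left: "ip (\<lambda>x. - f x) h = - ip f h"
  by (simp add: ip_def)

lemma ip_add_right: "sqint f \<Longrightarrow> sqint g \<Longrightarrow> sqint h \<Longrightarrow> ip h (\<lambda>x. f x + g x) = ip h f + ip h g"
  by (simp add: ip_def distrib_left sqint_integrable_mult)

lemma ip_diff_right: "sqint f \<Longrightarrow> sqint g \<Longrightarrow> sqint h \<Longrightarrow> ip h (\<lambda>x. f x - g x) = ip h f - ip h g"
  by (simp add: ip_def right_diff_distrib sqint_integrable_mult)

lemma ip_cmult_right: "ip h (\<lambda>x. c * f x) = c * ip h f"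
  by (simp add: ip_def mult.left_commute)

lemma ip_self_nonneg: "0 \<le> ip f f"
  by (simp add: ip_def)

lemma ip_self: "ip f f = (nrm f)\<^sup>2"
  by (simp add: nrm_def ip_self_nonneg)

lemma nrm_nonneg [simp]: "0 \<le> nrm f"
  by (simp add: nrm_def ip_self_nonneg)

lemma nrm_power2: "(nrm f)\<^sup>2 = (LINT x|lborel. (f x)\<^sup>2)"
  unfolding ip_self[symmetric] ip_def by (simp add: power2_eq_square)

lemma nrm_cmult: "nrm (\<lambda>x. c * f x) = \<bar>c\<bar> * nrm f"
  by (simp add: nrm_def ip_cmult_left ip_cmult_right real_sqrt_mult flip: mult.assoc)

lemma nrm_uminus: "nrm (\<lambda>x. - f x) = nrm f"
  by (simp add: nrm_def ip_def)

lemma nrm_abs: "nrm (\<lambda>x. \<bar>f x\<bar>) = nrm f"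
  by (simp add: nrm_def ip_def)

lemma nrm_zero [simp]: "nrm (\<lambda>x. 0) = 0"
  by (simp add: nrm_def ip_def)

lemma nrm_diff_commute: "nrm (\<lambda>x. f x - g x) = nrm (\<lambda>x. g x - f x)"
  using nrm_uminus[of "\<lambda>x. f x - g x"] by simp

lemma ip_le:
  assumes f: "sqint f" and g: "sqint g"
  shows "\<bar>ip f g\<bar> \<le> nrm f * nrm g"
proof -
  define F I G where "F = ip f f" and "I = ip f g" and "G = ip g g"
  have q: "0 \<le> F - 2 * t * I + t\<^sup>2 * G" for t
  proof -
    have "0 \<le> ip (\<lambda>x. f x - t * g x) (\<lambda>x. f x - t * g x)" by (rule ip_self_nonneg)
    also have "\<dots> = F - t * I - t * (I - t * G)"
      using f g sqint_cmult[OF g, of t] sqint_diff[OF f sqint_cmult[OF g, of t]]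
      by (simp add: ip_diff_left ip_diff_right ip_cmult_left ip_cmult_right F_def I_def G_def
          ip_commute[of g f])
    finally show ?thesis by (simp add: power2_eq_square algebra_simps)
  qed
  have "I\<^sup>2 \<le> F * G"
  proof (cases "G = 0")
    case True
    have "I = 0"
    proof (rule ccontr)
      assume "I \<noteq> 0"
      \<comment> \<open>With G = 0 the quadratic is affine in t, and this t gives it the value F -
        (F + 1) = -1.\<close>
      thus False using q[of "(F + 1) / (2 * I)"] True by simp
    qed
    thus ?thesis using True by simp
  next
    case False
    hence "G > 0" using ip_self_nonneg[of g] by (simp add: G_def)
    thus ?thesis using q[of "I / G"] by (simp add: field_simps power2_eq_square)
  qed
  hence "sqrt (I\<^sup>2) \<le> sqrt (F * G)" by (rule real_sqrt_le_mono)
  thus ?thesis by (simp add: nrm_def real_sqrt_mult I_def F_def G_def)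
qed

lemma nrm_triangle:
  assumes f: "sqint f" and g: "sqint g"
  shows "nrm (\<lambda>x. f x + g x) \<le> nrm f + nrm g"
proof (rule power2_le_imp_le)
  have "(nrm (\<lambda>x. f x + g x))\<^sup>2 = (nrm f)\<^sup>2 + 2 * ip f g + (nrm g)\<^sup>2"
    using f g by (simp add: sqint_add ip_add_left ip_add_right ip_commute[of g f] flip: ip_self)
  also have "\<dots> \<le> (nrm f + nrm g)\<^sup>2"
    using ip_le[OF f g] by (simp add: power2_sum)
  finally show "(nrm (\<lambda>x. f x + g x))\<^sup>2 \<le> (nrm f + nrm g)\<^sup>2" .
qed simp

lemma nrm_triangle_diff:
  assumes f: "sqint f" and g: "sqint g"
  shows "nrm (\<lambda>x. f x - g x) \<le> nrm f + nrm g"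
  using nrm_triangle[OF f sqint_uminus[OF g]] by (simp add: nrm_uminus)

lemma nrm_bound:
  assumes "sqint f" "g \<in> borel_measurable borel" "\<And>x. \<bar>g x\<bar> \<le> B * \<bar>f x\<bar>" "0 \<le> B"
  shows "nrm g \<le> B * nrm f"
proof (rule power2_le_imp_le)
  have g: "sqint g" by (rule sqint_bound[OF assms(1-3)])
  have "(nrm g)\<^sup>2 \<le> (LINT x|lborel. (B * f x)\<^sup>2)"
    unfolding nrm_power2
  proof (rule integral_mono)
    show "integrable lborel (\<lambda>x. (g x)\<^sup>2)" using g by (simp add: sqint_def)
    show "integrable lborel (\<lambda>x. (B * f x)\<^sup>2)"
      using sqint_cmult[OF assms(1)] by (simp add: sqint_def)
    show "(g x)\<^sup>2 \<le> (B * f x)\<^sup>2" for x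
      using assms(3)[of x] assms(4) by (simp flip: abs_le_square_iff add: abs_mult)
  qed
  thus "(nrm g)\<^sup>2 \<le> (B * nrm f)\<^sup>2"
    unfolding power_mult_distrib nrm_power2 by simp
qed (simp add: assms(4))

lemma nrm_mult_bounded:
  assumes "sqint f" "m \<in> borel_measurable borel" "\<And>x. \<bar>m x\<bar> \<le> B"
  shows "nrm (\<lambda>x. m x * f x) \<le> B * nrm f"
proof (rule nrm_bound[OF assms(1)])
  show "(\<lambda>x. m x * f x) \<in> borel_measurable borel" using sqint_meas[OF assms(1)] assms(2) by simp
  show "\<bar>m x * f x\<bar> \<le> B * \<bar>f x\<bar>" for x
    using assms(3)[of x] by (simp add: abs_mult mult_right_mono)
  show "0 \<le> B" using assms(3)[of 0] by simp
qed

lemma nrm_eq_0_AE: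
  assumes "sqint f" "nrm f = 0"
  shows "AE x in lborel. f x = 0"
proof -
  have "(LINT x|lborel. (f x)\<^sup>2) = 0" using assms(2) by (simp flip: nrm_power2)
  hence "AE x in lborel. (f x)\<^sup>2 = 0"
    using assms(1) by (subst (asm) integral_nonneg_eq_0_iff_AE) (auto simp: sqint_def)
  thus ?thesis by simp
qed

text \<open>Dominated convergence in L^2: |s n - f| is at most 2 |f|, so 4 f^2 is a majorant. It
  supplies the limits in the density argument.\<close>

lemma sqint_dominated_LIMSEQ:
  assumes f: "sqint f" and m: "\<And>n. s n \<in> borel_measurable borel" 
    and lim: "\<And>x. (\<lambda>n. s n x) \<longlonglongrightarrow> f x" and b: "\<And>n x. \<bar>s n x\<bar> \<le> \<bar>f x\<bar>"
  shows "(\<lambda>n. nrm (\<lambda>x. s n x - f x)) \<longlonglongrightarrow> 0"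
proof -
  have "(\<lambda>n. LINT x|lborel. (s n x - f x)\<^sup>2) \<longlonglongrightarrow> (LINT x::real|lborel. 0)"
  proof (rule integral_dominated_convergence[where w = "\<lambda>x. 4 * (f x)\<^sup>2" and f = "\<lambda>x. 0" and M = lborel
        and s = "\<lambda>n x. (s n x - f x)\<^sup>2"])
    show "AE x in lborel. (\<lambda>n. (s n x - f x)\<^sup>2) \<longlonglongrightarrow> 0"
    proof (rule AE_I2)
      fix x
      have "(\<lambda>n. (s n x - f x)\<^sup>2) \<longlonglongrightarrow> (f x - f x)\<^sup>2"
        by (intro tendsto_intros lim)
      thus "(\<lambda>n. (s n x - f x)\<^sup>2) \<longlonglongrightarrow> 0" by simp
    qed
    show "AE x in lborel. norm ((s n x - f x)\<^sup>2) \<le> 4 * (f x)\<^sup>2" for n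
    proof (rule AE_I2)
      fix x
      have "\<bar>s n x - f x\<bar> \<le> \<bar>2 * f x\<bar>" using b[of n x] by linarith
      hence "(s n x - f x)\<^sup>2 \<le> (2 * f x)\<^sup>2" unfolding abs_le_square_iff .
      thus "norm ((s n x - f x)\<^sup>2) \<le> 4 * (f x)\<^sup>2" by simp
    qed
  qed (use f m in \<open>auto simp: sqint_def\<close>)
  hence "(\<lambda>n. sqrt (LINT x|lborel. (s n x - f x)\<^sup>2)) \<longlonglongrightarrow> sqrt 0"
    by (intro tendsto_intros) simp
  moreover have "nrm (\<lambda>x. s n x - f x) = sqrt (LINT x|lborel. (s n x - f x)\<^sup>2)" for n
    by (simp add: nrm_def ip_def power2_eq_square)
  ultimately show ?thesis by simp
qed

section \<open>Test functions\<close>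

text \<open>Differentiability to a finite order, with the first derivative peeled off. Unlike a
  statement about \<open>(deriv ^^ n) f\<close>, this form lets closure properties go by induction
  on the order for all functions at once, since differentiating a product leaves products to be
  differentiated one time less.\<close>

primrec diff_n :: "nat \<Rightarrow> (real \<Rightarrow> real) \<Rightarrow> bool" where
  "diff_n 0 f \<longleftrightarrow> True"
| "diff_n (Suc n) f \<longleftrightarrow> (\<forall>x. f differentiable (at x)) \<and> diff_n n (deriv f)"

lemma diff_n_iff: "diff_n n f \<longleftrightarrow> (\<forall>k<n. \<forall>x. (deriv ^^ k) f differentiable (at x))"
proof (induction n arbitrary: f)
  case (Suc n)
  show ?case
    unfolding diff_n.simps Suc
    by (auto simp: less_Suc_eq_0_disj funpow_swap1 simp flip: funpow.simps)
       (auto simp: funpow_swap1)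
qed simp

definition smooth :: "(real \<Rightarrow> real) \<Rightarrow> bool" where
  "smooth f \<longleftrightarrow> (\<forall>n. diff_n n f)"

lemma smooth_iff: "smooth f \<longleftrightarrow> (\<forall>n x. (deriv ^^ n) f differentiable (at x))"
  by (auto simp: smooth_def diff_n_iff)

lemma diff_n_Suc_D: "diff_n (Suc n) f \<Longrightarrow> diff_n n f"
  by (simp add: diff_n_iff)

lemma differentiable_imp_has_deriv:
  "f differentiable (at x) \<Longrightarrow> (f has_real_derivative deriv f x) (at x)" for f :: "real \<Rightarrow> real"
  by (simp add: DERIV_deriv_iff_real_differentiable)

lemma diff_n_SucI:
  assumes "\<And>x. (f has_real_derivative g x) (at x)" "diff_n n g"
  shows "diff_n (Suc n) f"
proof -
  have "deriv f = g" using assms(1) by (auto intro: DERIV_imp_deriv)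
  thus ?thesis using assms by (auto simp: real_differentiable_def)
qed

lemma diff_n_SucE:
  assumes "diff_n (Suc n) f"
  obtains g where "\<And>x. (f has_real_derivative g x) (at x)" "diff_n n g"
  using assms differentiable_imp_has_deriv[of f] by auto

lemma diff_n_const: "diff_n n (\<lambda>x. c)"
proof (induction n arbitrary: c)
  case (Suc n)
  show ?case by (rule diff_n_SucI[where g = "\<lambda>x. 0"]) (auto intro: Suc)
qed simp

lemma diff_n_add: "diff_n n f \<Longrightarrow> diff_n n g \<Longrightarrow> diff_n n (\<lambda>x. f x + g x)"
proof (induction n arbitrary: f g)
  case (Suc n)
  from Suc.prems obtain f' g' where
    "\<And>x. (f has_real_derivative f' x) (at x)" "diff_n n f'"
    "\<And>x. (g has_real_derivative g' x) (at x)" "diff_n n g'"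
    by (metis diff_n_SucE)
  thus ?case
    by (intro diff_n_SucI[where g = "\<lambda>x. f' x + g' x"] Suc.IH) (auto intro: DERIV_add)
qed simp

lemma diff_n_mult: "diff_n n f \<Longrightarrow> diff_n n g \<Longrightarrow> diff_n n (\<lambda>x. f x * g x)"
proof (induction n arbitrary: f g)
  case (Suc n)
  from Suc.prems obtain f' g' where *:
    "\<And>x. (f has_real_derivative f' x) (at x)" "diff_n n f'"
    "\<And>x. (g has_real_derivative g' x) (at x)" "diff_n n g'"
    by (metis diff_n_SucE)
  have "diff_n n (\<lambda>x. f' x * g x + f x * g' x)"
    using Suc.prems by (intro diff_n_add Suc.IH *) (auto intro!: diff_n_Suc_D simp del: diff_n.simps)
  thus ?case
    by (rule diff_n_SucI[rotated]) (auto intro!: derivative_eq_intros *)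
qed simp

lemma diff_n_affine: "diff_n n f \<Longrightarrow> diff_n n (\<lambda>x. f (a * x + b))"
proof (induction n arbitrary: f)
  case (Suc n)
  from Suc.prems obtain f' where *: "\<And>x. (f has_real_derivative f' x) (at x)" "diff_n n f'"
    by (metis diff_n_SucE)
  have "diff_n n (\<lambda>x. a * f' (a * x + b))"
    by (intro diff_n_mult diff_n_const Suc.IH *)
  moreover have "((\<lambda>x. f (a * x + b)) has_real_derivative a * f' (a * x + b)) (at x)" for x
  proof -
    have "((\<lambda>x. a * x + b) has_real_derivative a) (at x)" by (auto intro!: derivative_eq_intros)
    from DERIV_chain2[OF *(1) this] show ?thesis by (rule DERIV_cong) simp
  qed
  ultimately show ?case by (intro diff_n_SucI) auto
qed simp

lemma smooth_const: "smooth (\<lambda>x. c)"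
  by (simp add: smooth_def diff_n_const)

lemma smooth_add: "smooth f \<Longrightarrow> smooth g \<Longrightarrow> smooth (\<lambda>x. f x + g x)"
  by (simp add: smooth_def diff_n_add)

lemma smooth_mult: "smooth f \<Longrightarrow> smooth g \<Longrightarrow> smooth (\<lambda>x. f x * g x)"
  by (simp add: smooth_def diff_n_mult)

lemma smooth_affine: "smooth f \<Longrightarrow> smooth (\<lambda>x. f (a * x + b))"
  by (simp add: smooth_def diff_n_affine)

lemma smooth_has_deriv: "smooth f \<Longrightarrow> (f has_real_derivative deriv f x) (at x)"
  unfolding smooth_def using diff_n.simps(2)[of 0 f] by (auto intro: differentiable_imp_has_deriv)

lemma smooth_deriv: "smooth f \<Longrightarrow> smooth (deriv f)"
  unfolding smooth_def using diff_n.simps(2) by blast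

lemma smoothI_deriv:
  assumes "\<And>x. (f has_real_derivative g x) (at x)" "smooth g"
  shows "smooth f"
proof -
  have "diff_n n f" for n
    using diff_n_SucI[OF assms(1)] assms(2) by (cases n) (auto simp: smooth_def simp del: diff_n.simps(2))
  thus ?thesis by (simp add: smooth_def)
qed

section \<open>Flat functions and a smooth step\<close>

definition exp_inv_poly :: "real poly \<Rightarrow> real \<Rightarrow> real" where
  "exp_inv_poly P x = (if 0 < x then poly P (1 / x) * exp (- (1 / x)) else 0)"

lemma poly_exp_tendsto_0: "((\<lambda>y. poly P y * exp (- y)) \<longlongrightarrow> (0 :: real)) at_top"
proof -
  have "((\<lambda>y. \<Sum>i\<le>degree P. coeff P i * (y ^ i / exp y)) \<longlongrightarrow> (\<Sum>i\<le>degree P. coeff P i * 0)) at_top"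
    by (intro tendsto_intros tendsto_power_div_exp_0)
  thus ?thesis
    by (simp add: poly_altdef exp_minus sum_distrib_right divide_inverse mult.assoc)
qed

lemma exp_inv_poly_tendsto_0: "(exp_inv_poly P \<longlongrightarrow> 0) (at 0)"
proof (rule filterlim_split_at)
  have "\<forall>\<^sub>F x in at_left 0. exp_inv_poly P x = 0"
    by (auto simp: eventually_at_filter exp_inv_poly_def)
  thus "(exp_inv_poly P \<longlongrightarrow> 0) (at_left 0)"
    by (rule tendsto_eventually)
  have "((\<lambda>x. poly P (1 / x) * exp (- (1 / x))) \<longlongrightarrow> 0) (at_right 0)"
    using filterlim_compose[OF poly_exp_tendsto_0 filterlim_inverse_at_top_right, of P]
    by (simp add: inverse_eq_divide)
  thus "(exp_inv_poly P \<longlongrightarrow> 0) (at_right 0)"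
    by (rule Lim_transform_eventually) (auto simp: eventually_at_filter exp_inv_poly_def)
qed

text \<open>With y = 1/x and dy/dx = - y^2, the derivative of P(y) exp(-y) is y^2 (P - P')(y)
  exp(-y); \<open>[:0, 0, 1:]\<close> is y^2. Carrying a polynomial along makes the family closed
  under differentiation, so that smoothness of exp(-1/x), the case P = 1, becomes an
  induction.\<close>

lemma exp_inv_poly_deriv:
  "(exp_inv_poly P has_real_derivative exp_inv_poly ([:0, 0, 1:] * (P - pderiv P)) x) (at x)"
proof -
  consider "x > 0" | "x < 0" | "x = 0" by linarith
  thus ?thesis
  proof cases
    case 1
    have "((\<lambda>x. poly P (1 / x) * exp (- (1 / x))) has_real_derivative
        exp_inv_poly ([:0, 0, 1:] * (P - pderiv P)) x) (at x)"
      using 1 by (auto intro!: derivative_eq_intros poly_DERIV[THEN DERIV_chain2]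
            simp: exp_inv_poly_def field_simps power2_eq_square)
    thus ?thesis
      by (rule has_field_derivative_transform_within_open[where S = "{0<..}"])
         (use 1 in \<open>auto simp: exp_inv_poly_def\<close>)
  next
    case 2
    have "((\<lambda>x. 0) has_real_derivative 0) (at x)" by simp
    hence "(exp_inv_poly P has_real_derivative 0) (at x)"
      by (rule has_field_derivative_transform_within_open[where S = "{..<0}"])
         (use 2 in \<open>auto simp: exp_inv_poly_def\<close>)
    thus ?thesis using 2 by (simp add: exp_inv_poly_def)
  next
    case 3
    \<comment> \<open>The difference quotient at 0 divides by h, which multiplies P(1/h) by 1/h:
      again a member of the family, with polynomial \<open>pCons 0 P\<close>.\<close>
    have "(exp_inv_poly (pCons 0 P) \<longlongrightarrow> 0) (at 0)" by (rule exp_inv_poly_tendsto_0)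
    moreover have "exp_inv_poly (pCons 0 P) = (\<lambda>h. (exp_inv_poly P (0 + h) - exp_inv_poly P 0) / h)"
      by (auto simp: exp_inv_poly_def fun_eq_iff)
    ultimately show ?thesis
      unfolding DERIV_def 3 by (simp add: exp_inv_poly_def)
  qed
qed

lemma smooth_exp_inv_poly: "smooth (exp_inv_poly P)"
proof -
  have "diff_n n (exp_inv_poly P)" for n
  proof (induction n arbitrary: P)
    case (Suc n)
    show ?case by (rule diff_n_SucI[OF exp_inv_poly_deriv Suc])
  qed simp
  thus ?thesis by (simp add: smooth_def)
qed

text \<open>The normalised antiderivative of r(x) = exp(-1/x) exp(-1/(1 - x)) on (0, 1), extended by
  0. Strict positivity of the derivative inside is recorded because that derivative later serves as
  a bump whose pairing with a function of one sign must not vanish.\<close>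

lemma smooth_step_exists:
  "\<exists>S :: real \<Rightarrow> real. smooth S \<and> (\<forall>x\<le>0. S x = 0) \<and> (\<forall>x\<ge>1. S x = 1) \<and> mono S \<and>
     (\<forall>x. 0 \<le> deriv S x) \<and> (\<forall>x. x \<le> 0 \<or> 1 \<le> x \<longrightarrow> deriv S x = 0) \<and> (\<forall>x. 0 < x \<and> x < 1 \<longrightarrow> 0 < deriv S x)"
proof -
  define r where "r = (\<lambda>x. exp_inv_poly 1 x * exp_inv_poly 1 (- 1 * x + 1))"
  have r_smooth: "smooth r"
    unfolding r_def by (intro smooth_mult smooth_affine smooth_exp_inv_poly)
  have r_pos: "0 < r x" if "0 < x" "x < 1" for x
    using that by (simp add: r_def exp_inv_poly_def)
  have r_0: "r x = 0" if "x \<le> 0 \<or> 1 \<le> x" for x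
    using that by (auto simp: r_def exp_inv_poly_def)
  have r_nonneg: "0 \<le> r x" for x
    using r_pos[of x] r_0[of x] by linarith
  have "isCont r x" for x
    using smooth_has_deriv[OF r_smooth] by (rule DERIV_isCont)
  then obtain F where F: "\<And>x. (F has_vector_derivative r x) (at x)"
    using einterval_antiderivative[of "-\<infinity>" "\<infinity>" r] by auto
  hence F': "(F has_real_derivative r x) (at x)" for x
    by (simp add: has_real_derivative_iff_has_vector_derivative)
  have F01: "F 0 < F 1"
    by (rule DERIV_pos_imp_increasing_open[where f = F])
       (use F' r_pos DERIV_isCont[OF F'] in \<open>auto intro!: continuous_at_imp_continuous_on simp del: DERIV_const\<close>)
  have mono: "F x \<le> F y" if "x \<le> y" for x y
    by (rule DERIV_nonneg_imp_nondecreasing[OF that]) (use F' r_nonneg in blast)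
  have F'_0: "(F has_real_derivative 0) (at x)" if "x \<le> 0 \<or> 1 \<le> x" for x
    using F'[of x] r_0[OF that] by simp
  have contF: "continuous_on A F" for A
    using DERIV_isCont[OF F'] by (blast intro: continuous_at_imp_continuous_on)
  have F_0: "F x = F 0" if "x \<le> 0" for x
  proof (cases "x = 0")
    case False
    hence "F 0 = F x"
      using that by (intro DERIV_isconst_end[of x 0 F] contF F'_0) auto
    thus ?thesis ..
  qed simp
  have F_1: "F x = F 1" if "x \<ge> 1" for x
  proof (cases "x = 1")
    case False
    thus ?thesis
      using that by (intro DERIV_isconst_end[of 1 x F] contF F'_0) auto
  qed simp
  define S where "S = (\<lambda>x. (F x - F 0) * (1 / (F 1 - F 0)))"
  have S': "(S has_real_derivative r x * (1 / (F 1 - F 0))) (at x)" for x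
    unfolding S_def using F01 by (auto intro!: derivative_eq_intros F')
  have dS: "deriv S = (\<lambda>x. r x * (1 / (F 1 - F 0)))"
    using S' by (auto intro: DERIV_imp_deriv)
  have "smooth S"
    by (rule smoothI_deriv[OF S']) (intro smooth_mult r_smooth smooth_const)
  moreover have "mono S"
    using F01 mono by (auto simp: mono_def S_def intro!: divide_right_mono)
  moreover have "S x = 0" if "x \<le> 0" for x using F_0[OF that] by (simp add: S_def)
  moreover have "S x = 1" if "1 \<le> x" for x using F_1[OF that] F01 by (auto simp: S_def)
  moreover have "0 \<le> deriv S x" for x using r_nonneg[of x] F01 by (simp add: dS)
  moreover have "deriv S x = 0" if "x \<le> 0 \<or> 1 \<le> x" for x using r_0[OF that] by (simp add: dS)
  moreover have "0 < deriv S x" if "0 < x" "x < 1" for x using r_pos[OF that] F01 by (simp add: dS)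
  ultimately show ?thesis by blast
qed

definition sstep :: "real \<Rightarrow> real" where
  "sstep = (SOME S. smooth S \<and> (\<forall>x\<le>0. S x = 0) \<and> (\<forall>x\<ge>1. S x = 1) \<and> mono S \<and>
     (\<forall>x. 0 \<le> deriv S x) \<and> (\<forall>x. x \<le> 0 \<or> 1 \<le> x \<longrightarrow> deriv S x = 0) \<and> (\<forall>x. 0 < x \<and> x < 1 \<longrightarrow> 0 < deriv S x))"

lemma sstep:
  shows smooth_sstep: "smooth sstep"
    and sstep_0: "x \<le> 0 \<Longrightarrow> sstep x = 0"
    and sstep_1: "x \<ge> 1 \<Longrightarrow> sstep x = 1"
    and mono_sstep: "mono sstep"
    and deriv_sstep_nonneg: "0 \<le> deriv sstep x"
    and deriv_sstep_0: "x \<le> 0 \<or> 1 \<le> x \<Longrightarrow> deriv sstep x = 0"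
    and deriv_sstep_pos: "0 < x \<Longrightarrow> x < 1 \<Longrightarrow> 0 < deriv sstep x"
  using someI_ex[OF smooth_step_exists] unfolding sstep_def[symmetric] by auto

section \<open>Test functions: closure properties, bounds, integrability\<close>

lemma test_functions_iff:
  "\<phi> \<in> test_functions \<longleftrightarrow> smooth \<phi> \<and> (\<exists>R. \<forall>x. R < \<bar>x\<bar> \<longrightarrow> \<phi> x = 0)"
  by (simp add: test_functions_def smooth_iff)

lemma test_functionsI: "smooth \<phi> \<Longrightarrow> (\<And>x. R < \<bar>x\<bar> \<Longrightarrow> \<phi> x = 0) \<Longrightarrow> \<phi> \<in> test_functions"
  by (auto simp: test_functions_iff)

lemma test_smooth: "\<phi> \<in> test_functions \<Longrightarrow> smooth \<phi>"
  by (simp add: test_functions_iff)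

lemma test_has_deriv: "\<phi> \<in> test_functions \<Longrightarrow> (\<phi> has_real_derivative deriv \<phi> x) (at x)"
  by (simp add: test_smooth smooth_has_deriv)

lemma test_continuous: "\<phi> \<in> test_functions \<Longrightarrow> continuous_on S \<phi>"
  using DERIV_isCont[OF test_has_deriv] by (auto intro: continuous_at_imp_continuous_on)

lemma test_measurable: "\<phi> \<in> test_functions \<Longrightarrow> \<phi> \<in> borel_measurable borel"
  by (intro borel_measurable_continuous_onI test_continuous)

lemma test_support:
  assumes "\<phi> \<in> test_functions"
  obtains R where "0 < R" "\<And>x. R \<le> \<bar>x\<bar> \<Longrightarrow> \<phi> x = 0"
proof -
  obtain R where R: "\<forall>x. R < \<bar>x\<bar> \<longrightarrow> \<phi> x = 0"
    using assms by (auto simp: test_functions_iff)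
  show thesis by (rule that[of "\<bar>R\<bar> + 1"]) (use R in auto)
qed

lemma deriv_eq_0_outside:
  fixes f :: "real \<Rightarrow> real"
  assumes "open S" "\<And>x. x \<in> S \<Longrightarrow> f x = 0" "x \<in> S"
  shows "deriv f x = 0"
proof -
  have "((\<lambda>x. 0 :: real) has_real_derivative 0) (at x)" by simp
  hence "(f has_real_derivative 0) (at x)"
    by (rule has_field_derivative_transform_within_open[OF _ assms(1,3)]) (simp add: assms(2))
  thus ?thesis by (rule DERIV_imp_deriv)
qed

lemma test_deriv:
  assumes "\<phi> \<in> test_functions" shows "deriv \<phi> \<in> test_functions"
proof -
  obtain R where R: "0 < R" "\<And>x. R \<le> \<bar>x\<bar> \<Longrightarrow> \<phi> x = 0" using test_support[OF assms] by blast
  have "deriv \<phi> x = 0" if "R < \<bar>x\<bar>" for x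
  proof (rule deriv_eq_0_outside[where S = "{x. R < \<bar>x\<bar>}"])
    show "open {x :: real. R < \<bar>x\<bar>}" by (intro open_Collect_less continuous_intros)
  qed (use that R in auto)
  thus ?thesis by (rule test_functionsI[OF smooth_deriv[OF test_smooth[OF assms]]])
qed

lemma test_add: "\<phi> \<in> test_functions \<Longrightarrow> \<psi> \<in> test_functions \<Longrightarrow> (\<lambda>x. \<phi> x + \<psi> x) \<in> test_functions"
proof -
  assume a: "\<phi> \<in> test_functions" "\<psi> \<in> test_functions"
  obtain R R' where R: "\<And>x. R \<le> \<bar>x\<bar> \<Longrightarrow> \<phi> x = 0" "\<And>x. R' \<le> \<bar>x\<bar> \<Longrightarrow> \<psi> x = 0"
    using test_support a by metis
  hence "\<phi> x + \<psi> x = 0" if "max R R' < \<bar>x\<bar>" for x using that by auto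
  thus ?thesis by (rule test_functionsI[OF smooth_add[OF a[THEN test_smooth]]])
qed

lemma test_cmult: "\<phi> \<in> test_functions \<Longrightarrow> (\<lambda>x. c * \<phi> x) \<in> test_functions"
  by (auto simp: test_functions_iff intro!: smooth_mult smooth_const)

lemma test_diff: "\<phi> \<in> test_functions \<Longrightarrow> \<psi> \<in> test_functions \<Longrightarrow> (\<lambda>x. \<phi> x - \<psi> x) \<in> test_functions"
  using test_add[OF _ test_cmult[of \<psi> "-1"], of \<phi>] by simp

lemma test_zero: "(\<lambda>x. 0) \<in> test_functions"
  by (simp add: test_functions_iff smooth_const)

lemma test_shift:
  assumes "\<phi> \<in> test_functions" shows "(\<lambda>x. \<phi> (x - c)) \<in> test_functions"
proof -
  obtain R where R: "0 < R" "\<And>x. R \<le> \<bar>x\<bar> \<Longrightarrow> \<phi> x = 0" using test_support[OF assms] by blast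
  have "\<phi> (x - c) = 0" if "R + \<bar>c\<bar> < \<bar>x\<bar>" for x using that by (intro R) auto
  moreover have "smooth (\<lambda>x. \<phi> (x - c))"
    using smooth_affine[OF test_smooth[OF assms], of 1 "-c"] by simp
  ultimately show ?thesis using test_functionsI by blast
qed

lemma deriv_shift: "\<phi> \<in> test_functions \<Longrightarrow> deriv (\<lambda>x. \<phi> (x - c)) = (\<lambda>x. deriv \<phi> (x - c))"
  by (rule ext, rule DERIV_imp_deriv)
     (auto intro!: derivative_eq_intros DERIV_chain2[OF test_has_deriv, where Db = 1, simplified])

lemma test_bounded:
  assumes "\<phi> \<in> test_functions" obtains B where "0 < B" "\<And>x. \<bar>\<phi> x\<bar> \<le> B"
proof -
  obtain R where R: "0 < R" "\<And>x. R \<le> \<bar>x\<bar> \<Longrightarrow> \<phi> x = 0" using test_support[OF assms] by blast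
  have "bounded (\<phi> ` {-R..R})"
    by (intro compact_imp_bounded compact_continuous_image test_continuous assms) auto
  then obtain B where B: "\<And>x. x \<in> {-R..R} \<Longrightarrow> \<bar>\<phi> x\<bar> \<le> B" "0 < B"
    unfolding bounded_pos by force
  have "\<bar>\<phi> x\<bar> \<le> B" for x
    using B(1)[of x] R(2)[of x] B(2) by (cases "\<bar>x\<bar> \<le> R") (auto simp: abs_le_iff)
  thus thesis using that B(2) by blast
qed

lemma test_mult_integrable:
  assumes "\<phi> \<in> test_functions" "f \<in> borel_measurable borel" "\<And>R. set_integrable lborel {-R..R} f"
  shows "integrable lborel (\<lambda>x. f x * \<phi> x)"
proof -
  obtain R where R: "0 < R" "\<And>x. R \<le> \<bar>x\<bar> \<Longrightarrow> \<phi> x = 0" using test_support[OF assms(1)] by blast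
  obtain B where B: "0 < B" "\<And>x. \<bar>\<phi> x\<bar> \<le> B" using test_bounded[OF assms(1)] by blast
  show ?thesis
  proof (rule Bochner_Integration.integrable_bound)
    show "integrable lborel (\<lambda>x. B * (indicator {-R..R} x * f x))"
      using assms(3)[of R] by (simp add: set_integrable_def)
    show "(\<lambda>x. f x * \<phi> x) \<in> borel_measurable lborel"
      using assms(2) test_measurable[OF assms(1)] by simp
    have "\<bar>f x\<bar> * \<bar>\<phi> x\<bar> \<le> B * (indicator {-R..R} x * \<bar>f x\<bar>)" for x
    proof (cases "\<bar>x\<bar> \<le> R")
      case True
      thus ?thesis using mult_left_mono[OF B(2)[of x], of "\<bar>f x\<bar>"] by (auto simp: indicator_def mult.commute)
    qed (use R B in auto)
    thus "AE x in lborel. norm (f x * \<phi> x) \<le> norm (B * (indicator {-R..R} x * f x))"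
      using B by (auto simp: abs_mult)
  qed
qed

lemma continuous_test_integrable:
  assumes "\<phi> \<in> test_functions" "continuous_on UNIV f"
  shows "integrable lborel (\<lambda>x. f x * \<phi> x)"
proof (rule test_mult_integrable[OF assms(1)])
  show "f \<in> borel_measurable borel" using assms(2) by (rule borel_measurable_continuous_onI)
  show "set_integrable lborel {-R..R} f" for R
    by (intro borel_integrable_atLeastAtMost' continuous_on_subset[OF assms(2)]) auto
qed

lemma test_integrable: "\<phi> \<in> test_functions \<Longrightarrow> integrable lborel \<phi>"
  using continuous_test_integrable[of \<phi> "\<lambda>x. 1"] by simp

lemma test_sqint: "\<phi> \<in> test_functions \<Longrightarrow> sqint \<phi>"
  unfolding sqint_def power2_eq_square
  by (intro conjI test_measurable continuous_test_integrable test_continuous)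

text \<open>For a < b a smoothed indicator of (a, b]: one ramp of width e starts at a, the other at
  b, both to the right, so that for e -> 0 the limit is 0 at a and 1 at b. Hence the half-open
  intervals below.\<close>

lemma test_box:
  assumes "a \<le> b" "0 < e"
  shows "(\<lambda>x. sstep ((x - a) / e) - sstep ((x - b) / e)) \<in> test_functions" (is "?f \<in> _")
proof -
  have "smooth (\<lambda>x. sstep ((1 / e) * x + - c / e))" for c
    by (intro smooth_affine smooth_sstep)
  hence "smooth (\<lambda>x. sstep ((x - c) / e))" for c
    using assms by (simp add: diff_divide_distrib)
  hence "smooth (\<lambda>x. sstep ((x - a) / e) + (-1) * sstep ((x - b) / e))"
    by (intro smooth_add smooth_mult smooth_const)
  moreover have "?f x = 0" if x: "max \<bar>a\<bar> (\<bar>b\<bar> + e) < \<bar>x\<bar>" for x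
  proof (cases "x \<ge> 0")
    case True
    hence "(x - a) / e \<ge> 1" "(x - b) / e \<ge> 1" using x assms by (auto simp: field_simps)
    thus ?thesis by (simp add: sstep_1)
  next
    case False
    hence "(x - a) / e \<le> 0" "(x - b) / e \<le> 0" using x assms by (auto simp: field_simps)
    thus ?thesis by (simp add: sstep_0)
  qed
  ultimately show ?thesis using test_functionsI[of ?f "max \<bar>a\<bar> (\<bar>b\<bar> + e)"] by simp
qed

section \<open>Density of the test functions in the square integrable functions\<close>

definition approximable :: "(real \<Rightarrow> real) \<Rightarrow> bool" where
  "approximable f \<longleftrightarrow> sqint f \<and> (\<forall>e>0. \<exists>\<phi>\<in>test_functions. nrm (\<lambda>x. f x - \<phi> x) < e)"

lemma approximable_limit:
  assumes "\<And>n. approximable (s n)" "sqint f" "(\<lambda>n. nrm (\<lambda>x. s n x - f x)) \<longlonglongrightarrow> 0"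
  shows "approximable f"
  unfolding approximable_def
proof (intro conjI allI impI)
  fix e :: real assume e: "e > 0"
  obtain n where n: "nrm (\<lambda>x. s n x - f x) < e / 2"
    using order_tendstoD(2)[OF assms(3), of "e / 2"] e by (auto simp: eventually_sequentially)
  obtain \<phi> where \<phi>: "\<phi> \<in> test_functions" "nrm (\<lambda>x. s n x - \<phi> x) < e / 2"
    using assms(1)[of n] e by (auto simp: approximable_def dest!: spec[of _ "e / 2"])
  have s: "sqint (s n)" using assms(1) by (simp add: approximable_def)
  have "nrm (\<lambda>x. f x - \<phi> x) \<le> nrm (\<lambda>x. f x - s n x) + nrm (\<lambda>x. s n x - \<phi> x)"
    using nrm_triangle[OF sqint_diff[OF assms(2) s] sqint_diff[OF s test_sqint[OF \<phi>(1)]]] by simp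
  also have "nrm (\<lambda>x. f x - s n x) = nrm (\<lambda>x. s n x - f x)" by (rule nrm_diff_commute)
  finally show "\<exists>\<phi>\<in>test_functions. nrm (\<lambda>x. f x - \<phi> x) < e" using n \<phi> by force
qed (fact assms)

lemma approximable_add:
  assumes "approximable f" "approximable g" shows "approximable (\<lambda>x. f x + g x)"
  unfolding approximable_def
proof (intro conjI allI impI)
  have fg: "sqint f" "sqint g" using assms by (auto simp: approximable_def)
  thus "sqint (\<lambda>x. f x + g x)" by (rule sqint_add)
  fix e :: real assume e: "e > 0"
  obtain \<phi> where \<phi>: "\<phi> \<in> test_functions" "nrm (\<lambda>x. f x - \<phi> x) < e / 2"
    using assms(1) e by (auto simp: approximable_def dest!: spec[of _ "e / 2"])
  obtain \<psi> where \<psi>: "\<psi> \<in> test_functions" "nrm (\<lambda>x. g x - \<psi> x) < e / 2"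
    using assms(2) e by (auto simp: approximable_def dest!: spec[of _ "e / 2"])
  have "nrm (\<lambda>x. (f x - \<phi> x) + (g x - \<psi> x)) \<le> nrm (\<lambda>x. f x - \<phi> x) + nrm (\<lambda>x. g x - \<psi> x)"
    by (intro nrm_triangle sqint_diff fg test_sqint \<phi> \<psi>)
  also have "(\<lambda>x. (f x - \<phi> x) + (g x - \<psi> x)) = (\<lambda>x. f x + g x - (\<phi> x + \<psi> x))"
    by (simp add: algebra_simps)
  finally show "\<exists>\<theta>\<in>test_functions. nrm (\<lambda>x. f x + g x - \<theta> x) < e"
    using \<phi> \<psi> by (intro bexI[of _ "\<lambda>x. \<phi> x + \<psi> x"] test_add) auto
qed

lemma approximable_cmult:
  assumes "approximable f" shows "approximable (\<lambda>x. c * f x)"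
  unfolding approximable_def
proof (intro conjI allI impI)
  show "sqint (\<lambda>x. c * f x)" using assms by (auto simp: approximable_def intro: sqint_cmult)
  fix e :: real assume e: "e > 0"
  obtain \<phi> where \<phi>: "\<phi> \<in> test_functions" "nrm (\<lambda>x. f x - \<phi> x) < e / (\<bar>c\<bar> + 1)"
    using assms(1) e by (auto simp: approximable_def dest!: spec[of _ "e / (\<bar>c\<bar> + 1)"])
  have "nrm (\<lambda>x. c * f x - c * \<phi> x) = \<bar>c\<bar> * nrm (\<lambda>x. f x - \<phi> x)"
    using nrm_cmult[of c "\<lambda>x. f x - \<phi> x"] by (simp add: right_diff_distrib)
  also have "\<dots> \<le> (\<bar>c\<bar> + 1) * nrm (\<lambda>x. f x - \<phi> x)" by (intro mult_right_mono) auto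
  also have "\<dots> < e" using \<phi>(2) by (simp add: field_simps)
  finally show "\<exists>\<theta>\<in>test_functions. nrm (\<lambda>x. c * f x - \<theta> x) < e"
    using \<phi> by (intro bexI[of _ "\<lambda>x. c * \<phi> x"] test_cmult) auto
qed

lemma approximable_zero: "approximable (\<lambda>x. 0)"
  by (auto simp: approximable_def sqint_zero intro!: bexI[OF _ test_zero])

lemma sqint_indicator: "A \<in> sets borel \<Longrightarrow> A \<subseteq> {-R..R} \<Longrightarrow> sqint (indicator A)"
  unfolding sqint_def
proof
  assume a: "A \<in> sets borel" "A \<subseteq> {-R..R}"
  have "emeasure lborel A \<le> emeasure lborel {-R..R}" by (rule emeasure_mono) (use a in auto)
  also have "\<dots> < \<infinity>" by (simp add: emeasure_lborel_Icc_eq)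
  finally have "integrable lborel (indicator A :: real \<Rightarrow> real)" using a by (intro integrable_real_indicator) auto
  thus "integrable lborel (\<lambda>x. (indicator A x :: real)\<^sup>2)"
    by (rule back_subst[of "integrable lborel"]) (auto simp: indicator_def fun_eq_iff)
qed simp

lemma approximable_Ioc: "approximable (indicator {a<..b})"
proof (cases "a \<le> b")
  case True
  define s where "s = (\<lambda>n x. sstep ((x - a) / (1 / (real n + 1))) - sstep ((x - b) / (1 / (real n + 1))))"
  have s_test: "s n \<in> test_functions" for n
    unfolding s_def by (rule test_box) (use True in auto)
  have f: "sqint (indicator {a<..b} :: real \<Rightarrow> real)"
    by (rule sqint_indicator[where R = "\<bar>a\<bar> + \<bar>b\<bar>"]) auto
  have lim: "(\<lambda>n. s n x) \<longlonglongrightarrow> indicator {a<..b} x" for x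
  proof -
    have l0: "(\<lambda>n. sstep ((x - c) / (1 / (real n + 1)))) \<longlonglongrightarrow> (if c < x then 1 else 0)" for c
    proof (cases "c < x")
      case True
      have "filterlim (\<lambda>n. (x - c) * (real n + 1)) at_top sequentially"
        using True by real_asymp
      hence "eventually (\<lambda>n. 1 \<le> (x - c) * (real n + 1)) sequentially"
        by (simp add: filterlim_at_top)
      hence "eventually (\<lambda>n. sstep ((x - c) / (1 / (real n + 1))) = 1) sequentially"
        by eventually_elim (simp add: sstep_1)
      thus ?thesis using True by (auto intro: tendsto_eventually)
    next
      case False
      hence "sstep ((x - c) / (1 / (real n + 1))) = 0" for n
        by (intro sstep_0) (auto simp: mult_nonpos_nonneg)
      thus ?thesis using False by simp
    qed
    have "(\<lambda>n. s n x) \<longlonglongrightarrow> (if a < x then 1 else 0) - (if b < x then 1 else 0)"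
      unfolding s_def by (intro tendsto_diff l0)
    also have "(if a < x then 1 else 0) - (if b < x then 1 else 0) = (indicator {a<..b} x :: real)"
      using True by (auto simp: indicator_def)
    finally show ?thesis .
  qed
  \<comment> \<open>The ramps have width at most 1, so one interval contains all the supports and
    its indicator is a common majorant.\<close>
  define g where "g = (indicator {a..b+1} :: real \<Rightarrow> real)"
  have g: "sqint g" unfolding g_def
    by (rule sqint_indicator[where R = "\<bar>a\<bar> + \<bar>b\<bar> + 1"]) auto
  have sb: "\<bar>s n x\<bar> \<le> g x" for n x
  proof -
    let ?e = "1 / (real n + 1)"
    have ab: "(x - b) / ?e \<le> (x - a) / ?e" using True by (intro divide_right_mono) auto
    have r: "0 \<le> sstep y" "sstep y \<le> 1" for y
      using monoD[OF mono_sstep, of "min y 0" y] monoD[OF mono_sstep, of y "max y 1"]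
      by (auto simp: sstep_0 sstep_1)
    have 1: "0 \<le> s n x" "s n x \<le> 1"
      using monoD[OF mono_sstep ab] r[of "(x - b) / ?e"] r[of "(x - a) / ?e"] unfolding s_def by linarith+
    have 2: "s n x = 0" if "x < a"
    proof -
      have "(x - a) / ?e \<le> 0" "(x - b) / ?e \<le> 0" using that True by (auto simp: mult_nonpos_nonneg)
      thus ?thesis by (simp only: s_def sstep_0)
    qed
    have 3: "s n x = 0" if "x > b + 1"
    proof -
      have "1 \<le> (x - b)" using that by simp
      also have "\<dots> \<le> (x - b) / ?e" using that mult_left_mono[of 1 "real n + 1" "x - b"] by simp
      finally have "1 \<le> (x - b) / ?e" "1 \<le> (x - a) / ?e" using ab by linarith+
      thus ?thesis by (simp only: s_def sstep_1)
    qed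
    show ?thesis using 1 2 3 by (auto simp: g_def indicator_def)
  qed
  have "(\<lambda>n. LINT x|lborel. (s n x - indicator {a<..b} x)\<^sup>2) \<longlonglongrightarrow> (LINT x::real|lborel. 0)"
  proof (rule integral_dominated_convergence[where w = g])
    show "AE x in lborel. (\<lambda>n. (s n x - indicator {a<..b} x)\<^sup>2) \<longlonglongrightarrow> 0"
    proof (rule AE_I2)
      fix x
      have "(\<lambda>n. (s n x - indicator {a<..b} x)\<^sup>2) \<longlonglongrightarrow> (indicator {a<..b} x - indicator {a<..b} x)\<^sup>2"
        by (intro tendsto_intros lim)
      thus "(\<lambda>n. (s n x - indicator {a<..b} x)\<^sup>2) \<longlonglongrightarrow> 0" by simp
    qed
    show "AE x in lborel. norm ((s n x - indicator {a<..b} x)\<^sup>2) \<le> g x" for n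
    proof (rule AE_I2)
      fix x
      have 0: "0 \<le> s n x"
        using monoD[OF mono_sstep, of "(x - b) / (1 / (real n + 1))" "(x - a) / (1 / (real n + 1))"] True
        by (simp add: s_def mult_right_mono)
      have "\<bar>s n x - indicator {a<..b} x\<bar> \<le> g x" "g x \<le> 1" "0 \<le> g x"
        using sb[of n x] 0 by (auto simp: g_def indicator_def split: if_splits)
      hence "\<bar>s n x - indicator {a<..b} x\<bar>\<^sup>2 \<le> g x * 1" unfolding power2_eq_square
        by (intro mult_mono) auto
      thus "norm ((s n x - indicator {a<..b} x)\<^sup>2) \<le> g x" by simp
    qed
    show "integrable lborel g" using g unfolding sqint_def
      by (rule back_subst[of "integrable lborel", OF conjunct2]) (auto simp: g_def fun_eq_iff indicator_def)
  qed (use test_measurable[OF s_test] in auto)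
  hence "(\<lambda>n. sqrt (LINT x|lborel. (s n x - indicator {a<..b} x)\<^sup>2)) \<longlonglongrightarrow> sqrt 0"
    by (intro tendsto_intros) simp
  hence "(\<lambda>n. nrm (\<lambda>x. s n x - indicator {a<..b} x)) \<longlonglongrightarrow> 0"
    by (simp add: nrm_def ip_def power2_eq_square)
  thus ?thesis
  proof (rule approximable_limit[rotated 2])
    show "approximable (s n)" for n
      using s_test[of n] by (auto simp: approximable_def test_sqint intro!: bexI[of _ "s n"])
  qed (fact f)
next
  case False
  hence "(indicator {a<..b} :: real \<Rightarrow> real) = (\<lambda>x. 0)" by (auto simp: fun_eq_iff indicator_def)
  thus ?thesis using approximable_zero by simp
qed

text \<open>A Dynkin argument on the half lines \<open>{..a}\<close>. The fixed cut to
  \<open>{-R<..R}\<close> keeps complements and countable unions square integrable; it is half-open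
  so that half lines leave intervals covered by \<open>approximable_Ioc\<close>.\<close>

lemma approximable_indicator_bounded:
  assumes "A \<in> sets borel"
  shows "approximable (indicator (A \<inter> {-R<..R}))"
proof -
  let ?K = "{-R<..R}"
  have Kb: "B \<inter> ?K \<subseteq> {-\<bar>R\<bar>..\<bar>R\<bar>}" for B by auto
  have "Int_stable (range (atMost :: real \<Rightarrow> _))"
    by (auto simp: Int_stable_def)
  moreover have "range (atMost :: real \<Rightarrow> _) \<subseteq> Pow UNIV" by simp
  moreover have "A \<in> sigma_sets UNIV (range atMost)"
    using assms unfolding borel_eq_atMost by (simp add: sets_measure_of)
  ultimately show ?thesis
  proof (induction rule: sigma_sets_induct_disjoint)
    case (basic A)
    then obtain a where "A = {..a}" by auto
    hence "A \<inter> ?K = {-R<..min a R}" by auto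
    thus ?case using approximable_Ioc by simp
  next
    case empty
    show ?case using approximable_zero by (simp add: indicator_def[abs_def])
  next
    case (compl A)
    have "approximable (\<lambda>x. indicator ?K x + (-1) * indicator (A \<inter> ?K) x)"
      by (intro approximable_add approximable_cmult compl approximable_Ioc)
    also have "(\<lambda>x. indicator ?K x + (-1) * indicator (A \<inter> ?K) x) = (indicator ((UNIV - A) \<inter> ?K) :: real \<Rightarrow> real)"
      by (auto simp: fun_eq_iff indicator_def)
    finally show ?case .
  next
    case (union A)
    have A: "A i \<in> sets borel" for i
      using union(2) unfolding borel_eq_atMost by (auto simp: sets_measure_of)
    define s where "s = (\<lambda>n x. \<Sum>i<n. indicator (A i \<inter> ?K) x :: real)"
    have s_eq: "s n x = indicator (\<Union>i<n. A i \<inter> ?K) x" for n x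
    proof -
      have "disjoint_family_on (\<lambda>i. A i \<inter> ?K) {..<n}"
        using union(1) unfolding disjoint_family_on_def by blast
      thus ?thesis unfolding s_def by (subst indicator_UN_disjoint) auto
    qed
    have ap: "approximable (s n)" for n
    proof (induction n)
      case 0 show ?case using approximable_zero by (simp add: s_def)
    next
      case (Suc n) show ?case using approximable_add[OF Suc union(3)[of n]] by (simp add: s_def)
    qed
    have sq: "sqint (indicator ((\<Union>i. A i) \<inter> ?K) :: real \<Rightarrow> real)"
      by (rule sqint_indicator[OF _ Kb]) (use A in auto)
    show ?case
    proof (rule approximable_limit[OF ap sq sqint_dominated_LIMSEQ[OF sq]])
      show "s n \<in> borel_measurable borel" for n using ap[of n] by (auto simp: approximable_def sqint_def)
      show "\<bar>s n x\<bar> \<le> \<bar>indicator ((\<Union>i. A i) \<inter> ?K) x\<bar>" for n x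
        unfolding s_eq by (auto simp: indicator_def)
      show "(\<lambda>n. s n x) \<longlonglongrightarrow> indicator ((\<Union>i. A i) \<inter> ?K) x" for x
      proof (cases "x \<in> (\<Union>i. A i) \<inter> ?K")
        case True
        then obtain i where i: "x \<in> A i" "x \<in> ?K" by blast
        have "s n x = indicator ((\<Union>i. A i) \<inter> ?K) x" if "Suc i \<le> n" for n
        proof -
          have "x \<in> (\<Union>i<n. A i \<inter> ?K)" using i that by (intro UN_I[of i]) auto
          thus ?thesis unfolding s_eq using True by simp
        qed
        thus ?thesis by (intro tendsto_eventually eventually_sequentiallyI[of "Suc i"]) blast
      next
        case False
        hence "x \<notin> (\<Union>i<n. A i \<inter> ?K)" for n by blast
        thus ?thesis unfolding s_eq using False by simp
      qed
    qed
  qed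
qed

text \<open>The induction runs through all nonnegative Borel functions, so square integrability is a
  premise inside the induction statement. It is inherited by the pieces because summands and
  monotone approximants lie below the function they build.\<close>

lemma approximable_nonneg:
  assumes "f \<in> borel_measurable borel" "\<And>x. 0 \<le> f x"
  shows "sqint f \<longrightarrow> approximable f"
  using assms
proof (induction rule: borel_measurable_induct_real)
  case (set A)
  show ?case
  proof
    assume sq: "sqint (indicator A :: real \<Rightarrow> real)"
    let ?s = "\<lambda>n. indicator (A \<inter> {-real n<..real n}) :: real \<Rightarrow> real"
    show "approximable (indicator A)"
    proof (rule approximable_limit[OF _ sq sqint_dominated_LIMSEQ[OF sq]])
      show "approximable (?s n)" for n by (rule approximable_indicator_bounded[OF set])
      show "?s n \<in> borel_measurable borel" for n using set by simp
      show "\<bar>?s n x\<bar> \<le> \<bar>indicator A x\<bar>" for n x by (auto simp: indicator_def)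
      show "(\<lambda>n. ?s n x) \<longlonglongrightarrow> indicator A x" for x
      proof (rule tendsto_eventually, rule eventually_sequentiallyI[of "nat \<lceil>\<bar>x\<bar>\<rceil> + 1"])
        fix n assume "nat \<lceil>\<bar>x\<bar>\<rceil> + 1 \<le> n"
        hence "\<bar>x\<bar> < real n" by linarith
        thus "?s n x = indicator A x" by (auto simp: indicator_def)
      qed
    qed
  qed
next
  case (mult u c)
  show ?case
  proof
    assume "sqint (\<lambda>x. c * u x)"
    show "approximable (\<lambda>x. c * u x)"
    proof (cases "c = 0")
      case False
      have "sqint u" using sqint_cmult[OF \<open>sqint (\<lambda>x. c * u x)\<close>, of "1 / c"] False by simp
      thus ?thesis using mult by (intro approximable_cmult) auto
    qed (simp add: approximable_zero)
  qed
next
  case (add u v)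
  show ?case
  proof
    assume sq: "sqint (\<lambda>x. v x + u x)"
    have "sqint u" "sqint v"
      using add by (auto intro!: sqint_bound[OF sq, where B = 1])
    thus "approximable (\<lambda>x. v x + u x)" using add by (intro approximable_add) auto
  qed
next
  case (seq U)
  show ?case
  proof
    assume sq: "sqint f"
    have le: "\<bar>U n x\<bar> \<le> \<bar>f x\<bar>" for n x
    proof -
      have "U n x \<le> f x"
        by (rule incseq_le[of "\<lambda>i. U i x"]) (use seq in \<open>auto simp: incseq_def le_fun_def\<close>)
      thus ?thesis using seq(2)[of n x] by simp
    qed
    show "approximable f"
    proof (rule approximable_limit[OF _ sq sqint_dominated_LIMSEQ[OF sq]])
      show "approximable (U n)" for n
        using sqint_bound[OF sq seq(1), of n 1] le seq.IH by simp
    qed (use seq le in auto)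
  qed
qed

lemma test_functions_dense:
  assumes "sqint f" "0 < e"
  obtains \<phi> where "\<phi> \<in> test_functions" "nrm (\<lambda>x. f x - \<phi> x) < e"
proof -
  have m: "f \<in> borel_measurable borel" using assms(1) by (rule sqint_meas)
  have "approximable (\<lambda>x. max 0 (f x))" "approximable (\<lambda>x. max 0 (- f x))"
    by (rule approximable_nonneg[rule_format]; use m in \<open>auto intro!: sqint_bound[OF assms(1), where B = 1]\<close>)+
  hence "approximable (\<lambda>x. max 0 (f x) + (-1) * max 0 (- f x))"
    by (intro approximable_add approximable_cmult)
  also have "(\<lambda>x. max 0 (f x) + (-1) * max 0 (- f x)) = f" by (auto simp: fun_eq_iff max_def)
  finally show thesis using assms(2) that by (auto simp: approximable_def)
qed

text \<open>A test function \<phi> closer to f than the norm of f would give |f|^2 = (f, f - \<phi>)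
  < |f|^2.\<close>

lemma sqint_orthogonal_test_AE_0:
  assumes f: "sqint f" and "\<And>\<phi>. \<phi> \<in> test_functions \<Longrightarrow> ip f \<phi> = 0"
  shows "AE x in lborel. f x = 0"
proof (rule nrm_eq_0_AE[OF f], rule ccontr)
  assume "nrm f \<noteq> 0"
  hence pos: "0 < nrm f" using nrm_nonneg[of f] by linarith
  obtain \<phi> where \<phi>: "\<phi> \<in> test_functions" "nrm (\<lambda>x. f x - \<phi> x) < nrm f"
    using test_functions_dense[OF f pos] by blast
  have "(nrm f)\<^sup>2 = ip f (\<lambda>x. f x - \<phi> x)"
    using f \<phi> assms(2) by (simp add: ip_diff_right test_sqint ip_self)
  also have "\<dots> \<le> nrm f * nrm (\<lambda>x. f x - \<phi> x)"
    using ip_le[OF f sqint_diff[OF f test_sqint[OF \<phi>(1)]]] by simp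
  also have "\<dots> < nrm f * nrm f" using pos \<phi> by simp
  finally show False by (simp add: power2_eq_square)
qed

section \<open>The Fourier transform of square integrable functions\<close>

lemma L2_iff: "f \<in> L2 \<longleftrightarrow> f \<in> borel_measurable borel \<and> sqint (\<lambda>x. cmod (f x))"
  by (auto simp: L2_def sqint_def)

lemma L2_norm_eq_nrm: "L2_norm f = nrm (\<lambda>x. cmod (f x))"
  by (simp add: L2_norm_def nrm_def ip_def power2_eq_square)

lemma L2_meas: "f \<in> L2 \<Longrightarrow> f \<in> borel_measurable borel"
  by (simp add: L2_iff)

lemma L2_norm_nonneg [simp]: "0 \<le> L2_norm f"
  by (simp add: L2_norm_eq_nrm)

lemma L2_bound:
  assumes "f \<in> L2" "g \<in> borel_measurable borel" "\<And>x. cmod (g x) \<le> B * cmod (f x)"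
  shows "g \<in> L2"
  unfolding L2_iff
proof (intro conjI assms(2))
  show "sqint (\<lambda>x. cmod (g x))"
    by (rule sqint_bound[of "\<lambda>x. cmod (f x)" _ B]) (use assms in \<open>auto simp: L2_iff\<close>)
qed

lemma L2_add: "f \<in> L2 \<Longrightarrow> g \<in> L2 \<Longrightarrow> (\<lambda>x. f x + g x) \<in> L2"
proof -
  assume f: "f \<in> L2" and g: "g \<in> L2"
  have "sqint (\<lambda>x. cmod (f x + g x))"
    by (rule sqint_bound[OF sqint_add[of "\<lambda>x. cmod (f x)" "\<lambda>x. cmod (g x)"], where B = 1])
       (use f g in \<open>auto simp: L2_iff norm_triangle_ineq\<close>)
  thus ?thesis using f g by (auto simp: L2_iff)
qed

lemma L2_norm_triangle:
  assumes f: "f \<in> L2" and g: "g \<in> L2"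
  shows "L2_norm (\<lambda>x. f x + g x) \<le> L2_norm f + L2_norm g"
proof -
  have "nrm (\<lambda>x. cmod (f x + g x)) \<le> 1 * nrm (\<lambda>x. cmod (f x) + cmod (g x))"
    by (rule nrm_bound) (use f g in \<open>auto simp: L2_iff norm_triangle_ineq sqint_add\<close>)
  also have "\<dots> \<le> nrm (\<lambda>x. cmod (f x)) + nrm (\<lambda>x. cmod (g x))"
    using nrm_triangle f g by (auto simp: L2_iff)
  finally show ?thesis by (simp add: L2_norm_eq_nrm)
qed

lemma L2_uminus: "f \<in> L2 \<Longrightarrow> (\<lambda>x. - f x) \<in> L2"
  by (auto simp: L2_iff)

lemma L2_diff: "f \<in> L2 \<Longrightarrow> g \<in> L2 \<Longrightarrow> (\<lambda>x. f x - g x) \<in> L2"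
  using L2_add[OF _ L2_uminus, of f g] by simp

lemma L2_norm_triangle_diff:
  "f \<in> L2 \<Longrightarrow> g \<in> L2 \<Longrightarrow> h \<in> L2 \<Longrightarrow>
    L2_norm (\<lambda>x. f x - h x) \<le> L2_norm (\<lambda>x. f x - g x) + L2_norm (\<lambda>x. g x - h x)"
  using L2_norm_triangle[of "\<lambda>x. f x - g x" "\<lambda>x. g x - h x"] by (simp add: L2_diff)

lemma L2_norm_diff_commute: "L2_norm (\<lambda>x. f x - g x) = L2_norm (\<lambda>x. g x - f x)"
  by (simp add: L2_norm_eq_nrm norm_minus_commute)

lemma cnj_measurable [measurable]: "cnj \<in> borel_measurable borel"
  by (intro borel_measurable_continuous_onI continuous_intros)

lemma L2_cnj: "f \<in> L2 \<Longrightarrow> (\<lambda>x. cnj (f x)) \<in> L2"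
  unfolding L2_iff by (auto intro: measurable_compose[OF _ cnj_measurable])

lemma L2_integrable_mult:
  assumes "f \<in> L2" "g \<in> L2"
  shows "integrable lborel (\<lambda>x. f x * g x)"
proof (rule Bochner_Integration.integrable_bound)
  show "integrable lborel (\<lambda>x. cmod (f x) * cmod (g x))"
    using assms by (intro sqint_integrable_mult) (auto simp: L2_iff)
  show "(\<lambda>x. f x * g x) \<in> borel_measurable lborel"
    using assms[THEN L2_meas] by simp
qed (auto simp: norm_mult)

lemma L2_mult_le:
  assumes "f \<in> L2" "g \<in> L2"
  shows "cmod (LINT x|lborel. f x * g x) \<le> L2_norm f * L2_norm g"
proof -
  have "cmod (LINT x|lborel. f x * g x) \<le> (LINT x|lborel. cmod (f x * g x))"
    by (rule integral_norm_bound)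
  also have "\<dots> = ip (\<lambda>x. cmod (f x)) (\<lambda>x. cmod (g x))"
    by (simp add: ip_def norm_mult)
  also have "\<dots> \<le> L2_norm f * L2_norm g"
    using ip_le[of "\<lambda>x. cmod (f x)" "\<lambda>x. cmod (g x)"] assms by (auto simp: L2_iff L2_norm_eq_nrm)
  finally show ?thesis .
qed

lemma nn_integral_L2:
  "f \<in> L2 \<Longrightarrow> (\<integral>\<^sup>+ x. ennreal ((cmod (f x))\<^sup>2) \<partial>lborel) = ennreal ((L2_norm f)\<^sup>2)"
  by (simp add: L2_norm_eq_nrm nrm_power2 nn_integral_eq_integral L2_iff sqint_def)

lemma L2I_nn_integral:
  assumes "f \<in> borel_measurable borel" "(\<integral>\<^sup>+ x. ennreal ((cmod (f x))\<^sup>2) \<partial>lborel) \<le> ennreal (B\<^sup>2)" "0 \<le> B"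
  shows "f \<in> L2" "L2_norm f \<le> B"
proof -
  show f: "f \<in> L2"
    unfolding L2_iff sqint_def
  proof (intro conjI integrableI_bounded)
    have "(\<integral>\<^sup>+ x. ennreal ((cmod (f x))\<^sup>2) \<partial>lborel) < \<infinity>"
      using assms(2) by (rule order.strict_trans1) simp
    thus "(\<integral>\<^sup>+ x. ennreal (norm ((cmod (f x))\<^sup>2)) \<partial>lborel) < \<infinity>" by simp
  qed (use assms in auto)
  have "(L2_norm f)\<^sup>2 \<le> B\<^sup>2"
    using assms(2) unfolding nn_integral_L2[OF f] by simp
  thus "L2_norm f \<le> B" using assms(3) by (rule power2_le_imp_le)
qed

lemma L2_Fatou:
  assumes f: "f \<in> borel_measurable borel" and s: "\<And>n. s n \<in> L2"
    and lim: "AE x in lborel. (\<lambda>n. s n x) \<longlonglongrightarrow> f x"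
    and B: "\<And>n. n \<ge> N \<Longrightarrow> L2_norm (s n) \<le> B"
  shows "f \<in> L2" "L2_norm f \<le> B"
proof -
  have B0: "0 \<le> B" using B[of N] L2_norm_nonneg[of "s N"] by linarith
  have "(\<integral>\<^sup>+ x. ennreal ((cmod (f x))\<^sup>2) \<partial>lborel) =
        (\<integral>\<^sup>+ x. liminf (\<lambda>n. ennreal ((cmod (s n x))\<^sup>2)) \<partial>lborel)"
  proof (rule nn_integral_cong_AE, use lim in eventually_elim)
    case (elim x)
    have "(\<lambda>n. ennreal ((cmod (s n x))\<^sup>2)) \<longlonglongrightarrow> ennreal ((cmod (f x))\<^sup>2)"
      by (intro tendsto_intros elim)
    thus ?case by (intro lim_imp_Liminf[symmetric]) auto
  qed
  also have "\<dots> \<le> liminf (\<lambda>n. \<integral>\<^sup>+ x. ennreal ((cmod (s n x))\<^sup>2) \<partial>lborel)"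
    by (rule nn_integral_liminf) (use s[THEN L2_meas] in simp)
  also have "\<dots> = liminf (\<lambda>n. ennreal ((L2_norm (s n))\<^sup>2))"
    by (simp add: nn_integral_L2 s)
  also have "\<dots> \<le> limsup (\<lambda>n. ennreal ((L2_norm (s n))\<^sup>2))"
    by (rule Liminf_le_Limsup) simp
  also have "\<dots> \<le> ennreal (B\<^sup>2)"
  proof (rule Limsup_bounded)
    show "\<forall>\<^sub>F n in sequentially. ennreal ((L2_norm (s n))\<^sup>2) \<le> ennreal (B\<^sup>2)"
      using B by (intro eventually_sequentiallyI[of N] ennreal_leI power_mono) auto
  qed
  finally show "f \<in> L2" "L2_norm f \<le> B"
    using L2I_nn_integral[OF f _ B0] by auto
qed

text \<open>Riesz-Fischer for geometrically small increments D n. The weights 2^n still leave a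
  finite sum of integrals of 2^n |D n|^2, and 2 |D n| <= 2^n |D n|^2 + 2^(-n) then gives absolute
  convergence of the telescoping series almost everywhere.\<close>

lemma L2_complete:
  assumes F: "\<And>n. F n \<in> L2" and d: "\<And>n. L2_norm (\<lambda>x. F (Suc n) x - F n x) \<le> c * (1 / 2) ^ n"
  obtains G where "G \<in> L2" "\<And>n. L2_norm (\<lambda>x. G x - F n x) \<le> 2 * c * (1 / 2) ^ n"
proof -
  define D where "D = (\<lambda>n x. F (Suc n) x - F n x)"
  have D: "D n \<in> L2" for n unfolding D_def by (intro L2_diff F)
  have Dm: "D n \<in> borel_measurable borel" for n by (rule L2_meas[OF D])
  have c0: "0 \<le> c" using order_trans[OF L2_norm_nonneg d[of 0]] by simp
  have AE_sum: "AE x in lborel. summable (\<lambda>n. 2 ^ n * (cmod (D n x))\<^sup>2)"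
  proof -
    have le: "(\<integral>\<^sup>+ x. ennreal (2 ^ n * (cmod (D n x))\<^sup>2) \<partial>lborel) \<le> ennreal (c\<^sup>2 * (1 / 2) ^ n)" for n
    proof -
      have "(\<integral>\<^sup>+ x. ennreal (2 ^ n * (cmod (D n x))\<^sup>2) \<partial>lborel) = ennreal (2 ^ n) * ennreal ((L2_norm (D n))\<^sup>2)"
        unfolding nn_integral_L2[OF D, symmetric]
        using Dm[of n] by (subst nn_integral_cmult[symmetric]) (auto simp: ennreal_mult)
      also have "\<dots> \<le> ennreal (2 ^ n) * ennreal ((c * (1 / 2) ^ n)\<^sup>2)"
        using d[of n] by (intro mult_left_mono ennreal_leI power_mono) (auto simp: D_def)
      also have "\<dots> = ennreal (2 ^ n * (c * (1 / 2) ^ n)\<^sup>2)"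
        by (simp add: ennreal_mult)
      also have "2 ^ n * (c * (1 / 2) ^ n)\<^sup>2 = c\<^sup>2 * (1 / 2) ^ n"
        by (simp add: power_mult_distrib power2_eq_square field_simps)
      finally show ?thesis .
    qed
    have "(\<integral>\<^sup>+ x. (\<Sum>n. ennreal (2 ^ n * (cmod (D n x))\<^sup>2)) \<partial>lborel) =
        (\<Sum>n. \<integral>\<^sup>+ x. ennreal (2 ^ n * (cmod (D n x))\<^sup>2) \<partial>lborel)"
      using Dm by (intro nn_integral_suminf) simp
    also have "\<dots> \<le> (\<Sum>n. ennreal (c\<^sup>2 * (1 / 2) ^ n))"
      by (intro suminf_le le) auto
    also have "\<dots> = ennreal (\<Sum>n. c\<^sup>2 * (1 / 2) ^ n)"
      by (rule suminf_ennreal2) (auto intro!: summable_mult summable_geometric)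
    also have "\<dots> < \<infinity>" by simp
    finally have "AE x in lborel. (\<Sum>n. ennreal (2 ^ n * (cmod (D n x))\<^sup>2)) \<noteq> \<infinity>"
      using Dm by (intro nn_integral_PInf_AE) auto
    thus ?thesis by eventually_elim (auto intro: summable_suminf_not_top)
  qed
  define G where "G = (\<lambda>x. lim (\<lambda>n. F n x))"
  have Gm: "G \<in> borel_measurable borel"
    unfolding G_def by (rule borel_measurable_lim_metric) (rule L2_meas[OF F])
  have AE_lim: "AE x in lborel. (\<lambda>n. F n x) \<longlonglongrightarrow> G x"
    using AE_sum
  proof eventually_elim
    case (elim x)
    have "summable (\<lambda>n. 2 ^ n * (cmod (D n x))\<^sup>2 + (1 / 2) ^ n)"
      by (intro summable_add elim summable_geometric) simp
    hence "summable (\<lambda>n. D n x)"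
    proof (rule summable_comparison_test'[where N = 0])
      fix n
      have "0 \<le> (2 ^ n * cmod (D n x) - 1)\<^sup>2" by simp
      also have "\<dots> = 2 ^ n * (2 ^ n * (cmod (D n x))\<^sup>2) + 1 - 2 * (2 ^ n * cmod (D n x))"
        unfolding power2_eq_square by algebra
      finally have "2 * (2 ^ n * cmod (D n x)) \<le> 2 ^ n * (2 ^ n * (cmod (D n x))\<^sup>2) + 1" by simp
      hence "2 * cmod (D n x) \<le> 2 ^ n * (cmod (D n x))\<^sup>2 + (1 / 2) ^ n"
        by (simp add: field_simps power_one_over)
      thus "norm (D n x) \<le> 2 ^ n * (cmod (D n x))\<^sup>2 + (1 / 2) ^ n"
        using norm_ge_zero[of "D n x"] by linarith
    qed
    hence "(\<lambda>n. \<Sum>k<n. D k x) \<longlonglongrightarrow> (\<Sum>k. D k x)" by (rule summable_LIMSEQ)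
    moreover have "(\<Sum>k<n. D k x) = F n x - F 0 x" for n
      unfolding D_def by (rule sum_lessThan_telescope)
    ultimately have "(\<lambda>n. F n x - F 0 x) \<longlonglongrightarrow> (\<Sum>k. D k x)" by simp
    hence "(\<lambda>n. F n x - F 0 x + F 0 x) \<longlonglongrightarrow> (\<Sum>k. D k x) + F 0 x"
      by (intro tendsto_intros)
    hence "convergent (\<lambda>n. F n x)" by (auto simp: convergent_def)
    thus ?case unfolding G_def by (simp add: convergent_LIMSEQ_iff)
  qed
  have dist: "L2_norm (\<lambda>x. F (n + m) x - F n x) \<le> 2 * c * (1 / 2) ^ n" for n m
  proof -
    have "L2_norm (\<lambda>x. F (n + m) x - F n x) \<le> 2 * c * (1 / 2) ^ n - 2 * c * (1 / 2) ^ (n + m)"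
    proof (induction m)
      case (Suc m)
      have "L2_norm (\<lambda>x. F (n + Suc m) x - F n x) \<le>
          L2_norm (\<lambda>x. F (n + Suc m) x - F (n + m) x) + L2_norm (\<lambda>x. F (n + m) x - F n x)"
        by (rule L2_norm_triangle_diff) (rule F)+
      also have "\<dots> \<le> c * (1 / 2) ^ (n + m) + (2 * c * (1 / 2) ^ n - 2 * c * (1 / 2) ^ (n + m))"
        using Suc d[of "n + m"] by (intro add_mono) auto
      finally show ?case by simp
    qed (simp add: L2_norm_def)
    moreover have "0 \<le> 2 * c * (1 / 2) ^ (n + m)" using c0 by simp
    ultimately show ?thesis by linarith
  qed
  \<comment> \<open>Fatou in the second index m carries the uniform bound on F m - F n over to G - F
    n.\<close>
  have G_F: "(\<lambda>x. G x - F n x) \<in> L2 \<and> L2_norm (\<lambda>x. G x - F n x) \<le> 2 * c * (1 / 2) ^ n" for n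
  proof
    have a: "AE x in lborel. (\<lambda>m. F m x - F n x) \<longlonglongrightarrow> G x - F n x"
      using AE_lim by eventually_elim (intro tendsto_intros)
    have b: "L2_norm (\<lambda>x. F m x - F n x) \<le> 2 * c * (1 / 2) ^ n" if "m \<ge> n" for m
      using dist[of n "m - n"] that by simp
    have m: "(\<lambda>x. G x - F n x) \<in> borel_measurable borel"
      using Gm L2_meas[OF F, of n] by simp
    show "(\<lambda>x. G x - F n x) \<in> L2" "L2_norm (\<lambda>x. G x - F n x) \<le> 2 * c * (1 / 2) ^ n"
      by (rule L2_Fatou[where s = "\<lambda>m x. F m x - F n x" and N = n]; use m a b L2_diff[OF F F] in blast)+
  qed
  have "G \<in> L2" using L2_add[OF conjunct1[OF G_F[of 0]] F[of 0]] by simp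
  thus thesis using that G_F by blast
qed

section \<open>The Fourier integral and Gaussian damping\<close>

definition ft :: "(real \<Rightarrow> complex) \<Rightarrow> real \<Rightarrow> complex" where
  "ft f \<xi> = complex_of_real (1 / sqrt (2 * pi)) * (LINT x|lborel. f x * cis (- (x * \<xi>)))"

abbreviation trunc :: "real \<Rightarrow> (real \<Rightarrow> complex) \<Rightarrow> real \<Rightarrow> complex" where
  "trunc R f \<equiv> (\<lambda>x. indicator {-R..R} x *\<^sub>R f x)"

lemma truncated_fourier_eq_ft: "truncated_fourier f R = ft (trunc R f)"
  by (simp add: truncated_fourier_def ft_def set_lebesgue_integral_def fun_eq_iff)

lemma cis_measurable [measurable]: "cis \<in> borel_measurable borel"
  by (intro borel_measurable_continuous_onI continuous_intros)

lemma integrable_mult_bounded: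
  fixes f m :: "real \<Rightarrow> complex"
  assumes "integrable lborel f" "m \<in> borel_measurable borel" "\<And>x. cmod (m x) \<le> B"
  shows "integrable lborel (\<lambda>x. f x * m x)"
proof (rule Bochner_Integration.integrable_bound)
  show "integrable lborel (\<lambda>x. B *\<^sub>R f x)" using assms by simp
  have "0 \<le> B" using assms(3)[of 0] norm_ge_zero order_trans by blast
  thus "AE x in lborel. norm (f x * m x) \<le> norm (B *\<^sub>R f x)"
    using assms(3) by (auto simp: norm_mult mult.commute[of B] intro!: mult_left_mono)
  show "(\<lambda>x. f x * m x) \<in> borel_measurable lborel"
    using assms(2) borel_measurable_integrable[OF assms(1)] by simp
qed

lemma integrable_mult_cis: "integrable lborel f \<Longrightarrow> integrable lborel (\<lambda>x. f x * cis (x * c))"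
  by (rule integrable_mult_bounded[where B = 1]) auto

lemma integrable_mult_cis': "integrable lborel f \<Longrightarrow> integrable lborel (\<lambda>x. f x * cis (- (x * c)))"
  by (rule integrable_mult_bounded[where B = 1]) auto

lemma ft_measurable [measurable]:
  assumes "f \<in> borel_measurable borel" shows "ft f \<in> borel_measurable borel"
proof -
  have [measurable]: "f \<in> borel_measurable borel" by fact
  have "(\<lambda>\<xi>. LINT x|lborel. f x * cis (- (x * \<xi>))) \<in> borel_measurable borel"
    by measurable
  thus ?thesis unfolding ft_def[abs_def] by measurable
qed

lemma ft_diff: "integrable lborel f \<Longrightarrow> integrable lborel g \<Longrightarrow> ft (\<lambda>x. f x - g x) = (\<lambda>\<xi>. ft f \<xi> - ft g \<xi>)"
  by (simp add: ft_def fun_eq_iff left_diff_distrib right_diff_distrib integrable_mult_cis')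

lemma ft_bounded: "cmod (ft f \<xi>) \<le> (LINT x|lborel. cmod (f x))"
proof -
  have "cmod (LINT x|lborel. f x * cis (- (x * \<xi>))) \<le> (LINT x|lborel. cmod (f x * cis (- (x * \<xi>))))"
    by (rule integral_norm_bound)
  also have "\<dots> = (LINT x|lborel. cmod (f x))" by (simp add: norm_mult)
  finally have *: "cmod (LINT x|lborel. f x * cis (- (x * \<xi>))) \<le> (LINT x|lborel. cmod (f x))" .
  have "1 \<le> 2 * pi" using pi_gt3 by simp
  hence "1 / sqrt (2 * pi) \<le> 1" by simp
  hence "cmod (ft f \<xi>) \<le> 1 * cmod (LINT x|lborel. f x * cis (- (x * \<xi>)))"
    unfolding ft_def norm_mult by (intro mult_right_mono) (auto simp: norm_divide)
  thus ?thesis using * by simp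
qed

lemma fubini_mult:
  fixes f h :: "real \<Rightarrow> complex"
  assumes f: "integrable lborel f" and h: "integrable lborel h"
    and k: "case_prod k \<in> borel_measurable (borel \<Otimes>\<^sub>M borel)" "\<And>x y. cmod (k x y) \<le> B"
  shows "(LINT x|lborel. f x * (LINT y|lborel. h y * k x y)) = (LINT y|lborel. h y * (LINT x|lborel. f x * k x y))"
proof -
  have fm [measurable]: "f \<in> borel_measurable borel" using borel_measurable_integrable[OF f] by simp
  have hm [measurable]: "h \<in> borel_measurable borel" using borel_measurable_integrable[OF h] by simp
  have [measurable]: "(\<lambda>p. k (fst p) (snd p)) \<in> borel_measurable (borel \<Otimes>\<^sub>M borel)"
    using k(1) by (simp add: case_prod_beta')
  have km: "(\<lambda>y. k x y) \<in> borel_measurable borel" for x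
    using measurable_compose[OF measurable_Pair1' k(1), of x] by simp
  have B0: "0 \<le> B" using k(2)[of 0 0] norm_ge_zero order_trans by blast
  define F where "F = (\<lambda>(x, y). f x * h y * k x y)"
  have Fm [measurable]: "F \<in> borel_measurable (lborel \<Otimes>\<^sub>M lborel)"
    unfolding F_def case_prod_beta' by measurable
  have i2: "integrable lborel (\<lambda>y. F (x, y))" for x
  proof -
    have "integrable lborel (\<lambda>y. f x * (h y * k x y))"
      by (intro integrable_mult_right integrable_mult_bounded[OF h km k(2)])
    thus ?thesis by (simp add: F_def mult.assoc)
  qed
  have "integrable (lborel \<Otimes>\<^sub>M lborel) F"
  proof (rule lborel_pair.Fubini_integrable[OF Fm])
    show "AE x in lborel. integrable lborel (\<lambda>y. F (x, y))" using i2 by simp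
    show "integrable lborel (\<lambda>x. \<integral>y. norm (F (x, y)) \<partial>lborel)"
    proof (rule Bochner_Integration.integrable_bound)
      show "integrable lborel (\<lambda>x. cmod (f x) * (B * (LINT y|lborel. cmod (h y))))" using f by simp
      show "(\<lambda>x. \<integral>y. norm (F (x, y)) \<partial>lborel) \<in> borel_measurable lborel" by measurable
      show "AE x in lborel. norm (\<integral>y. norm (F (x, y)) \<partial>lborel) \<le> norm (cmod (f x) * (B * (LINT y|lborel. cmod (h y))))"
      proof (rule AE_I2)
        fix x
        have "(\<integral>y. norm (F (x, y)) \<partial>lborel) \<le> (\<integral>y. cmod (f x) * (B * cmod (h y)) \<partial>lborel)"
        proof (rule integral_mono)
          show "norm (F (x, y)) \<le> cmod (f x) * (B * cmod (h y))" for y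
            unfolding F_def using mult_left_mono[OF k(2)[of x y], of "cmod (f x) * cmod (h y)"]
            by (simp add: norm_mult mult_ac)
        qed (use i2 h in auto)
        also have "\<dots> = cmod (f x) * (B * (LINT y|lborel. cmod (h y)))" by simp
        finally show "norm (\<integral>y. norm (F (x, y)) \<partial>lborel) \<le> norm (cmod (f x) * (B * (LINT y|lborel. cmod (h y))))"
          using B0 by (simp add: abs_mult)
      qed
    qed
  qed
  from lborel_pair.Fubini_integral[of "\<lambda>x y. F (x, y)"] this
  have "(LINT y|lborel. LINT x|lborel. F (x, y)) = (LINT x|lborel. LINT y|lborel. F (x, y))"
    by simp
  moreover have "(LINT y|lborel. F (x, y)) = f x * (LINT y|lborel. h y * k x y)" for x
    by (simp add: F_def mult.assoc)
  moreover have "(LINT x|lborel. F (x, y)) = h y * (LINT x|lborel. f x * k x y)" for y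
    unfolding integral_mult_right_zero[symmetric] by (simp add: F_def mult_ac)
  ultimately show ?thesis by simp
qed

text \<open>Fubini with the bounded kernel exp(-i x \<xi>), which is symmetric in its two
  variables.\<close>

lemma ft_multiplication:
  assumes f: "integrable lborel f" and h: "integrable lborel h"
  shows "(LINT \<xi>|lborel. ft f \<xi> * h \<xi>) = (LINT x|lborel. f x * ft h x)"
proof -
  let ?c = "complex_of_real (1 / sqrt (2 * pi))"
  have "(LINT \<xi>|lborel. ft f \<xi> * h \<xi>) = ?c * (LINT \<xi>|lborel. h \<xi> * (LINT x|lborel. f x * cis (- (x * \<xi>))))"
    by (subst integral_mult_right_zero[symmetric]) (simp add: ft_def mult_ac)
  also have "(LINT \<xi>|lborel. h \<xi> * (LINT x|lborel. f x * cis (- (x * \<xi>)))) =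
      (LINT x|lborel. f x * (LINT \<xi>|lborel. h \<xi> * cis (- (x * \<xi>))))"
    by (rule fubini_mult[OF h f, where B = 1]) auto
  also have "?c * \<dots> = (LINT x|lborel. f x * ft h x)"
    by (subst integral_mult_right_zero[symmetric]) (simp add: ft_def mult_ac)
  finally show ?thesis .
qed

abbreviation gauss :: "real \<Rightarrow> real" where "gauss \<equiv> std_normal_density"

lemma gauss_le_1: "gauss x \<le> 1"
proof -
  have "1 \<le> 2 * pi" using pi_gt3 by simp
  hence "1 / sqrt (2 * pi) \<le> 1" by simp
  moreover have "exp (- x\<^sup>2 / 2) \<le> 1" by simp
  ultimately have "1 / sqrt (2 * pi) * exp (- x\<^sup>2 / 2) \<le> 1 * 1" by (intro mult_mono) auto
  thus ?thesis by (simp add: std_normal_density_def)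
qed

lemma gauss_integrable: "integrable lborel gauss" and gauss_integral: "(LINT x|lborel. gauss x) = 1"
  using integrable_normal_density[of 1 0] integral_normal_density[of 1 0] by auto

text \<open>The left-hand side is the characteristic function of the standard normal distribution,
  whose value is known.\<close>

lemma gauss_fourier: "(LINT x|lborel. complex_of_real (gauss x) * cis (t * x)) = complex_of_real (exp (- t\<^sup>2 / 2))"
proof -
  have "char std_normal_distribution t = (LINT x|lborel. gauss x *\<^sub>R iexp (t * x))"
    unfolding char_def by (rule integral_density) auto
  thus ?thesis by (simp add: char_std_normal_distribution scaleR_conv_of_real cis_conv_exp)
qed

lemma gauss_scaled_fourier:
  assumes "0 < e"
  shows "(LINT \<xi>|lborel. complex_of_real (gauss (e * \<xi>)) * cis (x * \<xi>)) =
    complex_of_real (sqrt (2 * pi) / e * gauss (x / e))"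
proof -
  have "(LINT \<xi>|lborel. complex_of_real (gauss (e * \<xi>)) * cis (x * \<xi>)) =
     \<bar>1 / e\<bar> *\<^sub>R (LINT \<xi>|lborel. complex_of_real (gauss (e * (0 + 1 / e * \<xi>))) * cis (x * (0 + 1 / e * \<xi>)))"
    by (rule lborel_integral_real_affine) (use assms in simp)
  also have "\<dots> = (1 / e) *\<^sub>R (LINT \<xi>|lborel. complex_of_real (gauss \<xi>) * cis (x / e * \<xi>))"
    using assms by (simp add: field_simps)
  also have "\<dots> = complex_of_real (sqrt (2 * pi) / e * gauss (x / e))"
    unfolding gauss_fourier by (simp add: scaleR_conv_of_real std_normal_density_def)
  finally show ?thesis .
qed

lemma gauss_scaled_integrable: "0 < e \<Longrightarrow> integrable lborel (\<lambda>\<xi>. gauss (e * \<xi>))"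
  using lborel_integrable_real_affine[OF gauss_integrable, of e 0] by simp

text \<open>A Gaussian cut-off in frequency that tends to 1 as e tends to 0. Fourier integrals are a
  priori only bounded; damping makes their products integrable.\<close>

definition damp :: "real \<Rightarrow> real \<Rightarrow> real" where "damp e \<xi> = exp (- (e * \<xi>)\<^sup>2 / 2)"

lemma damp_measurable [measurable]: "damp e \<in> borel_measurable borel"
  unfolding damp_def[abs_def] by simp

lemma damp_eq: "damp e \<xi> = sqrt (2 * pi) * gauss (e * \<xi>)"
  by (simp add: damp_def std_normal_density_def)

lemma damp_pos: "0 < damp e \<xi>" and damp_le_1: "damp e \<xi> \<le> 1"
  by (simp_all add: damp_def)

lemma damp_integrable: "0 < e \<Longrightarrow> integrable lborel (damp e)"
  unfolding damp_eq[abs_def] by (intro integrable_mult_right gauss_scaled_integrable)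

text \<open>Damping in frequency is averaging with a Gaussian of width e in space. The
  multiplication formula moves the transform from f to h = conj(ft g) damp, and a second use of it
  computes the transform of h.\<close>

lemma damped_parseval:
  assumes f: "integrable lborel f" and g: "integrable lborel g" and e: "0 < e"
  shows "(LINT \<xi>|lborel. ft f \<xi> * (cnj (ft g \<xi>) * damp e \<xi>)) =
     (LINT x|lborel. f x * (LINT y|lborel. cnj (g y) * (gauss ((x - y) / e) / e)))"
proof -
  have fm [measurable]: "f \<in> borel_measurable borel" using borel_measurable_integrable[OF f] by simp
  have gm [measurable]: "g \<in> borel_measurable borel" using borel_measurable_integrable[OF g] by simp
  define h where "h = (\<lambda>\<xi>. cnj (ft g \<xi>) * complex_of_real (damp e \<xi>))"
  have dc: "integrable lborel (\<lambda>\<xi>. complex_of_real (damp e \<xi>))" using damp_integrable[OF e] by simp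
  have h: "integrable lborel h"
  proof -
    have "integrable lborel (\<lambda>\<xi>. complex_of_real (damp e \<xi>) * cnj (ft g \<xi>))"
      by (rule integrable_mult_bounded[OF dc, where B = "LINT x|lborel. cmod (g x)"])
         (auto intro: ft_bounded measurable_compose[OF _ cnj_measurable])
    thus ?thesis by (simp add: h_def mult.commute)
  qed
  have "ft h x = (LINT y|lborel. cnj (g y) * (gauss ((x - y) / e) / e))" for x
  proof -
    \<comment> \<open>The damping times the oscillation at the point x: its transform is, up to the
      factor sqrt(2 pi), the Gaussian kernel centred at x.\<close>
    define k where "k = (\<lambda>\<xi>. complex_of_real (damp e \<xi>) * cis (\<xi> * x))"
    have k: "integrable lborel k" unfolding k_def by (rule integrable_mult_cis[OF dc])
    have ftk: "ft k y = complex_of_real (sqrt (2 * pi)) * (gauss ((x - y) / e) / e)" for y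
    proof -
      have "(LINT \<xi>|lborel. k \<xi> * cis (- (\<xi> * y))) =
          complex_of_real (sqrt (2 * pi)) * (LINT \<xi>|lborel. complex_of_real (gauss (e * \<xi>)) * cis ((x - y) * \<xi>))"
      proof (subst integral_mult_right_zero[symmetric], rule Bochner_Integration.integral_cong)
        fix \<xi> :: real
        have "cis (\<xi> * x) * cis (- (\<xi> * y)) = cis ((x - y) * \<xi>)" by (simp add: cis_mult algebra_simps)
        thus "k \<xi> * cis (- (\<xi> * y)) = complex_of_real (sqrt (2 * pi)) * (complex_of_real (gauss (e * \<xi>)) * cis ((x - y) * \<xi>))"
          unfolding k_def damp_eq of_real_mult mult.assoc by simp
      qed simp
      also have "\<dots> = complex_of_real (2 * pi) * (gauss ((x - y) / e) / e)"
        unfolding gauss_scaled_fourier[OF e] by (simp flip: of_real_mult)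
      finally have "ft k y = complex_of_real (2 * pi / sqrt (2 * pi) * (gauss ((x - y) / e) / e))"
        unfolding ft_def by simp
      thus ?thesis using real_div_sqrt[of "2 * pi"] by simp
    qed
    have "ft h x = complex_of_real (1 / sqrt (2 * pi)) * (LINT \<xi>|lborel. cnj (ft g \<xi> * k \<xi>))"
      unfolding ft_def[of h] by (simp add: h_def k_def cis_cnj mult.assoc)
    also have "(LINT \<xi>|lborel. cnj (ft g \<xi> * k \<xi>)) = cnj (LINT \<xi>|lborel. ft g \<xi> * k \<xi>)"
      using Bochner_Integration.integral_cnj[of lborel "\<lambda>\<xi>. ft g \<xi> * k \<xi>"] by (simp only:)
    also have "(LINT \<xi>|lborel. ft g \<xi> * k \<xi>) = (LINT y|lborel. g y * ft k y)"
      by (rule ft_multiplication[OF g k])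
    also have "\<dots> = complex_of_real (sqrt (2 * pi)) * (LINT y|lborel. g y * (gauss ((x - y) / e) / e))"
      by (subst integral_mult_right_zero[symmetric]) (simp add: ftk mult_ac)
    also have "complex_of_real (1 / sqrt (2 * pi)) * cnj \<dots> = cnj (LINT y|lborel. g y * (gauss ((x - y) / e) / e))"
      by simp
    also have "\<dots> = (LINT y|lborel. cnj (g y) * (gauss ((x - y) / e) / e))"
      using Bochner_Integration.integral_cnj[of lborel "\<lambda>y. g y * (gauss ((x - y) / e) / e)"]
      by (simp only: complex_cnj_mult complex_cnj_divide complex_cnj_complex_of_real)
    finally show ?thesis .
  qed
  thus ?thesis using ft_multiplication[OF f h] unfolding h_def by simp
qed

lemma gauss_kernel_nn_integral: "0 < e \<Longrightarrow> (\<integral>\<^sup>+ y. ennreal (gauss ((x - y) / e) / e) \<partial>lborel) = 1"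
proof -
  assume e: "0 < e"
  have "(\<integral>\<^sup>+ y. ennreal (gauss ((x - y) / e) / e) \<partial>lborel) =
      \<bar>- e\<bar> * (\<integral>\<^sup>+ y. ennreal (gauss ((x - (x + (- e) * y)) / e) / e) \<partial>lborel)"
    by (rule nn_integral_real_affine) (use e in auto)
  also have "\<dots> = ennreal e * (\<integral>\<^sup>+ y. ennreal (1 / e) * ennreal (gauss y) \<partial>lborel)"
    using e by (simp flip: ennreal_mult)
  also have "\<dots> = ennreal e * (ennreal (1 / e) * (\<integral>\<^sup>+ y. ennreal (gauss y) \<partial>lborel))"
    by (subst nn_integral_cmult) auto
  also have "(\<integral>\<^sup>+ y. ennreal (gauss y) \<partial>lborel) = ennreal 1"
    using gauss_integrable gauss_integral by (subst nn_integral_eq_integral) auto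
  finally show ?thesis using e by (simp flip: ennreal_mult)
qed

text \<open>The Plancherel inequality before e tends to 0. By \<open>damped_parseval\<close> the
  left side is a double integral of f(x) conj(f(y)) K(x, y); bounding |f(x)| |f(y)| by half the sum
  of the squares and using that K is symmetric with total mass 1 in each variable leaves exactly the
  square of the norm of f.\<close>

lemma ft_damped_le:
  assumes f: "integrable lborel f" "f \<in> L2" and e: "0 < e"
  shows "(\<integral>\<^sup>+ \<xi>. ennreal ((cmod (ft f \<xi>))\<^sup>2 * damp e \<xi>) \<partial>lborel) \<le> ennreal ((L2_norm f)\<^sup>2)"
proof -
  have fm [measurable]: "f \<in> borel_measurable borel" using f by (simp add: L2_iff)
  have ftm [measurable]: "ft f \<in> borel_measurable borel" by measurable
  define A where "A = (\<lambda>\<xi>. (cmod (ft f \<xi>))\<^sup>2 * damp e \<xi>)"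
  define B where "B = (LINT x|lborel. cmod (f x))"
  define K where "K = (\<lambda>x y. gauss ((x - y) / e) / e)"
  have Km [measurable]: "(\<lambda>p. K (fst p) (snd p)) \<in> borel_measurable (borel \<Otimes>\<^sub>M borel)"
    unfolding K_def by measurable
  have Km1 [measurable]: "K x \<in> borel_measurable borel" for x unfolding K_def by measurable
  have K0: "0 \<le> K x y" for x y using e by (simp add: K_def)
  have K1: "K x y \<le> 1 / e" for x y using e gauss_le_1 by (simp add: K_def divide_right_mono)
  have Kint: "(\<integral>\<^sup>+ y. ennreal (K x y) \<partial>lborel) = 1" for x
    unfolding K_def by (rule gauss_kernel_nn_integral[OF e])
  have Ksym: "K x y = K y x" for x y by (simp add: K_def std_normal_density_def power2_commute field_simps)
  have intA: "integrable lborel A"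
  proof (rule Bochner_Integration.integrable_bound)
    show "integrable lborel (\<lambda>\<xi>. B\<^sup>2 * damp e \<xi>)" using damp_integrable[OF e] by simp
    show "A \<in> borel_measurable lborel" unfolding A_def by measurable
    have "(cmod (ft f \<xi>))\<^sup>2 \<le> B\<^sup>2" for \<xi>
      by (intro power_mono) (auto simp: B_def ft_bounded)
    hence "A \<xi> \<le> B\<^sup>2 * damp e \<xi>" for \<xi>
      unfolding A_def using damp_pos[of e \<xi>] by (intro mult_right_mono) auto
    moreover have "0 \<le> A \<xi>" for \<xi> using damp_pos[of e \<xi>] by (simp add: A_def)
    ultimately show "AE \<xi> in lborel. norm (A \<xi>) \<le> norm (B\<^sup>2 * damp e \<xi>)"
      by (auto intro: order_trans[OF _ abs_ge_self])
  qed
  have A0: "0 \<le> A \<xi>" for \<xi> using damp_pos[of e \<xi>] by (simp add: A_def)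
  have "complex_of_real (LINT \<xi>|lborel. A \<xi>) = (LINT \<xi>|lborel. ft f \<xi> * (cnj (ft f \<xi>) * damp e \<xi>))"
  proof -
    have "complex_of_real (A \<xi>) = ft f \<xi> * (cnj (ft f \<xi>) * damp e \<xi>)" for \<xi>
      unfolding A_def of_real_mult complex_norm_square by (rule mult.assoc)
    thus ?thesis by (simp flip: integral_complex_of_real)
  qed
  also have "\<dots> = (LINT x|lborel. f x * (LINT y|lborel. cnj (f y) * complex_of_real (K x y)))"
    unfolding K_def by (rule damped_parseval[OF f(1) f(1) e])
  finally have eq: "complex_of_real (LINT \<xi>|lborel. A \<xi>) = (LINT x|lborel. f x * (LINT y|lborel. cnj (f y) * complex_of_real (K x y)))" .
  have cf: "integrable lborel (\<lambda>y. cnj (f y))" using f(1) by simp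
  have inner: "integrable lborel (\<lambda>y. cnj (f y) * complex_of_real (K x y))" for x
    by (rule integrable_mult_bounded[OF cf, where B = "1 / e"]) (use K0 K1 in auto)
  have inner_le: "cmod (LINT y|lborel. cnj (f y) * complex_of_real (K x y)) \<le> B * (1 / e)" for x
  proof -
    have "cmod (LINT y|lborel. cnj (f y) * complex_of_real (K x y)) \<le>
      (LINT y|lborel. cmod (cnj (f y) * complex_of_real (K x y)))" by (rule integral_norm_bound)
    also have "\<dots> \<le> (LINT y|lborel. cmod (f y) * (1 / e))"
    proof (rule integral_mono)
      show "cmod (cnj (f y) * complex_of_real (K x y)) \<le> cmod (f y) * (1 / e)" for y
        using mult_left_mono[OF K1[of x y], of "cmod (f y)"] K0[of x y] by (simp add: norm_mult)
    qed (use inner[THEN integrable_norm] f(1) in auto)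
    finally show ?thesis by (simp add: B_def)
  qed
  have outer: "integrable lborel (\<lambda>x. f x * (LINT y|lborel. cnj (f y) * complex_of_real (K x y)))"
  proof (rule integrable_mult_bounded[OF f(1) _ inner_le])
    have "(\<lambda>p. cnj (f (snd p)) * complex_of_real (K (fst p) (snd p))) \<in> borel_measurable (borel \<Otimes>\<^sub>M borel)"
      by measurable
    thus "(\<lambda>x. LINT y|lborel. cnj (f y) * complex_of_real (K x y)) \<in> borel_measurable borel"
      using lborel.borel_measurable_lebesgue_integral[of "\<lambda>x y. cnj (f y) * complex_of_real (K x y)" borel]
      by (simp add: case_prod_beta')
  qed
  define a where "a = (\<lambda>x. cmod (f x))"
  have am [measurable]: "a \<in> borel_measurable borel" unfolding a_def by measurable
  have a0: "0 \<le> a x" for x by (simp add: a_def)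
  have "ennreal (LINT \<xi>|lborel. A \<xi>) = ennreal (cmod (complex_of_real (LINT \<xi>|lborel. A \<xi>)))"
    using A0 by (simp add: integral_nonneg_AE)
  also have "\<dots> \<le> (\<integral>\<^sup>+ x. norm (f x * (LINT y|lborel. cnj (f y) * complex_of_real (K x y))) \<partial>lborel)"
    unfolding eq by (rule integral_norm_bound_ennreal[OF outer])
  also have "\<dots> \<le> (\<integral>\<^sup>+ x. \<integral>\<^sup>+ y. ennreal (a x * a y * K x y) \<partial>lborel \<partial>lborel)"
  proof (rule nn_integral_mono)
    fix x :: real
    have "ennreal (norm (f x * (LINT y|lborel. cnj (f y) * complex_of_real (K x y)))) =
        ennreal (a x) * ennreal (norm (LINT y|lborel. cnj (f y) * complex_of_real (K x y)))"
      by (simp add: norm_mult a_def ennreal_mult)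
    also have "\<dots> \<le> ennreal (a x) * (\<integral>\<^sup>+ y. norm (cnj (f y) * complex_of_real (K x y)) \<partial>lborel)"
      by (intro mult_left_mono integral_norm_bound_ennreal[OF inner]) auto
    also have "\<dots> = (\<integral>\<^sup>+ y. ennreal (a x) * ennreal (norm (cnj (f y) * complex_of_real (K x y))) \<partial>lborel)"
      by (rule nn_integral_cmult[symmetric]) measurable
    also have "\<dots> = (\<integral>\<^sup>+ y. ennreal (a x * a y * K x y) \<partial>lborel)"
      using K0 by (intro nn_integral_cong) (simp add: norm_mult a_def mult.assoc flip: ennreal_mult)
    finally show "ennreal (norm (f x * (LINT y|lborel. cnj (f y) * complex_of_real (K x y)))) \<le>
      (\<integral>\<^sup>+ y. ennreal (a x * a y * K x y) \<partial>lborel)" .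
  qed
  also have "\<dots> \<le> (\<integral>\<^sup>+ x. \<integral>\<^sup>+ y. ennreal ((a x)\<^sup>2 / 2) * ennreal (K x y) + ennreal ((a y)\<^sup>2 / 2) * ennreal (K x y) \<partial>lborel \<partial>lborel)"
  proof (intro nn_integral_mono)
    fix x y :: real
    have "0 \<le> (a x - a y)\<^sup>2" by simp
    hence "a x * a y \<le> (a x)\<^sup>2 / 2 + (a y)\<^sup>2 / 2" by (simp add: power2_diff)
    hence "a x * a y * K x y \<le> ((a x)\<^sup>2 / 2 + (a y)\<^sup>2 / 2) * K x y" using K0 by (rule mult_right_mono)
    thus "ennreal (a x * a y * K x y) \<le> ennreal ((a x)\<^sup>2 / 2) * ennreal (K x y) + ennreal ((a y)\<^sup>2 / 2) * ennreal (K x y)"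
      using K0 by (simp add: distrib_right flip: ennreal_mult ennreal_plus)
  qed
  also have "\<dots> = (\<integral>\<^sup>+ x. \<integral>\<^sup>+ y. ennreal ((a x)\<^sup>2 / 2) * ennreal (K x y) \<partial>lborel \<partial>lborel) +
       (\<integral>\<^sup>+ x. \<integral>\<^sup>+ y. ennreal ((a y)\<^sup>2 / 2) * ennreal (K x y) \<partial>lborel \<partial>lborel)"
    by (simp add: nn_integral_add)
  also have "(\<integral>\<^sup>+ x. \<integral>\<^sup>+ y. ennreal ((a y)\<^sup>2 / 2) * ennreal (K x y) \<partial>lborel \<partial>lborel) =
       (\<integral>\<^sup>+ y. \<integral>\<^sup>+ x. ennreal ((a y)\<^sup>2 / 2) * ennreal (K x y) \<partial>lborel \<partial>lborel)"
    by (rule lborel_pair.Fubini'[symmetric]) measurable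
  also have "\<dots> = (\<integral>\<^sup>+ x. \<integral>\<^sup>+ y. ennreal ((a x)\<^sup>2 / 2) * ennreal (K x y) \<partial>lborel \<partial>lborel)"
    using Ksym by simp
  also have "(\<integral>\<^sup>+ x. \<integral>\<^sup>+ y. ennreal ((a x)\<^sup>2 / 2) * ennreal (K x y) \<partial>lborel \<partial>lborel) =
      (\<integral>\<^sup>+ x. ennreal ((a x)\<^sup>2 / 2) \<partial>lborel)"
    by (simp add: nn_integral_cmult Kint)
  also have "(\<integral>\<^sup>+ x. ennreal ((a x)\<^sup>2 / 2) \<partial>lborel) + (\<integral>\<^sup>+ x. ennreal ((a x)\<^sup>2 / 2) \<partial>lborel) =
      (\<integral>\<^sup>+ x. ennreal ((a x)\<^sup>2) \<partial>lborel)"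
    by (subst nn_integral_add[symmetric]) (auto simp flip: ennreal_plus)
  also have "\<dots> = ennreal ((L2_norm f)\<^sup>2)" unfolding a_def by (rule nn_integral_L2[OF f(2)])
  finally show ?thesis
    using nn_integral_eq_integral[OF intA] A0 by (simp add: A_def)
qed

text \<open>Fatou, as the damping is removed along e = 1/(n + 1).\<close>

lemma ft_L2:
  assumes f: "integrable lborel f" "f \<in> L2"
  shows "ft f \<in> L2" "L2_norm (ft f) \<le> L2_norm f"
proof -
  have fm: "f \<in> borel_measurable borel" using f by (simp add: L2_iff)
  have ftm [measurable]: "ft f \<in> borel_measurable borel" by (rule ft_measurable[OF fm])
  define e where "e = (\<lambda>n. 1 / (real n + 1))"
  have e: "0 < e n" for n by (simp add: e_def)
  have "(\<integral>\<^sup>+ \<xi>. ennreal ((cmod (ft f \<xi>))\<^sup>2) \<partial>lborel) =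
        (\<integral>\<^sup>+ \<xi>. liminf (\<lambda>n. ennreal ((cmod (ft f \<xi>))\<^sup>2 * damp (e n) \<xi>)) \<partial>lborel)"
  proof (rule nn_integral_cong)
    fix \<xi>
    have "e \<longlonglongrightarrow> 0" unfolding e_def by real_asymp
    hence "(\<lambda>n. damp (e n) \<xi>) \<longlonglongrightarrow> exp (- (0 * \<xi>)\<^sup>2 / 2)"
      unfolding damp_def by (intro tendsto_intros) auto
    hence "(\<lambda>n. ennreal ((cmod (ft f \<xi>))\<^sup>2 * damp (e n) \<xi>)) \<longlonglongrightarrow> ennreal ((cmod (ft f \<xi>))\<^sup>2 * 1)"
      by (intro tendsto_intros) simp
    thus "ennreal ((cmod (ft f \<xi>))\<^sup>2) = liminf (\<lambda>n. ennreal ((cmod (ft f \<xi>))\<^sup>2 * damp (e n) \<xi>))"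
      by (intro lim_imp_Liminf[symmetric]) auto
  qed
  also have "\<dots> \<le> liminf (\<lambda>n. \<integral>\<^sup>+ \<xi>. ennreal ((cmod (ft f \<xi>))\<^sup>2 * damp (e n) \<xi>) \<partial>lborel)"
    by (rule nn_integral_liminf) simp
  also have "\<dots> \<le> limsup (\<lambda>n. \<integral>\<^sup>+ \<xi>. ennreal ((cmod (ft f \<xi>))\<^sup>2 * damp (e n) \<xi>) \<partial>lborel)"
    by (rule Liminf_le_Limsup) simp
  also have "\<dots> \<le> ennreal ((L2_norm f)\<^sup>2)"
    by (intro Limsup_bounded always_eventually allI ft_damped_le f e)
  finally show "ft f \<in> L2" "L2_norm (ft f) \<le> L2_norm f"
    using L2I_nn_integral[OF ftm] by auto
qed

lemma test_complex:
  assumes "\<phi> \<in> test_functions"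
  shows "integrable lborel (cplx \<phi>)" "cplx \<phi> \<in> L2"
  using test_integrable[OF assms] test_sqint[OF assms] test_measurable[OF assms]
  by (auto simp: L2_iff sqint_abs)

text \<open>The limit e -> 0 in \<open>damped_parseval\<close>. In space the Gaussian averages I of
  \<phi> converge pointwise and stay below the bound of \<phi>; in frequency the undamped product of
  two L^2 functions is a majorant.\<close>

lemma parseval_test_integrable:
  assumes f: "integrable lborel f" "f \<in> L2" and \<phi>: "\<phi> \<in> test_functions"
  shows "(LINT \<xi>|lborel. ft f \<xi> * cnj (ft (cplx \<phi>) \<xi>)) = (LINT x|lborel. f x * \<phi> x)"
proof -
  have fm [measurable]: "f \<in> borel_measurable borel" using f by (simp add: L2_iff)
  have pm [measurable]: "\<phi> \<in> borel_measurable borel" by (rule test_measurable[OF \<phi>])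
  obtain B where B: "0 < B" "\<And>x. \<bar>\<phi> x\<bar> \<le> B" using test_bounded[OF \<phi>] by blast
  define e where "e = (\<lambda>n. 1 / (real n + 1))"
  have e: "0 < e n" for n by (simp add: e_def)
  have e_lim: "e \<longlonglongrightarrow> 0" unfolding e_def by real_asymp
  define I where "I = (\<lambda>n x. LINT y|lborel. gauss y * \<phi> (x + e n * y))"
  have I_eq: "(LINT y|lborel. cnj (cplx \<phi> y) * (gauss ((x - y) / e n) / e n)) = complex_of_real (I n x)" for n x
  proof -
    have "(LINT y|lborel. \<phi> y * (gauss ((x - y) / e n) / e n)) =
        \<bar>e n\<bar> *\<^sub>R (LINT y|lborel. \<phi> (x + e n * y) * (gauss ((x - (x + e n * y)) / e n) / e n))"
      by (rule lborel_integral_real_affine) (use e[of n] in simp)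
    also have "\<dots> = (LINT y|lborel. e n * (\<phi> (x + e n * y) * (gauss ((x - (x + e n * y)) / e n) / e n)))"
      using e[of n] by simp
    also have "\<dots> = I n x"
      unfolding I_def using e[of n]
      by (intro Bochner_Integration.integral_cong) (auto simp: std_normal_density_def)
    finally have "complex_of_real (LINT y|lborel. \<phi> y * (gauss ((x - y) / e n) / e n)) = complex_of_real (I n x)" by simp
    moreover have "cnj (cplx \<phi> y) * (gauss ((x - y) / e n) / e n) =
        complex_of_real (\<phi> y * (gauss ((x - y) / e n) / e n))" for y by simp
    ultimately show ?thesis by (simp only: integral_complex_of_real)
  qed
  have I_le: "\<bar>I n x\<bar> \<le> B" for n x
  proof -
    have "\<bar>I n x\<bar> \<le> (LINT y|lborel. \<bar>gauss y * \<phi> (x + e n * y)\<bar>)"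
      unfolding I_def by (rule integral_abs_bound)
    also have "\<dots> \<le> (LINT y|lborel. gauss y * B)"
    proof (rule integral_mono)
      show "integrable lborel (\<lambda>y. gauss y * B)" using gauss_integrable by simp
      show b: "\<bar>gauss y * \<phi> (x + e n * y)\<bar> \<le> gauss y * B" for y
        using B(2)[of "x + e n * y"] by (simp add: abs_mult mult_left_mono)
      show "integrable lborel (\<lambda>y. \<bar>gauss y * \<phi> (x + e n * y)\<bar>)"
        by (rule Bochner_Integration.integrable_bound[of _ "\<lambda>y. gauss y * B"])
           (use gauss_integrable b B in \<open>auto simp: abs_mult\<close>)
    qed
    finally show ?thesis using gauss_integral by simp
  qed
  have I_lim: "(\<lambda>n. I n x) \<longlonglongrightarrow> \<phi> x" for x
  proof -
    have "(\<lambda>n. I n x) \<longlonglongrightarrow> (LINT y|lborel. gauss y * \<phi> x)"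
      unfolding I_def
    proof (rule integral_dominated_convergence[where w = "\<lambda>y. gauss y * B"])
      show "AE y in lborel. (\<lambda>n. gauss y * \<phi> (x + e n * y)) \<longlonglongrightarrow> gauss y * \<phi> x"
      proof (rule AE_I2)
        fix y
        have "isCont \<phi> x" using test_has_deriv[OF \<phi>] by (rule DERIV_isCont)
        moreover have "(\<lambda>n. x + e n * y) \<longlonglongrightarrow> x + 0 * y" by (intro tendsto_intros e_lim)
        ultimately have "(\<lambda>n. \<phi> (x + e n * y)) \<longlonglongrightarrow> \<phi> x" by (auto intro: isCont_tendsto_compose)
        thus "(\<lambda>n. gauss y * \<phi> (x + e n * y)) \<longlonglongrightarrow> gauss y * \<phi> x" by (intro tendsto_intros)
      qed
      show "AE y in lborel. norm (gauss y * \<phi> (x + e n * y)) \<le> gauss y * B" for n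
        using B(2) by (auto simp: abs_mult intro!: mult_left_mono)
    qed (use gauss_integrable in auto)
    thus ?thesis using gauss_integral by simp
  qed
  have lim1: "(\<lambda>n. LINT x|lborel. f x * complex_of_real (I n x)) \<longlonglongrightarrow> (LINT x|lborel. f x * complex_of_real (\<phi> x))"
  proof (rule integral_dominated_convergence[where w = "\<lambda>x. cmod (f x) * B"])
    show "AE x in lborel. (\<lambda>n. f x * complex_of_real (I n x)) \<longlonglongrightarrow> f x * complex_of_real (\<phi> x)"
      by (intro AE_I2 tendsto_intros I_lim)
    show "AE x in lborel. norm (f x * complex_of_real (I n x)) \<le> cmod (f x) * B" for n
      using I_le by (auto simp: norm_mult intro!: mult_left_mono)
    have "I n \<in> borel_measurable borel" for n unfolding I_def by measurable
    thus "(\<lambda>x. f x * complex_of_real (I n x)) \<in> borel_measurable lborel" for n by simp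
  qed (use f in auto)
  have P: "integrable lborel (\<lambda>\<xi>. ft f \<xi> * cnj (ft (cplx \<phi>) \<xi>))"
    by (intro L2_integrable_mult L2_cnj ft_L2 f test_complex[OF \<phi>])
  have lim2: "(\<lambda>n. LINT \<xi>|lborel. ft f \<xi> * (cnj (ft (cplx \<phi>) \<xi>) * damp (e n) \<xi>)) \<longlonglongrightarrow>
      (LINT \<xi>|lborel. ft f \<xi> * cnj (ft (cplx \<phi>) \<xi>))"
  proof (rule integral_dominated_convergence[where w = "\<lambda>\<xi>. cmod (ft f \<xi> * cnj (ft (cplx \<phi>) \<xi>))"])
    show "AE \<xi> in lborel. (\<lambda>n. ft f \<xi> * (cnj (ft (cplx \<phi>) \<xi>) * damp (e n) \<xi>)) \<longlonglongrightarrow> ft f \<xi> * cnj (ft (cplx \<phi>) \<xi>)"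
    proof (rule AE_I2)
      fix \<xi>
      have "(\<lambda>n. damp (e n) \<xi>) \<longlonglongrightarrow> exp (- (0 * \<xi>)\<^sup>2 / 2)"
        unfolding damp_def by (intro tendsto_intros e_lim) auto
      hence "(\<lambda>n. ft f \<xi> * (cnj (ft (cplx \<phi>) \<xi>) * damp (e n) \<xi>)) \<longlonglongrightarrow> ft f \<xi> * (cnj (ft (cplx \<phi>) \<xi>) * complex_of_real 1)"
        by (intro tendsto_intros) simp
      thus "(\<lambda>n. ft f \<xi> * (cnj (ft (cplx \<phi>) \<xi>) * damp (e n) \<xi>)) \<longlonglongrightarrow> ft f \<xi> * cnj (ft (cplx \<phi>) \<xi>)" by simp
    qed
    show "AE \<xi> in lborel. norm (ft f \<xi> * (cnj (ft (cplx \<phi>) \<xi>) * damp (e n) \<xi>)) \<le> cmod (ft f \<xi> * cnj (ft (cplx \<phi>) \<xi>))" for n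
      using damp_pos[of "e n"] damp_le_1[of "e n"]
      by (auto simp: norm_mult less_imp_le intro!: mult_left_mono mult_left_le)
    show "(\<lambda>\<xi>. ft f \<xi> * cnj (ft (cplx \<phi>) \<xi>)) \<in> borel_measurable lborel"
      using borel_measurable_integrable[OF P] .
    have [measurable]: "(\<lambda>\<xi>. cnj (ft (cplx \<phi>) \<xi>)) \<in> borel_measurable borel"
      by (intro measurable_compose[OF _ cnj_measurable]) measurable
    show "(\<lambda>\<xi>. ft f \<xi> * (cnj (ft (cplx \<phi>) \<xi>) * damp (e n) \<xi>)) \<in> borel_measurable lborel" for n
      by measurable
  qed (use P in auto)
  have "(\<lambda>n. LINT \<xi>|lborel. ft f \<xi> * (cnj (ft (cplx \<phi>) \<xi>) * damp (e n) \<xi>)) =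
      (\<lambda>n. LINT x|lborel. f x * complex_of_real (I n x))"
    unfolding damped_parseval[OF f(1) test_complex(1)[OF \<phi>] e] I_eq ..
  with lim1 lim2 show ?thesis by (metis LIMSEQ_unique)
qed

section \<open>Truncation and the passage to all of L^2\<close>

lemma trunc_measurable [measurable]: "f \<in> borel_measurable borel \<Longrightarrow> trunc R f \<in> borel_measurable borel"
  by simp

lemma trunc_L2: "f \<in> L2 \<Longrightarrow> trunc R f \<in> L2"
  by (rule L2_bound[where B = 1, OF _ trunc_measurable[OF L2_meas]]) (auto simp: indicator_def)

lemma trunc_integrable:
  assumes "f \<in> L2" shows "integrable lborel (trunc R f)"
proof -
  have "(\<lambda>x. complex_of_real (indicator {-R..R} x)) \<in> L2"
    using sqint_indicator[of "{-R..R}" R] by (auto simp: L2_iff)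
  from L2_integrable_mult[OF this assms] show ?thesis by (simp add: scaleR_conv_of_real)
qed

lemma trunc_tendsto:
  assumes f: "f \<in> L2"
  shows "((\<lambda>R. L2_norm (\<lambda>x. f x - trunc R f x)) \<longlongrightarrow> 0) at_top"
proof -
  have fm [measurable]: "f \<in> borel_measurable borel" by (rule L2_meas[OF f])
  have "((\<lambda>R. LINT x|lborel. (cmod (f x - trunc R f x))\<^sup>2) \<longlongrightarrow> (LINT x::real|lborel. 0)) at_top"
  proof (rule integral_dominated_convergence_at_top[where w = "\<lambda>x. (cmod (f x))\<^sup>2"])
    show "AE x in lborel. ((\<lambda>R. (cmod (f x - trunc R f x))\<^sup>2) \<longlongrightarrow> 0) at_top"
    proof (intro AE_I2 tendsto_eventually)
      fix x
      show "\<forall>\<^sub>F R in at_top. (cmod (f x - trunc R f x))\<^sup>2 = 0"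
        using eventually_ge_at_top[of "\<bar>x\<bar>"] by eventually_elim (auto simp: indicator_def abs_le_iff)
    qed
    show "\<forall>\<^sub>F R in at_top. AE x in lborel. norm ((cmod (f x - trunc R f x))\<^sup>2) \<le> (cmod (f x))\<^sup>2"
      by (auto simp: indicator_def)
  qed (use f in \<open>auto simp: L2_iff sqint_def\<close>)
  hence "((\<lambda>R. sqrt (LINT x|lborel. (cmod (f x - trunc R f x))\<^sup>2)) \<longlongrightarrow> sqrt 0) at_top"
    by (intro tendsto_intros) simp
  thus ?thesis by (simp add: L2_norm_def)
qed

text \<open>Justifies the choice in \<open>fourier\<close>. By \<open>ft_L2\<close> the transforms
  of the truncations are as close in L^2 as the truncations themselves, so a suitable sequence of
  cut-offs converges and all larger cut-offs follow it.\<close>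

lemma is_fourier_fourier:
  assumes f: "f \<in> L2" shows "is_fourier f (fourier f)"
proof -
  have "\<exists>r. \<forall>R\<ge>r. L2_norm (\<lambda>x. f x - trunc R f x) < (1 / 2) ^ n" for n :: nat
    using order_tendstoD(2)[OF trunc_tendsto[OF f], of "(1 / 2) ^ n"] by (simp add: eventually_at_top_linorder)
  then obtain r where r: "\<And>n R. R \<ge> r n \<Longrightarrow> L2_norm (\<lambda>x. f x - trunc R f x) < (1 / 2) ^ n" by metis
  have d: "L2_norm (\<lambda>\<xi>. ft (trunc R f) \<xi> - ft (trunc R' f) \<xi>) \<le> 2 * (1 / 2) ^ n"
    if "R \<ge> r n" "R' \<ge> r n" for R R' n
  proof -
    have "L2_norm (ft (\<lambda>x. trunc R f x - trunc R' f x)) \<le> L2_norm (\<lambda>x. trunc R f x - trunc R' f x)"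
      by (intro ft_L2 L2_diff trunc_L2 Bochner_Integration.integrable_diff trunc_integrable f)
    also have "\<dots> \<le> L2_norm (\<lambda>x. trunc R f x - f x) + L2_norm (\<lambda>x. f x - trunc R' f x)"
      by (intro L2_norm_triangle_diff trunc_L2 f)
    also have "L2_norm (\<lambda>x. trunc R f x - f x) = L2_norm (\<lambda>x. f x - trunc R f x)"
      by (rule L2_norm_diff_commute)
    finally show ?thesis using r[OF that(1)] r[OF that(2)] by (simp add: ft_diff trunc_integrable f)
  qed
  \<comment> \<open>The maximum puts both q n and q (n + 1) beyond the threshold r (n + 1), so that
    consecutive terms can be compared.\<close>
  define q where "q = (\<lambda>n. max (r n) (r (Suc n)))"
  have tL: "ft (trunc R f) \<in> L2" for R by (intro ft_L2 trunc_L2 trunc_integrable f)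
  have q0: "q n \<ge> r n" for n by (simp add: q_def)
  have "L2_norm (\<lambda>\<xi>. ft (trunc (q (Suc n)) f) \<xi> - ft (trunc (q n) f) \<xi>) \<le> 4 * (1 / 2) ^ n" for n
  proof -
    have "L2_norm (\<lambda>\<xi>. ft (trunc (q (Suc n)) f) \<xi> - ft (trunc (q n) f) \<xi>) \<le> 2 * (1 / 2) ^ (Suc n)"
      by (rule d) (auto simp: q_def)
    also have "\<dots> \<le> 4 * (1 / 2) ^ n" by simp
    finally show ?thesis .
  qed
  then obtain G where G: "G \<in> L2" "\<And>n. L2_norm (\<lambda>\<xi>. G \<xi> - ft (trunc (q n) f) \<xi>) \<le> 2 * 4 * (1 / 2) ^ n"
    using L2_complete[of "\<lambda>n. ft (trunc (q n) f)" 4] tL by blast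
  have "((\<lambda>R. L2_norm (\<lambda>\<xi>. G \<xi> - ft (trunc R f) \<xi>)) \<longlongrightarrow> 0) at_top"
  proof (rule tendstoI)
    fix e :: real assume "0 < e"
    \<comment> \<open>10 = 8 + 2: the distance from G to the n-th term of the sequence, and from
      that term to any later truncation.\<close>
    moreover have "(\<lambda>n. 10 * (1 / 2) ^ n :: real) \<longlonglongrightarrow> 0" by real_asymp
    ultimately have "\<forall>\<^sub>F n in sequentially. 10 * (1 / 2) ^ n < e" by (intro order_tendstoD)
    then obtain n where n: "10 * (1 / 2) ^ n < e" by (auto simp: eventually_sequentially)
    have "L2_norm (\<lambda>\<xi>. G \<xi> - ft (trunc R f) \<xi>) < e" if "R \<ge> r n" for R
    proof -
      have "L2_norm (\<lambda>\<xi>. G \<xi> - ft (trunc R f) \<xi>) \<le> L2_norm (\<lambda>\<xi>. G \<xi> - ft (trunc (q n) f) \<xi>) +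
          L2_norm (\<lambda>\<xi>. ft (trunc (q n) f) \<xi> - ft (trunc R f) \<xi>)"
        by (intro L2_norm_triangle_diff G tL)
      also have "\<dots> \<le> 2 * 4 * (1 / 2) ^ n + 2 * (1 / 2) ^ n"
        by (intro add_mono G d that q0)
      also have "\<dots> < e" using n by simp
      finally show ?thesis .
    qed
    thus "\<forall>\<^sub>F R in at_top. dist (L2_norm (\<lambda>\<xi>. G \<xi> - ft (trunc R f) \<xi>)) 0 < e"
      by (auto simp: eventually_at_top_linorder)
  qed
  hence "((\<lambda>R. ennreal ((L2_norm (\<lambda>\<xi>. G \<xi> - ft (trunc R f) \<xi>))\<^sup>2)) \<longlongrightarrow> ennreal (0\<^sup>2)) at_top"
    by (intro tendsto_intros)
  hence "is_fourier f G"
    unfolding is_fourier_def truncated_fourier_eq_ft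
    by (subst nn_integral_L2) (use G tL in \<open>auto intro: L2_diff\<close>)
  thus ?thesis unfolding fourier_def by (rule someI[of "is_fourier f"])
qed

lemma fourier_L2: "f \<in> L2 \<Longrightarrow> fourier f \<in> L2"
  using is_fourier_fourier by (simp add: is_fourier_def)

lemma fourier_tendsto:
  assumes f: "f \<in> L2"
  shows "((\<lambda>R. L2_norm (\<lambda>\<xi>. fourier f \<xi> - ft (trunc R f) \<xi>)) \<longlongrightarrow> 0) at_top"
proof -
  have tL: "ft (trunc R f) \<in> L2" for R by (intro ft_L2 trunc_L2 trunc_integrable f)
  have "((\<lambda>R. ennreal ((L2_norm (\<lambda>\<xi>. fourier f \<xi> - ft (trunc R f) \<xi>))\<^sup>2)) \<longlongrightarrow> ennreal 0) at_top"
    using is_fourier_fourier[OF f] unfolding is_fourier_def truncated_fourier_eq_ft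
    by (subst (asm) nn_integral_L2[OF L2_diff[OF fourier_L2[OF f] tL]]) auto
  hence "((\<lambda>R. (L2_norm (\<lambda>\<xi>. fourier f \<xi> - ft (trunc R f) \<xi>))\<^sup>2) \<longlongrightarrow> 0) at_top"
    by (subst (asm) tendsto_ennreal_iff) auto
  hence "((\<lambda>R. sqrt ((L2_norm (\<lambda>\<xi>. fourier f \<xi> - ft (trunc R f) \<xi>))\<^sup>2)) \<longlongrightarrow> sqrt 0) at_top"
    by (intro tendsto_intros)
  thus ?thesis by simp
qed

lemma L2_tendsto_integral:
  assumes F: "F \<in> L2" "\<And>R. G R \<in> L2" "h \<in> L2"
    and lim: "((\<lambda>R :: real. L2_norm (\<lambda>\<xi>. F \<xi> - G R \<xi>)) \<longlongrightarrow> 0) at_top"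
  shows "((\<lambda>R. LINT \<xi>|lborel. G R \<xi> * h \<xi>) \<longlongrightarrow> (LINT \<xi>|lborel. F \<xi> * h \<xi>)) at_top"
proof -
  have "((\<lambda>R. (LINT \<xi>|lborel. G R \<xi> * h \<xi>) - (LINT \<xi>|lborel. F \<xi> * h \<xi>)) \<longlongrightarrow> 0) at_top"
  proof (rule Lim_null_comparison)
    have "cmod ((LINT \<xi>|lborel. G R \<xi> * h \<xi>) - (LINT \<xi>|lborel. F \<xi> * h \<xi>)) \<le> L2_norm (\<lambda>\<xi>. F \<xi> - G R \<xi>) * L2_norm h" for R
      using L2_mult_le[OF L2_diff[OF F(1) F(2)] F(3), of R]
      by (simp add: left_diff_distrib L2_integrable_mult F norm_minus_commute)
    thus "\<forall>\<^sub>F R in at_top. norm ((LINT \<xi>|lborel. G R \<xi> * h \<xi>) - (LINT \<xi>|lborel. F \<xi> * h \<xi>)) \<le> L2_norm (\<lambda>\<xi>. F \<xi> - G R \<xi>) * L2_norm h"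
      by simp
    show "((\<lambda>R. L2_norm (\<lambda>\<xi>. F \<xi> - G R \<xi>) * L2_norm h) \<longlongrightarrow> 0) at_top"
      using tendsto_mult_right[OF lim, of "L2_norm h"] by simp
  qed
  thus ?thesis by (rule LIM_zero_cancel)
qed

lemma fourier_multiplication:
  assumes f: "f \<in> L2" and h: "integrable lborel h" "h \<in> L2"
  shows "(LINT \<xi>|lborel. fourier f \<xi> * h \<xi>) = (LINT x|lborel. f x * ft h x)"
proof (rule tendsto_unique[where F = "at_top :: real filter"])
  show "((\<lambda>R. LINT \<xi>|lborel. ft (trunc R f) \<xi> * h \<xi>) \<longlongrightarrow> (LINT \<xi>|lborel. fourier f \<xi> * h \<xi>)) at_top"
    by (intro L2_tendsto_integral fourier_L2 fourier_tendsto f h ft_L2 trunc_L2 trunc_integrable)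
  show "((\<lambda>R. LINT \<xi>|lborel. ft (trunc R f) \<xi> * h \<xi>) \<longlongrightarrow> (LINT x|lborel. f x * ft h x)) at_top"
    unfolding ft_multiplication[OF trunc_integrable[OF f] h(1)]
    by (intro L2_tendsto_integral f trunc_L2 ft_L2 h trunc_tendsto)
qed simp

lemma fourier_parseval_test:
  assumes f: "f \<in> L2" and \<phi>: "\<phi> \<in> test_functions"
  shows "(LINT \<xi>|lborel. fourier f \<xi> * cnj (ft (cplx \<phi>) \<xi>)) = (LINT x|lborel. f x * \<phi> x)"
proof (rule tendsto_unique[where F = "at_top :: real filter"])
  show "((\<lambda>R. LINT \<xi>|lborel. ft (trunc R f) \<xi> * cnj (ft (cplx \<phi>) \<xi>)) \<longlongrightarrow>
      (LINT \<xi>|lborel. fourier f \<xi> * cnj (ft (cplx \<phi>) \<xi>))) at_top"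
    by (intro L2_tendsto_integral fourier_L2 fourier_tendsto f L2_cnj ft_L2 trunc_L2 trunc_integrable test_complex \<phi>)
  show "((\<lambda>R. LINT \<xi>|lborel. ft (trunc R f) \<xi> * cnj (ft (cplx \<phi>) \<xi>)) \<longlongrightarrow> (LINT x|lborel. f x * \<phi> x)) at_top"
    unfolding parseval_test_integrable[OF trunc_integrable[OF f] trunc_L2[OF f] \<phi>]
    by (intro L2_tendsto_integral f trunc_L2 trunc_tendsto test_complex \<phi>)
qed simp

section \<open>Regular representatives of Sobolev functions\<close>

definition fmom :: "nat \<Rightarrow> (real \<Rightarrow> complex) \<Rightarrow> real \<Rightarrow> complex" where
  "fmom k f \<xi> = (\<i> * complex_of_real \<xi>) ^ k * fourier f \<xi>"

text \<open>The k-th derivative as an inverse Fourier integral, written as \<open>ft\<close> at - x.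
  Taking the real part in the definition yields a real function without proving a reflection
  symmetry of \<open>fourier f\<close>.\<close>

definition sob_rep :: "nat \<Rightarrow> (real \<Rightarrow> complex) \<Rightarrow> real \<Rightarrow> real" where
  "sob_rep k f x = Re (ft (fmom k f) (- x))"

lemma Sob_L2: "f \<in> Sob s \<Longrightarrow> f \<in> L2"
  by (simp add: Sob_def)

lemma fmom_measurable [measurable]: "f \<in> L2 \<Longrightarrow> fmom k f \<in> borel_measurable borel"
  unfolding fmom_def[abs_def] using L2_meas[OF fourier_L2] by measurable

lemma cmod_fmom: "cmod (fmom k f \<xi>) = \<bar>\<xi>\<bar> ^ k * cmod (fourier f \<xi>)"
  by (simp add: fmom_def norm_mult norm_power)

lemma fmom_sq_le:
  assumes "real k \<le> s"
  shows "(cmod (fmom k f \<xi>))\<^sup>2 \<le> (1 + \<xi>\<^sup>2) powr s * (cmod (fourier f \<xi>))\<^sup>2"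
proof -
  have 0: "0 < 1 + \<xi>\<^sup>2" by (rule add_pos_nonneg) auto
  have "(\<bar>\<xi>\<bar> ^ k)\<^sup>2 = (\<bar>\<xi>\<bar>\<^sup>2) ^ k" by (simp only: power_mult[symmetric] mult.commute)
  also have "\<dots> = (\<xi>\<^sup>2) ^ k" by simp
  also have "\<dots> \<le> (1 + \<xi>\<^sup>2) ^ k" by (intro power_mono) auto
  also have "\<dots> = (1 + \<xi>\<^sup>2) powr real k" using 0 by (simp add: powr_realpow)
  also have "\<dots> \<le> (1 + \<xi>\<^sup>2) powr s" by (intro powr_mono assms) auto
  finally show ?thesis
    unfolding cmod_fmom power_mult_distrib by (intro mult_right_mono) auto
qed

lemma fmom_L2:
  assumes f: "f \<in> Sob s" and k: "real k \<le> s"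
  shows "fmom k f \<in> L2" "L2_norm (fmom k f) \<le> Sob_norm s f"
proof -
  have m [measurable]: "fmom k f \<in> borel_measurable borel" using Sob_L2[OF f] by measurable
  have i: "integrable lborel (\<lambda>\<xi>. (1 + \<xi>\<^sup>2) powr s * (cmod (fourier f \<xi>))\<^sup>2)" using f by (simp add: Sob_def)
  have i2: "integrable lborel (\<lambda>\<xi>. (cmod (fmom k f \<xi>))\<^sup>2)"
    by (rule Bochner_Integration.integrable_bound[OF i]) (use fmom_sq_le[OF k] in \<open>auto intro: order_trans[OF _ abs_ge_self]\<close>)
  thus "fmom k f \<in> L2" using m by (simp add: L2_def)
  show "L2_norm (fmom k f) \<le> Sob_norm s f"
    unfolding L2_norm_def Sob_norm_def
    by (intro real_sqrt_le_mono integral_mono i i2 fmom_sq_le k)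
qed

lemma integrable_inverse_1_plus_sq: "integrable lborel (\<lambda>x :: real. 1 / (1 + x\<^sup>2))"
  using integrable_inverse_1_plus_square by (simp add: set_integrable_def einterval_def inverse_eq_divide)

text \<open>Cauchy-Schwarz in the form 2 c <= a c^2 + 1/a with a = 1 + \<xi>^2. The factor a costs
  one order of regularity, hence \<open>k + 1 <= s\<close>.\<close>

lemma fmom_integrable:
  assumes f: "f \<in> Sob s" and k: "real k + 1 \<le> s"
  shows "integrable lborel (fmom k f)"
proof (rule Bochner_Integration.integrable_bound)
  have i: "integrable lborel (\<lambda>\<xi>. (1 + \<xi>\<^sup>2) powr s * (cmod (fourier f \<xi>))\<^sup>2)" using f by (simp add: Sob_def)
  show "integrable lborel (\<lambda>\<xi>. 1 / (1 + \<xi>\<^sup>2) + (1 + \<xi>\<^sup>2) powr s * (cmod (fourier f \<xi>))\<^sup>2)"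
    by (intro Bochner_Integration.integrable_add integrable_inverse_1_plus_sq i)
  show "fmom k f \<in> borel_measurable lborel" using Sob_L2[OF f] by measurable
  show "AE \<xi> in lborel. norm (fmom k f \<xi>) \<le> norm (1 / (1 + \<xi>\<^sup>2) + (1 + \<xi>\<^sup>2) powr s * (cmod (fourier f \<xi>))\<^sup>2)"
  proof (rule AE_I2)
    fix \<xi> :: real
    let ?a = "1 + \<xi>\<^sup>2" and ?c = "cmod (fmom k f \<xi>)"
    have 0: "0 < ?a" by (rule add_pos_nonneg) auto
    have "(cmod (fmom k f \<xi>))\<^sup>2 \<le> ?a powr (s - 1) * (cmod (fourier f \<xi>))\<^sup>2"
      by (rule fmom_sq_le) (use k in simp)
    hence "?a * ?c\<^sup>2 \<le> ?a * (?a powr (s - 1) * (cmod (fourier f \<xi>))\<^sup>2)"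
      using 0 by (intro mult_left_mono) auto
    also have "\<dots> = ?a powr s * (cmod (fourier f \<xi>))\<^sup>2"
      using 0 by (simp add: powr_diff)
    finally have 1: "?a * ?c\<^sup>2 \<le> ?a powr s * (cmod (fourier f \<xi>))\<^sup>2" .
    have "0 \<le> (?a * ?c - 1)\<^sup>2 / ?a" using 0 by simp
    also have "(?a * ?c - 1)\<^sup>2 = ?a * (?a * ?c\<^sup>2 - 2 * ?c) + 1" unfolding power2_eq_square by algebra
    also have "\<dots> / ?a = ?a * ?c\<^sup>2 - 2 * ?c + 1 / ?a"
      using 0 by (simp only: add_divide_distrib nonzero_mult_div_cancel_left[OF less_imp_neq[OF 0, symmetric]])
    finally have "2 * ?c \<le> ?a * ?c\<^sup>2 + 1 / ?a" by simp
    hence "?c \<le> 1 / ?a + ?a powr s * (cmod (fourier f \<xi>))\<^sup>2" using 1 norm_ge_zero[of "fmom k f \<xi>"] by linarith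
    thus "norm (fmom k f \<xi>) \<le> norm (1 / (1 + \<xi>\<^sup>2) + (1 + \<xi>\<^sup>2) powr s * (cmod (fourier f \<xi>))\<^sup>2)"
      by (rule order_trans) simp
  qed
qed

section \<open>Differentiation of inverse Fourier integrals\<close>

lemma cmod_cis_minus_1_le: "cmod (cis x - 1) \<le> \<bar>x\<bar>"
  using iexp_approx1[of x 0] by (simp add: cis_conv_exp)

lemma cis_has_deriv: "((\<lambda>x. cis (x * \<xi>)) has_vector_derivative (\<i> * complex_of_real \<xi> * cis (x * \<xi>))) (at x)"
proof -
  have "((\<lambda>x. exp (\<i> * complex_of_real (x * \<xi>))) has_vector_derivative (\<i> * complex_of_real \<xi> * exp (\<i> * complex_of_real (x * \<xi>)))) (at x)"
    by (auto intro!: derivative_eq_intros has_vector_derivative_real_field simp: mult_ac)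
  thus ?thesis by (simp add: cis_conv_exp)
qed

lemma has_vector_derivative_iff_quotient:
  fixes f :: "real \<Rightarrow> complex"
  shows "(f has_vector_derivative D) (at x) \<longleftrightarrow> ((\<lambda>h. (f (x + h) - f x) / complex_of_real h) \<longlongrightarrow> D) (at 0)"
proof -
  have "(f has_vector_derivative D) (at x) \<longleftrightarrow> ((\<lambda>h. norm (f (x + h) - f x - h *\<^sub>R D) / norm h) \<longlongrightarrow> 0) (at 0)"
    unfolding has_vector_derivative_def has_derivative_at by (auto intro: bounded_linear_scaleR_left)
  also have "\<dots> \<longleftrightarrow> ((\<lambda>h. norm ((f (x + h) - f x) / complex_of_real h - D)) \<longlongrightarrow> 0) (at 0)"
  proof (rule filterlim_cong[OF refl refl])
    show "\<forall>\<^sub>F h in at 0. norm (f (x + h) - f x - h *\<^sub>R D) / norm h = norm ((f (x + h) - f x) / complex_of_real h - D)"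
      unfolding eventually_at_filter
    proof (intro always_eventually allI impI)
      fix h :: real assume "h \<noteq> 0"
      hence "(f (x + h) - f x) / complex_of_real h - D = (f (x + h) - f x - h *\<^sub>R D) / complex_of_real h"
        by (simp add: diff_divide_distrib scaleR_conv_of_real)
      thus "norm (f (x + h) - f x - h *\<^sub>R D) / norm h = norm ((f (x + h) - f x) / complex_of_real h - D)"
        by (simp only: norm_divide norm_of_real real_norm_def)
    qed
  qed
  also have "\<dots> \<longleftrightarrow> ((\<lambda>h. (f (x + h) - f x) / complex_of_real h) \<longlongrightarrow> D) (at 0)"
    by (simp add: tendsto_norm_zero_iff LIM_zero_iff)
  finally show ?thesis .
qed

lemma ft_neg: "ft M (- x) = complex_of_real (1 / sqrt (2 * pi)) * (LINT \<xi>|lborel. M \<xi> * cis (\<xi> * x))"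
  by (simp add: ft_def)

text \<open>Differentiation under the integral: the quotients of exp(i x \<xi>) are bounded by
  |\<xi>|, so |\<xi> M(\<xi>)| is an integrable majorant.\<close>

lemma ft_has_deriv:
  assumes M: "integrable lborel M" and M1: "integrable lborel (\<lambda>\<xi>. \<i> * complex_of_real \<xi> * M \<xi>)"
  shows "((\<lambda>x. ft M (- x)) has_vector_derivative ft (\<lambda>\<xi>. \<i> * complex_of_real \<xi> * M \<xi>) (- x)) (at x)"
proof -
  have Mm [measurable]: "M \<in> borel_measurable borel" using borel_measurable_integrable[OF M] by simp
  define q where "q = (\<lambda>h \<xi>. M \<xi> * ((cis (\<xi> * (x + h)) - cis (\<xi> * x)) / complex_of_real h))"
  have lim: "((\<lambda>h. LINT \<xi>|lborel. q h \<xi>) \<longlongrightarrow> (LINT \<xi>|lborel. \<i> * complex_of_real \<xi> * M \<xi> * cis (\<xi> * x))) (at 0)"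
  proof (rule tendsto_at_iff_sequentially[THEN iffD2], intro allI impI)
    fix X :: "nat \<Rightarrow> real" assume X: "\<forall>i. X i \<in> UNIV - {0}" "X \<longlonglongrightarrow> 0"
    show "((\<lambda>h. LINT \<xi>|lborel. q h \<xi>) \<circ> X) \<longlonglongrightarrow> (LINT \<xi>|lborel. \<i> * complex_of_real \<xi> * M \<xi> * cis (\<xi> * x))"
      unfolding o_def
    proof (rule integral_dominated_convergence[where w = "\<lambda>\<xi>. cmod (\<i> * complex_of_real \<xi> * M \<xi>)"])
      show "AE \<xi> in lborel. (\<lambda>i. q (X i) \<xi>) \<longlonglongrightarrow> \<i> * complex_of_real \<xi> * M \<xi> * cis (\<xi> * x)"
      proof (rule AE_I2)
        fix \<xi>
        have "((\<lambda>h. (cis ((x + h) * \<xi>) - cis (x * \<xi>)) / complex_of_real h) \<longlongrightarrow> \<i> * complex_of_real \<xi> * cis (x * \<xi>)) (at 0)"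
          using cis_has_deriv[of \<xi> x] unfolding has_vector_derivative_iff_quotient .
        hence "(\<lambda>i. (cis ((x + X i) * \<xi>) - cis (x * \<xi>)) / complex_of_real (X i)) \<longlonglongrightarrow> \<i> * complex_of_real \<xi> * cis (x * \<xi>)"
          using X unfolding tendsto_at_iff_sequentially o_def by blast
        from tendsto_mult_left[OF this, of "M \<xi>"]
        show "(\<lambda>i. q (X i) \<xi>) \<longlonglongrightarrow> \<i> * complex_of_real \<xi> * M \<xi> * cis (\<xi> * x)"
          by (simp add: q_def mult_ac)
      qed
      show "AE \<xi> in lborel. norm (q (X i) \<xi>) \<le> cmod (\<i> * complex_of_real \<xi> * M \<xi>)" for i
      proof (rule AE_I2)
        fix \<xi>
        have h0: "X i \<noteq> 0" using X(1) by auto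
        have "cis (\<xi> * (x + X i)) - cis (\<xi> * x) = cis (\<xi> * x) * (cis (\<xi> * X i) - 1)"
          by (simp add: cis_mult algebra_simps)
        hence "cmod (cis (\<xi> * (x + X i)) - cis (\<xi> * x)) \<le> \<bar>\<xi>\<bar> * \<bar>X i\<bar>"
          using cmod_cis_minus_1_le[of "\<xi> * X i"] by (simp add: norm_mult abs_mult)
        hence "cmod ((cis (\<xi> * (x + X i)) - cis (\<xi> * x)) / complex_of_real (X i)) \<le> \<bar>\<xi>\<bar>"
          using h0 by (simp add: norm_divide field_simps)
        from mult_left_mono[OF this norm_ge_zero[of "M \<xi>"]]
        have "norm (q (X i) \<xi>) \<le> cmod (M \<xi>) * \<bar>\<xi>\<bar>" unfolding q_def norm_mult[of "M \<xi>"] .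
        also have "\<dots> = cmod (\<i> * complex_of_real \<xi> * M \<xi>)" by (simp add: norm_mult)
        finally show "norm (q (X i) \<xi>) \<le> cmod (\<i> * complex_of_real \<xi> * M \<xi>)" .
      qed
      show "(\<lambda>\<xi>. q (X i) \<xi>) \<in> borel_measurable lborel" for i unfolding q_def by measurable
    qed (use M1 in auto)
  qed
  have eq: "(ft M (- (x + h)) - ft M (- x)) / complex_of_real h = complex_of_real (1 / sqrt (2 * pi)) * (LINT \<xi>|lborel. q h \<xi>)" if "h \<noteq> 0" for h
  proof -
    have i: "integrable lborel (\<lambda>\<xi>. M \<xi> * cis (\<xi> * c))" for c by (rule integrable_mult_cis[OF M])
    have "q h = (\<lambda>\<xi>. (M \<xi> * cis (\<xi> * (x + h)) - M \<xi> * cis (\<xi> * x)) / complex_of_real h)"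
      by (simp add: q_def fun_eq_iff right_diff_distrib diff_divide_distrib)
    hence "(LINT \<xi>|lborel. q h \<xi>) = ((LINT \<xi>|lborel. M \<xi> * cis (\<xi> * (x + h))) - (LINT \<xi>|lborel. M \<xi> * cis (\<xi> * x))) / complex_of_real h"
      using Bochner_Integration.integral_diff[OF i i, of "x + h" x] by simp
    thus ?thesis unfolding ft_neg by (simp only: right_diff_distrib[symmetric] times_divide_eq_right)
  qed
  have "((\<lambda>h. complex_of_real (1 / sqrt (2 * pi)) * (LINT \<xi>|lborel. q h \<xi>)) \<longlongrightarrow> ft (\<lambda>\<xi>. \<i> * complex_of_real \<xi> * M \<xi>) (- x)) (at 0)"
    unfolding ft_neg by (rule tendsto_mult_left[OF lim])
  thus ?thesis
    unfolding has_vector_derivative_iff_quotient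
    by (rule Lim_transform_eventually) (use eq in \<open>auto simp: eventually_at_filter simp del: of_real_divide\<close>)
qed

section \<open>Integration by parts on the line\<close>

text \<open>The derivative is a second argument, so that later chains f, f', f'' are tuples of given
  functions whose continuity and integrability can be assumed separately.\<close>

definition c1_deriv :: "(real \<Rightarrow> real) \<Rightarrow> (real \<Rightarrow> real) \<Rightarrow> bool" where
  "c1_deriv f g \<longleftrightarrow> (\<forall>x. (f has_real_derivative g x) (at x)) \<and> continuous_on UNIV g"

lemma c1_derivD: "c1_deriv f g \<Longrightarrow> (f has_real_derivative g x) (at x)"
  by (simp add: c1_deriv_def)

lemma c1_deriv_cont:
  assumes "c1_deriv f g" shows "continuous_on A f" "continuous_on A g"
  using assms DERIV_isCont[of f] continuous_on_subset[of UNIV g A]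
  by (auto simp: c1_deriv_def intro: continuous_at_imp_continuous_on)

lemma c1_deriv_meas:
  assumes "c1_deriv f g" shows "f \<in> borel_measurable borel" "g \<in> borel_measurable borel"
  using c1_deriv_cont[OF assms] by (auto intro: borel_measurable_continuous_onI)

lemma c1_deriv_add: "c1_deriv f f' \<Longrightarrow> c1_deriv g g' \<Longrightarrow> c1_deriv (\<lambda>x. f x + g x) (\<lambda>x. f' x + g' x)"
  by (auto simp: c1_deriv_def intro!: derivative_eq_intros continuous_intros)

lemma c1_deriv_diff: "c1_deriv f f' \<Longrightarrow> c1_deriv g g' \<Longrightarrow> c1_deriv (\<lambda>x. f x - g x) (\<lambda>x. f' x - g' x)"
  by (auto simp: c1_deriv_def intro!: derivative_eq_intros continuous_intros)

lemma c1_deriv_cmult: "c1_deriv f f' \<Longrightarrow> c1_deriv (\<lambda>x. c * f x) (\<lambda>x. c * f' x)"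
  by (auto simp: c1_deriv_def intro!: derivative_eq_intros continuous_intros)

lemma c1_deriv_uminus: "c1_deriv f f' \<Longrightarrow> c1_deriv (\<lambda>x. - f x) (\<lambda>x. - f' x)"
  by (auto simp: c1_deriv_def intro!: derivative_eq_intros continuous_intros)

lemma c1_deriv_mult:
  assumes "c1_deriv f f'" "c1_deriv g g'"
  shows "c1_deriv (\<lambda>x. f x * g x) (\<lambda>x. f' x * g x + f x * g' x)"
  unfolding c1_deriv_def using c1_deriv_cont[OF assms(1)] c1_deriv_cont[OF assms(2)]
  by (auto intro!: derivative_eq_intros continuous_intros c1_derivD[OF assms(1)] c1_derivD[OF assms(2)])

lemma c1_deriv_test: "\<phi> \<in> test_functions \<Longrightarrow> c1_deriv \<phi> (deriv \<phi>)"
  by (simp add: c1_deriv_def test_has_deriv test_continuous test_deriv)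

lemma c1_FTC:
  assumes "c1_deriv f g" "a \<le> b"
  shows "(LINT x|lborel. indicator {a..b} x * g x) = f b - f a"
proof -
  have "(LINT x|lborel. indicator {a..b} x *\<^sub>R g x) = f b - f a"
  proof (rule integral_FTC_atLeastAtMost[OF assms(2)])
    show "(f has_vector_derivative g x) (at x within {a..b})" for x
      using c1_derivD[OF assms(1), of x]
      by (auto simp: has_real_derivative_iff_has_vector_derivative intro: has_vector_derivative_at_within)
  qed (rule c1_deriv_cont[OF assms(1)])
  thus ?thesis by simp
qed

lemma integrable_tendsto_at_top_imp_0:
  fixes h :: "real \<Rightarrow> real"
  assumes h: "integrable lborel h" and lim: "(h \<longlongrightarrow> L) at_top"
  shows "L = 0"
proof (rule ccontr)
  assume "L \<noteq> 0"
  have "((\<lambda>x. \<bar>h x\<bar>) \<longlongrightarrow> \<bar>L\<bar>) at_top" by (intro tendsto_intros lim)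
  hence "\<forall>\<^sub>F x in at_top. \<bar>L\<bar> / 2 < \<bar>h x\<bar>" by (rule order_tendstoD) (use \<open>L \<noteq> 0\<close> in simp)
  then obtain R where R: "\<And>x. x \<ge> R \<Longrightarrow> \<bar>L\<bar> / 2 < \<bar>h x\<bar>" by (auto simp: eventually_at_top_linorder)
  have le: "real n * (\<bar>L\<bar> / 2) \<le> (LINT x|lborel. \<bar>h x\<bar>)" for n :: nat
  proof -
    have "(LINT x|lborel. indicator {R..R + real n} x * (\<bar>L\<bar> / 2)) \<le> (LINT x|lborel. \<bar>h x\<bar>)"
    proof (rule integral_mono)
      show "integrable lborel (\<lambda>x. indicator {R..R + real n} x * (\<bar>L\<bar> / 2))"
        by (intro integrable_mult_left integrable_real_indicator) (auto simp: emeasure_lborel_Icc_eq)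
    qed (use h R in \<open>auto simp: indicator_def less_imp_le\<close>)
    thus ?thesis by simp
  qed
  obtain n where "(LINT x|lborel. \<bar>h x\<bar>) < real n * (\<bar>L\<bar> / 2)"
    using reals_Archimedean3[of "\<bar>L\<bar> / 2"] \<open>L \<noteq> 0\<close> by auto
  thus False using le[of n] by simp
qed

text \<open>Integrability of h' makes h converge at infinity; integrability of h forces the limit to
  be 0.\<close>

lemma c1_tendsto_0_at_top:
  assumes c: "c1_deriv h h'" and h: "integrable lborel h" and h': "integrable lborel h'"
  shows "(h \<longlongrightarrow> 0) at_top"
proof -
  have "((\<lambda>R. LINT x|lborel. indicator {0..R} x * h' x) \<longlongrightarrow> (LINT x|lborel. indicator {0..} x * h' x)) at_top"
  proof (rule integral_dominated_convergence_at_top[where w = "\<lambda>x. \<bar>h' x\<bar>"])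
    show "AE x in lborel. ((\<lambda>R. indicator {0..R} x * h' x) \<longlongrightarrow> indicator {0..} x * h' x) at_top"
    proof (intro AE_I2 tendsto_eventually)
      fix x :: real
      show "\<forall>\<^sub>F R in at_top. indicator {0..R} x * h' x = indicator {0..} x * h' x"
        using eventually_ge_at_top[of x] by eventually_elim (auto simp: indicator_def)
    qed
  qed (use h' c1_deriv_meas[OF c] in \<open>auto simp: indicator_def\<close>)
  moreover have "\<forall>\<^sub>F R in at_top. (LINT x|lborel. indicator {0..R} x * h' x) = h R - h 0"
    using eventually_ge_at_top[of 0] by eventually_elim (rule c1_FTC[OF c])
  ultimately have "((\<lambda>R. h R - h 0) \<longlongrightarrow> (LINT x|lborel. indicator {0..} x * h' x)) at_top"
    by (rule Lim_transform_eventually)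
  from tendsto_add[OF this tendsto_const[of "h 0"]]
  have lim: "(h \<longlongrightarrow> (LINT x|lborel. indicator {0..} x * h' x) + h 0) at_top" by simp
  with integrable_tendsto_at_top_imp_0[OF h this] show ?thesis by simp
qed

lemma c1_deriv_reflect: "c1_deriv f g \<Longrightarrow> c1_deriv (\<lambda>x. f (- x)) (\<lambda>x. - g (- x))"
  unfolding c1_deriv_def
proof (intro conjI allI)
  assume f: "(\<forall>x. (f has_real_derivative g x) (at x)) \<and> continuous_on UNIV g"
  show "((\<lambda>x. f (- x)) has_real_derivative - g (- x)) (at x)" for x
  proof -
    have "(uminus has_real_derivative - 1) (at x)" by (auto intro!: derivative_eq_intros)
    from DERIV_chain2[OF conjunct1[OF f, rule_format] this] show ?thesis by simp
  qed
  show "continuous_on UNIV (\<lambda>x. - g (- x))"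
    using f by (auto intro!: continuous_intros continuous_on_compose2[of UNIV g])
qed

lemma integrable_reflect: "integrable lborel f \<Longrightarrow> integrable lborel (\<lambda>x. f (- x))"
  for f :: "real \<Rightarrow> 'a :: {banach, second_countable_topology}"
  using lborel_integrable_real_affine[of f "-1" 0] by simp

lemma integral_reflect: "(LINT x|lborel. f (- x)) = (LINT x|lborel. f x)"
  for f :: "real \<Rightarrow> 'a :: {banach, second_countable_topology}"
  using lborel_integral_real_affine[of "-1" f 0] by simp

lemma c1_integral_deriv_0:
  assumes c: "c1_deriv h h'" and h: "integrable lborel h" and h': "integrable lborel h'"
  shows "(LINT x|lborel. h' x) = 0"
proof -
  have "((\<lambda>R. LINT x|lborel. indicator {-R..R} x * h' x) \<longlongrightarrow> (LINT x|lborel. h' x)) at_top"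
  proof (rule integral_dominated_convergence_at_top[where w = "\<lambda>x. \<bar>h' x\<bar>"])
    show "AE x in lborel. ((\<lambda>R. indicator {-R..R} x * h' x) \<longlongrightarrow> h' x) at_top"
    proof (intro AE_I2 tendsto_eventually)
      fix x :: real
      show "\<forall>\<^sub>F R in at_top. indicator {-R..R} x * h' x = h' x"
        using eventually_ge_at_top[of "\<bar>x\<bar>"] by eventually_elim (auto simp: indicator_def)
    qed
  qed (use h' c1_deriv_meas[OF c] in \<open>auto simp: indicator_def\<close>)
  moreover have "\<forall>\<^sub>F R in at_top. (LINT x|lborel. indicator {-R..R} x * h' x) = h R - h (- R)"
    using eventually_ge_at_top[of 0] by eventually_elim (use c1_FTC[OF c] in auto)
  ultimately have "((\<lambda>R. h R - h (- R)) \<longlongrightarrow> (LINT x|lborel. h' x)) at_top"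
    by (rule Lim_transform_eventually)
  moreover have "((\<lambda>R. h R - h (- R)) \<longlongrightarrow> 0 - 0) at_top"
    by (intro tendsto_diff c1_tendsto_0_at_top[OF c h h']
        c1_tendsto_0_at_top[OF c1_deriv_reflect[OF c]] integrable_reflect h integrable_minus h')
  ultimately show ?thesis by (auto dest: tendsto_unique[rotated])
qed

lemma ip_by_parts:
  assumes "c1_deriv f f'" "c1_deriv g g'" "sqint f" "sqint f'" "sqint g" "sqint g'"
  shows "ip f' g = - ip f g'"
proof -
  have "(LINT x|lborel. f' x * g x + f x * g' x) = 0"
    by (rule c1_integral_deriv_0[OF c1_deriv_mult[OF assms(1,2)]])
       (intro Bochner_Integration.integrable_add sqint_integrable_mult assms)+
  thus ?thesis unfolding ip_def by (subst (asm) Bochner_Integration.integral_add) (auto intro: sqint_integrable_mult assms)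
qed

lemma integral_by_parts_test:
  assumes f: "c1_deriv f f'" and \<phi>: "\<phi> \<in> test_functions"
  shows "(LINT x|lborel. f' x * \<phi> x) = - (LINT x|lborel. f x * deriv \<phi> x)"
proof -
  note i = continuous_test_integrable[OF \<phi> c1_deriv_cont(2)[OF f]]
    continuous_test_integrable[OF test_deriv[OF \<phi>] c1_deriv_cont(1)[OF f]]
  have "(LINT x|lborel. f' x * \<phi> x + f x * deriv \<phi> x) = 0"
    by (rule c1_integral_deriv_0[OF c1_deriv_mult[OF f c1_deriv_test[OF \<phi>]]])
       (intro Bochner_Integration.integrable_add i continuous_test_integrable[OF \<phi> c1_deriv_cont(1)[OF f]])+
  thus ?thesis using i by simp
qed

text \<open>The one-dimensional Sobolev embedding: f(x)^2 is minus the integral of 2 f f' over [x,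
  \<infinity>), hence at most 2 |f| |f'| in L^2 norms, which is below (|f| + |f'|)^2.\<close>

lemma sqint_sup_le:
  assumes c: "c1_deriv f f'" and f: "sqint f" "sqint f'"
  shows "\<bar>f x\<bar> \<le> nrm f + nrm f'"
proof -
  have c2: "c1_deriv (\<lambda>x. f x * f x) (\<lambda>x. f' x * f x + f x * f' x)" by (rule c1_deriv_mult[OF c c])
  have i: "integrable lborel (\<lambda>x. f' x * f x + f x * f' x)"
    by (intro Bochner_Integration.integrable_add sqint_integrable_mult f)
  have "((\<lambda>x. f x * f x) \<longlongrightarrow> 0) at_top"
    by (rule c1_tendsto_0_at_top[OF c2 sqint_integrable_mult[OF f(1) f(1)] i])
  hence l: "((\<lambda>b. f x * f x - f b * f b) \<longlongrightarrow> f x * f x - 0) at_top" by (intro tendsto_intros)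
  have b: "f x * f x - f b * f b \<le> 2 * (nrm f * nrm f')" if "x \<le> b" for b
  proof -
    have "f x * f x - f b * f b = - (LINT y|lborel. indicator {x..b} y * (f' y * f y + f y * f' y))"
      using c1_FTC[OF c2 that] by simp
    also have "\<dots> \<le> \<bar>LINT y|lborel. indicator {x..b} y * (f' y * f y + f y * f' y)\<bar>" by simp
    also have "\<dots> \<le> (LINT y|lborel. \<bar>indicator {x..b} y * (f' y * f y + f y * f' y)\<bar>)"
      by (rule integral_abs_bound)
    also have "\<dots> \<le> (LINT y|lborel. 2 * (\<bar>f y\<bar> * \<bar>f' y\<bar>))"
    proof (rule integral_mono)
      show "integrable lborel (\<lambda>y. 2 * (\<bar>f y\<bar> * \<bar>f' y\<bar>))"
        by (intro integrable_mult_right sqint_integrable_mult sqint_abs f)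
      show "integrable lborel (\<lambda>y. \<bar>indicator {x..b} y * (f' y * f y + f y * f' y)\<bar>)"
        by (rule Bochner_Integration.integrable_bound[OF i]) (use f[THEN sqint_meas] in \<open>auto simp: indicator_def\<close>)
      show "\<bar>indicator {x..b} y * (f' y * f y + f y * f' y)\<bar> \<le> 2 * (\<bar>f y\<bar> * \<bar>f' y\<bar>)" for y
        by (auto simp: indicator_def abs_mult mult.commute)
    qed
    also have "\<dots> = 2 * ip (\<lambda>y. \<bar>f y\<bar>) (\<lambda>y. \<bar>f' y\<bar>)" by (simp add: ip_def)
    also have "\<dots> \<le> 2 * (nrm f * nrm f')"
      using ip_le[OF sqint_abs[OF f(1)] sqint_abs[OF f(2)]] by (simp add: nrm_abs)
    finally show ?thesis .
  qed
  have "f x * f x - 0 \<le> 2 * (nrm f * nrm f')"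
    by (rule tendsto_upperbound[OF l]) (use eventually_mono[OF eventually_ge_at_top[of x] b] in auto)
  also have "\<dots> \<le> (nrm f + nrm f')\<^sup>2" by (simp add: power2_sum)
  finally have "\<bar>f x\<bar>\<^sup>2 \<le> (nrm f + nrm f')\<^sup>2" by (simp add: power2_eq_square)
  thus ?thesis by (rule power2_le_imp_le) simp
qed

text \<open>Serves to turn L^2 smallness of a time increment, together with bounds on its higher
  derivatives in x, into smallness of its first two derivatives.\<close>

lemma nrm_deriv_interpolation:
  assumes "c1_deriv f f'" "c1_deriv f' f''" "sqint f" "sqint f'" "sqint f''"
  shows "(nrm f')\<^sup>2 \<le> nrm f * nrm f''"
proof -
  have "(nrm f')\<^sup>2 = - ip f f''"
    unfolding ip_self[symmetric] by (rule ip_by_parts) (use assms in auto)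
  also have "\<dots> \<le> nrm f * nrm f''" using ip_le[OF assms(3,5)] by simp
  finally show ?thesis .
qed

section \<open>Regular representatives: properties\<close>

lemma ft_deriv_test:
  assumes \<phi>: "\<phi> \<in> test_functions"
  shows "ft (cplx (deriv \<phi>)) \<xi> = \<i> * complex_of_real \<xi> * ft (cplx \<phi>) \<xi>"
proof -
  obtain R where R: "0 < R" "\<And>x. R \<le> \<bar>x\<bar> \<Longrightarrow> \<phi> x = 0" using test_support[OF \<phi>] by blast
  define d where "d = (\<lambda>x. complex_of_real (deriv \<phi> x) * cis (- (x * \<xi>)) - \<i> * complex_of_real \<xi> * (complex_of_real (\<phi> x) * cis (- (x * \<xi>))))"
  have d0: "d x = 0" if "x \<notin> {-R..R}" for x
  proof -
    have "deriv \<phi> x = 0"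
      by (rule deriv_eq_0_outside[where S = "- {-R..R}"]) (use R that in auto)
    moreover have "\<phi> x = 0" using R that by auto
    ultimately show ?thesis by (simp add: d_def)
  qed
  have "(LINT x|lborel. indicator {-R..R} x *\<^sub>R d x) =
     complex_of_real (\<phi> R) * cis (- (R * \<xi>)) - complex_of_real (\<phi> (-R)) * cis (- (- R * \<xi>))"
  proof (rule integral_FTC_atLeastAtMost)
    show "((\<lambda>x. complex_of_real (\<phi> x) * cis (- (x * \<xi>))) has_vector_derivative d x) (at x within {-R..R})" for x
    proof -
      have "((\<lambda>x. complex_of_real (\<phi> x)) has_vector_derivative complex_of_real (deriv \<phi> x)) (at x)"
        using test_has_deriv[OF \<phi>, of x] by (intro has_vector_derivative_of_real) (simp add: has_real_derivative_iff_has_vector_derivative)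
      moreover have "((\<lambda>x. cis (- (x * \<xi>))) has_vector_derivative - \<i> * complex_of_real \<xi> * cis (- (x * \<xi>))) (at x)"
        using cis_has_deriv[of "- \<xi>" x] by simp
      ultimately have "((\<lambda>x. complex_of_real (\<phi> x) * cis (- (x * \<xi>))) has_vector_derivative d x) (at x)"
        unfolding d_def by (auto intro!: has_vector_derivative_eq_rhs[OF has_vector_derivative_mult] simp: algebra_simps)
      thus ?thesis by (rule has_vector_derivative_at_within)
    qed
    show "continuous_on {-R..R} d" unfolding d_def
      by (intro continuous_intros test_continuous test_deriv \<phi>)
  qed (use R in simp)
  also have "(\<lambda>x. indicator {-R..R} x *\<^sub>R d x) = d" using d0 by (auto simp: fun_eq_iff indicator_def)
  finally have "(LINT x|lborel. d x) = 0" using R by simp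
  moreover have "(LINT x|lborel. d x) = (LINT x|lborel. complex_of_real (deriv \<phi> x) * cis (- (x * \<xi>))) -
      \<i> * complex_of_real \<xi> * (LINT x|lborel. complex_of_real (\<phi> x) * cis (- (x * \<xi>)))"
    unfolding d_def using test_complex(1)[OF \<phi>] test_complex(1)[OF test_deriv[OF \<phi>]]
    by (subst Bochner_Integration.integral_diff) (auto intro!: integrable_mult_cis' integrable_mult_right)
  ultimately show ?thesis by (simp add: ft_def)
qed

lemma test_reflect:
  assumes "\<phi> \<in> test_functions" shows "(\<lambda>x. \<phi> (- x)) \<in> test_functions"
proof -
  obtain R where R: "0 < R" "\<And>x. R \<le> \<bar>x\<bar> \<Longrightarrow> \<phi> x = 0" using test_support[OF assms] by blast
  show ?thesis
    using smooth_affine[OF test_smooth[OF assms], of "-1" 0] R by (intro test_functionsI[of _ R]) auto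
qed

lemma ft_reflect_test: "ft (cplx (\<lambda>x. \<phi> (- x))) \<xi> = cnj (ft (cplx \<phi>) \<xi>)"
proof -
  have "(LINT x|lborel. complex_of_real (\<phi> (- x)) * cis (- (x * \<xi>))) =
      (LINT x|lborel. complex_of_real (\<phi> x) * cis (x * \<xi>))"
    using integral_reflect[of "\<lambda>x. complex_of_real (\<phi> x) * cis (x * \<xi>)"] by simp
  also have "\<dots> = (LINT x|lborel. cnj (complex_of_real (\<phi> x) * cis (- (x * \<xi>))))"
    by (simp add: cis_cnj)
  also have "\<dots> = cnj (LINT x|lborel. complex_of_real (\<phi> x) * cis (- (x * \<xi>)))"
    by (rule Bochner_Integration.integral_cnj)
  finally show ?thesis by (simp add: ft_def)
qed

lemma ft_neg_test:
  assumes M: "integrable lborel M" and \<phi>: "\<phi> \<in> test_functions"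
  shows "(LINT x|lborel. ft M (- x) * \<phi> x) = (LINT \<xi>|lborel. M \<xi> * cnj (ft (cplx \<phi>) \<xi>))"
proof -
  have "(LINT x|lborel. ft M (- x) * \<phi> x) = (LINT x|lborel. ft M x * cplx (\<lambda>x. \<phi> (- x)) x)"
    using integral_reflect[of "\<lambda>x. ft M x * \<phi> (- x)"] by simp
  also have "\<dots> = (LINT \<xi>|lborel. M \<xi> * ft (cplx (\<lambda>x. \<phi> (- x))) \<xi>)"
    by (rule ft_multiplication[OF M test_complex(1)[OF test_reflect[OF \<phi>]]])
  finally show ?thesis unfolding ft_reflect_test .
qed

lemma sqint_Re: "f \<in> L2 \<Longrightarrow> sqint (\<lambda>x. Re (f x))"
  by (rule sqint_bound[of "\<lambda>x. cmod (f x)" _ 1]) (auto simp: L2_iff abs_Re_le_cmod intro: measurable_compose)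

lemma nrm_Re_le: "f \<in> L2 \<Longrightarrow> nrm (\<lambda>x. Re (f x)) \<le> L2_norm f"
  using nrm_bound[of "\<lambda>x. cmod (f x)" "\<lambda>x. Re (f x)" 1]
  by (auto simp: L2_iff L2_norm_eq_nrm abs_Re_le_cmod intro: measurable_compose)

lemma L2_reflect: assumes "f \<in> L2" shows "(\<lambda>x. f (- x)) \<in> L2" "L2_norm (\<lambda>x. f (- x)) = L2_norm f"
proof -
  have m: "f \<in> borel_measurable borel" by (rule L2_meas[OF assms])
  show "(\<lambda>x. f (- x)) \<in> L2"
    using assms integrable_reflect[of "\<lambda>x. (cmod (f x))\<^sup>2"] m measurable_compose[of uminus borel borel f borel]
    by (simp add: L2_def)
  show "L2_norm (\<lambda>x. f (- x)) = L2_norm f"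
    using integral_reflect[of "\<lambda>x. (cmod (f x))\<^sup>2"] by (simp add: L2_norm_def)
qed

lemma sob_rep_sqint:
  assumes f: "f \<in> Sob s" and k: "real k + 1 \<le> s"
  shows "sqint (sob_rep k f)" "nrm (sob_rep k f) \<le> Sob_norm s f"
proof -
  have k': "real k \<le> s" using k by simp
  note L = ft_L2[OF fmom_integrable[OF f k] fmom_L2(1)[OF f k']]
  show "sqint (sob_rep k f)" unfolding sob_rep_def[abs_def] by (intro sqint_Re L2_reflect L)
  have "nrm (sob_rep k f) \<le> L2_norm (\<lambda>x. ft (fmom k f) (- x))"
    unfolding sob_rep_def[abs_def] by (intro nrm_Re_le L2_reflect L)
  also have "\<dots> \<le> L2_norm (fmom k f)" unfolding L2_reflect(2)[OF L(1)] by (rule L)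
  also have "\<dots> \<le> Sob_norm s f" by (rule fmom_L2[OF f k'])
  finally show "nrm (sob_rep k f) \<le> Sob_norm s f" .
qed

lemma fmom_Suc: "fmom (Suc k) f = (\<lambda>\<xi>. \<i> * complex_of_real \<xi> * fmom k f \<xi>)"
  by (simp add: fmom_def fun_eq_iff)

lemma sob_rep_has_deriv:
  assumes f: "f \<in> Sob s" and k: "real k + 2 \<le> s"
  shows "(sob_rep k f has_real_derivative sob_rep (Suc k) f x) (at x)"
proof -
  have "((\<lambda>x. ft (fmom k f) (- x)) has_vector_derivative ft (fmom (Suc k) f) (- x)) (at x)"
    unfolding fmom_Suc
    using fmom_integrable[OF f, of k] fmom_integrable[OF f, of "Suc k"] k
    by (intro ft_has_deriv) (auto simp: fmom_Suc)
  from bounded_linear.has_vector_derivative[OF bounded_linear_Re this]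
  show ?thesis unfolding sob_rep_def[abs_def] by (simp add: has_real_derivative_iff_has_vector_derivative)
qed

lemma sob_rep_continuous:
  assumes f: "f \<in> Sob s" and k: "real k + 1 \<le> s"
  shows "continuous_on UNIV (sob_rep k f)"
proof -
  let ?M = "fmom k f"
  have i: "integrable lborel ?M" by (rule fmom_integrable[OF f k])
  have "isCont (\<lambda>x. ft ?M (- x)) x" for x
    unfolding isCont_def
  proof (rule tendsto_at_iff_sequentially[THEN iffD2], intro allI impI)
    fix X :: "nat \<Rightarrow> real" assume X: "\<forall>i. X i \<in> UNIV - {x}" "X \<longlonglongrightarrow> x"
    have "(\<lambda>n. LINT \<xi>|lborel. ?M \<xi> * cis (\<xi> * X n)) \<longlonglongrightarrow> (LINT \<xi>|lborel. ?M \<xi> * cis (\<xi> * x))"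
    proof (rule integral_dominated_convergence[where w = "\<lambda>\<xi>. cmod (?M \<xi>)"])
      show "AE \<xi> in lborel. (\<lambda>n. ?M \<xi> * cis (\<xi> * X n)) \<longlonglongrightarrow> ?M \<xi> * cis (\<xi> * x)"
        by (intro AE_I2 tendsto_intros X)
    qed (use i borel_measurable_integrable[OF i] in \<open>auto simp: norm_mult\<close>)
    thus "((\<lambda>x. ft ?M (- x)) \<circ> X) \<longlonglongrightarrow> ft ?M (- x)"
      unfolding ft_neg o_def by (intro tendsto_mult_left)
  qed
  hence "continuous_on UNIV (\<lambda>x. ft ?M (- x))" by (simp add: continuous_at_imp_continuous_on)
  thus ?thesis unfolding sob_rep_def[abs_def] by (intro continuous_intros)
qed

lemma sob_rep_c1:
  assumes "f \<in> Sob s" "real k + 2 \<le> s"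
  shows "c1_deriv (sob_rep k f) (sob_rep (Suc k) f)"
  unfolding c1_deriv_def using sob_rep_has_deriv[OF assms] sob_rep_continuous[OF assms(1), of "Suc k"] assms(2) by simp

lemma sob_rep_test:
  assumes f: "f \<in> Sob s" and k: "real k + 1 \<le> s" and \<phi>: "\<phi> \<in> test_functions"
  shows "(LINT x|lborel. sob_rep k f x * \<phi> x) = Re (LINT \<xi>|lborel. fmom k f \<xi> * cnj (ft (cplx \<phi>) \<xi>))"
proof -
  have k': "real k \<le> s" using k by simp
  have i: "integrable lborel (fmom k f)" by (rule fmom_integrable[OF f k])
  have L: "(\<lambda>x. ft (fmom k f) (- x)) \<in> L2" by (intro L2_reflect ft_L2 i fmom_L2(1)[OF f k'])
  have "Re (LINT x|lborel. ft (fmom k f) (- x) * \<phi> x) = (LINT x|lborel. Re (ft (fmom k f) (- x) * \<phi> x))"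
    by (rule integral_Re[symmetric]) (rule L2_integrable_mult[OF L test_complex(2)[OF \<phi>]])
  thus ?thesis unfolding ft_neg_test[OF i \<phi>] by (simp add: sob_rep_def)
qed

text \<open>Both functions have the same pairing with every test function, by Parseval on either
  side.\<close>

lemma sob_rep_AE:
  assumes f: "cplx r \<in> Sob s" and s: "1 \<le> s"
  shows "AE x in lborel. r x = sob_rep 0 (cplx r) x"
proof -
  have r: "sqint r"
    using sqint_Re[OF Sob_L2[OF f]] by simp
  have g: "sqint (sob_rep 0 (cplx r))" by (rule sob_rep_sqint(1)[OF f]) (use s in simp)
  have "AE x in lborel. r x - sob_rep 0 (cplx r) x = 0"
  proof (rule sqint_orthogonal_test_AE_0[OF sqint_diff[OF r g]])
    fix \<phi> assume \<phi>: "\<phi> \<in> test_functions"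
    have "ip (sob_rep 0 (cplx r)) \<phi> = Re (LINT \<xi>|lborel. fourier (cplx r) \<xi> * cnj (ft (cplx \<phi>) \<xi>))"
      unfolding ip_def using sob_rep_test[OF f, of 0, OF _ \<phi>] s by (simp add: fmom_def)
    also have "\<dots> = Re (LINT x|lborel. complex_of_real (r x * \<phi> x))"
      unfolding fourier_parseval_test[OF Sob_L2[OF f] \<phi>] by simp
    also have "\<dots> = ip r \<phi>" unfolding integral_complex_of_real by (simp add: ip_def)
    finally show "ip (\<lambda>x. r x - sob_rep 0 (cplx r) x) \<phi> = 0"
      using ip_diff_left[OF r g test_sqint[OF \<phi>]] by simp
  qed
  thus ?thesis by simp
qed

text \<open>At the top order \<open>fmom (Suc k) f\<close> is only known to be in L^2, so its
  inverse transform is a weak derivative and no longer a classical one. This is the situation for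
  the second derivative of an H^3 eigenfunction.\<close>

lemma sob_rep_weak_deriv:
  assumes f: "f \<in> Sob s" and k: "real k + 1 \<le> s"
  obtains h where "sqint h"
    "\<And>\<phi>. \<phi> \<in> test_functions \<Longrightarrow> (LINT x|lborel. sob_rep k f x * deriv \<phi> x) = - (LINT x|lborel. h x * \<phi> x)"
proof -
  let ?M = "fmom (Suc k) f"
  have M: "?M \<in> L2" by (rule fmom_L2[OF f]) (use k in simp)
  define h where "h = (\<lambda>x. fourier ?M (- x))"
  have h: "h \<in> L2" unfolding h_def by (intro L2_reflect fourier_L2 M)
  show thesis
  proof (rule that[of "\<lambda>x. Re (h x)"])
    show "sqint (\<lambda>x. Re (h x))" by (rule sqint_Re[OF h])
    fix \<phi> assume \<phi>: "\<phi> \<in> test_functions"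
    note r = test_complex[OF test_reflect[OF \<phi>]]
    have "(LINT x|lborel. h x * \<phi> x) = (LINT x|lborel. fourier ?M x * cplx (\<lambda>x. \<phi> (- x)) x)"
      using integral_reflect[of "\<lambda>x. fourier ?M x * \<phi> (- x)"] by (simp add: h_def)
    also have "\<dots> = (LINT \<xi>|lborel. ?M \<xi> * cnj (ft (cplx \<phi>) \<xi>))"
      unfolding fourier_multiplication[OF M r] ft_reflect_test ..
    also have "\<dots> = - (LINT \<xi>|lborel. fmom k f \<xi> * cnj (ft (cplx (deriv \<phi>)) \<xi>))"
      unfolding ft_deriv_test[OF \<phi>] fmom_Suc by (simp add: mult_ac)
    finally have eq: "(LINT \<xi>|lborel. fmom k f \<xi> * cnj (ft (cplx (deriv \<phi>)) \<xi>)) = - (LINT x|lborel. h x * \<phi> x)" by simp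
    have "(LINT x|lborel. Re (h x) * \<phi> x) = Re (LINT x|lborel. h x * \<phi> x)"
      using integral_Re[OF L2_integrable_mult[OF h test_complex(2)[OF \<phi>]]] by simp
    thus "(LINT x|lborel. sob_rep k f x * deriv \<phi> x) = - (LINT x|lborel. Re (h x) * \<phi> x)"
      unfolding sob_rep_test[OF f k test_deriv[OF \<phi>]] eq by simp
  qed
qed

section \<open>The lemma of du Bois-Reymond\<close>

text \<open>A one-sided mollifier of mass 1 on [a, a + e]. It is the derivative of the ramp used in
  \<open>test_box\<close>, so the derivative of a box is a difference of two bumps.\<close>

definition bump :: "real \<Rightarrow> real \<Rightarrow> real \<Rightarrow> real" where
  "bump a e x = deriv sstep ((x - a) / e) / e"

lemma bump_nonneg: "0 < e \<Longrightarrow> 0 \<le> bump a e x"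
  by (simp add: bump_def deriv_sstep_nonneg)

lemma bump_0: "0 < e \<Longrightarrow> x \<le> a \<or> a + e \<le> x \<Longrightarrow> bump a e x = 0"
  unfolding bump_def by (subst deriv_sstep_0) (auto simp: field_simps)

lemma bump_pos: "0 < e \<Longrightarrow> a < x \<Longrightarrow> x < a + e \<Longrightarrow> 0 < bump a e x"
  unfolding bump_def by (intro divide_pos_pos deriv_sstep_pos) (auto simp: field_simps)

lemma bump_test:
  assumes "0 < e" shows "bump a e \<in> test_functions"
proof (rule test_functionsI[where R = "\<bar>a\<bar> + e"])
  have "smooth (\<lambda>x. deriv sstep ((1 / e) * x + - a / e) * (1 / e))"
    by (rule smooth_mult[OF smooth_affine[OF smooth_deriv[OF smooth_sstep]] smooth_const])
  thus "smooth (bump a e)" using assms by (simp add: bump_def[abs_def] diff_divide_distrib)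
qed (use assms in \<open>auto intro!: bump_0\<close>)

lemma deriv_sstep_test: "deriv sstep \<in> test_functions"
  using bump_test[of 1 0] by (simp add: bump_def[abs_def])

lemma c1_deriv_sstep: "c1_deriv sstep (deriv sstep)"
  by (simp add: c1_deriv_def smooth_has_deriv smooth_sstep test_continuous deriv_sstep_test)

lemma integral_deriv_sstep: "(LINT x|lborel. deriv sstep x) = 1"
proof -
  have "(LINT x|lborel. deriv sstep x) = (LINT x|lborel. indicator {0..1} x * deriv sstep x)"
  proof (rule Bochner_Integration.integral_cong)
    show "deriv sstep x = indicator {0..1} x * deriv sstep x" for x
      using deriv_sstep_0[of x] by (cases "x \<in> {0..1}") auto
  qed simp
  also have "\<dots> = sstep 1 - sstep 0" by (rule c1_FTC[OF c1_deriv_sstep]) simp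
  finally show ?thesis by (simp add: sstep_0 sstep_1)
qed

lemma integral_bump_subst:
  assumes "0 < e"
  shows "(LINT x|lborel. u x * bump a e x) = (LINT y|lborel. u (a + e * y) * deriv sstep y)"
proof -
  have "(LINT x|lborel. u x * bump a e x) = \<bar>e\<bar> *\<^sub>R (LINT y|lborel. u (a + e * y) * bump a e (a + e * y))"
    by (rule lborel_integral_real_affine) (use assms in simp)
  thus ?thesis using assms by (simp add: bump_def)
qed

lemma bump_tendsto:
  assumes u: "continuous_on UNIV u"
  shows "(\<lambda>n. LINT x|lborel. u x * bump a (1 / (real n + 1)) x) \<longlonglongrightarrow> u a"
proof -
  have um [measurable]: "u \<in> borel_measurable borel" by (rule borel_measurable_continuous_onI[OF u])
  have sm [measurable]: "deriv sstep \<in> borel_measurable borel" by (rule test_measurable[OF deriv_sstep_test])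
  have "bounded (u ` {a..a+1})"
    by (intro compact_imp_bounded compact_continuous_image continuous_on_subset[OF u]) auto
  then obtain B where B: "\<And>x. a \<le> x \<Longrightarrow> x \<le> a + 1 \<Longrightarrow> \<bar>u x\<bar> \<le> B" unfolding bounded_iff by force
  have "(\<lambda>n. LINT y|lborel. u (a + 1 / (real n + 1) * y) * deriv sstep y) \<longlonglongrightarrow> (LINT y|lborel. u a * deriv sstep y)"
  proof (rule integral_dominated_convergence[where w = "\<lambda>y. B * deriv sstep y"])
    show "AE y in lborel. (\<lambda>n. u (a + 1 / (real n + 1) * y) * deriv sstep y) \<longlonglongrightarrow> u a * deriv sstep y"
    proof (intro AE_I2 tendsto_mult_right)
      fix y
      have "(\<lambda>n. a + 1 / (real n + 1) * y) \<longlonglongrightarrow> a" by real_asymp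
      moreover have "isCont u a" using u by (simp add: continuous_on_eq_continuous_at)
      ultimately show "(\<lambda>n. u (a + 1 / (real n + 1) * y)) \<longlonglongrightarrow> u a" by (rule isCont_tendsto_compose[rotated])
    qed
    show "AE y in lborel. norm (u (a + 1 / (real n + 1) * y) * deriv sstep y) \<le> B * deriv sstep y" for n
    proof (rule AE_I2)
      fix y :: real
      show "norm (u (a + 1 / (real n + 1) * y) * deriv sstep y) \<le> B * deriv sstep y"
      proof (cases "0 < y \<and> y < 1")
        case True
        have "1 / (real n + 1) * y \<le> 1 * 1" using True by (intro mult_mono) auto
        hence "\<bar>u (a + 1 / (real n + 1) * y)\<bar> \<le> B" using True by (intro B) auto
        thus ?thesis using deriv_sstep_nonneg[of y] by (auto simp: abs_mult intro: mult_right_mono)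
      next
        case False
        thus ?thesis by (subst (1 2) deriv_sstep_0) auto
      qed
    qed
  qed (use test_integrable[OF deriv_sstep_test] in auto)
  thus ?thesis by (simp add: integral_bump_subst integral_deriv_sstep)
qed

lemma continuous_antiderivative:
  assumes "continuous_on UNIV g"
  obtains G where "c1_deriv G g"
proof -
  have "\<And>x. isCont g x" using assms by (simp add: continuous_on_eq_continuous_at)
  then obtain G where "\<And>x. (G has_vector_derivative g x) (at x)"
    using einterval_antiderivative[of "-\<infinity>" "\<infinity>" g] by auto
  thus thesis using assms by (intro that[of G]) (simp add: c1_deriv_def has_real_derivative_iff_has_vector_derivative)
qed

lemma box_deriv:
  assumes "0 < e"
  shows "deriv (\<lambda>x. sstep ((x - a) / e) - sstep ((x - b) / e)) = (\<lambda>x. bump a e x - bump b e x)"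
proof
  fix x
  have "((\<lambda>x. sstep ((x - c) / e)) has_real_derivative bump c e x) (at x)" for c
  proof -
    have "((\<lambda>x. (x - c) / e) has_real_derivative 1 / e) (at x)"
      using assms by (auto intro!: derivative_eq_intros)
    from DERIV_chain2[OF smooth_has_deriv[OF smooth_sstep] this] show ?thesis by (simp add: bump_def)
  qed
  hence "((\<lambda>x. sstep ((x - a) / e) - sstep ((x - b) / e)) has_real_derivative bump a e x - bump b e x) (at x)"
    by (intro DERIV_diff)
  thus "deriv (\<lambda>x. sstep ((x - a) / e) - sstep ((x - b) / e)) x = bump a e x - bump b e x"
    by (rule DERIV_imp_deriv)
qed

text \<open>After subtracting an antiderivative G of g, the function u = f - G has weak derivative
  0. Testing with the box between a and b says that the bump averages of u at a and at b agree, and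
  as the width shrinks these averages tend to u a and u b.\<close>

lemma du_Bois_Reymond:
  assumes f: "continuous_on UNIV f" and g: "continuous_on UNIV g"
    and w: "\<And>\<phi>. \<phi> \<in> test_functions \<Longrightarrow> (LINT x|lborel. f x * deriv \<phi> x) = - (LINT x|lborel. g x * \<phi> x)"
  shows "c1_deriv f g"
proof -
  obtain G where G: "c1_deriv G g" using continuous_antiderivative[OF g] .
  define u where "u = (\<lambda>x. f x - G x)"
  have uc: "continuous_on UNIV u" unfolding u_def by (intro continuous_intros f c1_deriv_cont[OF G])
  have u0: "(LINT x|lborel. u x * deriv \<phi> x) = 0" if \<phi>: "\<phi> \<in> test_functions" for \<phi>
  proof -
    note i = continuous_test_integrable[OF test_deriv[OF \<phi>]]
    have "(LINT x|lborel. u x * deriv \<phi> x) = (LINT x|lborel. f x * deriv \<phi> x) - (LINT x|lborel. G x * deriv \<phi> x)"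
      unfolding u_def left_diff_distrib
      by (rule Bochner_Integration.integral_diff) (intro i f c1_deriv_cont[OF G])+
    thus ?thesis using w[OF \<phi>] integral_by_parts_test[OF G \<phi>] by simp
  qed
  have eq: "u a = u b" if "a \<le> b" for a b
  proof -
    have eqn: "(LINT x|lborel. u x * bump a (1 / (real n + 1)) x) = (LINT x|lborel. u x * bump b (1 / (real n + 1)) x)" for n
    proof -
      let ?e = "1 / (real n + 1)"
      have e: "0 < ?e" by simp
      have "(LINT x|lborel. u x * (bump a ?e x - bump b ?e x)) = 0"
        using u0[OF test_box[OF that e]] unfolding box_deriv[OF e] .
      moreover have "integrable lborel (\<lambda>x. u x * bump c ?e x)" for c
        by (rule continuous_test_integrable[OF bump_test[OF e] uc])
      ultimately show ?thesis by (simp add: right_diff_distrib)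
    qed
    show ?thesis
      by (rule LIMSEQ_unique[OF bump_tendsto[OF uc, of a]]) (unfold eqn, rule bump_tendsto[OF uc])
  qed
  have u_const: "u x = u 0" for x
  proof (cases "x \<ge> 0")
    case True
    show ?thesis by (rule eq[OF True, symmetric])
  next
    case False
    show ?thesis by (rule eq) (use False in simp)
  qed
  have "f x = G x + u 0" for x using u_const[of x] unfolding u_def by linarith
  hence "f = (\<lambda>x. G x + u 0)" by (rule ext)
  thus ?thesis
    using G g DERIV_add[OF c1_derivD[OF G] DERIV_const[of "u 0"]] by (simp add: c1_deriv_def)
qed

section \<open>The soliton\<close>

locale soliton =
  fixes p :: nat
  assumes p_gt: "5 < p"
begin

text \<open>With t = tanh(k x) one has t' = k (1 - t^2), \<open>Q' = - t Q\<close> and W = Q^(p-1) =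
  (k + 1)(1 - t^2), so that the derivatives of the soliton are the soliton times polynomials in t. V
  = 1 - p W is the potential of L.\<close>

definition k :: real where "k = (real p - 1) / 2"
definition T :: "real \<Rightarrow> real" where "T x = tanh (k * x)"
definition W :: "real \<Rightarrow> real" where "W x = (real p + 1) / 2 * (1 - (T x)\<^sup>2)"
definition V :: "real \<Rightarrow> real" where "V x = 1 - real p * W x"
definition V' :: "real \<Rightarrow> real" where "V' x = real p * (real p - 1) * T x * W x"
definition Q' :: "real \<Rightarrow> real" where "Q' x = - T x * Q p x"
definition Q'' :: "real \<Rightarrow> real" where "Q'' x = Q p x - W x * Q p x"

lemma k_ge: "5 / 2 \<le> k" using p_gt by (simp add: k_def)

lemma T_deriv: "(T has_real_derivative k * (1 - (T x)\<^sup>2)) (at x)"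
  unfolding T_def[abs_def] by (auto intro!: derivative_eq_intros simp: cosh_real_nonzero)

lemma T_bound: "\<bar>T x\<bar> < 1" "(T x)\<^sup>2 < 1"
proof -
  show "\<bar>T x\<bar> < 1" using tanh_real_bounds[of "k * x"] by (simp add: T_def abs_less_iff)
  thus "(T x)\<^sup>2 < 1" by (simp add: abs_square_less_1)
qed

lemma T_cont: "continuous_on A T"
  using DERIV_isCont[OF T_deriv] by (auto intro: continuous_at_imp_continuous_on)

lemma T_minus: "T (- x) = - T x" by (simp add: T_def)

lemma T_pos: "0 < x \<Longrightarrow> 0 < T x" using k_ge by (simp add: T_def)

lemma T_0: "T 0 = 0" by (simp add: T_def)

lemma W_pos: "0 < W x" using T_bound(2)[of x] by (simp add: W_def)

lemma W_le: "W x \<le> (real p + 1) / 2"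
  using mult_left_mono[of "1 - (T x)\<^sup>2" 1 "(real p + 1) / 2"] by (simp add: W_def)

lemma W_eq: "W x = (real p + 1) / (2 * (cosh (k * x))\<^sup>2)"
proof -
  have c: "(cosh (k * x))\<^sup>2 \<noteq> 0" by (simp add: cosh_real_nonzero)
  have "1 - (T x)\<^sup>2 = ((cosh (k * x))\<^sup>2 - (sinh (k * x))\<^sup>2) / (cosh (k * x))\<^sup>2"
    unfolding diff_divide_distrib divide_self[OF c] by (simp add: T_def tanh_def power_divide)
  also have "\<dots> = 1 / (cosh (k * x))\<^sup>2" by (simp add: hyperbolic_pythagoras)
  finally show ?thesis unfolding W_def by simp
qed

lemma W_k: "W x = (k + 1) * (1 - (T x)\<^sup>2)"
proof -
  have "(real p + 1) / 2 = k + 1" by (simp add: k_def field_simps)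
  thus ?thesis unfolding W_def by simp
qed

lemma W_deriv: "(W has_real_derivative - (real p - 1) * T x * W x) (at x)"
proof -
  have W: "W = (\<lambda>x. (real p + 1) / 2 * (1 - (T x)\<^sup>2))" by (rule ext) (rule W_def)
  have k: "real p - 1 = 2 * k" by (simp add: k_def)
  have d: "((\<lambda>x. (real p + 1) / 2 * (1 - (T x)\<^sup>2)) has_real_derivative
      (real p + 1) / 2 * (0 - real 2 * (k * (1 - (T x)\<^sup>2) * T x ^ (2 - Suc 0)))) (at x)"
    by (intro DERIV_cmult DERIV_diff DERIV_const DERIV_power T_deriv)
  have "(real p + 1) / 2 * (0 - real 2 * (k * (1 - (T x)\<^sup>2) * T x ^ (2 - Suc 0))) =
      - (2 * k) * T x * W x" unfolding W_def by (simp add: mult_ac)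
  with d show ?thesis unfolding k W[symmetric] by (simp only:)
qed

lemma Q_eq: "Q p x = W x powr (1 / (real p - 1))"
  by (simp add: Q_def W_eq k_def)

lemma Q_pos: "0 < Q p x"
  using W_pos[of x] by (simp add: Q_eq)

lemma Q_power: "Q p x ^ (p - 1) = W x"
proof -
  have r: "real (p - 1) = real p - 1" using p_gt by (simp add: of_nat_diff)
  have "Q p x ^ (p - 1) = Q p x powr (real (p - 1))" by (rule powr_realpow[OF Q_pos, symmetric])
  also have "\<dots> = W x powr (1 / (real p - 1) * (real p - 1))" unfolding Q_eq powr_powr r ..
  also have "1 / (real p - 1) * (real p - 1) = 1" using p_gt by simp
  also have "W x powr 1 = W x" using W_pos[of x] by (intro powr_one) simp
  finally show ?thesis .
qed

lemma Q_deriv: "(Q p has_real_derivative Q' x) (at x)"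
proof -
  let ?c = "1 / (real p - 1)"
  have c: "((\<lambda>x. ?c) has_real_derivative 0) (at x)" by (rule DERIV_const)
  have "W x powr ?c * (0 * ln (W x) + - (real p - 1) * T x * W x * ?c / W x) = Q' x"
  proof -
    have nz: "real p - 1 \<noteq> 0" "W x \<noteq> 0" using p_gt W_pos[of x] by auto
    have "- c * t * w * (1 / c) / w = - t" if "c \<noteq> 0" "w \<noteq> 0" for c t w :: real
      using that by (simp add: field_simps)
    from this[OF nz] have "0 * ln (W x) + - (real p - 1) * T x * W x * ?c / W x = - T x"
      by (simp only: mult_zero_left add_0)
    thus ?thesis unfolding Q'_def Q_eq by (simp only: mult.commute)
  qed
  moreover have "Q p = (\<lambda>x. W x powr ?c)" by (rule ext) (rule Q_eq)
  ultimately show ?thesis using DERIV_powr[OF W_deriv W_pos c] by (simp only:)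
qed

lemma Q'_deriv: "(Q' has_real_derivative Q'' x) (at x)"
proof -
  have "(Q' has_real_derivative - (k * (1 - (T x)\<^sup>2)) * Q p x + Q' x * - T x) (at x)"
    using DERIV_mult[OF DERIV_minus[OF T_deriv] Q_deriv, of x] by (simp add: Q'_def[abs_def])
  moreover have "- (k * (1 - (T x)\<^sup>2)) * Q p x + Q' x * - T x = Q'' x"
    by (simp add: Q'_def Q''_def W_k power2_eq_square algebra_simps)
  ultimately show ?thesis by simp
qed

lemma Q''_deriv: "(Q'' has_real_derivative V x * Q' x) (at x)"
proof -
  have "(Q'' has_real_derivative Q' x - (- (real p - 1) * T x * W x * Q p x + Q' x * W x)) (at x)"
    using DERIV_diff[OF Q_deriv DERIV_mult[OF W_deriv Q_deriv], of x] by (simp add: Q''_def[abs_def])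
  moreover have "Q' x - (- (real p - 1) * T x * W x * Q p x + Q' x * W x) = V x * Q' x"
    by (simp add: Q'_def V_def algebra_simps)
  ultimately show ?thesis by simp
qed

lemma V_deriv: "(V has_real_derivative V' x) (at x)"
  using DERIV_diff[OF DERIV_const DERIV_cmult[OF W_deriv, of "real p"], of 1 x]
  by (simp add: V_def[abs_def] V'_def algebra_simps)

lemma W_cont: "continuous_on A W"
  using DERIV_isCont[OF W_deriv] by (auto intro: continuous_at_imp_continuous_on)

lemma c1_V: "c1_deriv V V'"
  unfolding c1_deriv_def V'_def by (intro conjI allI V_deriv[unfolded V'_def] continuous_intros T_cont W_cont)

lemma Q_cont: "continuous_on A (Q p)" and Q'_cont: "continuous_on A Q'" and Q''_cont: "continuous_on A Q''"
  using DERIV_isCont[OF Q_deriv] DERIV_isCont[OF Q'_deriv] DERIV_isCont[OF Q''_deriv]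
  by (auto intro: continuous_at_imp_continuous_on)

lemma c1_Q: "c1_deriv (Q p) Q'" and c1_Q': "c1_deriv Q' Q''" and c1_Q'': "c1_deriv Q'' (\<lambda>x. V x * Q' x)"
  by (auto simp: c1_deriv_def Q_deriv Q'_deriv Q''_deriv Q'_cont Q''_cont
      intro!: continuous_intros c1_deriv_cont[OF c1_V])

text \<open>One crude constant for V, \<open>V'\<close>, Q and \<open>Q'\<close> at once;
  \<open>Q''\<close> is bounded by its square.\<close>

definition CV :: real where "CV = 1 + real p * (real p + 1) * real p"

lemma CV_pos: "1 \<le> CV" by (simp add: CV_def)

lemma V_bound: "\<bar>V x\<bar> \<le> CV"
proof -
  have "real p * W x \<le> real p * ((real p + 1) / 2)" using W_le by (intro mult_left_mono) auto
  also have "\<dots> = real p * (real p + 1) * (1 / 2)" by simp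
  also have "\<dots> \<le> real p * (real p + 1) * real p" using p_gt by (intro mult_left_mono) auto
  finally have "real p * W x \<le> CV - 1" by (simp add: CV_def)
  moreover have "0 \<le> real p * W x" using W_pos[of x] by simp
  ultimately show ?thesis using CV_pos unfolding V_def by linarith
qed

lemma V'_bound: "\<bar>V' x\<bar> \<le> CV"
proof -
  have "\<bar>V' x\<bar> = real p * (real p - 1) * (\<bar>T x\<bar> * W x)"
    using p_gt W_pos[of x] by (simp add: V'_def abs_mult)
  also have "\<dots> \<le> real p * (real p - 1) * (1 * ((real p + 1) / 2))"
    using p_gt T_bound(1)[of x] W_le[of x] W_pos[of x] by (intro mult_left_mono mult_mono) auto
  also have "\<dots> = real p * (real p + 1) * ((real p - 1) / 2)" by simp
  also have "\<dots> \<le> real p * (real p + 1) * real p" using p_gt by (intro mult_left_mono) auto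
  also have "\<dots> \<le> CV" by (simp add: CV_def)
  finally show ?thesis .
qed

lemma W_le_CV: "W x \<le> CV - 1"
proof -
  have "1 / 2 \<le> real p" using p_gt by simp
  also have "\<dots> = real p * 1" by simp
  also have "\<dots> \<le> real p * real p" using p_gt by (intro mult_left_mono) auto
  finally have "(real p + 1) * (1 / 2) \<le> (real p + 1) * (real p * real p)" by (intro mult_left_mono) auto
  moreover have "CV - 1 = (real p + 1) * (real p * real p)" by (simp add: CV_def)
  ultimately show ?thesis using W_le[of x] by linarith
qed

lemma Q_le: "Q p x \<le> CV"
proof -
  have "Q p x \<le> max 1 (W x)"
  proof (cases "Q p x \<le> 1")
    case False
    hence "Q p x ^ 1 \<le> Q p x ^ (p - 1)" using p_gt by (intro power_increasing) auto
    hence "Q p x \<le> W x" unfolding Q_power by simp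
    thus ?thesis by simp
  qed auto
  also have "\<dots> \<le> CV" using W_le_CV[of x] CV_pos by simp
  finally show ?thesis .
qed

lemma Q'_le: "\<bar>Q' x\<bar> \<le> CV"
  using mult_mono[OF less_imp_le[OF T_bound(1)[of x]] Q_le[of x]] Q_pos[of x] by (simp add: Q'_def abs_mult)

lemma Q''_le: "\<bar>Q'' x\<bar> \<le> CV * CV"
proof -
  have "\<bar>1 - W x\<bar> \<le> CV"
    using W_pos[of x] W_le_CV[of x] CV_pos by linarith
  hence "\<bar>1 - W x\<bar> * Q p x \<le> CV * CV" using Q_le[of x] Q_pos[of x] by (intro mult_mono) auto
  moreover have "Q'' x = (1 - W x) * Q p x" by (simp add: Q''_def left_diff_distrib)
  ultimately show ?thesis using Q_pos[of x] by (simp add: abs_mult)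
qed

lemma Q'_neg: "0 < x \<Longrightarrow> Q' x < 0"
  using T_pos Q_pos by (simp add: Q'_def)

lemma Q'_reflect: "Q' (- x) = - Q' x"
  by (simp add: Q'_def T_minus Q_def)

lemma V_reflect: "V (- x) = V x"
  by (simp add: V_def W_def T_minus)

text \<open>So \<open>Q'\<close> has a simple zero at the origin, and quotients by \<open>Q'\<close>
  of functions vanishing there stay bounded.\<close>

lemma Q''_0: "Q'' 0 \<noteq> 0"
  using p_gt Q_pos[of 0] by (simp add: Q''_def W_def T_0)

text \<open>The second derivative is passed as an argument; the two functions are tied together by
  \<open>c1_deriv\<close> where the operator is used.\<close>

definition Lop :: "(real \<Rightarrow> real) \<Rightarrow> (real \<Rightarrow> real) \<Rightarrow> real \<Rightarrow> real" where
  "Lop f f'' x = - f'' x + V x * f x"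

end

section \<open>The eigenfunction\<close>

lemma has_weak_deriv_weak_deriv: "has_weak_deriv f g \<Longrightarrow> has_weak_deriv f (weak_deriv f)"
  unfolding weak_deriv_def by (rule someI[of "has_weak_deriv f"])

lemma locally_integrable_L2: "f \<in> L2 \<Longrightarrow> locally_integrable f"
  using trunc_integrable[of f] L2_meas[of f] by (simp add: locally_integrable_def set_integrable_def)

lemma L2_cplx: "sqint f \<Longrightarrow> cplx f \<in> L2"
  using sqint_meas[of f] by (auto simp: L2_iff sqint_abs)

lemma locally_integrable_test:
  assumes f: "locally_integrable f" and \<phi>: "\<phi> \<in> test_functions"
  shows "integrable lborel (\<lambda>x. f x * complex_of_real (\<phi> x))"
proof -
  obtain R where R: "0 < R" "\<And>x. R \<le> \<bar>x\<bar> \<Longrightarrow> \<phi> x = 0" using test_support[OF \<phi>] by blast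
  obtain B where B: "0 < B" "\<And>x. \<bar>\<phi> x\<bar> \<le> B" using test_bounded[OF \<phi>] by blast
  have "integrable lborel (\<lambda>x. trunc R f x * complex_of_real (\<phi> x))"
    by (rule integrable_mult_bounded[where B = B])
       (use f B test_measurable[OF \<phi>] in \<open>auto simp: locally_integrable_def set_integrable_def\<close>)
  moreover have "trunc R f x * complex_of_real (\<phi> x) = f x * complex_of_real (\<phi> x)" for x
    using R(2)[of x] by (cases "\<bar>x\<bar> \<le> R") (auto simp: indicator_def)
  ultimately show ?thesis by simp
qed

lemma locally_integrable_add:
  "locally_integrable f \<Longrightarrow> locally_integrable g \<Longrightarrow> locally_integrable (\<lambda>x. f x + g x)"
  by (auto simp: locally_integrable_def)

lemma locally_integrable_uminus: "locally_integrable f \<Longrightarrow> locally_integrable (\<lambda>x. - f x)"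
  by (auto simp: locally_integrable_def set_integrable_def)

lemma integral_cplx_test: "(LINT x|lborel. cplx f x * complex_of_real (\<phi> x)) = complex_of_real (LINT x|lborel. f x * \<phi> x)"
  unfolding of_real_mult[symmetric] by (rule integral_complex_of_real)

lemma has_weak_deriv_test:
  "has_weak_deriv f g \<Longrightarrow> \<phi> \<in> test_functions \<Longrightarrow>
    (LINT x|lborel. g x * complex_of_real (\<phi> x)) = - (LINT x|lborel. f x * complex_of_real (deriv \<phi> x))"
  by (simp add: has_weak_deriv_def)

context soliton
begin

text \<open>\<open>weak_deriv\<close> is a choice that means something only once a weak derivative
  exists. Each of the three nested weak derivatives is therefore first exhibited through the regular
  representative and then evaluated against test functions. The outcome is (L Y)' = - e0 Y in the
  weak sense with both sides continuous, which du Bois-Reymond makes classical.\<close>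

lemma eigenfunction_regular:
  assumes e: "eigenfunction p (complex_of_real e0) (cplx Yp)"
  obtains Y Y' Y'' where "c1_deriv Y Y'" "c1_deriv Y' Y''" "sqint Y" "sqint Y'" "sqint Y''"
    "AE x in lborel. Yp x = Y x" "c1_deriv (Lop Y Y'') (\<lambda>x. - e0 * Y x)" "\<exists>x. Y x \<noteq> 0"
proof -
  define a where "a = cplx Yp"
  have a: "a \<in> Sob 3" and na: "\<not> (AE x in lborel. a x = 0)"
    and ev: "AE x in lborel. lin_op p a x = complex_of_real e0 * a x"
    using e by (auto simp: eigenfunction_def a_def)
  define Y where "Y = (\<lambda>k. sob_rep k a)"
  have c: "c1_deriv (Y 0) (Y 1)" "c1_deriv (Y 1) (Y 2)"
    using sob_rep_c1[OF a, of 0] sob_rep_c1[OF a, of 1] by (auto simp: Y_def numeral_2_eq_2)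
  have sq: "sqint (Y i)" if "i \<le> 2" for i
    unfolding Y_def by (rule sob_rep_sqint(1)[OF a]) (use that in simp)
  have AE: "AE x in lborel. Yp x = Y 0 x"
    unfolding Y_def using sob_rep_AE[of Yp 3] a by (simp add: a_def)
  obtain h where h: "sqint h" "\<And>\<phi>. \<phi> \<in> test_functions \<Longrightarrow> (LINT x|lborel. Y 2 x * deriv \<phi> x) = - (LINT x|lborel. h x * \<phi> x)"
    using sob_rep_weak_deriv[OF a, of 2] unfolding Y_def by auto
  have aL: "a \<in> L2" by (rule Sob_L2[OF a])
  have aY: "(LINT x|lborel. a x * complex_of_real (\<phi> x)) = complex_of_real (LINT x|lborel. Y 0 x * \<phi> x)"
    if \<phi>: "\<phi> \<in> test_functions" for \<phi>
  proof -
    have "(LINT x|lborel. a x * complex_of_real (\<phi> x)) = (LINT x|lborel. cplx (Y 0) x * complex_of_real (\<phi> x))"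
    proof (rule integral_cong_AE)
      show "AE x in lborel. a x * complex_of_real (\<phi> x) = cplx (Y 0) x * complex_of_real (\<phi> x)"
        using AE by eventually_elim (simp add: a_def)
    qed (use L2_meas[OF aL] sqint_meas[OF sq[of 0]] test_measurable[OF \<phi>] in auto)
    thus ?thesis unfolding integral_cplx_test .
  qed
  \<comment> \<open>The chosen weak derivative may differ from \<open>Y 1\<close> on a null set;
    only its pairings with test functions are used.\<close>
  define g1 where "g1 = weak_deriv a"
  have "has_weak_deriv a (cplx (Y 1))"
    unfolding has_weak_deriv_def
  proof (intro conjI ballI)
    fix \<phi> assume \<phi>: "\<phi> \<in> test_functions"
    show "(LINT x|lborel. a x * complex_of_real (deriv \<phi> x)) = - (LINT x|lborel. cplx (Y 1) x * complex_of_real (\<phi> x))"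
      unfolding aY[OF test_deriv[OF \<phi>]] integral_cplx_test integral_by_parts_test[OF c(1) \<phi>] by simp
  qed (intro locally_integrable_L2 L2_cplx aL sq; simp)+
  hence g1: "has_weak_deriv a g1" unfolding g1_def by (rule has_weak_deriv_weak_deriv)
  define g2 where "g2 = weak_deriv g1"
  have "has_weak_deriv g1 (cplx (Y 2))"
    unfolding has_weak_deriv_def
  proof (intro conjI ballI)
    show "locally_integrable g1" using g1 by (simp add: has_weak_deriv_def)
    fix \<phi> assume \<phi>: "\<phi> \<in> test_functions"
    have "(LINT x|lborel. g1 x * complex_of_real (deriv \<phi> x)) = - complex_of_real (LINT x|lborel. Y 0 x * deriv (deriv \<phi>) x)"
      using has_weak_deriv_test[OF g1 test_deriv[OF \<phi>]] aY[OF test_deriv[OF test_deriv[OF \<phi>]]] by simp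
    also have "\<dots> = - (LINT x|lborel. cplx (Y 2) x * complex_of_real (\<phi> x))"
      unfolding integral_cplx_test integral_by_parts_test[OF c(2) \<phi>]
      using integral_by_parts_test[OF c(1) test_deriv[OF \<phi>]] by simp
    finally show "(LINT x|lborel. g1 x * complex_of_real (deriv \<phi> x)) = - (LINT x|lborel. cplx (Y 2) x * complex_of_real (\<phi> x))" .
  qed (intro locally_integrable_L2 L2_cplx sq; simp)
  note g2' = this has_weak_deriv_weak_deriv[OF this, folded g2_def]
  have g2: "(LINT x|lborel. g2 x * complex_of_real (\<phi> x)) = complex_of_real (LINT x|lborel. Y 2 x * \<phi> x)"
    if "\<phi> \<in> test_functions" for \<phi>
    using has_weak_deriv_test[OF g2'(1) that] has_weak_deriv_test[OF g2'(2) that] unfolding integral_cplx_test by simp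
  define WY where "WY = (\<lambda>x. real p * W x * Y 0 x)"
  define Wa where "Wa = (\<lambda>x. complex_of_real (real p * W x) * a x)"
  have Wm: "W \<in> borel_measurable borel" by (rule borel_measurable_continuous_onI[OF W_cont])
  have WaL: "Wa \<in> L2"
    by (rule L2_bound[OF aL, where B = "real p * ((real p + 1) / 2)"])
       (use L2_meas[OF aL] Wm W_pos W_le in
          \<open>auto simp: Wa_def norm_mult less_imp_le simp del: times_divide_eq_right intro!: mult_right_mono mult_left_mono\<close>)
  have Wa: "(LINT x|lborel. Wa x * complex_of_real (\<phi> x)) = complex_of_real (LINT x|lborel. WY x * \<phi> x)"
    if \<phi>: "\<phi> \<in> test_functions" for \<phi>
  proof -
    have "(LINT x|lborel. Wa x * complex_of_real (\<phi> x)) = (LINT x|lborel. cplx WY x * complex_of_real (\<phi> x))"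
    proof (rule integral_cong_AE)
      show "AE x in lborel. Wa x * complex_of_real (\<phi> x) = cplx WY x * complex_of_real (\<phi> x)"
        using AE by eventually_elim (simp add: a_def Wa_def WY_def)
    qed (use L2_meas[OF WaL] sqint_meas[OF sq[of 0]] test_measurable[OF \<phi>] Wm in \<open>auto simp: WY_def\<close>)
    thus ?thesis unfolding integral_cplx_test .
  qed
  define LY where "LY = Lop (Y 0) (Y 2)"
  have LY_c: "continuous_on UNIV LY"
    unfolding LY_def Lop_def[abs_def] by (intro continuous_intros c1_deriv_cont[OF c(1)] c1_deriv_cont[OF c(2)] c1_deriv_cont[OF c1_V])
  have opL: "op_L p a = (\<lambda>x. - g2 x + a x + - Wa x)"
    unfolding op_L_def Q_power by (simp add: g2_def g1_def Wa_def fun_eq_iff)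
  have li: "locally_integrable (\<lambda>x. - g2 x)" "locally_integrable a" "locally_integrable (\<lambda>x. - Wa x)"
    using g2'(2) locally_integrable_L2[OF aL] locally_integrable_L2[OF WaL]
    by (auto simp: has_weak_deriv_def intro: locally_integrable_uminus)
  have opL_li: "locally_integrable (op_L p a)"
    unfolding opL by (intro locally_integrable_add li)
  have opL_test: "(LINT x|lborel. op_L p a x * complex_of_real (\<phi> x)) = complex_of_real (LINT x|lborel. LY x * \<phi> x)"
    if \<phi>: "\<phi> \<in> test_functions" for \<phi>
  proof -
    have "(LINT x|lborel. op_L p a x * complex_of_real (\<phi> x)) =
        (LINT x|lborel. - g2 x * complex_of_real (\<phi> x)) + (LINT x|lborel. a x * complex_of_real (\<phi> x)) + (LINT x|lborel. - Wa x * complex_of_real (\<phi> x))"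
      unfolding opL distrib_right
      by (subst Bochner_Integration.integral_add, intro Bochner_Integration.integrable_add locally_integrable_test li \<phi>, intro locally_integrable_test li \<phi>,
          subst Bochner_Integration.integral_add, (intro locally_integrable_test li \<phi>)+, rule refl)
    also have "\<dots> = complex_of_real (- (LINT x|lborel. Y 2 x * \<phi> x) + (LINT x|lborel. Y 0 x * \<phi> x) - (LINT x|lborel. WY x * \<phi> x))"
      using g2[OF \<phi>] aY[OF \<phi>] Wa[OF \<phi>] by simp
    also have "- (LINT x|lborel. Y 2 x * \<phi> x) + (LINT x|lborel. Y 0 x * \<phi> x) - (LINT x|lborel. WY x * \<phi> x) =
        (LINT x|lborel. - (Y 2 x * \<phi> x) + Y 0 x * \<phi> x - WY x * \<phi> x)"
    proof -
      have "continuous_on UNIV WY" unfolding WY_def by (intro continuous_intros W_cont c1_deriv_cont[OF c(1)])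
      note i = continuous_test_integrable[OF \<phi> this] continuous_test_integrable[OF \<phi> c1_deriv_cont(1)[OF c(1)]]
        continuous_test_integrable[OF \<phi> c1_deriv_cont(2)[OF c(2)]]
      show ?thesis using i by simp
    qed
    also have "\<dots> = (LINT x|lborel. LY x * \<phi> x)"
      by (intro Bochner_Integration.integral_cong) (auto simp: LY_def Lop_def V_def WY_def algebra_simps)
    finally show ?thesis .
  qed
  \<comment> \<open>A square integrable weak derivative of L Y, built from the weak derivative h of
    the second derivative and the classical derivative of V Y. It shows that the outermost
    \<open>weak_deriv\<close> in \<open>lin_op\<close> is a genuine one.\<close>
  define m where "m = (\<lambda>x. - h x + (V' x * Y 0 x + V x * Y 1 x))"
  have VY: "c1_deriv (\<lambda>x. V x * Y 0 x) (\<lambda>x. V' x * Y 0 x + V x * Y 1 x)" by (rule c1_deriv_mult[OF c1_V c(1)])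
  have VY_sq: "sqint (\<lambda>x. V' x * Y 0 x + V x * Y 1 x)"
    by (intro sqint_add sqint_mult_bounded[OF sq c1_deriv_meas(2)[OF c1_V] V'_bound]
        sqint_mult_bounded[OF sq c1_deriv_meas(1)[OF c1_V] V_bound]) auto
  have m_sq: "sqint m" unfolding m_def by (intro sqint_add sqint_uminus h VY_sq)
  have LY_m: "(LINT x|lborel. LY x * deriv \<phi> x) = - (LINT x|lborel. m x * \<phi> x)" if \<phi>: "\<phi> \<in> test_functions" for \<phi>
  proof -
    note \<phi>' = test_deriv[OF \<phi>]
    have "(LINT x|lborel. LY x * deriv \<phi> x) = (LINT x|lborel. - (Y 2 x * deriv \<phi> x) + V x * Y 0 x * deriv \<phi> x)"
      by (simp add: LY_def Lop_def left_diff_distrib)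
    also have "\<dots> = - (LINT x|lborel. Y 2 x * deriv \<phi> x) + (LINT x|lborel. V x * Y 0 x * deriv \<phi> x)"
      using continuous_test_integrable[OF \<phi>' c1_deriv_cont(2)[OF c(2)]] continuous_test_integrable[OF \<phi>' c1_deriv_cont(1)[OF VY]]
      by (subst Bochner_Integration.integral_add) auto
    also have "\<dots> = (LINT x|lborel. h x * \<phi> x) - (LINT x|lborel. (V' x * Y 0 x + V x * Y 1 x) * \<phi> x)"
      using h(2)[OF \<phi>] integral_by_parts_test[OF VY \<phi>] by simp
    also have "\<dots> = - (LINT x|lborel. m x * \<phi> x)"
      unfolding m_def distrib_right[of "- h _"]
      using sqint_integrable_mult[OF h(1) test_sqint[OF \<phi>]] sqint_integrable_mult[OF VY_sq test_sqint[OF \<phi>]]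
      by (subst Bochner_Integration.integral_add) auto
    finally show ?thesis .
  qed
  have "has_weak_deriv (op_L p a) (cplx m)"
    unfolding has_weak_deriv_def
  proof (intro conjI ballI opL_li)
    show "locally_integrable (cplx m)" by (intro locally_integrable_L2 L2_cplx m_sq)
    fix \<phi> assume \<phi>: "\<phi> \<in> test_functions"
    show "(LINT x|lborel. op_L p a x * complex_of_real (deriv \<phi> x)) = - (LINT x|lborel. cplx m x * complex_of_real (\<phi> x))"
      unfolding opL_test[OF test_deriv[OF \<phi>]] integral_cplx_test LY_m[OF \<phi>] by simp
  qed
  hence g3: "has_weak_deriv (op_L p a) (weak_deriv (op_L p a))" by (rule has_weak_deriv_weak_deriv)
  have fin: "(LINT x|lborel. LY x * deriv \<phi> x) = - (LINT x|lborel. - e0 * Y 0 x * \<phi> x)" if \<phi>: "\<phi> \<in> test_functions" for \<phi>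
  proof -
    have "complex_of_real (LINT x|lborel. LY x * deriv \<phi> x) = - (LINT x|lborel. weak_deriv (op_L p a) x * complex_of_real (\<phi> x))"
      using has_weak_deriv_test[OF g3 \<phi>] opL_test[OF test_deriv[OF \<phi>]] by simp
    also have "\<dots> = (LINT x|lborel. lin_op p a x * complex_of_real (\<phi> x))" by (simp add: lin_op_def)
    also have "\<dots> = (LINT x|lborel. complex_of_real e0 * (a x * complex_of_real (\<phi> x)))"
    proof (rule integral_cong_AE)
      show "AE x in lborel. lin_op p a x * complex_of_real (\<phi> x) = complex_of_real e0 * (a x * complex_of_real (\<phi> x))"
        using ev by eventually_elim simp
      have "weak_deriv (op_L p a) \<in> borel_measurable borel"
        using g3 by (simp add: has_weak_deriv_def locally_integrable_def)
      thus "(\<lambda>x. lin_op p a x * complex_of_real (\<phi> x)) \<in> borel_measurable lborel"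
        using test_measurable[OF \<phi>] by (simp add: lin_op_def)
    qed (use L2_meas[OF aL] test_measurable[OF \<phi>] in auto)
    also have "\<dots> = complex_of_real (e0 * (LINT x|lborel. Y 0 x * \<phi> x))"
      using aY[OF \<phi>] by simp
    finally have "(LINT x|lborel. LY x * deriv \<phi> x) = e0 * (LINT x|lborel. Y 0 x * \<phi> x)" by (simp only: of_real_eq_iff)
    thus ?thesis by (simp add: mult.assoc)
  qed
  have "c1_deriv LY (\<lambda>x. - e0 * Y 0 x)"
    by (rule du_Bois_Reymond[OF LY_c _ fin]) (intro continuous_intros c1_deriv_cont[OF c(1)])
  moreover have "\<exists>x. Y 0 x \<noteq> 0"
  proof (rule ccontr)
    assume "\<not> (\<exists>x. Y 0 x \<noteq> 0)"
    hence "AE x in lborel. a x = 0" using AE by (auto simp: a_def)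
    thus False using na by simp
  qed
  ultimately show thesis using that[OF c(1) c(2) sq sq sq AE] by (simp add: LY_def)
qed

end

section \<open>Coercivity of the linearised energy\<close>

lemma integrable_on_Icc:
  fixes g :: "real \<Rightarrow> real"
  shows "continuous_on {a..b} g \<Longrightarrow> integrable lborel (\<lambda>x. indicator {a..b} x * g x)"
  using borel_integrable_atLeastAtMost'[of a b g] by (simp add: set_integrable_def)

lemma FTC_on_Icc:
  assumes "a \<le> b" "\<And>x. a \<le> x \<Longrightarrow> x \<le> b \<Longrightarrow> (F has_real_derivative g x) (at x)" "continuous_on {a..b} g"
  shows "(LINT x|lborel. indicator {a..b} x * g x) = F b - F a"
proof -
  have "(LINT x|lborel. indicator {a..b} x *\<^sub>R g x) = F b - F a"
    by (rule integral_FTC_atLeastAtMost[OF assms(1) _ assms(3)])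
       (use assms(2) in \<open>auto simp: has_real_derivative_iff_has_vector_derivative intro: has_vector_derivative_at_within\<close>)
  thus ?thesis by simp
qed

lemma integral_Icc_mono:
  fixes f g :: "real \<Rightarrow> real"
  assumes "continuous_on {a..b} f" "continuous_on {a..b} g" "\<And>x. a \<le> x \<Longrightarrow> x \<le> b \<Longrightarrow> f x \<le> g x"
  shows "(LINT x|lborel. indicator {a..b} x * f x) \<le> (LINT x|lborel. indicator {a..b} x * g x)"
  by (rule integral_mono[OF integrable_on_Icc[OF assms(1)] integrable_on_Icc[OF assms(2)]])
     (use assms(3) in \<open>auto simp: indicator_def\<close>)

lemma integral_Icc_add:
  fixes f g :: "real \<Rightarrow> real"
  assumes "continuous_on {a..b} f" "continuous_on {a..b} g"
  shows "(LINT x|lborel. indicator {a..b} x * (f x + g x)) =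
    (LINT x|lborel. indicator {a..b} x * f x) + (LINT x|lborel. indicator {a..b} x * g x)"
  using integrable_on_Icc[OF assms(1)] integrable_on_Icc[OF assms(2)] by (simp add: distrib_left)

lemma integral_Icc_subset:
  fixes f :: "real \<Rightarrow> real"
  assumes "continuous_on {c..d} f" "\<And>x. c \<le> x \<Longrightarrow> x \<le> d \<Longrightarrow> 0 \<le> f x" "c \<le> a" "b \<le> d"
  shows "(LINT x|lborel. indicator {a..b} x * f x) \<le> (LINT x|lborel. indicator {c..d} x * f x)"
proof (rule integral_mono)
  show "integrable lborel (\<lambda>x. indicator {a..b} x * f x)"
    by (rule integrable_on_Icc[OF continuous_on_subset[OF assms(1)]]) (use assms in auto)
  show "integrable lborel (\<lambda>x. indicator {c..d} x * f x)" by (rule integrable_on_Icc[OF assms(1)])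
qed (use assms in \<open>auto simp: indicator_def\<close>)

lemma integral_Icc_split:
  fixes f :: "real \<Rightarrow> real"
  assumes "continuous_on {a..c} f" "a \<le> b" "b \<le> c"
  shows "(LINT x|lborel. indicator {a..c} x * f x) =
    (LINT x|lborel. indicator {a..b} x * f x) + (LINT x|lborel. indicator {b..c} x * f x)"
proof -
  have i: "integrable lborel (\<lambda>x. indicator {a..b} x * f x)" "integrable lborel (\<lambda>x. indicator {b..c} x * f x)"
    by (rule integrable_on_Icc[OF continuous_on_subset[OF assms(1)]]; use assms in auto)+
  have "(LINT x|lborel. indicator {a..c} x * f x) = (LINT x|lborel. indicator {a..b} x * f x + indicator {b..c} x * f x)"
  proof (rule integral_cong_AE)
    have "AE x in lborel. x \<noteq> b" by (rule AE_lborel_singleton)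
    thus "AE x in lborel. indicator {a..c} x * f x = indicator {a..b} x * f x + indicator {b..c} x * f x"
      by eventually_elim (use assms in \<open>auto simp: indicator_def\<close>)
    show "(\<lambda>x. indicator {a..c} x * f x) \<in> borel_measurable lborel"
      using borel_measurable_integrable[OF integrable_on_Icc[OF assms(1)]] .
    show "(\<lambda>x. indicator {a..b} x * f x + indicator {b..c} x * f x) \<in> borel_measurable lborel"
      using i[THEN borel_measurable_integrable] by simp
  qed
  thus ?thesis using i by simp
qed

text \<open>The windows exhaust the open half line but stay away from 0, where the function
  \<open>q\<close> defined below has its pole.\<close>

lemma integral_halfline_LIMSEQ:
  fixes g :: "real \<Rightarrow> real"
  assumes g: "integrable lborel g" and a: "0 < a"
  shows "(\<lambda>n. LINT x|lborel. indicator {a / (real n + 1)..b + real n} x * g x) \<longlonglongrightarrow> (LINT x|lborel. indicator {0<..} x * g x)"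
proof (rule integral_dominated_convergence[where w = "\<lambda>x. \<bar>g x\<bar>"])
  show "AE x in lborel. (\<lambda>n. indicator {a / (real n + 1)..b + real n} x * g x) \<longlonglongrightarrow> indicator {0<..} x * g x"
  proof (intro AE_I2 tendsto_eventually)
    fix x :: real
    show "\<forall>\<^sub>F n in sequentially. indicator {a / (real n + 1)..b + real n} x * g x = indicator {0<..} x * g x"
    proof (cases "0 < x")
      case True
      have "(\<lambda>n. a / (real n + 1)) \<longlonglongrightarrow> 0" by real_asymp
      hence "\<forall>\<^sub>F n in sequentially. a / (real n + 1) < x" by (rule order_tendstoD) (use True in simp)
      moreover have "\<forall>\<^sub>F n in sequentially. x - b \<le> real n"
        using eventually_ge_at_top[of "nat \<lceil>x - b\<rceil>"] by eventually_elim linarith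
      ultimately show ?thesis by eventually_elim (use True in \<open>auto simp: indicator_def\<close>)
    next
      case False
      have "\<not> a / (real n + 1) \<le> x" for n
      proof -
        have "0 < a / (real n + 1)" using a by simp
        thus ?thesis using False by linarith
      qed
      thus ?thesis using False by (auto simp: indicator_def)
    qed
  qed
qed (use g in \<open>auto simp: indicator_def\<close>)

context soliton
begin

text \<open>The Riccati equation \<open>q' = V - q\<^sup>2\<close> gives \<open>f'\<^sup>2 + V f\<^sup>2 = (f' - q f)\<^sup>2 + (q f\<^sup>2)'\<close>.  The pole of \<^term>\<open>q\<close> at 0 is
  harmless for functions vanishing there.\<close>

definition q :: "real \<Rightarrow> real" where "q x = Q'' x / Q' x"

lemma q_eq: "q x = (k * (1 - (T x)\<^sup>2) - (T x)\<^sup>2) / T x"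
proof -
  have "Q'' x = - (k * (1 - (T x)\<^sup>2) - (T x)\<^sup>2) * Q p x" by (simp add: Q''_def W_k algebra_simps)
  moreover have "- A * Q p x / (- T x * Q p x) = A / T x" for A using Q_pos[of x] by simp
  ultimately show ?thesis unfolding q_def Q'_def by (simp only:)
qed

lemma q_deriv: "0 < x \<Longrightarrow> (q has_real_derivative V x - (q x)\<^sup>2) (at x)"
proof -
  assume x: "0 < x"
  have nz: "Q' x \<noteq> 0" using Q'_neg[OF x] by simp
  have "((\<lambda>x. Q'' x / Q' x) has_real_derivative (V x * Q' x * Q' x - Q'' x * Q'' x) / (Q' x * Q' x)) (at x)"
    by (rule DERIV_divide[OF Q''_deriv Q'_deriv nz])
  moreover have "(V x * Q' x * Q' x - Q'' x * Q'' x) / (Q' x * Q' x) = V x - (q x)\<^sup>2"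
    using nz by (simp add: q_def diff_divide_distrib power2_eq_square)
  ultimately show ?thesis by (simp add: q_def[abs_def])
qed

lemma q_cont: "A \<subseteq> {0<..} \<Longrightarrow> continuous_on A q"
  using DERIV_isCont[OF q_deriv] by (intro continuous_at_imp_continuous_on) auto

text \<open>T q tends to k > 0 while T tends to 0, so q is large to the right of the pole. In the
  coercivity estimate this sign makes f^2 grow away from 0 and controls its integral near 0 by a
  boundary value.\<close>

lemma q_near_0: "\<exists>d>0. d < 1 \<and> (\<forall>x. 0 < x \<and> x \<le> d \<longrightarrow> 1 \<le> q x)"
proof -
  define g where "g = (\<lambda>x. k * (1 - (T x)\<^sup>2) - (T x)\<^sup>2 - T x)"
  have "isCont g 0" unfolding g_def using T_cont[of UNIV]
    by (intro continuous_intros) (auto simp: continuous_on_eq_continuous_at)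
  hence "(g \<longlongrightarrow> g 0) (at 0)" by (simp add: isCont_def)
  moreover have "0 < g 0" using k_ge by (simp add: g_def T_0)
  ultimately have "\<forall>\<^sub>F x in at 0. 0 < g x" by (rule order_tendstoD)
  then obtain d where d: "0 < d" "\<And>x. x \<noteq> 0 \<Longrightarrow> dist x 0 < d \<Longrightarrow> 0 < g x"
    by (auto simp: eventually_at)
  show ?thesis
  proof (intro exI[of _ "min (d / 2) (1 / 2)"] conjI allI impI)
    fix x assume x: "0 < x \<and> x \<le> min (d / 2) (1 / 2)"
    hence "0 < g x" using d by (intro d) auto
    thus "1 \<le> q x" unfolding q_eq using T_pos[of x] x by (simp add: g_def field_simps)
  qed (use d in auto)
qed

lemma T_lim: "(T \<longlongrightarrow> 1) at_top"
proof -
  have "filterlim (\<lambda>x. k * x) at_top at_top"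
    using k_ge by (intro filterlim_tendsto_pos_mult_at_top[OF tendsto_const _ filterlim_ident]) auto
  thus ?thesis unfolding T_def[abs_def] by (rule filterlim_compose[OF tanh_real_at_top])
qed

text \<open>q tends to -1, the exponential rate of \<open>Q'\<close>; the negative sign controls the
  integral of f^2 near infinity.\<close>

lemma q_far: "\<exists>R>1. \<forall>x\<ge>R. q x \<le> - 1 / 2"
proof -
  have "((\<lambda>x. k * (1 - (T x)\<^sup>2) - (T x)\<^sup>2 + T x / 2) \<longlongrightarrow> k * (1 - 1\<^sup>2) - 1\<^sup>2 + 1 / 2) at_top"
    by (intro tendsto_intros T_lim) auto
  hence "\<forall>\<^sub>F x in at_top. k * (1 - (T x)\<^sup>2) - (T x)\<^sup>2 + T x / 2 < 0"
    by (rule order_tendstoD) simp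
  then obtain R where R: "\<And>x. x \<ge> R \<Longrightarrow> k * (1 - (T x)\<^sup>2) - (T x)\<^sup>2 + T x / 2 < 0"
    by (auto simp: eventually_at_top_linorder)
  show ?thesis
  proof (intro exI[of _ "max R 2"] conjI allI impI)
    fix x assume x: "max R 2 \<le> x"
    thus "q x \<le> - 1 / 2" unfolding q_eq using T_pos[of x] R[of x] by (simp add: field_simps)
  qed auto
qed

lemma q_bound_far: "1 \<le> x \<Longrightarrow> \<bar>q x\<bar> \<le> (k + 1) / T 1"
proof -
  assume x: "1 \<le> x"
  have T1: "0 < T 1" "T 1 \<le> T x"
    using T_pos[of 1] x k_ge by (auto simp: T_def)
  have "\<bar>k * (1 - (T x)\<^sup>2) - (T x)\<^sup>2\<bar> \<le> k * 1 + 1"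
  proof -
    have "0 \<le> k * (1 - (T x)\<^sup>2)" "k * (1 - (T x)\<^sup>2) \<le> k * 1"
      using T_bound(2)[of x] k_ge by (auto intro!: mult_left_mono)
    thus ?thesis using T_bound(2)[of x] zero_le_power2[of "T x"] by linarith
  qed
  thus ?thesis unfolding q_eq using T1 by (simp add: abs_divide) (intro frac_le; simp)
qed

section \<open>The quadratic form on functions vanishing at the origin\<close>

definition admissible :: "(real \<Rightarrow> real) \<Rightarrow> (real \<Rightarrow> real) \<Rightarrow> bool" where
  "admissible f f' \<longleftrightarrow> c1_deriv f f' \<and> sqint f \<and> sqint f' \<and> f 0 = 0"

text \<open>The quadratic form (L f, f) after one integration by parts, which makes sense for
  functions in H^1.\<close>

definition en :: "(real \<Rightarrow> real) \<Rightarrow> (real \<Rightarrow> real) \<Rightarrow> real" where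
  "en f f' = (LINT x|lborel. (f' x)\<^sup>2 + V x * (f x)\<^sup>2)"

definition en_half :: "(real \<Rightarrow> real) \<Rightarrow> (real \<Rightarrow> real) \<Rightarrow> real" where
  "en_half f f' = (LINT x|lborel. indicator {0<..} x * ((f' x)\<^sup>2 + V x * (f x)\<^sup>2))"

lemma en_integrable:
  assumes "sqint f" "sqint f'"
  shows "integrable lborel (\<lambda>x. (f' x)\<^sup>2 + V x * (f x)\<^sup>2)"
proof -
  have "integrable lborel (\<lambda>x. (V x * f x) * f x)"
    by (intro sqint_integrable_mult sqint_mult_bounded[OF assms(1) c1_deriv_meas(1)[OF c1_V] V_bound] assms)
  thus ?thesis using assms(2) by (simp add: sqint_def power2_eq_square mult.assoc)
qed

lemma admissible_quotient_at_0:
  assumes "admissible f f'"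
  shows "((\<lambda>x. f x / Q' x) \<longlongrightarrow> f' 0 / Q'' 0) (at 0)"
proof -
  have "(\<lambda>h. (f (0 + h) - f 0) / h) \<midarrow>0\<rightarrow> f' 0" "(\<lambda>h. (Q' (0 + h) - Q' 0) / h) \<midarrow>0\<rightarrow> Q'' 0"
    using assms Q'_deriv[of 0] c1_derivD[of f f' 0] by (auto simp: admissible_def DERIV_def)
  hence "((\<lambda>h. (f h / h) / (Q' h / h)) \<longlongrightarrow> f' 0 / Q'' 0) (at 0)"
    using assms by (intro tendsto_divide Q''_0) (auto simp: admissible_def Q'_def T_0)
  thus ?thesis
    by (rule Lim_transform_eventually) (auto simp: eventually_at_filter)
qed

text \<open>The identity behind \<open>q\<close> is integrated over compact intervals of the half
  line, which leaves the boundary terms q f^2. At infinity q is bounded and f^2 tends to 0; at the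
  origin q f^2 = \<open>Q''\<close> f (f / \<open>Q'\<close>), where the last quotient has a limit
  and f tends to 0.\<close>

lemma en_half_ge:
  assumes f: "admissible f f'" and a: "0 < a"
  shows "(LINT x|lborel. indicator {a..b} x * (f' x - q x * f x)\<^sup>2) \<le> en_half f f'"
proof -
  have c: "c1_deriv f f'" and sq: "sqint f" "sqint f'" and f0: "f 0 = 0" using f by (auto simp: admissible_def)
  define g where "g = (\<lambda>x. (f' x)\<^sup>2 + V x * (f x)\<^sup>2)"
  define B where "B = (\<lambda>x. q x * (f x)\<^sup>2)"
  define n where "n = (\<lambda>x. (f' x - q x * f x)\<^sup>2)"
  have n_cont: "continuous_on A n" if "A \<subseteq> {0<..}" for A
    unfolding n_def by (intro continuous_intros c1_deriv_cont[OF c] q_cont that)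
  have g_cont: "continuous_on A g" for A
    unfolding g_def by (intro continuous_intros c1_deriv_cont[OF c] c1_deriv_cont[OF c1_V])
  have gi: "integrable lborel g" unfolding g_def by (rule en_integrable[OF sq])
  have eq: "(LINT x|lborel. indicator {\<alpha>..\<beta>} x * n x) = (LINT x|lborel. indicator {\<alpha>..\<beta>} x * g x) - B \<beta> + B \<alpha>"
    if "0 < \<alpha>" "\<alpha> \<le> \<beta>" for \<alpha> \<beta>
  proof -
    have sub: "{\<alpha>..\<beta>} \<subseteq> {0<..}" using that by auto
    have "(LINT x|lborel. indicator {\<alpha>..\<beta>} x * (g x - n x)) = B \<beta> - B \<alpha>"
    proof (rule FTC_on_Icc[OF that(2)])
      fix x assume x: "\<alpha> \<le> x"
      have "(B has_real_derivative (V x - (q x)\<^sup>2) * (f x)\<^sup>2 + real 2 * (f' x * f x ^ (2 - Suc 0)) * q x) (at x)"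
        unfolding B_def by (intro DERIV_mult q_deriv DERIV_power c1_derivD[OF c]) (use x that in simp)
      moreover have "(V x - (q x)\<^sup>2) * (f x)\<^sup>2 + real 2 * (f' x * f x ^ (2 - Suc 0)) * q x = g x - n x"
        by (simp add: g_def n_def power2_eq_square algebra_simps)
      ultimately show "(B has_real_derivative g x - n x) (at x)" by simp
    qed (intro continuous_intros g_cont n_cont sub)
    moreover have "(LINT x|lborel. indicator {\<alpha>..\<beta>} x * (g x - n x)) =
        (LINT x|lborel. indicator {\<alpha>..\<beta>} x * g x) - (LINT x|lborel. indicator {\<alpha>..\<beta>} x * n x)"
      using integrable_on_Icc[OF g_cont] integrable_on_Icc[OF n_cont[OF sub]] by (simp add: right_diff_distrib)
    ultimately show ?thesis by simp
  qed
  define b' where "b' = max 1 (max a b)"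
  let ?a = "\<lambda>m. a / (real m + 1)" and ?b = "\<lambda>m. b' + real m"
  have le: "(LINT x|lborel. indicator {a..b} x * n x) \<le> (LINT x|lborel. indicator {?a m..?b m} x * g x) - B (?b m) + B (?a m)" for m
  proof -
    have 1: "0 < ?a m" "?a m \<le> a" using a by (auto simp: field_simps)
    have 2: "a \<le> ?b m" "b \<le> ?b m" by (auto simp: b'_def)
    have "(LINT x|lborel. indicator {a..b} x * n x) \<le> (LINT x|lborel. indicator {?a m..?b m} x * n x)"
    proof (rule integral_Icc_subset)
      show "continuous_on {?a m..?b m} n" by (rule n_cont) (use 1 in auto)
    qed (use 1 2 in \<open>auto simp: n_def\<close>)
    also have "\<dots> = (LINT x|lborel. indicator {?a m..?b m} x * g x) - B (?b m) + B (?a m)"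
      by (rule eq) (use 1 2 in linarith)+
    finally show ?thesis .
  qed
  have l1: "(\<lambda>m. LINT x|lborel. indicator {?a m..?b m} x * g x) \<longlonglongrightarrow> en_half f f'"
    unfolding en_half_def g_def[symmetric]
    using integral_halfline_LIMSEQ[OF gi a] by (simp add: g_def)
  have l2: "(\<lambda>m. B (?b m)) \<longlonglongrightarrow> 0"
  proof -
    have "((\<lambda>x. f x * f x) \<longlongrightarrow> 0) at_top"
      by (rule c1_tendsto_0_at_top[OF c1_deriv_mult[OF c c]])
         (intro Bochner_Integration.integrable_add sqint_integrable_mult sq)+
    moreover have bt: "filterlim ?b at_top sequentially"
      by (rule filterlim_tendsto_add_at_top[OF tendsto_const filterlim_real_sequentially])
    ultimately have "(\<lambda>m. f (?b m) * f (?b m)) \<longlonglongrightarrow> 0" by (rule filterlim_compose)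
    hence z: "(\<lambda>m. (k + 1) / T 1 * (f (?b m) * f (?b m))) \<longlonglongrightarrow> 0" using tendsto_mult_left[of _ 0 _ "(k + 1) / T 1"] by fastforce
    show ?thesis
    proof (rule Lim_null_comparison[OF _ z], rule always_eventually, rule allI)
      fix m
      have "1 \<le> ?b m" by (simp add: b'_def)
      from mult_right_mono[OF q_bound_far[OF this], of "(f (?b m))\<^sup>2"]
      show "norm (B (?b m)) \<le> (k + 1) / T 1 * (f (?b m) * f (?b m))"
        unfolding B_def by (simp add: abs_mult power2_eq_square)
    qed
  qed
  have l3: "(\<lambda>m. B (?a m)) \<longlonglongrightarrow> 0"
  proof -
    have "isCont Q'' 0" "isCont f 0" using DERIV_isCont[OF Q''_deriv] DERIV_isCont[OF c1_derivD[OF c]] by auto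
    hence "(Q'' \<longlongrightarrow> Q'' 0) (at 0)" "(f \<longlongrightarrow> 0) (at 0)" using f0 by (auto simp: isCont_def)
    hence "((\<lambda>x. Q'' x * f x * (f x / Q' x)) \<longlongrightarrow> Q'' 0 * 0 * (f' 0 / Q'' 0)) (at 0)"
      by (intro tendsto_mult admissible_quotient_at_0[OF f])
    moreover have "Q'' x * f x * (f x / Q' x) = B x" for x by (simp add: B_def q_def power2_eq_square)
    ultimately have B0: "(B \<longlongrightarrow> 0) (at 0)" by simp
    have "?a \<longlonglongrightarrow> 0" by real_asymp
    moreover have "\<forall>m. ?a m \<noteq> 0" using a by (auto simp: add_nonneg_eq_0_iff)
    ultimately show ?thesis using B0 unfolding tendsto_at_iff_sequentially o_def by auto
  qed
  have "(\<lambda>m. (LINT x|lborel. indicator {?a m..?b m} x * g x) - B (?b m) + B (?a m)) \<longlonglongrightarrow> en_half f f' - 0 + 0"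
    by (intro tendsto_intros l1 l2 l3)
  hence "(LINT x|lborel. indicator {a..b} x * n x) \<le> en_half f f' - 0 + 0"
    by (rule tendsto_lowerbound) (use le in auto)
  thus ?thesis by (simp add: n_def)
qed

lemma en_half_nonneg: "admissible f f' \<Longrightarrow> 0 \<le> en_half f f'"
  using en_half_ge[of f f' 1 1] by (rule order_trans[rotated]) auto

text \<open>The derivative of f / \<open>Q'\<close> is (f' - q f) / \<open>Q'\<close>, and the
  energy bounds the integral of the square of f' - q f. Cauchy-Schwarz on a compact interval off 0
  then bounds the oscillation, with a constant that does not depend on f.\<close>

lemma quotient_near_constant:
  assumes a: "0 < a" "a \<le> b"
  obtains C where "0 \<le> C"
    "\<And>f f' x y. admissible f f' \<Longrightarrow> a \<le> x \<Longrightarrow> x \<le> b \<Longrightarrow> a \<le> y \<Longrightarrow> y \<le> b \<Longrightarrow>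
       \<bar>f x / Q' x - f y / Q' y\<bar> \<le> C * sqrt (en_half f f')"
proof -
  have nz: "Q' x \<noteq> 0" if "a \<le> x" for x using Q'_neg[of x] that a by simp
  have "continuous_on {a..b} (\<lambda>x. 1 / Q' x)" using nz by (intro continuous_intros Q'_cont) auto
  hence "bounded ((\<lambda>x. 1 / Q' x) ` {a..b})" by (intro compact_imp_bounded compact_continuous_image) auto
  then obtain M where M: "0 < M" "\<And>x. a \<le> x \<Longrightarrow> x \<le> b \<Longrightarrow> \<bar>1 / Q' x\<bar> \<le> M" unfolding bounded_pos by force
  define D where "D = nrm (indicator {a..b})"
  have main: "\<bar>f y / Q' y - f x / Q' x\<bar> \<le> M * D * sqrt (en_half f f')"
    if f: "admissible f f'" and xy: "a \<le> x" "x \<le> y" "y \<le> b" for f f' x y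
  proof -
    have c: "c1_deriv f f'" using f by (simp add: admissible_def)
    define n where "n = (\<lambda>x. f' x - q x * f x)"
    have n_cont: "continuous_on A n" if "A \<subseteq> {0<..}" for A
      unfolding n_def by (intro continuous_intros c1_deriv_cont[OF c] q_cont that)
    have sub: "{x..y} \<subseteq> {0<..}" "{a..b} \<subseteq> {0<..}" using xy a by auto
    define N where "N = (\<lambda>x. indicator {a..b} x * n x)"
    have N: "sqint N" unfolding sqint_def
    proof
      show "N \<in> borel_measurable borel"
        using borel_measurable_integrable[OF integrable_on_Icc[OF n_cont[OF sub(2)]]] by (simp add: N_def)
      have "integrable lborel (\<lambda>x. indicator {a..b} x * (n x)\<^sup>2)"
        by (intro integrable_on_Icc continuous_intros n_cont sub)
      moreover have "(N x)\<^sup>2 = indicator {a..b} x * (n x)\<^sup>2" for x by (simp add: N_def indicator_def)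
      ultimately show "integrable lborel (\<lambda>x. (N x)\<^sup>2)" by simp
    qed
    have nrmN: "nrm N \<le> sqrt (en_half f f')"
    proof -
      have "N x * N x = indicator {a..b} x * (f' x - q x * f x)\<^sup>2" for x
        by (simp add: N_def n_def indicator_def power2_eq_square)
      thus ?thesis using en_half_ge[OF f a(1), of b] by (simp add: nrm_def ip_def)
    qed
    have I: "sqint (indicator {a..b} :: real \<Rightarrow> real)"
      by (rule sqint_indicator[where R = "\<bar>a\<bar> + \<bar>b\<bar>"]) auto
    have cQ: "continuous_on {x..y} (\<lambda>x. n x / Q' x)" using nz xy by (intro continuous_intros n_cont Q'_cont sub) auto
    have "f y / Q' y - f x / Q' x = (LINT z|lborel. indicator {x..y} z * (n z / Q' z))"
    proof (rule FTC_on_Icc[symmetric, OF xy(2) _ cQ])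
      fix z assume z: "x \<le> z"
      have nzz: "Q' z \<noteq> 0" using nz z xy by simp
      have "((\<lambda>z. f z / Q' z) has_real_derivative (f' z * Q' z - f z * Q'' z) / (Q' z * Q' z)) (at z)"
        by (rule DERIV_divide[OF c1_derivD[OF c] Q'_deriv nzz])
      moreover have "(f' z * Q' z - f z * Q'' z) / (Q' z * Q' z) = n z / Q' z"
        using nzz by (simp add: n_def q_def field_simps)
      ultimately show "((\<lambda>z. f z / Q' z) has_real_derivative n z / Q' z) (at z)" by simp
    qed
    also have "\<bar>\<dots>\<bar> \<le> (LINT z|lborel. \<bar>indicator {x..y} z * (n z / Q' z)\<bar>)"
      by (rule integral_abs_bound)
    also have "\<dots> \<le> (LINT z|lborel. M * (indicator {a..b} z * \<bar>N z\<bar>))"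
    proof (rule integral_mono)
      show "integrable lborel (\<lambda>z. \<bar>indicator {x..y} z * (n z / Q' z)\<bar>)"
        using integrable_on_Icc[OF cQ] by (rule integrable_abs)
      show "integrable lborel (\<lambda>z. M * (indicator {a..b} z * \<bar>N z\<bar>))"
        by (intro integrable_mult_right sqint_integrable_mult I sqint_abs N)
      fix z
      show "\<bar>indicator {x..y} z * (n z / Q' z)\<bar> \<le> M * (indicator {a..b} z * \<bar>N z\<bar>)"
      proof (cases "z \<in> {x..y}")
        case True
        hence "\<bar>n z\<bar> * \<bar>1 / Q' z\<bar> \<le> \<bar>n z\<bar> * M" using xy by (intro mult_left_mono M) auto
        thus ?thesis using True xy by (simp add: N_def abs_mult abs_divide mult.commute)
      qed (use M in auto)
    qed
    also have "\<dots> = M * ip (indicator {a..b}) (\<lambda>z. \<bar>N z\<bar>)" by (simp add: ip_def)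
    also have "\<dots> \<le> M * (D * nrm N)"
      using ip_le[OF I sqint_abs[OF N]] M by (intro mult_left_mono) (auto simp: D_def nrm_abs)
    also have "\<dots> \<le> M * (D * sqrt (en_half f f'))"
      using M nrmN by (intro mult_left_mono) (auto simp: D_def)
    finally show ?thesis by (simp add: mult.assoc)
  qed
  show thesis
  proof (rule that[of "M * D"])
    show "0 \<le> M * D" using M by (simp add: D_def)
    fix f f' x y assume f: "admissible f f'" and xy: "a \<le> x" "x \<le> b" "a \<le> y" "y \<le> b"
    show "\<bar>f x / Q' x - f y / Q' y\<bar> \<le> M * D * sqrt (en_half f f')"
      using main[OF f, of x y] main[OF f, of y x] xy by (cases "x \<le> y") (auto simp: abs_minus_commute)
  qed
qed

text \<open>Three zones. On [d, R] the function is nearly a multiple of \<open>Q'\<close> whose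
  coefficient is fixed by f(1). Near 0 and near infinity the sign of q in f' = n + q f lets the
  derivative of f^2 dominate f^2 up to n^2, so the integral of f^2 is bounded by a value at d or R
  and by the energy.\<close>

lemma half_line_coercive:
  obtains C where "0 \<le> C"
    "\<And>f f'. admissible f f' \<Longrightarrow> (LINT x|lborel. indicator {0<..} x * (f x)\<^sup>2) \<le> C * ((f 1)\<^sup>2 + en_half f f')"
proof -
  obtain d where d: "0 < d" "d < 1" "\<And>x. 0 < x \<Longrightarrow> x \<le> d \<Longrightarrow> 1 \<le> q x" using q_near_0 by auto
  obtain R where R: "1 < R" "\<And>x. R \<le> x \<Longrightarrow> q x \<le> - 1 / 2" using q_far by auto
  obtain K where K: "0 \<le> K" "\<And>f f' x y. admissible f f' \<Longrightarrow> d \<le> x \<Longrightarrow> x \<le> R \<Longrightarrow> d \<le> y \<Longrightarrow> y \<le> R \<Longrightarrow>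
       \<bar>f x / Q' x - f y / Q' y\<bar> \<le> K * sqrt (en_half f f')"
    using quotient_near_constant[of d R] d R by auto
  define c where "c = CV * (1 / \<bar>Q' 1\<bar> + K)"
  have Q1: "Q' 1 \<noteq> 0" using Q'_neg[of 1] by simp
  have c0: "0 \<le> c" unfolding c_def using CV_pos K by (intro mult_nonneg_nonneg) auto
  define S where "S = (\<lambda>f f'. (f 1 :: real)\<^sup>2 + en_half f f')"
  have mid: "(f x)\<^sup>2 \<le> 2 * c\<^sup>2 * S f f'" if f: "admissible f f'" and x: "d \<le> x" "x \<le> R" for f f' x
  proof -
    let ?h = "sqrt (en_half f f')"
    have h0: "0 \<le> en_half f f'" by (rule en_half_nonneg[OF f])
    have nz: "Q' x \<noteq> 0" using Q'_neg[of x] x d by simp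
    have "\<bar>f x / Q' x\<bar> \<le> \<bar>f 1 / Q' 1\<bar> + K * ?h"
      using K(2)[OF f x, of 1] d R by linarith
    also have "\<dots> \<le> (1 / \<bar>Q' 1\<bar> + K) * (\<bar>f 1\<bar> + ?h)"
      using K(1) h0 by (simp add: algebra_simps)
    finally have "\<bar>f x / Q' x\<bar> \<le> (1 / \<bar>Q' 1\<bar> + K) * (\<bar>f 1\<bar> + ?h)" .
    hence "\<bar>Q' x\<bar> * \<bar>f x / Q' x\<bar> \<le> CV * ((1 / \<bar>Q' 1\<bar> + K) * (\<bar>f 1\<bar> + ?h))"
      using Q'_le[of x] CV_pos by (intro mult_mono) auto
    moreover have "\<bar>Q' x\<bar> * \<bar>f x / Q' x\<bar> = \<bar>f x\<bar>" using nz by (simp add: abs_divide)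
    ultimately have "\<bar>f x\<bar> \<le> c * (\<bar>f 1\<bar> + ?h)" by (simp only: c_def mult.assoc)
    hence "\<bar>f x\<bar>\<^sup>2 \<le> (c * (\<bar>f 1\<bar> + ?h))\<^sup>2" by (intro power_mono) auto
    also have "\<dots> = c\<^sup>2 * (\<bar>f 1\<bar> + ?h)\<^sup>2" by (rule power_mult_distrib)
    also have "\<dots> \<le> c\<^sup>2 * (2 * S f f')"
    proof (rule mult_left_mono)
      have "0 \<le> (\<bar>f 1\<bar> - ?h)\<^sup>2" by simp
      thus "(\<bar>f 1\<bar> + ?h)\<^sup>2 \<le> 2 * S f f'" using h0 by (simp add: S_def power2_sum power2_diff)
    qed simp
    finally show ?thesis by simp
  qed
  \<comment> \<open>The summands belong to the zone near 0, the middle zone and the far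
    zone.\<close>
  define C where "C = (2 * c\<^sup>2 + 1) + (R - d) * (2 * c\<^sup>2) + (4 * c\<^sup>2 + 4)"
  show thesis
  proof (rule that[of C])
    show C0: "0 \<le> C" using d R by (simp add: C_def)
    fix f f' assume f: "admissible f f'"
    have cf: "c1_deriv f f'" and sq: "sqint f" "sqint f'" using f by (auto simp: admissible_def)
    have h0: "0 \<le> en_half f f'" by (rule en_half_nonneg[OF f])
    have hS: "en_half f f' \<le> S f f'" by (simp add: S_def)
    define n where "n = (\<lambda>x. f' x - q x * f x)"
    have n_cont: "continuous_on A n" if "A \<subseteq> {0<..}" for A
      unfolding n_def by (intro continuous_intros c1_deriv_cont[OF cf] q_cont that)
    have f_cont: "continuous_on A f" "continuous_on A f'" for A by (rule c1_deriv_cont[OF cf])+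
    have nle: "(LINT x|lborel. indicator {a..b} x * (n x)\<^sup>2) \<le> en_half f f'" if "0 < a" for a b
      unfolding n_def by (rule en_half_ge[OF f that])
    have ff: "(LINT x|lborel. indicator {a..b} x * (2 * (f x * f' x))) = (f b)\<^sup>2 - (f a)\<^sup>2" if "a \<le> b" for a b
      using c1_FTC[OF c1_deriv_mult[OF cf cf] that] by (simp add: power2_eq_square algebra_simps)
    have near: "(LINT x|lborel. indicator {a..d} x * (f x)\<^sup>2) \<le> (2 * c\<^sup>2 + 1) * S f f'" if a: "0 < a" "a \<le> d" for a
    proof -
      have sub: "{a..d} \<subseteq> {0<..}" using a by auto
      \<comment> \<open>With q >= 1, 2 f f' = 2 f n + 2 q f^2 >= 2 f n + 2 f^2, and (f + n)^2 >= 0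
        disposes of the mixed term.\<close>
      have "(LINT x|lborel. indicator {a..d} x * (f x)\<^sup>2) \<le> (LINT x|lborel. indicator {a..d} x * (2 * (f x * f' x) + (n x)\<^sup>2))"
      proof (rule integral_Icc_mono)
        fix x assume x: "a \<le> x" "x \<le> d"
        have "1 * (f x)\<^sup>2 \<le> q x * (f x)\<^sup>2" using d(3)[of x] x a by (intro mult_right_mono) auto
        moreover have "0 \<le> (f x + n x)\<^sup>2" by simp
        moreover have "f' x = n x + q x * f x" by (simp add: n_def)
        ultimately show "(f x)\<^sup>2 \<le> 2 * (f x * f' x) + (n x)\<^sup>2" by (simp add: power2_eq_square algebra_simps)
      qed (intro continuous_intros f_cont n_cont sub)+
      also have "\<dots> = (f d)\<^sup>2 - (f a)\<^sup>2 + (LINT x|lborel. indicator {a..d} x * (n x)\<^sup>2)"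
        unfolding ff[OF a(2), symmetric] by (rule integral_Icc_add) (intro continuous_intros f_cont n_cont sub)+
      also have "\<dots> \<le> 2 * c\<^sup>2 * S f f' + S f f'"
        using nle[OF a(1), of d] hS mid[OF f, of d] d R zero_le_power2[of "f a"] by linarith
      finally show ?thesis by (simp add: algebra_simps)
    qed
    have middle: "(LINT x|lborel. indicator {d..R} x * (f x)\<^sup>2) \<le> (R - d) * (2 * c\<^sup>2) * S f f'"
    proof -
      have "(LINT x|lborel. indicator {d..R} x * (f x)\<^sup>2) \<le> (LINT x|lborel. indicator {d..R} x * (2 * c\<^sup>2 * S f f'))"
        by (rule integral_Icc_mono) (use mid[OF f] in \<open>auto intro!: continuous_intros f_cont\<close>)
      thus ?thesis using d R by (simp add: mult_ac)
    qed
    have far: "(LINT x|lborel. indicator {R..b} x * (f x)\<^sup>2) \<le> (4 * c\<^sup>2 + 4) * S f f'" if b: "R \<le> b" for b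
    proof -
      have sub: "{R..b} \<subseteq> {0<..}" using R by auto
      \<comment> \<open>With q <= -1/2, 2 f f' <= 2 f n - f^2, and (f - 2 n)^2 >= 0 gives 2 f n <=
        f^2 / 2 + 2 n^2.\<close>
      have "(LINT x|lborel. indicator {R..b} x * (1 / 2 * (f x)\<^sup>2 + 2 * (f x * f' x))) \<le> (LINT x|lborel. indicator {R..b} x * (2 * (n x)\<^sup>2))"
      proof (rule integral_Icc_mono)
        fix x assume x: "R \<le> x" "x \<le> b"
        have "q x * (f x)\<^sup>2 \<le> - 1 / 2 * (f x)\<^sup>2" using R(2)[of x] x by (intro mult_right_mono) auto
        moreover have "0 \<le> (f x - 2 * n x)\<^sup>2" by simp
        moreover have "f' x = n x + q x * f x" by (simp add: n_def)
        ultimately show "1 / 2 * (f x)\<^sup>2 + 2 * (f x * f' x) \<le> 2 * (n x)\<^sup>2" by (simp add: power2_eq_square algebra_simps)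
      qed (intro continuous_intros f_cont n_cont sub)+
      moreover have "(LINT x|lborel. indicator {R..b} x * (1 / 2 * (f x)\<^sup>2 + 2 * (f x * f' x))) =
          (LINT x|lborel. indicator {R..b} x * (1 / 2 * (f x)\<^sup>2)) + ((f b)\<^sup>2 - (f R)\<^sup>2)"
        unfolding ff[OF b, symmetric] by (rule integral_Icc_add) (intro continuous_intros f_cont)+
      moreover have "(LINT x|lborel. indicator {R..b} x * (1 / 2 * (f x)\<^sup>2)) = 1 / 2 * (LINT x|lborel. indicator {R..b} x * (f x)\<^sup>2)"
        by (subst integral_mult_right_zero[symmetric]) (simp add: mult.left_commute)
      moreover have "(LINT x|lborel. indicator {R..b} x * (2 * (n x)\<^sup>2)) = 2 * (LINT x|lborel. indicator {R..b} x * (n x)\<^sup>2)"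
        by (subst integral_mult_right_zero[symmetric]) (simp add: mult.left_commute)
      moreover have "0 < R" using R by simp
      ultimately have "(LINT x|lborel. indicator {R..b} x * (f x)\<^sup>2) \<le> 2 * (2 * c\<^sup>2 * S f f') + 4 * S f f'"
        using nle[of R b] hS mid[OF f, of R] d R zero_le_power2[of "f b"] by linarith
      thus ?thesis by (simp add: algebra_simps)
    qed
    have fi: "integrable lborel (\<lambda>x. (f x)\<^sup>2)" using sq by (simp add: sqint_def)
    have "(LINT x|lborel. indicator {0<..} x * (f x)\<^sup>2) \<le> C * S f f'"
    proof (rule tendsto_upperbound[OF integral_halfline_LIMSEQ[OF fi d(1), of R]])
      show "\<forall>\<^sub>F n in sequentially. (LINT x|lborel. indicator {d / (real n + 1)..R + real n} x * (f x)\<^sup>2) \<le> C * S f f'"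
      proof (intro always_eventually allI)
        fix m :: nat
        let ?a = "d / (real m + 1)" and ?b = "R + real m"
        have 1: "0 < ?a" "?a \<le> d" using d by (auto simp: field_simps)
        have "(LINT x|lborel. indicator {?a..?b} x * (f x)\<^sup>2) =
            (LINT x|lborel. indicator {?a..d} x * (f x)\<^sup>2) + (LINT x|lborel. indicator {d..?b} x * (f x)\<^sup>2)"
          by (rule integral_Icc_split) (use 1 d R in \<open>auto intro!: continuous_intros f_cont\<close>)
        also have "(LINT x|lborel. indicator {d..?b} x * (f x)\<^sup>2) =
            (LINT x|lborel. indicator {d..R} x * (f x)\<^sup>2) + (LINT x|lborel. indicator {R..?b} x * (f x)\<^sup>2)"
          by (rule integral_Icc_split) (use d R in \<open>auto intro!: continuous_intros f_cont\<close>)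
        finally show "(LINT x|lborel. indicator {?a..?b} x * (f x)\<^sup>2) \<le> C * S f f'"
          using near[OF 1] middle far[of ?b] by (simp add: C_def distrib_right)
      qed
    qed simp
    thus "(LINT x|lborel. indicator {0<..} x * (f x)\<^sup>2) \<le> C * ((f 1)\<^sup>2 + en_half f f')" by (simp add: S_def)
  qed
qed

lemma admissible_reflect: "admissible f f' \<Longrightarrow> admissible (\<lambda>x. f (- x)) (\<lambda>x. - f' (- x))"
proof -
  have r: "sqint (\<lambda>x. g (- x))" if "sqint g" for g
    using that integrable_reflect[of "\<lambda>x. (g x)\<^sup>2"] by (auto simp: sqint_def intro: measurable_compose)
  assume "admissible f f'"
  thus ?thesis by (auto simp: admissible_def intro!: c1_deriv_reflect sqint_uminus r)
qed

lemma half_line_reflect: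
  fixes g :: "real \<Rightarrow> real"
  assumes g: "integrable lborel g"
  shows "(LINT x|lborel. g x) = (LINT x|lborel. indicator {0<..} x * g x) + (LINT x|lborel. indicator {0<..} x * g (- x))"
proof -
  have gm: "g \<in> borel_measurable borel" using borel_measurable_integrable[OF g] by simp
  have i: "integrable lborel (\<lambda>x. indicator {0<..} x * g x)" "integrable lborel (\<lambda>x. indicator {..<0} x * g x)"
    by (rule Bochner_Integration.integrable_bound[OF g]; use gm in \<open>auto simp: indicator_def\<close>)+
  have "(LINT x|lborel. g x) = (LINT x|lborel. indicator {0<..} x * g x + indicator {..<0} x * g x)"
  proof (rule integral_cong_AE)
    have "AE x :: real in lborel. x \<noteq> 0" by (rule AE_lborel_singleton)
    thus "AE x in lborel. g x = indicator {0<..} x * g x + indicator {..<0} x * g x"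
      by eventually_elim (auto simp: indicator_def)
  qed (use gm in auto)
  also have "\<dots> = (LINT x|lborel. indicator {0<..} x * g x) + (LINT x|lborel. indicator {..<0} x * g x)" using i by simp
  also have "(LINT x|lborel. indicator {..<0} x * g x) = (LINT x|lborel. indicator {..<0} (- x) * g (- x))"
    by (rule integral_reflect[symmetric])
  also have "\<dots> = (LINT x|lborel. indicator {0<..} x * g (- x))"
    by (rule Bochner_Integration.integral_cong) (auto simp: indicator_def)
  finally show ?thesis .
qed

lemma en_split:
  assumes f: "admissible f f'"
  shows "en f f' = en_half f f' + en_half (\<lambda>x. f (- x)) (\<lambda>x. - f' (- x))"
proof -
  have "integrable lborel (\<lambda>x. (f' x)\<^sup>2 + V x * (f x)\<^sup>2)" using f by (intro en_integrable) (auto simp: admissible_def)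
  from half_line_reflect[OF this] show ?thesis by (simp add: en_def en_half_def V_reflect)
qed

lemma en_half_le_en:
  assumes f: "admissible f f'"
  shows "en_half f f' \<le> en f f'" "en_half (\<lambda>x. f (- x)) (\<lambda>x. - f' (- x)) \<le> en f f'" "0 \<le> en f f'"
  using en_split[OF f] en_half_nonneg[OF f] en_half_nonneg[OF admissible_reflect[OF f]] by linarith+

text \<open>On functions vanishing at 0 the form is degenerate exactly along multiples of
  \<open>Q'\<close> taken independently on the two half lines; the values at 1 and -1 fix these two
  coefficients. The norm of f' is then read off from the energy, since V is bounded.\<close>

lemma en_coercive:
  obtains C where "0 \<le> C"
    "\<And>f f'. admissible f f' \<Longrightarrow> (nrm f)\<^sup>2 + (nrm f')\<^sup>2 \<le> C * ((f 1)\<^sup>2 + (f (- 1))\<^sup>2 + en f f')"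
proof -
  obtain C where C: "0 \<le> C" "\<And>f f'. admissible f f' \<Longrightarrow> (LINT x|lborel. indicator {0<..} x * (f x)\<^sup>2) \<le> C * ((f 1)\<^sup>2 + en_half f f')"
    using half_line_coercive by blast
  show thesis
  proof (rule that[of "(2 + CV) * (2 * C) + 1"])
    show "0 \<le> (2 + CV) * (2 * C) + 1" using C CV_pos by simp
    fix f f' assume f: "admissible f f'"
    have sq: "sqint f" "sqint f'" using f by (auto simp: admissible_def)
    let ?S = "(f 1)\<^sup>2 + (f (- 1))\<^sup>2 + en f f'"
    have S0: "0 \<le> ?S" "en f f' \<le> ?S" using en_half_le_en(3)[OF f] by auto
    have "(nrm f)\<^sup>2 = (LINT x|lborel. indicator {0<..} x * (f x)\<^sup>2) + (LINT x|lborel. indicator {0<..} x * (f (- x))\<^sup>2)"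
      unfolding nrm_power2 using sq by (intro half_line_reflect) (simp add: sqint_def)
    also have "\<dots> \<le> C * ((f 1)\<^sup>2 + en f f') + C * ((f (- 1))\<^sup>2 + en f f')"
    proof (rule add_mono)
      show "(LINT x|lborel. indicator {0<..} x * (f x)\<^sup>2) \<le> C * ((f 1)\<^sup>2 + en f f')"
        by (rule order_trans[OF C(2)[OF f]]) (use C(1) en_half_le_en[OF f] in \<open>auto intro!: mult_left_mono\<close>)
      show "(LINT x|lborel. indicator {0<..} x * (f (- x))\<^sup>2) \<le> C * ((f (- 1))\<^sup>2 + en f f')"
        by (rule order_trans[OF C(2)[OF admissible_reflect[OF f]]]) (use C(1) en_half_le_en[OF f] in \<open>auto intro!: mult_left_mono\<close>)
    qed
    also have "\<dots> \<le> 2 * C * ?S" using C(1) en_half_le_en(3)[OF f] by (simp add: algebra_simps)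
    finally have 1: "(nrm f)\<^sup>2 \<le> 2 * C * ?S" .
    have Vf: "sqint (\<lambda>x. V x * f x)" by (rule sqint_mult_bounded[OF sq(1) c1_deriv_meas(1)[OF c1_V] V_bound])
    have "en f f' = (nrm f')\<^sup>2 + ip (\<lambda>x. V x * f x) f"
      unfolding en_def nrm_power2 ip_def using sq sqint_integrable_mult[OF Vf sq(1)]
      by (subst Bochner_Integration.integral_add[symmetric]) (auto simp: sqint_def power2_eq_square mult.assoc)
    moreover have "\<bar>ip (\<lambda>x. V x * f x) f\<bar> \<le> CV * (nrm f)\<^sup>2"
    proof -
      have "\<bar>ip (\<lambda>x. V x * f x) f\<bar> \<le> nrm (\<lambda>x. V x * f x) * nrm f" by (rule ip_le[OF Vf sq(1)])
      also have "\<dots> \<le> (CV * nrm f) * nrm f"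
        by (intro mult_right_mono nrm_mult_bounded[OF sq(1) c1_deriv_meas(1)[OF c1_V] V_bound]) simp
      finally show ?thesis by (simp add: power2_eq_square)
    qed
    ultimately have "(nrm f')\<^sup>2 \<le> ?S + CV * (nrm f)\<^sup>2" using S0 by linarith
    also have "\<dots> \<le> ?S + CV * (2 * C * ?S)" using 1 CV_pos by (intro add_left_mono mult_left_mono) auto
    finally have "(nrm f)\<^sup>2 + (nrm f')\<^sup>2 \<le> 2 * C * ?S + (?S + CV * (2 * C * ?S))" using 1 by linarith
    also have "\<dots> \<le> ((2 + CV) * (2 * C) + 1) * ?S"
    proof -
      have "0 \<le> C * ?S" using C S0 by simp
      thus ?thesis by (simp add: algebra_simps)
    qed
    finally show "(nrm f)\<^sup>2 + (nrm f')\<^sup>2 \<le> ((2 + CV) * (2 * C) + 1) * ?S" .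
  qed
qed

text \<open>The quotient at 1 is the coefficient of \<open>Q'\<close> on the right half line. The
  error is linear in the square root of the energy, which makes it comparable with the norms of the
  decaying solution.\<close>

lemma near_kernel_right:
  assumes ab: "0 < a" "a \<le> 1" "1 \<le> b"
  obtains C where "0 \<le> C" "\<And>f f' x. admissible f f' \<Longrightarrow> a \<le> x \<Longrightarrow> x \<le> b \<Longrightarrow>
     \<bar>f x - f 1 / Q' 1 * Q' x\<bar> \<le> C * sqrt (en f f')"
proof -
  have le: "a \<le> b" using ab by simp
  obtain C where C: "0 \<le> C" "\<And>f f' x y. admissible f f' \<Longrightarrow> a \<le> x \<Longrightarrow> x \<le> b \<Longrightarrow> a \<le> y \<Longrightarrow> y \<le> b \<Longrightarrow>
       \<bar>f x / Q' x - f y / Q' y\<bar> \<le> C * sqrt (en_half f f')"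
    using quotient_near_constant[OF ab(1) le] by blast
  show thesis
  proof (rule that[of "CV * C"])
    show "0 \<le> CV * C" using C CV_pos by simp
    fix f f' x assume f: "admissible f f'" and x: "a \<le> x" "x \<le> b"
    have nz: "Q' x \<noteq> 0" using Q'_neg[of x] x ab by simp
    have "\<bar>f x - f 1 / Q' 1 * Q' x\<bar> = \<bar>Q' x\<bar> * \<bar>f x / Q' x - f 1 / Q' 1\<bar>"
      using nz by (simp add: right_diff_distrib mult.commute flip: abs_mult)
    also have "\<dots> \<le> CV * (C * sqrt (en_half f f'))"
      using C(2)[OF f x, of 1] ab Q'_le[of x] CV_pos by (intro mult_mono) auto
    also have "\<dots> \<le> CV * (C * sqrt (en f f'))"
      using CV_pos C(1) en_half_le_en[OF f] by (intro mult_left_mono real_sqrt_le_mono) auto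
    finally show "\<bar>f x - f 1 / Q' 1 * Q' x\<bar> \<le> CV * C * sqrt (en f f')" by (simp add: mult.assoc)
  qed
qed

lemma near_kernel_left:
  assumes ab: "0 < a" "a \<le> 1" "1 \<le> b"
  obtains C where "0 \<le> C" "\<And>f f' x. admissible f f' \<Longrightarrow> - b \<le> x \<Longrightarrow> x \<le> - a \<Longrightarrow>
     \<bar>f x - f (- 1) / Q' (- 1) * Q' x\<bar> \<le> C * sqrt (en f f')"
proof -
  obtain C where C: "0 \<le> C" "\<And>f f' x. admissible f f' \<Longrightarrow> a \<le> x \<Longrightarrow> x \<le> b \<Longrightarrow>
     \<bar>f x - f 1 / Q' 1 * Q' x\<bar> \<le> C * sqrt (en f f')"
    using near_kernel_right[OF ab] by blast
  show thesis
  proof (rule that[OF C(1)])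
    fix f f' x assume f: "admissible f f'" and x: "- b \<le> x" "x \<le> - a"
    have e: "en (\<lambda>x. f (- x)) (\<lambda>x. - f' (- x)) = en f f'"
      using en_split[OF f] en_split[OF admissible_reflect[OF f]] by simp
    have "Q' x = - Q' (- x)" "Q' (- 1) = - Q' 1" using Q'_reflect[of x] Q'_reflect[of 1] by simp_all
    thus "\<bar>f x - f (- 1) / Q' (- 1) * Q' x\<bar> \<le> C * sqrt (en f f')"
      using C(2)[OF admissible_reflect[OF f], of "- x"] x unfolding e by simp
  qed
qed

end

section \<open>The unstable direction\<close>

context soliton
begin

lemma sqint_V: "sqint f \<Longrightarrow> sqint (\<lambda>x. V x * f x)"
  by (rule sqint_mult_bounded[OF _ c1_deriv_meas(1)[OF c1_V] V_bound])

lemma nrm_V: "sqint f \<Longrightarrow> nrm (\<lambda>x. V x * f x) \<le> CV * nrm f"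
  by (rule nrm_mult_bounded[OF _ c1_deriv_meas(1)[OF c1_V] V_bound])

lemma sqint_Lop: "sqint f \<Longrightarrow> sqint f'' \<Longrightarrow> sqint (Lop f f'')"
  unfolding Lop_def[abs_def] by (intro sqint_add sqint_uminus sqint_V)

lemma en_eq: "sqint f \<Longrightarrow> sqint f' \<Longrightarrow> en f f' = ip f' f' + ip (\<lambda>x. V x * f x) f"
  unfolding en_def ip_def using sqint_integrable_mult[of f' f'] sqint_integrable_mult[OF sqint_V, of f f]
  by (subst Bochner_Integration.integral_add[symmetric]) (auto simp: power2_eq_square mult.assoc)

lemma ip_Lop:
  assumes "c1_deriv f f'" "c1_deriv f' f''" "c1_deriv h h'" "sqint f" "sqint f'" "sqint f''" "sqint h" "sqint h'"
  shows "ip (Lop f f'') h = ip f' h' + ip (\<lambda>x. V x * f x) h"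
proof -
  have "ip (Lop f f'') h = - ip f'' h + ip (\<lambda>x. V x * f x) h"
    unfolding Lop_def[abs_def] ip_add_left[OF sqint_uminus[OF assms(6)] sqint_V[OF assms(4)] assms(7)] ip_uminus_left ..
  also have "ip f'' h = - ip f' h'" by (rule ip_by_parts) (use assms in auto)
  finally show ?thesis by simp
qed

lemma ip_V_commute: "ip (\<lambda>x. V x * f x) h = ip (\<lambda>x. V x * h x) f"
  by (simp add: ip_def mult_ac)

text \<open>Polarisation with the operator moved onto the regular argument f, so that h needs only
  one derivative.\<close>

lemma en_add:
  assumes f: "c1_deriv f f'" "c1_deriv f' f''" "sqint f" "sqint f'" "sqint f''"
    and h: "c1_deriv h h'" "sqint h" "sqint h'"
  shows "en (\<lambda>x. f x + h x) (\<lambda>x. f' x + h' x) = en f f' + 2 * ip (Lop f f'') h + en h h'"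
proof -
  have sq: "sqint (\<lambda>x. f x + h x)" "sqint (\<lambda>x. f' x + h' x)" using f h by (auto intro: sqint_add)
  have V: "(\<lambda>x. V x * (f x + h x)) = (\<lambda>x. V x * f x + V x * h x)" by (simp add: distrib_left)
  show ?thesis
    unfolding en_eq[OF sq] en_eq[OF f(3,4)] en_eq[OF h(2,3)] ip_Lop[OF f(1,2) h(1) f(3-5) h(2,3)] V
    using f h by (simp add: ip_add_left ip_add_right sqint_V sqint_add ip_commute[of h' f'] ip_V_commute[of h f])
qed

lemma en_abs_le:
  assumes "sqint f" "sqint f'"
  shows "\<bar>en f f'\<bar> \<le> (nrm f')\<^sup>2 + CV * (nrm f)\<^sup>2"
proof -
  have "\<bar>ip (\<lambda>x. V x * f x) f\<bar> \<le> nrm (\<lambda>x. V x * f x) * nrm f" by (rule ip_le[OF sqint_V assms(1)]) (rule assms)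
  also have "\<dots> \<le> (CV * nrm f) * nrm f" by (intro mult_right_mono nrm_V assms) simp
  finally have "\<bar>ip (\<lambda>x. V x * f x) f\<bar> \<le> CV * (nrm f)\<^sup>2" by (simp add: power2_eq_square)
  thus ?thesis unfolding en_eq[OF assms] ip_self using zero_le_power2[of "nrm f'"] by linarith
qed

end

locale eigen = soliton +
  fixes e0 :: real and Y Y1 Y2 :: "real \<Rightarrow> real"
  assumes e0: "0 < e0"
    and Y_c1: "c1_deriv Y Y1" "c1_deriv Y1 Y2"
    and Y_sq: "sqint Y" "sqint Y1" "sqint Y2"
    and LY_c1: "c1_deriv (Lop Y Y2) (\<lambda>x. - e0 * Y x)"
    and Y_nz: "\<exists>x. Y x \<noteq> 0"
begin

abbreviation LY :: "real \<Rightarrow> real" where "LY \<equiv> Lop Y Y2"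

lemma LY_sq: "sqint LY" by (intro sqint_Lop Y_sq)

text \<open>(L Y)' = - e0 Y, and a function is orthogonal to its derivative.\<close>

lemma ip_LY_Y: "ip LY Y = 0"
proof -
  have "ip (\<lambda>x. - e0 * Y x) LY = - ip LY (\<lambda>x. - e0 * Y x)"
    by (rule ip_by_parts[OF LY_c1 LY_c1]) (intro LY_sq sqint_cmult Y_sq)+
  hence "e0 * ip Y LY = - (e0 * ip Y LY)"
    by (simp only: ip_cmult_left ip_cmult_right ip_commute[of LY Y])
  thus ?thesis using e0 by (simp add: ip_commute[of LY Y])
qed

lemma en_Y: "en Y Y1 = 0"
  unfolding en_eq[OF Y_sq(1,2)] using ip_Lop[OF Y_c1 Y_c1(1) Y_sq Y_sq(1,2)] ip_LY_Y by simp

text \<open>If \<^term>\<open>Y 0\<close> vanished, then \<^term>\<open>Y\<close> would be in the kernel of the quadratic form on each half line,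
  so a multiple of \<^term>\<open>Q'\<close> there; as \<^term>\<open>Y\<close> is differentiable at 0, the two multiples agree.\<close>

lemma Y_0: "Y 0 \<noteq> 0"
proof
  assume Y0: "Y 0 = 0"
  have ad: "admissible Y Y1" using Y_c1 Y_sq Y0 by (simp add: admissible_def)
  define c where "c = Y1 0 / Q'' 0"
  have lim: "((\<lambda>x. Y x / Q' x) \<longlongrightarrow> c) (at 0)" unfolding c_def by (rule admissible_quotient_at_0[OF ad])
  have pos: "Y x = Y 1 / Q' 1 * Q' x" if x: "0 < x" for x
  proof -
    have m: "0 < min x 1" "min x 1 \<le> 1" "1 \<le> max x 1" using x by auto
    obtain C where "\<And>f f' y. admissible f f' \<Longrightarrow> min x 1 \<le> y \<Longrightarrow> y \<le> max x 1 \<Longrightarrow>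
       \<bar>f y - f 1 / Q' 1 * Q' y\<bar> \<le> C * sqrt (en f f')"
      by (rule near_kernel_right[OF m]) blast
    from this[OF ad, of x] show ?thesis by (simp add: en_Y)
  qed
  have neg: "Y x = Y (- 1) / Q' (- 1) * Q' x" if x: "x < 0" for x
  proof -
    have m: "0 < min (- x) 1" "min (- x) 1 \<le> 1" "1 \<le> max (- x) 1" using x by auto
    obtain C where "\<And>f f' y. admissible f f' \<Longrightarrow> - max (- x) 1 \<le> y \<Longrightarrow> y \<le> - min (- x) 1 \<Longrightarrow>
       \<bar>f y - f (- 1) / Q' (- 1) * Q' y\<bar> \<le> C * sqrt (en f f')"
      by (rule near_kernel_left[OF m]) blast
    from this[OF ad, of x] show ?thesis by (simp add: en_Y)
  qed
  have nzp: "Q' x \<noteq> 0" if "x \<noteq> 0" for x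
    using Q'_neg[of x] Q'_neg[of "- x"] Q'_reflect[of x] that by (cases "x > 0") auto
  have "Y 1 / Q' 1 = c"
  proof (rule tendsto_unique[OF _ _ filterlim_mono[OF lim order_refl at_le]])
    show "((\<lambda>x. Y x / Q' x) \<longlongrightarrow> Y 1 / Q' 1) (at_right 0)"
    proof (rule tendsto_eventually, unfold eventually_at_filter, intro always_eventually allI impI)
      fix x :: real assume "x \<in> {0<..}"
      hence x: "0 < x" by simp
      show "Y x / Q' x = Y 1 / Q' 1" unfolding pos[OF x] using nzp[of x] x by simp
    qed
  qed auto
  moreover have "Y (- 1) / Q' (- 1) = c"
  proof (rule tendsto_unique[OF _ _ filterlim_mono[OF lim order_refl at_le]])
    show "((\<lambda>x. Y x / Q' x) \<longlongrightarrow> Y (- 1) / Q' (- 1)) (at_left 0)"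
    proof (rule tendsto_eventually, unfold eventually_at_filter, intro always_eventually allI impI)
      fix x :: real assume "x \<in> {..<0}"
      hence x: "x < 0" by simp
      show "Y x / Q' x = Y (- 1) / Q' (- 1)" unfolding neg[OF x] using nzp[of x] x by simp
    qed
  qed auto
  ultimately have c: "Y 1 / Q' 1 = c" "Y (- 1) / Q' (- 1) = c" by blast+
  have "Y x = c * Q' x" for x
  proof (cases x "0 :: real" rule: linorder_cases)
    case less
    show ?thesis using neg[OF less] unfolding c .
  next
    case equal
    show ?thesis unfolding equal Y0 by (simp add: Q'_def T_0)
  next
    case greater
    show ?thesis using pos[OF greater] unfolding c .
  qed
  hence Yc: "Y = (\<lambda>x. c * Q' x)" by (rule ext)
  have Y1c: "Y1 = (\<lambda>x. c * Q'' x)"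
    using DERIV_unique[OF c1_derivD[OF Y_c1(1)]] DERIV_cmult[OF Q'_deriv, of c] unfolding Yc by (intro ext) blast
  have Y2c: "Y2 = (\<lambda>x. c * (V x * Q' x))"
    using DERIV_unique[OF c1_derivD[OF Y_c1(2)]] DERIV_cmult[OF Q''_deriv, of c] unfolding Y1c by (intro ext) blast
  \<comment> \<open>\<open>Q'\<close> is annihilated by L, so L Y = 0, against (L Y)' = - e0 Y with
    e0 > 0 and Y not identically 0.\<close>
  have "LY = (\<lambda>x. 0)" by (simp add: Lop_def fun_eq_iff Yc Y2c)
  hence "- e0 * Y x = 0" for x
    using DERIV_unique[OF c1_derivD[OF LY_c1, of x]] by (metis DERIV_const)
  thus False using Y_nz e0 by simp
qed

text \<open>Detects the coefficient of Y without seeing that of \<open>Q'\<close>, from data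
  supported on the open right half line. It exists because Y is not a multiple of \<open>Q'\<close>
  there: by continuity at 0 that would give Y(0) = 0, as \<open>Q'\<close> vanishes at 0.\<close>

lemma dual_test_function:
  obtains \<phi> a b where "\<phi> \<in> test_functions" "0 < a" "a \<le> 1" "1 \<le> b" "\<And>x. x \<notin> {a..b} \<Longrightarrow> \<phi> x = 0"
    "ip Q' \<phi> = 0" "ip Y \<phi> = 1"
proof -
  let ?\<psi> = "bump 1 1"
  have \<psi>: "?\<psi> \<in> test_functions" by (rule bump_test) simp
  have int: "integrable lborel (\<lambda>x. f x * \<phi> x)" if "\<phi> \<in> test_functions" "continuous_on UNIV f" for f \<phi>
    by (rule continuous_test_integrable[OF that])
  define \<nu> where "\<nu> = ip Q' ?\<psi>"
  have \<nu>: "\<nu> \<noteq> 0"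
  proof
    assume "\<nu> = 0"
    have np: "0 \<le> - (Q' x * ?\<psi> x)" for x
      using Q'_neg[of x] bump_nonneg[of 1 1 x] bump_0[of 1 x 1] by (cases "x > 1") (auto simp: mult_nonpos_nonneg)
    have "(LINT x|lborel. - (Q' x * ?\<psi> x)) = 0" using \<open>\<nu> = 0\<close> by (simp add: \<nu>_def ip_def)
    hence "AE x in lborel. - (Q' x * ?\<psi> x) = 0"
      using int[OF \<psi> Q'_cont] np by (subst (asm) integral_nonneg_eq_0_iff_AE) auto
    hence "AE x :: real in lborel. x \<notin> {1<..<2}"
    proof eventually_elim
      case (elim x)
      thus ?case using bump_pos[of 1 1 x] Q'_neg[of x] by auto
    qed
    hence "{1<..<2 :: real} \<in> null_sets lborel" by (subst AE_iff_null_sets) auto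
    thus False by (simp add: null_sets_def)
  qed
  \<comment> \<open>The multiple for which Y - \<kappa> \<open>Q'\<close> is orthogonal to the bump
    \<psi>. Pairing \<phi>0 with this combination is then the same as pairing Y with the corrected
    function \<phi>1 below.\<close>
  define \<kappa> where "\<kappa> = ip Y ?\<psi> / \<nu>"
  have "\<exists>x0 n. 0 < x0 \<and> ip (\<lambda>x. Y x - \<kappa> * Q' x) (bump x0 (1 / (real n + 1))) \<noteq> 0"
  proof (rule ccontr)
    assume "\<not> ?thesis"
    hence z: "ip (\<lambda>x. Y x - \<kappa> * Q' x) (bump x0 (1 / (real n + 1))) = 0" if "0 < x0" for x0 n using that by blast
    have cont: "continuous_on UNIV (\<lambda>x. Y x - \<kappa> * Q' x)" by (intro continuous_intros c1_deriv_cont[OF Y_c1(1)] Q'_cont)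
    have "Y x - \<kappa> * Q' x = 0" if "0 < x" for x
      using bump_tendsto[OF cont, of x] z[OF that] by (auto simp: ip_def dest: LIMSEQ_unique[OF tendsto_const])
    hence l1: "((\<lambda>x. Y x - \<kappa> * Q' x) \<longlongrightarrow> 0) (at_right 0)"
      by (intro tendsto_eventually) (auto simp: eventually_at_filter)
    have l2: "((\<lambda>x. Y x - \<kappa> * Q' x) \<longlongrightarrow> Y 0 - \<kappa> * Q' 0) (at_right 0)"
    proof (rule filterlim_mono[OF _ order_refl at_le])
      show "((\<lambda>x. Y x - \<kappa> * Q' x) \<longlongrightarrow> Y 0 - \<kappa> * Q' 0) (at 0)"
        using cont by (simp add: continuous_on_eq_continuous_at isCont_def)
    qed simp
    have "Y 0 - \<kappa> * Q' 0 = 0" by (rule tendsto_unique[OF _ l2 l1]) simp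
    thus False using Y_0 by (simp add: Q'_def T_0)
  qed
  then obtain x0 n where x0: "0 < x0" "ip (\<lambda>x. Y x - \<kappa> * Q' x) (bump x0 (1 / (real n + 1))) \<noteq> 0" by blast
  let ?e = "1 / (real n + 1)"
  define \<phi>0 where "\<phi>0 = bump x0 ?e"
  have \<phi>0: "\<phi>0 \<in> test_functions" unfolding \<phi>0_def by (rule bump_test) simp
  \<comment> \<open>Subtracting this multiple of \<psi> makes the pairing with \<open>Q'\<close>
    vanish; \<nu> is nonzero because \<open>Q'\<close> has a strict sign on the support of
    \<psi>.\<close>
  define \<phi>1 where "\<phi>1 = (\<lambda>x. \<phi>0 x - (ip Q' \<phi>0 / \<nu>) * ?\<psi> x)"
  have \<phi>1: "\<phi>1 \<in> test_functions" unfolding \<phi>1_def by (intro test_diff test_cmult \<phi>0 \<psi>)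
  have ip1: "ip f \<phi>1 = ip f \<phi>0 - (ip Q' \<phi>0 / \<nu>) * ip f ?\<psi>" if "continuous_on UNIV f" for f
  proof -
    have "ip f (\<lambda>x. \<phi>0 x - c * ?\<psi> x) = ip f \<phi>0 - c * ip f ?\<psi>" for c
      unfolding ip_def using int[OF \<phi>0 that] int[OF \<psi> that]
      by (simp add: right_diff_distrib mult.left_commute[of _ c])
    thus ?thesis unfolding \<phi>1_def .
  qed
  have Yc: "continuous_on UNIV Y" by (rule c1_deriv_cont[OF Y_c1(1)])
  have Q1: "ip Q' \<phi>1 = 0" unfolding ip1[OF Q'_cont] \<nu>_def[symmetric] using \<nu> by simp
  have "ip (\<lambda>x. Y x - \<kappa> * Q' x) \<phi>0 = ip Y \<phi>0 - \<kappa> * ip Q' \<phi>0"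
    unfolding ip_def using int[OF \<phi>0 Yc] int[OF \<phi>0 Q'_cont] by (simp add: left_diff_distrib mult.assoc)
  hence nz: "ip Y \<phi>1 \<noteq> 0" using x0 unfolding ip1[OF Yc] \<phi>0_def[symmetric] by (simp add: \<kappa>_def mult.commute)
  define c where "c = 1 / ip Y \<phi>1"
  have e1: "0 < ?e" "?e \<le> 1" by auto
  show thesis
  proof (rule that[of "\<lambda>x. c * \<phi>1 x" "min x0 1" "max (x0 + 1) 2"])
    show "(\<lambda>x. c * \<phi>1 x) \<in> test_functions" by (intro test_cmult \<phi>1)
    show "ip Q' (\<lambda>x. c * \<phi>1 x) = 0" "ip Y (\<lambda>x. c * \<phi>1 x) = 1"
      unfolding ip_cmult_right using Q1 nz by (simp_all add: c_def)
    show "c * \<phi>1 x = 0" if "x \<notin> {min x0 1..max (x0 + 1) 2}" for x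
    proof -
      have "x < min x0 1 \<or> max (x0 + 1) 2 < x" using that by auto
      hence "x \<le> x0 \<or> x0 + ?e \<le> x" "x \<le> 1 \<or> 1 + 1 \<le> x" using e1(2) by linarith+
      thus ?thesis using bump_0[OF e1(1), of x x0] bump_0[of 1 x 1] by (simp add: \<phi>1_def \<phi>0_def)
    qed
  qed (use x0 in auto)
qed

end

section \<open>Decaying solutions of the perturbed linearised flow\<close>

text \<open>The norm by duality: a test function close to \<psi> itself nearly realises the
  supremum.\<close>

lemma nrm_le_of_test:
  assumes \<psi>: "sqint \<psi>" and B: "0 \<le> B" and le: "\<And>\<phi>. \<phi> \<in> test_functions \<Longrightarrow> \<bar>ip \<psi> \<phi>\<bar> \<le> B * nrm \<phi>"
  shows "nrm \<psi> \<le> B"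
proof (cases "nrm \<psi> = 0")
  case False
  hence pos: "0 < nrm \<psi>" using nrm_nonneg[of \<psi>] by linarith
  have "nrm \<psi> * nrm \<psi> \<le> B * nrm \<psi>"
  proof (rule field_le_epsilon)
    fix e :: real assume e: "0 < e"
    define d where "d = e / (B + nrm \<psi>)"
    have d: "0 < d" using e B pos by (simp add: d_def)
    obtain \<phi> where \<phi>: "\<phi> \<in> test_functions" "nrm (\<lambda>x. \<psi> x - \<phi> x) < d"
      using test_functions_dense[OF \<psi> d] by blast
    note sq = test_sqint[OF \<phi>(1)] sqint_diff[OF \<psi> test_sqint[OF \<phi>(1)]]
    have n\<phi>: "nrm \<phi> \<le> nrm \<psi> + d"
      using nrm_triangle_diff[OF \<psi> sq(2)] \<phi>(2) by simp
    have "nrm \<psi> * nrm \<psi> = ip \<psi> \<phi> + ip \<psi> (\<lambda>x. \<psi> x - \<phi> x)"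
      using ip_diff_right[OF \<psi> sq(1) \<psi>] ip_self[of \<psi>] by (simp add: power2_eq_square)
    also have "\<dots> \<le> B * nrm \<phi> + nrm \<psi> * nrm (\<lambda>x. \<psi> x - \<phi> x)"
      using le[OF \<phi>(1)] ip_le[OF \<psi> sq(2)] by linarith
    also have "\<dots> \<le> B * (nrm \<psi> + d) + nrm \<psi> * d"
      using n\<phi> B \<phi>(2) by (intro add_mono mult_left_mono) auto
    also have "\<dots> = B * nrm \<psi> + (B + nrm \<psi>) * d" by (simp add: algebra_simps)
    also have "(B + nrm \<psi>) * d = e" using B pos by (simp add: d_def)
    finally show "nrm \<psi> * nrm \<psi> \<le> B * nrm \<psi> + e" .
  qed
  thus ?thesis using pos by simp
qed (use B in simp)

lemma nonneg_deriv_tendsto_0_imp_le_0: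
  fixes h :: "real \<Rightarrow> real"
  assumes d: "\<And>t. T \<le> t \<Longrightarrow> (h has_real_derivative h' t) (at t within {T..})"
    and pos: "\<And>t. T \<le> t \<Longrightarrow> 0 \<le> h' t" and lim: "(h \<longlongrightarrow> 0) at_top" and t: "T \<le> t"
  shows "h t \<le> 0"
proof -
  have cont: "continuous_on {T..} h"
    using d by (intro DERIV_continuous_on) auto
  have "h t \<le> h s" if "t \<le> s" for s
  proof (rule DERIV_nonneg_imp_increasing_open[OF that])
    fix x assume x: "t < x" "x < s"
    hence "at x within {T..} = at x" using t by (intro at_within_interior) auto
    thus "\<exists>y. (h has_real_derivative y) (at x) \<and> 0 \<le> y" using d[of x] pos[of x] x t by auto
  qed (use t in \<open>auto intro: continuous_on_subset[OF cont]\<close>)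
  hence "\<forall>\<^sub>F s in at_top. h t \<le> h s" by (rule eventually_mono[OF eventually_ge_at_top[of t]])
  thus ?thesis by (rule tendsto_lowerbound[OF lim]) simp
qed

text \<open>Integration from infinity: multiplied by exp(-l t), f minus the claimed bound becomes a
  nondecreasing function with limit 0, hence nonpositive. The limit hypothesis excludes the
  homogeneous solution exp(l t), for either sign of l.\<close>

lemma ode_decay_upper:
  fixes f :: "real \<Rightarrow> real"
  assumes d: "\<And>t. T \<le> t \<Longrightarrow> (f has_real_derivative l * f t + r t) (at t within {T..})"
    and r: "\<And>t. T \<le> t \<Longrightarrow> \<bar>r t\<bar> \<le> R * exp (- m * t)" and lm: "0 < l + m"
    and lim: "((\<lambda>t. exp (- l * t) * f t) \<longlongrightarrow> 0) at_top" and t: "T \<le> t"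
  shows "f t \<le> R / (l + m) * exp (- m * t)"
proof -
  define h where "h = (\<lambda>t. exp (- l * t) * f t - R / (l + m) * exp (- (l + m) * t))"
  have dh: "(h has_real_derivative exp (- l * t) * r t + R * exp (- (l + m) * t)) (at t within {T..})" if "T \<le> t" for t
  proof -
    have E: "((\<lambda>t. exp (a * t)) has_real_derivative exp (a * t) * a) (at t within {T..})" for a :: real
      by (auto intro!: derivative_eq_intros)
    have "(h has_real_derivative (exp (- l * t) * (- l)) * f t + (l * f t + r t) * exp (- l * t) -
        R / (l + m) * (exp (- (l + m) * t) * (- (l + m)))) (at t within {T..})"
      unfolding h_def by (rule DERIV_diff[OF DERIV_mult[OF E d[OF that]] DERIV_cmult[OF E]])
    moreover have "R / (l + m) * (E2 * (- (l + m))) = - (R * E2)" for E2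
    proof -
      have "R / (l + m) * (l + m) = R" using lm by simp
      thus ?thesis by (simp only: mult_minus_right mult.left_commute[of "R / (l + m)" E2] mult.commute[of E2 R])
    qed
    moreover have "(E1 * (- l)) * f t + (l * f t + r t) * E1 = E1 * r t" for E1 by (simp add: algebra_simps)
    ultimately show ?thesis by (simp only: diff_minus_eq_add)
  qed
  have "h t \<le> 0"
  proof (rule nonneg_deriv_tendsto_0_imp_le_0[OF dh _ _ t])
    fix t assume "T \<le> t"
    have "- (R * exp (- m * t)) \<le> r t" using r[OF \<open>T \<le> t\<close>] by linarith
    hence "exp (- l * t) * (- (R * exp (- m * t))) \<le> exp (- l * t) * r t" by (intro mult_left_mono) auto
    moreover have "exp (- l * t) * exp (- m * t) = exp (- (l + m) * t)" unfolding exp_add[symmetric] by (simp add: algebra_simps)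
    ultimately show "0 \<le> exp (- l * t) * r t + R * exp (- (l + m) * t)" by (simp add: mult.left_commute)
  next
    have "((\<lambda>t. exp (- (l + m) * t)) \<longlongrightarrow> 0) at_top" using lm by real_asymp
    from tendsto_diff[OF lim tendsto_mult_left[OF this, of "R / (l + m)"]] show "(h \<longlongrightarrow> 0) at_top"
      unfolding h_def by (simp only: mult_zero_right diff_zero)
  qed
  hence "exp (l * t) * (exp (- l * t) * f t) \<le> exp (l * t) * (R / (l + m) * exp (- (l + m) * t))"
    by (intro mult_left_mono) (auto simp: h_def)
  also have "exp (l * t) * (R / (l + m) * exp (- (l + m) * t)) = R / (l + m) * (exp (l * t) * exp (- (l + m) * t))"
    by (rule mult.left_commute)
  also have "exp (l * t) * exp (- (l + m) * t) = exp (- m * t)"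
    unfolding exp_add[symmetric] by (simp add: algebra_simps)
  also have "exp (l * t) * (exp (- l * t) * f t) = f t"
    unfolding mult.assoc[symmetric] exp_add[symmetric] by simp
  finally show ?thesis .
qed

lemma ode_decay:
  fixes f :: "real \<Rightarrow> real"
  assumes d: "\<And>t. T \<le> t \<Longrightarrow> (f has_real_derivative l * f t + r t) (at t within {T..})"
    and r: "\<And>t. T \<le> t \<Longrightarrow> \<bar>r t\<bar> \<le> R * exp (- m * t)" and lm: "0 < l + m"
    and lim: "((\<lambda>t. exp (- l * t) * f t) \<longlongrightarrow> 0) at_top" and t: "T \<le> t"
  shows "\<bar>f t\<bar> \<le> R / (l + m) * exp (- m * t)"
proof -
  have "- f t \<le> R / (l + m) * exp (- m * t)"
  proof (rule ode_decay_upper[of T "\<lambda>t. - f t" l "\<lambda>t. - r t"])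
    show "((\<lambda>t. - f t) has_real_derivative l * - f t + - r t) (at t within {T..})" if "T \<le> t" for t
      using DERIV_minus[OF d[OF that]] by simp
    show "((\<lambda>t. exp (- l * t) * - f t) \<longlongrightarrow> 0) at_top" using tendsto_minus[OF lim] by simp
  qed (use r lm t in auto)
  thus ?thesis using ode_decay_upper[OF d r lm lim t] by linarith
qed

text \<open>The difference of two solutions with the same leading term, made abstract.
  \<open>w t i\<close> is the i-th derivative in x at time t, g is the variable part of the
  coefficient in the equation for the difference, with derivatives g1 and g2, and K serves all
  bounds. The evolution equation is available only against test functions.\<close>

locale flow = eigen +
  fixes T0 K :: real and w :: "real \<Rightarrow> nat \<Rightarrow> real \<Rightarrow> real" and g g1 g2 :: "real \<Rightarrow> real \<Rightarrow> real"
  assumes T0: "0 \<le> T0"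
    and w_c1: "\<And>t i. T0 \<le> t \<Longrightarrow> i \<le> 2 \<Longrightarrow> c1_deriv (w t i) (w t (Suc i))"
    and w_sq: "\<And>t i. T0 \<le> t \<Longrightarrow> i \<le> 3 \<Longrightarrow> sqint (w t i)"
    and w_le: "\<And>t i. T0 \<le> t \<Longrightarrow> i \<le> 3 \<Longrightarrow> nrm (w t i) \<le> K * exp (- 2 * e0 * t)"
    and g_c1: "\<And>t. T0 \<le> t \<Longrightarrow> c1_deriv (g t) (g1 t)" "\<And>t. T0 \<le> t \<Longrightarrow> c1_deriv (g1 t) (g2 t)"
    and g_le: "\<And>t x. T0 \<le> t \<Longrightarrow> \<bar>g t x\<bar> \<le> K * exp (- e0 * t)"
      "\<And>t x. T0 \<le> t \<Longrightarrow> \<bar>g1 t x\<bar> \<le> K * exp (- e0 * t)" "\<And>t x. T0 \<le> t \<Longrightarrow> \<bar>g2 t x\<bar> \<le> K * exp (- e0 * t)"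
    and evol: "\<And>\<phi> t. \<phi> \<in> test_functions \<Longrightarrow> T0 \<le> t \<Longrightarrow>
      ((\<lambda>s. LINT x|lborel. w s 0 x * \<phi> x) has_real_derivative
        (LINT x|lborel. w t 0 x * (deriv ^^ 3) \<phi> x - (V x - g t x) * w t 0 x * deriv \<phi> x)) (at t within {T0..})"
begin

lemma K_nonneg: "0 \<le> K"
proof -
  have "0 \<le> K * exp (- e0 * T0)" using g_le(1)[of T0 0] by linarith
  thus ?thesis by (simp add: zero_le_mult_iff)
qed

definition LW where "LW t = Lop (w t 0) (w t 2)"
definition LW1 where "LW1 t = (\<lambda>x. - w t 3 x + (V' x * w t 0 x + V x * w t 1 x))"
definition gw where "gw t = (\<lambda>x. g t x * w t 0 x)"
definition gw1 where "gw1 t = (\<lambda>x. g1 t x * w t 0 x + g t x * w t 1 x)"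
text \<open>The x-derivative of L w - g w, which is the time derivative of w; the lemmas on
  derivatives of pairings make this precise.\<close>

definition F where "F t = (\<lambda>x. LW1 t x - gw1 t x)"
definition X where "X t = nrm (w t 0) + nrm (w t 1)"

lemma w01: "T0 \<le> t \<Longrightarrow> c1_deriv (w t 0) (w t 1)" and w12: "T0 \<le> t \<Longrightarrow> c1_deriv (w t 1) (w t 2)"
  and w23: "T0 \<le> t \<Longrightarrow> c1_deriv (w t 2) (w t 3)"
  using w_c1[of t 0] w_c1[of t 1] w_c1[of t 2] by (auto simp: numeral_2_eq_2 numeral_3_eq_3)

lemma LW_c1: "T0 \<le> t \<Longrightarrow> c1_deriv (LW t) (LW1 t)"
  unfolding LW_def Lop_def[abs_def] LW1_def
  by (intro c1_deriv_add c1_deriv_uminus c1_deriv_mult c1_V w01 w23)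

lemma gw_c1: "T0 \<le> t \<Longrightarrow> c1_deriv (gw t) (gw1 t)"
  unfolding gw_def gw1_def by (intro c1_deriv_mult g_c1 w01)

lemma g_meas: "T0 \<le> t \<Longrightarrow> g t \<in> borel_measurable borel" "T0 \<le> t \<Longrightarrow> g1 t \<in> borel_measurable borel"
  "T0 \<le> t \<Longrightarrow> g2 t \<in> borel_measurable borel"
  using c1_deriv_meas g_c1 by blast+

lemma sq_g: assumes "T0 \<le> t" "sqint f"
  shows "sqint (\<lambda>x. g t x * f x)" "sqint (\<lambda>x. g1 t x * f x)" "sqint (\<lambda>x. g2 t x * f x)"
    "nrm (\<lambda>x. g t x * f x) \<le> K * exp (- e0 * t) * nrm f"
    "nrm (\<lambda>x. g1 t x * f x) \<le> K * exp (- e0 * t) * nrm f"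
    "nrm (\<lambda>x. g2 t x * f x) \<le> K * exp (- e0 * t) * nrm f"
  by (rule sqint_mult_bounded[OF assms(2) g_meas(1)[OF assms(1)] g_le(1)[OF assms(1)]]
      sqint_mult_bounded[OF assms(2) g_meas(2)[OF assms(1)] g_le(2)[OF assms(1)]]
      sqint_mult_bounded[OF assms(2) g_meas(3)[OF assms(1)] g_le(3)[OF assms(1)]]
      nrm_mult_bounded[OF assms(2) g_meas(1)[OF assms(1)] g_le(1)[OF assms(1)]]
      nrm_mult_bounded[OF assms(2) g_meas(2)[OF assms(1)] g_le(2)[OF assms(1)]]
      nrm_mult_bounded[OF assms(2) g_meas(3)[OF assms(1)] g_le(3)[OF assms(1)]])+

lemma gw_sq: "T0 \<le> t \<Longrightarrow> sqint (gw t)" and gw1_sq: "T0 \<le> t \<Longrightarrow> sqint (gw1 t)"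
  and LW_sq: "T0 \<le> t \<Longrightarrow> sqint (LW t)" and LW1_sq: "T0 \<le> t \<Longrightarrow> sqint (LW1 t)"
  unfolding gw_def gw1_def LW_def LW1_def
  by (intro sqint_add sq_g sqint_uminus sqint_Lop sqint_V w_sq sqint_mult_bounded[OF _ c1_deriv_meas(2)[OF c1_V] V'_bound]; simp)+

lemma F_sq: "T0 \<le> t \<Longrightarrow> sqint (F t)"
  unfolding F_def by (intro sqint_diff LW1_sq gw1_sq)

lemma gw1_le: "T0 \<le> t \<Longrightarrow> nrm (gw1 t) \<le> K * exp (- e0 * t) * X t"
proof -
  assume t: "T0 \<le> t"
  have sq: "sqint (w t 0)" "sqint (w t 1)" using w_sq[OF t] by auto
  have "nrm (gw1 t) \<le> nrm (\<lambda>x. g1 t x * w t 0 x) + nrm (\<lambda>x. g t x * w t 1 x)"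
    unfolding gw1_def by (intro nrm_triangle sq_g t sq)
  also have "\<dots> \<le> K * exp (- e0 * t) * nrm (w t 0) + K * exp (- e0 * t) * nrm (w t 1)"
    by (intro add_mono sq_g t sq)
  finally show ?thesis by (simp add: X_def distrib_left)
qed

lemma X_nonneg: "0 \<le> X t" by (simp add: X_def)

lemma exp_le_1: "T0 \<le> t \<Longrightarrow> 0 \<le> c \<Longrightarrow> exp (- c * e0 * t) \<le> 1"
  using T0 e0 by (simp add: mult_nonneg_nonneg)

lemma w_le_K: "T0 \<le> t \<Longrightarrow> i \<le> 3 \<Longrightarrow> nrm (w t i) \<le> K"
  using w_le[of t i] mult_left_mono[OF exp_le_1[of t 2] K_nonneg] by simp

definition BF :: real where "BF = K + 2 * CV * K + 2 * K * K"

lemma BF_nonneg: "0 \<le> BF" using K_nonneg CV_pos by (simp add: BF_def)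

lemma F_le: "T0 \<le> t \<Longrightarrow> nrm (F t) \<le> BF"
proof -
  assume t: "T0 \<le> t"
  have sq: "sqint (w t 0)" "sqint (w t 1)" "sqint (w t 3)" using w_sq[OF t] by auto
  note V's = sqint_mult_bounded[OF sq(1) c1_deriv_meas(2)[OF c1_V] V'_bound]
  have "nrm (F t) \<le> nrm (LW1 t) + nrm (gw1 t)"
    unfolding F_def by (rule nrm_triangle_diff[OF LW1_sq[OF t] gw1_sq[OF t]])
  also have "nrm (LW1 t) \<le> nrm (\<lambda>x. - w t 3 x) + nrm (\<lambda>x. V' x * w t 0 x + V x * w t 1 x)"
    unfolding LW1_def by (intro nrm_triangle sqint_uminus sqint_add V's sqint_V sq)
  also have "nrm (\<lambda>x. V' x * w t 0 x + V x * w t 1 x) \<le> nrm (\<lambda>x. V' x * w t 0 x) + nrm (\<lambda>x. V x * w t 1 x)"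
    by (intro nrm_triangle V's sqint_V sq)
  also have "nrm (\<lambda>x. V' x * w t 0 x) \<le> CV * nrm (w t 0)"
    by (rule nrm_mult_bounded[OF sq(1) c1_deriv_meas(2)[OF c1_V] V'_bound])
  also have "nrm (\<lambda>x. V x * w t 1 x) \<le> CV * nrm (w t 1)" by (rule nrm_V[OF sq(2)])
  also have "nrm (gw1 t) \<le> K * exp (- e0 * t) * X t" by (rule gw1_le[OF t])
  also have "\<dots> \<le> K * 1 * (K + K)"
    unfolding X_def using K_nonneg w_le_K[OF t] exp_le_1[OF t, of 1] by (intro mult_mono add_mono) auto
  finally have "nrm (F t) \<le> nrm (w t 3) + (CV * nrm (w t 0) + CV * nrm (w t 1)) + K * 1 * (K + K)"
    by (simp add: nrm_uminus)
  also have "\<dots> \<le> K + (CV * K + CV * K) + K * 1 * (K + K)"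
    using CV_pos K_nonneg by (intro add_mono mult_left_mono w_le_K t) auto
  finally show ?thesis by (simp add: BF_def algebra_simps)
qed

section \<open>Time derivatives of pairings and of the energy\<close>

lemma integral_Lop_test:
  assumes f: "c1_deriv f f'" "c1_deriv f' f''" and \<phi>: "\<phi> \<in> test_functions"
  shows "(LINT x|lborel. f x * (- (deriv ^^ 3) \<phi> x + V x * deriv \<phi> x)) = (LINT x|lborel. Lop f f'' x * deriv \<phi> x)"
proof -
  note \<phi>1 = test_deriv[OF \<phi>] note \<phi>2 = test_deriv[OF \<phi>1] note \<phi>3 = test_deriv[OF \<phi>2]
  have 3: "(deriv ^^ 3) \<phi> = deriv (deriv (deriv \<phi>))" by (simp add: numeral_3_eq_3)
  have Vf: "continuous_on UNIV (\<lambda>x. V x * f x)"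
    by (intro continuous_intros c1_deriv_cont[OF f(1)] c1_deriv_cont[OF c1_V])
  note i = continuous_test_integrable[OF \<phi>3 c1_deriv_cont(1)[OF f(1)]] continuous_test_integrable[OF \<phi>1 Vf]
    continuous_test_integrable[OF \<phi>1 c1_deriv_cont(2)[OF f(2)]]
  have "(LINT x|lborel. f x * (- (deriv ^^ 3) \<phi> x + V x * deriv \<phi> x)) =
      (LINT x|lborel. (V x * f x) * deriv \<phi> x - f x * deriv (deriv (deriv \<phi>)) x)"
    unfolding 3 by (intro Bochner_Integration.integral_cong) (auto simp: algebra_simps)
  also have "\<dots> = (LINT x|lborel. (V x * f x) * deriv \<phi> x) - (LINT x|lborel. f x * deriv (deriv (deriv \<phi>)) x)"
    by (rule Bochner_Integration.integral_diff) (use i in auto)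
  also have "(LINT x|lborel. f x * deriv (deriv (deriv \<phi>)) x) = (LINT x|lborel. f'' x * deriv \<phi> x)"
    using integral_by_parts_test[OF f(1) \<phi>2] integral_by_parts_test[OF f(2) \<phi>1] by simp
  also have "(LINT x|lborel. (V x * f x) * deriv \<phi> x) - (LINT x|lborel. f'' x * deriv \<phi> x) =
      (LINT x|lborel. (V x * f x) * deriv \<phi> x - f'' x * deriv \<phi> x)"
    by (rule Bochner_Integration.integral_diff[symmetric]) (use i in auto)
  also have "\<dots> = (LINT x|lborel. Lop f f'' x * deriv \<phi> x)"
    by (intro Bochner_Integration.integral_cong) (auto simp: Lop_def algebra_simps)
  finally show ?thesis .
qed

lemma F_test:
  assumes t: "T0 \<le> t" and \<phi>: "\<phi> \<in> test_functions"
  shows "ip (F t) \<phi> = - (LINT x|lborel. w t 0 x * (- (deriv ^^ 3) \<phi> x + V x * deriv \<phi> x)) + ip (gw t) (deriv \<phi>)"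
proof -
  have "ip (F t) \<phi> = - (LINT x|lborel. (LW t x - gw t x) * deriv \<phi> x)"
    unfolding ip_def F_def by (rule integral_by_parts_test[OF c1_deriv_diff[OF LW_c1[OF t] gw_c1[OF t]] \<phi>])
  also have "(LINT x|lborel. (LW t x - gw t x) * deriv \<phi> x) = ip (LW t) (deriv \<phi>) - ip (gw t) (deriv \<phi>)"
    using ip_diff_left[OF LW_sq[OF t] gw_sq[OF t] test_sqint[OF test_deriv[OF \<phi>]]] by (simp add: ip_def)
  also have "ip (LW t) (deriv \<phi>) = (LINT x|lborel. w t 0 x * (- (deriv ^^ 3) \<phi> x + V x * deriv \<phi> x))"
    unfolding integral_Lop_test[OF w01[OF t] w12[OF t] \<phi>] by (simp add: ip_def LW_def)
  finally show ?thesis by simp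
qed

lemma deriv_ip_test:
  assumes t: "T0 \<le> t" and \<phi>: "\<phi> \<in> test_functions"
  shows "((\<lambda>s. ip (w s 0) \<phi>) has_real_derivative ip (F t) \<phi>) (at t within {T0..})"
proof -
  note \<phi>1 = test_deriv[OF \<phi>] note \<phi>2 = test_deriv[OF \<phi>1] note \<phi>3 = test_deriv[OF \<phi>2]
  have 3: "(deriv ^^ 3) \<phi> = deriv (deriv (deriv \<phi>))" by (simp add: numeral_3_eq_3)
  have c: "continuous_on UNIV (w t 0)" "continuous_on UNIV (\<lambda>x. V x * w t 0 x)" "continuous_on UNIV (gw t)"
    using c1_deriv_cont[OF w01[OF t]] c1_deriv_cont[OF c1_V] c1_deriv_cont[OF gw_c1[OF t]] by (auto intro!: continuous_intros)
  note i = continuous_test_integrable[OF \<phi>3 c(1)] continuous_test_integrable[OF \<phi>1 c(2)] continuous_test_integrable[OF \<phi>1 c(3)]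
  have "(LINT x|lborel. w t 0 x * (deriv ^^ 3) \<phi> x - (V x - g t x) * w t 0 x * deriv \<phi> x) =
      (LINT x|lborel. - (w t 0 x * (- (deriv ^^ 3) \<phi> x + V x * deriv \<phi> x)) + gw t x * deriv \<phi> x)"
    by (intro Bochner_Integration.integral_cong) (auto simp: gw_def algebra_simps)
  also have "\<dots> = (LINT x|lborel. - (w t 0 x * (- (deriv ^^ 3) \<phi> x + V x * deriv \<phi> x))) + (LINT x|lborel. gw t x * deriv \<phi> x)"
  proof (rule Bochner_Integration.integral_add)
    have "integrable lborel (\<lambda>x. w t 0 x * deriv (deriv (deriv \<phi>)) x - V x * w t 0 x * deriv \<phi> x)"
      using i by (intro Bochner_Integration.integrable_diff) auto
    thus "integrable lborel (\<lambda>x. - (w t 0 x * (- (deriv ^^ 3) \<phi> x + V x * deriv \<phi> x)))"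
      unfolding 3 by (rule back_subst[of "integrable lborel"]) (simp add: fun_eq_iff algebra_simps)
  qed (use i in auto)
  also have "\<dots> = ip (F t) \<phi>" unfolding F_test[OF t \<phi>] by (simp add: ip_def)
  finally show ?thesis using evol[OF \<phi> t] by (simp add: ip_def)
qed

text \<open>The mean value inequality for each pairing with a test function, followed by duality:
  the uniform bound on F turns the weak equation into Lipschitz continuity in L^2.\<close>

lemma w_lipschitz:
  assumes t: "T0 \<le> t" and s: "T0 \<le> s"
  shows "nrm (\<lambda>x. w s 0 x - w t 0 x) \<le> BF * \<bar>s - t\<bar>"
proof (rule nrm_le_of_test)
  have sq: "sqint (w t 0)" "sqint (w s 0)" using w_sq[OF t, of 0] w_sq[OF s, of 0] by auto
  show "sqint (\<lambda>x. w s 0 x - w t 0 x)" by (intro sqint_diff sq)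
  show "0 \<le> BF * \<bar>s - t\<bar>" using BF_nonneg by simp
  fix \<phi> assume \<phi>: "\<phi> \<in> test_functions"
  have "norm (ip (w s 0) \<phi> - ip (w t 0) \<phi>) \<le> (BF * nrm \<phi>) * norm (s - t)"
  proof (rule field_differentiable_bound[where S = "{T0..}"])
    show "norm (ip (F r) \<phi>) \<le> BF * nrm \<phi>" if "r \<in> {T0..}" for r
      using ip_le[OF F_sq test_sqint[OF \<phi>], of r] mult_right_mono[OF F_le, of r "nrm \<phi>"] that by simp
  qed (use deriv_ip_test \<phi> s t in auto)
  thus "\<bar>ip (\<lambda>x. w s 0 x - w t 0 x) \<phi>\<bar> \<le> BF * \<bar>s - t\<bar> * nrm \<phi>"
    by (simp add: ip_diff_left sq test_sqint \<phi> mult_ac)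
qed

text \<open>Density: \<psi> is replaced by a test function, and on the remainder \<theta> both the
  difference quotients, by the Lipschitz bound, and the candidate derivative are small uniformly in
  s.\<close>

lemma deriv_ip:
  assumes t: "T0 \<le> t" and \<psi>: "sqint \<psi>"
  shows "((\<lambda>s. ip (w s 0) \<psi>) has_real_derivative ip (F t) \<psi>) (at t within {T0..})"
  unfolding has_field_derivative_iff
proof (rule tendstoI)
  fix e :: real assume e: "0 < e"
  \<comment> \<open>Small enough that BF d <= e/4, which bounds each of the two errors coming from
    \<theta>; BF + 1 avoids division by 0.\<close>
  define d where "d = e / (4 * (BF + 1))"
  have d: "0 < d" using e BF_nonneg by (simp add: d_def)
  have de: "BF * d \<le> e / 4"
  proof -
    have "BF * d \<le> (BF + 1) * d" using d by simp
    also have "\<dots> = e / 4" using BF_nonneg by (simp add: d_def field_simps)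
    finally show ?thesis .
  qed
  obtain \<phi> where \<phi>: "\<phi> \<in> test_functions" "nrm (\<lambda>x. \<psi> x - \<phi> x) < d"
    using test_functions_dense[OF \<psi> d] by blast
  define \<theta> where "\<theta> = (\<lambda>x. \<psi> x - \<phi> x)"
  have \<theta>: "sqint \<theta>" unfolding \<theta>_def by (intro sqint_diff \<psi> test_sqint \<phi>)
  have split: "ip f \<psi> = ip f \<phi> + ip f \<theta>" if "sqint f" for f
    using ip_diff_right[OF \<psi> test_sqint[OF \<phi>(1)] that] by (simp add: \<theta>_def)
  have "((\<lambda>s. (ip (w s 0) \<phi> - ip (w t 0) \<phi>) / (s - t)) \<longlongrightarrow> ip (F t) \<phi>) (at t within {T0..})"
    using deriv_ip_test[OF t \<phi>(1)] unfolding has_field_derivative_iff .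
  hence "\<forall>\<^sub>F s in at t within {T0..}. dist ((ip (w s 0) \<phi> - ip (w t 0) \<phi>) / (s - t)) (ip (F t) \<phi>) < e / 4"
    using e by (intro tendstoD) auto
  moreover have "\<forall>\<^sub>F s in at t within {T0..}. s \<in> {T0..} \<and> s \<noteq> t"
    by (auto simp: eventually_at_filter)
  ultimately show "\<forall>\<^sub>F s in at t within {T0..}. dist ((ip (w s 0) \<psi> - ip (w t 0) \<psi>) / (s - t)) (ip (F t) \<psi>) < e"
  proof eventually_elim
    case (elim s)
    hence s: "T0 \<le> s" "s \<noteq> t" by auto
    have sq: "sqint (w s 0)" "sqint (w t 0)" using w_sq[OF s(1), of 0] w_sq[OF t, of 0] by auto
    define A where "A = (ip (w s 0) \<theta> - ip (w t 0) \<theta>) / (s - t)"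
    have "\<bar>ip (w s 0) \<theta> - ip (w t 0) \<theta>\<bar> \<le> (BF * \<bar>s - t\<bar>) * d"
    proof -
      have "\<bar>ip (w s 0) \<theta> - ip (w t 0) \<theta>\<bar> = \<bar>ip (\<lambda>x. w s 0 x - w t 0 x) \<theta>\<bar>" by (simp add: ip_diff_left sq \<theta>)
      also have "\<dots> \<le> nrm (\<lambda>x. w s 0 x - w t 0 x) * nrm \<theta>" by (rule ip_le[OF sqint_diff[OF sq] \<theta>])
      also have "\<dots> \<le> (BF * \<bar>s - t\<bar>) * d"
        using \<phi>(2) d BF_nonneg by (intro mult_mono w_lipschitz t s) (auto simp: \<theta>_def)
      finally show ?thesis .
    qed
    hence "\<bar>A\<bar> \<le> BF * d" using s(2) by (simp add: A_def abs_divide field_simps)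
    moreover have "\<bar>ip (F t) \<theta>\<bar> \<le> BF * d"
    proof -
      have "\<bar>ip (F t) \<theta>\<bar> \<le> nrm (F t) * nrm \<theta>" by (rule ip_le[OF F_sq[OF t] \<theta>])
      also have "\<dots> \<le> BF * d" using \<phi>(2) BF_nonneg by (intro mult_mono F_le t) (auto simp: \<theta>_def)
      finally show ?thesis .
    qed
    moreover have "(ip (w s 0) \<psi> - ip (w t 0) \<psi>) / (s - t) = (ip (w s 0) \<phi> - ip (w t 0) \<phi>) / (s - t) + A"
      unfolding split[OF sq(1)] split[OF sq(2)] A_def by (simp add: add_divide_distrib diff_divide_distrib)
    moreover have "ip (F t) \<psi> = ip (F t) \<phi> + ip (F t) \<theta>" by (rule split[OF F_sq[OF t]])
    ultimately show ?case using elim(1) de e unfolding dist_real_def by linarith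
  qed
qed

text \<open>The energy involves the x-derivative of w, whereas time differences are controlled only
  in L^2. Expanding around time t leaves a linear term, handled by \<open>deriv_ip\<close> with L w
  at the fixed time t, and the energy of the increment. Interpolating twice against the bounded
  third derivative shows the latter to be of order |s - t|^(5/4), hence without effect on the
  derivative.\<close>

lemma deriv_en:
  assumes t: "T0 \<le> t"
  shows "((\<lambda>s. en (w s 0) (w s 1)) has_real_derivative 2 * ip (F t) (LW t)) (at t within {T0..})"
proof -
  define \<Delta> where "\<Delta> = (\<lambda>s i x. w s i x - w t i x)"
  define e where "e = (\<lambda>s. en (\<Delta> s 0) (\<Delta> s 1))"
  have t_sq: "sqint (w t 0)" "sqint (w t 1)" "sqint (w t 2)" using w_sq[OF t] by auto
  have \<Delta>c: "c1_deriv (\<Delta> s 0) (\<Delta> s 1)" "c1_deriv (\<Delta> s 1) (\<Delta> s 2)" "c1_deriv (\<Delta> s 2) (\<Delta> s 3)" if "T0 \<le> s" for s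
    unfolding \<Delta>_def by (intro c1_deriv_diff w01 w12 w23 t that)+
  have \<Delta>s: "sqint (\<Delta> s i)" if "T0 \<le> s" "i \<le> 3" for s i
    unfolding \<Delta>_def by (intro sqint_diff w_sq t that)
  have expand: "en (w s 0) (w s 1) = en (w t 0) (w t 1) + 2 * (ip (w s 0) (LW t) - ip (w t 0) (LW t)) + e s" if s: "T0 \<le> s" for s
  proof -
    have sq: "sqint (w s 0)" using w_sq[OF s, of 0] by simp
    have "(\<lambda>x. w t 0 x + \<Delta> s 0 x) = w s 0" "(\<lambda>x. w t 1 x + \<Delta> s 1 x) = w s 1" by (auto simp: \<Delta>_def)
    moreover have "ip (LW t) (\<Delta> s 0) = ip (w s 0) (LW t) - ip (w t 0) (LW t)"
      unfolding \<Delta>_def ip_diff_right[OF sq t_sq(1) LW_sq[OF t]] by (simp add: ip_commute)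
    moreover have "sqint (\<Delta> s 0)" "sqint (\<Delta> s 1)" using \<Delta>s[OF s] by auto
    ultimately show ?thesis
      using en_add[OF w01[OF t] w12[OF t] t_sq \<Delta>c(1)[OF s]] unfolding e_def LW_def by simp
  qed
  \<comment> \<open>The fourth power of the norm of the second derivative is at most (2 K)^2 times
    the squared norm of the first, which is at most BF |s - t| times 2 K.\<close>
  define c where "c = (2 * K) ^ 3 * BF"
  have n: "nrm (\<Delta> s 0) \<le> BF * \<bar>s - t\<bar>" "nrm (\<Delta> s 2) \<le> sqrt (sqrt (c * \<bar>s - t\<bar>))"
    "(nrm (\<Delta> s 1))\<^sup>2 \<le> nrm (\<Delta> s 0) * nrm (\<Delta> s 2)" if s: "T0 \<le> s" for s
  proof -
    show n0: "nrm (\<Delta> s 0) \<le> BF * \<bar>s - t\<bar>" unfolding \<Delta>_def by (rule w_lipschitz[OF t s])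
    show n1: "(nrm (\<Delta> s 1))\<^sup>2 \<le> nrm (\<Delta> s 0) * nrm (\<Delta> s 2)"
      by (rule nrm_deriv_interpolation[OF \<Delta>c(1,2)[OF s]]) (use \<Delta>s[OF s] in auto)
    have n2: "(nrm (\<Delta> s 2))\<^sup>2 \<le> nrm (\<Delta> s 1) * nrm (\<Delta> s 3)"
      by (rule nrm_deriv_interpolation[OF \<Delta>c(2,3)[OF s]]) (use \<Delta>s[OF s] in auto)
    have b: "nrm (\<Delta> s i) \<le> 2 * K" if "i \<le> 3" for i
      using nrm_triangle_diff[OF w_sq[OF s that] w_sq[OF t that]] w_le_K[OF s that] w_le_K[OF t that] by (simp add: \<Delta>_def)
    have K2: "0 \<le> 2 * K" using K_nonneg by simp
    have "(nrm (\<Delta> s 2))\<^sup>2 \<le> nrm (\<Delta> s 1) * (2 * K)" by (rule order_trans[OF n2]) (intro mult_left_mono b; simp)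
    hence "((nrm (\<Delta> s 2))\<^sup>2)\<^sup>2 \<le> (nrm (\<Delta> s 1) * (2 * K))\<^sup>2" by (intro power_mono) auto
    also have "\<dots> = (2 * K)\<^sup>2 * (nrm (\<Delta> s 1))\<^sup>2" by (simp add: power_mult_distrib)
    also have "\<dots> \<le> (2 * K)\<^sup>2 * ((BF * \<bar>s - t\<bar>) * (2 * K))"
      by (intro mult_left_mono order_trans[OF n1] mult_mono n0 b) (use BF_nonneg in auto)
    also have "\<dots> = c * \<bar>s - t\<bar>" by (simp add: c_def power2_eq_square power3_eq_cube)
    finally show "nrm (\<Delta> s 2) \<le> sqrt (sqrt (c * \<bar>s - t\<bar>))" by (intro real_le_rsqrt)
  qed
  have e_le: "\<bar>e s\<bar> \<le> \<bar>s - t\<bar> * (BF * sqrt (sqrt (c * \<bar>s - t\<bar>)) + CV * BF * (BF * \<bar>s - t\<bar>))" if s: "T0 \<le> s" for s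
  proof -
    have "\<bar>e s\<bar> \<le> (nrm (\<Delta> s 1))\<^sup>2 + CV * (nrm (\<Delta> s 0))\<^sup>2"
      unfolding e_def by (rule en_abs_le) (use \<Delta>s[OF s] in auto)
    also have "\<dots> \<le> (BF * \<bar>s - t\<bar>) * sqrt (sqrt (c * \<bar>s - t\<bar>)) + CV * (BF * \<bar>s - t\<bar>)\<^sup>2"
    proof (rule add_mono)
      show "(nrm (\<Delta> s 1))\<^sup>2 \<le> (BF * \<bar>s - t\<bar>) * sqrt (sqrt (c * \<bar>s - t\<bar>))"
        by (rule order_trans[OF n(3)[OF s]]) (intro mult_mono n s; use BF_nonneg in simp)
      show "CV * (nrm (\<Delta> s 0))\<^sup>2 \<le> CV * (BF * \<bar>s - t\<bar>)\<^sup>2"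
        using CV_pos by (intro mult_left_mono power_mono n s) auto
    qed
    finally show ?thesis by (simp add: power2_eq_square algebra_simps)
  qed
  have e_t: "e t = 0" using e_le[OF t] by simp
  have "(e has_real_derivative 0) (at t within {T0..})"
    unfolding has_field_derivative_iff
  proof (rule Lim_null_comparison)
    let ?\<rho> = "\<lambda>s. BF * sqrt (sqrt (c * \<bar>s - t\<bar>)) + CV * BF * (BF * \<bar>s - t\<bar>)"
    show "\<forall>\<^sub>F s in at t within {T0..}. norm ((e s - e t) / (s - t)) \<le> ?\<rho> s"
      unfolding eventually_at_filter
    proof (intro always_eventually allI impI)
      fix s assume "s \<noteq> t" "s \<in> {T0..}"
      thus "norm ((e s - e t) / (s - t)) \<le> ?\<rho> s"
        using e_le[of s] by (simp add: e_t abs_divide pos_divide_le_eq mult.commute)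
    qed
    have "(?\<rho> \<longlongrightarrow> BF * sqrt (sqrt (c * \<bar>t - t\<bar>)) + CV * BF * (BF * \<bar>t - t\<bar>)) (at t within {T0..})"
      by (intro tendsto_intros)
    thus "(?\<rho> \<longlongrightarrow> 0) (at t within {T0..})" by simp
  qed
  moreover have "((\<lambda>s. en (w t 0) (w t 1) + 2 * (ip (w s 0) (LW t) - ip (w t 0) (LW t))) has_real_derivative
      0 + 2 * (ip (F t) (LW t) - 0)) (at t within {T0..})"
    by (intro DERIV_add DERIV_cmult DERIV_diff DERIV_const deriv_ip t LW_sq)
  ultimately have "((\<lambda>s. en (w t 0) (w t 1) + 2 * (ip (w s 0) (LW t) - ip (w t 0) (LW t)) + e s) has_real_derivative
      (0 + 2 * (ip (F t) (LW t) - 0)) + 0) (at t within {T0..})" by (rule DERIV_add[rotated])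
  hence "((\<lambda>s. en (w t 0) (w t 1) + 2 * (ip (w s 0) (LW t) - ip (w t 0) (LW t)) + e s) has_real_derivative
      2 * ip (F t) (LW t)) (at t within {T0..})" by simp
  thus ?thesis
  proof (rule has_field_derivative_transform_within[where d = 1])
    fix s assume "s \<in> {T0..}"
    hence s: "T0 \<le> s" by simp
    show "en (w t 0) (w t 1) + 2 * (ip (w s 0) (LW t) - ip (w t 0) (LW t)) + e s = en (w s 0) (w s 1)"
      by (rule expand[OF s, symmetric])
  qed (use t in auto)
qed

end

section \<open>A decaying difference vanishes\<close>

context flow
begin

text \<open>The quantity improved by the iteration. In the lemmas below the constants are fixed
  before S and M, which is what makes infinitely many passes possible.\<close>

definition decay :: "real \<Rightarrow> real \<Rightarrow> bool" where
  "decay S M \<longleftrightarrow> T0 \<le> S \<and> 0 \<le> M \<and> (\<forall>t\<ge>S. X t \<le> M * exp (- 2 * e0 * t))"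

lemma decayD: "decay S M \<Longrightarrow> S \<le> t \<Longrightarrow> X t \<le> M * exp (- 2 * e0 * t)"
  "decay S M \<Longrightarrow> S \<le> t \<Longrightarrow> T0 \<le> t" "decay S M \<Longrightarrow> 0 \<le> M"
  by (auto simp: decay_def)

lemma w0_le_X: "nrm (w t 0) \<le> X t" "nrm (w t 1) \<le> X t"
  by (simp_all add: X_def)

lemma exp_mult_exp: "exp (- a * e0 * t) * exp (- b * e0 * t) = exp (- (a + b) * e0 * t)"
  unfolding exp_add[symmetric] by (simp add: algebra_simps)

lemma exp_decay_tendsto: "0 < l \<Longrightarrow> ((\<lambda>t. C * exp (- l * t)) \<longlongrightarrow> 0) at_top" for l C :: real
proof -
  assume "0 < l"
  hence "((\<lambda>t. exp (- l * t)) \<longlongrightarrow> 0) at_top" by real_asymp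
  thus ?thesis by (rule tendsto_mult_right_zero)
qed

lemma has_deriv_subset:
  "(f has_real_derivative D) (at t within {T0..}) \<Longrightarrow> T0 \<le> S \<Longrightarrow> (f has_real_derivative D) (at t within {S..})"
  by (rule DERIV_subset) auto

text \<open>L Y is an eigenfunction of the adjoint flow: since L is symmetric and (L Y)' = - e0 Y,
  the pairing \<alpha> = (w, L Y) satisfies \<alpha>' = e0 \<alpha> - e0 (g w, Y). The homogeneous
  solution grows, so integration from infinity leaves only the source, which carries the extra
  factor exp(-e0 t) of g.\<close>

lemma alpha_decay:
  obtains C where "0 \<le> C" "\<And>S M t. decay S M \<Longrightarrow> S \<le> t \<Longrightarrow> \<bar>ip (w t 0) LY\<bar> \<le> C * M * exp (- 3 * e0 * t)"
proof -
  define R where "R = e0 * K * nrm Y"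
  have R0: "0 \<le> R" using e0 K_nonneg by (simp add: R_def)
  have main: "\<bar>ip (w t 0) LY\<bar> \<le> (R * M) / (e0 + 3 * e0) * exp (- (3 * e0) * t)" if dec: "decay S M" and t: "S \<le> t" for S M t
  proof (rule ode_decay[where l = e0 and r = "\<lambda>t. - (e0 * ip (gw t) Y)" and T = S])
    have TT: "T0 \<le> S" using dec by (simp add: decay_def)
    show "((\<lambda>t. ip (w t 0) LY) has_real_derivative e0 * ip (w t 0) LY + - (e0 * ip (gw t) Y)) (at t within {S..})"
      if "S \<le> t" for t
    proof -
      have t0: "T0 \<le> t" using that TT by simp
      have sq: "sqint (w t 0)" "sqint (w t 1)" "sqint (w t 2)" using w_sq[OF t0] by auto
      have "ip (F t) LY = - ip (\<lambda>x. LW t x - gw t x) (\<lambda>x. - e0 * Y x)"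
        unfolding F_def
        by (rule ip_by_parts[OF c1_deriv_diff[OF LW_c1[OF t0] gw_c1[OF t0]] LY_c1])
           (intro sqint_diff LW_sq gw_sq LW1_sq gw1_sq t0 LY_sq sqint_cmult Y_sq)+
      also have "\<dots> = e0 * (ip (LW t) Y - ip (gw t) Y)"
        unfolding ip_cmult_right ip_diff_left[OF LW_sq[OF t0] gw_sq[OF t0] Y_sq(1)] by simp
      also have "ip (LW t) Y = ip (w t 0) LY"
        using ip_Lop[OF w01[OF t0] w12[OF t0] Y_c1(1) sq Y_sq(1,2)] ip_Lop[OF Y_c1 w01[OF t0] Y_sq sq(1,2)]
        unfolding LW_def ip_commute[of "w t 0" LY] ip_commute[of "w t 1" Y1] ip_V_commute[of "w t 0" Y] by simp
      finally have "ip (F t) LY = e0 * ip (w t 0) LY + - (e0 * ip (gw t) Y)" by (simp add: right_diff_distrib)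
      thus ?thesis using has_deriv_subset[OF deriv_ip[OF t0 LY_sq] TT] by simp
    qed
    show "\<bar>- (e0 * ip (gw t) Y)\<bar> \<le> R * M * exp (- (3 * e0) * t)" if "S \<le> t" for t
    proof -
      have t0: "T0 \<le> t" using that TT by simp
      have sq: "sqint (w t 0)" using w_sq[OF t0, of 0] by simp
      have "\<bar>ip (gw t) Y\<bar> \<le> nrm (gw t) * nrm Y" by (rule ip_le[OF gw_sq[OF t0] Y_sq(1)])
      also have "\<dots> \<le> (K * exp (- e0 * t) * (M * exp (- 2 * e0 * t))) * nrm Y"
      proof (rule mult_right_mono)
        have "nrm (gw t) \<le> K * exp (- e0 * t) * nrm (w t 0)" unfolding gw_def by (rule sq_g(4)[OF t0 sq])
        also have "\<dots> \<le> K * exp (- e0 * t) * (M * exp (- 2 * e0 * t))"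
          using K_nonneg order_trans[OF w0_le_X(1) decayD(1)[OF dec that]] by (intro mult_left_mono) auto
        finally show "nrm (gw t) \<le> K * exp (- e0 * t) * (M * exp (- 2 * e0 * t))" .
      qed simp
      also have "\<dots> = K * nrm Y * M * (exp (- 1 * e0 * t) * exp (- 2 * e0 * t))" by simp
      also have "exp (- 1 * e0 * t) * exp (- 2 * e0 * t) = exp (- (3 * e0) * t)" unfolding exp_mult_exp by simp
      finally have "e0 * \<bar>ip (gw t) Y\<bar> \<le> e0 * (K * nrm Y * M * exp (- (3 * e0) * t))" using e0 by (intro mult_left_mono) auto
      thus ?thesis using e0 by (simp add: abs_mult R_def mult_ac)
    qed
    show "0 < e0 + 3 * e0" using e0 by simp
    show "((\<lambda>t. exp (- e0 * t) * ip (w t 0) LY) \<longlongrightarrow> 0) at_top"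
    proof (rule Lim_null_comparison)
      show "\<forall>\<^sub>F t in at_top. norm (exp (- e0 * t) * ip (w t 0) LY) \<le> M * nrm LY * exp (- 3 * e0 * t)"
        using eventually_ge_at_top[of S]
      proof eventually_elim
        case (elim t)
        have t0: "T0 \<le> t" using elim TT by simp
        have "\<bar>ip (w t 0) LY\<bar> \<le> nrm (w t 0) * nrm LY" by (rule ip_le[OF w_sq[OF t0] LY_sq]) simp
        also have "\<dots> \<le> (M * exp (- 2 * e0 * t)) * nrm LY"
          by (intro mult_right_mono order_trans[OF w0_le_X(1) decayD(1)[OF dec elim]]) simp
        finally have "exp (- 1 * e0 * t) * \<bar>ip (w t 0) LY\<bar> \<le> exp (- 1 * e0 * t) * ((M * exp (- 2 * e0 * t)) * nrm LY)"
          by (intro mult_left_mono) auto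
        also have "\<dots> = M * nrm LY * (exp (- 1 * e0 * t) * exp (- 2 * e0 * t))" by simp
        also have "exp (- 1 * e0 * t) * exp (- 2 * e0 * t) = exp (- 3 * e0 * t)" unfolding exp_mult_exp by simp
        finally show ?case by (simp add: abs_mult)
      qed
      show "((\<lambda>t. M * nrm LY * exp (- 3 * e0 * t)) \<longlongrightarrow> 0) at_top"
        using exp_decay_tendsto[of "3 * e0" "M * nrm LY"] e0 by (simp add: mult.assoc)
    qed
  qed (use t in simp)
  show thesis
  proof (rule that[of "R / (4 * e0)"])
    show "0 \<le> R / (4 * e0)" using R0 e0 by simp
    show "\<bar>ip (w t 0) LY\<bar> \<le> R / (4 * e0) * M * exp (- 3 * e0 * t)" if "decay S M" "S \<le> t" for S M t
      using main[OF that] by simp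
  qed
qed

text \<open>The main part, the pairing of (L w)' with L w, vanishes. What is left contains the
  second derivative of w against (g w)'; moving a derivative back, and using that the pairing of w''
  with g w' is minus half the integral of g' w'^2, leaves only H^1 norms of w and two derivatives of
  g.\<close>

lemma ip_F_LW_le:
  assumes t: "T0 \<le> t"
  shows "\<bar>ip (F t) (LW t)\<bar> \<le> (2 + CV) * K * exp (- e0 * t) * (X t)\<^sup>2"
proof -
  let ?d = "K * exp (- e0 * t)"
  have d0: "0 \<le> ?d" using K_nonneg by simp
  have sq: "sqint (w t 0)" "sqint (w t 1)" "sqint (w t 2)" using w_sq[OF t] by auto
  have "ip (LW1 t) (LW t) = - ip (LW t) (LW1 t)"
    by (rule ip_by_parts[OF LW_c1[OF t] LW_c1[OF t]]) (intro LW_sq LW1_sq t)+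
  hence "ip (LW1 t) (LW t) = 0" by (simp add: ip_commute[of "LW t"])
  hence 1: "ip (F t) (LW t) = - ip (LW t) (gw1 t)"
    unfolding F_def ip_diff_left[OF LW1_sq[OF t] gw1_sq[OF t] LW_sq[OF t]] by (simp add: ip_commute)
  have 2: "ip (LW t) (gw1 t) = - ip (w t 2) (gw1 t) + ip (\<lambda>x. V x * w t 0 x) (gw1 t)"
    unfolding LW_def Lop_def[abs_def] ip_add_left[OF sqint_uminus[OF sq(3)] sqint_V[OF sq(1)] gw1_sq[OF t]] ip_uminus_left ..
  have 3: "ip (w t 2) (gw1 t) = ip (w t 2) (\<lambda>x. g1 t x * w t 0 x) + ip (w t 2) (\<lambda>x. g t x * w t 1 x)"
    unfolding gw1_def by (rule ip_add_right[OF sq_g(2)[OF t sq(1)] sq_g(1)[OF t sq(2)] sq(3)])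
  have 4: "ip (w t 2) (\<lambda>x. g1 t x * w t 0 x) = - ip (w t 1) (\<lambda>x. g2 t x * w t 0 x + g1 t x * w t 1 x)"
    by (rule ip_by_parts[OF w12[OF t] c1_deriv_mult[OF g_c1(2)[OF t] w01[OF t]]]) (intro sq sqint_add sq_g t)+
  have "ip (w t 2) (\<lambda>x. g t x * w t 1 x) = - ip (w t 1) (\<lambda>x. g1 t x * w t 1 x + g t x * w t 2 x)"
    by (rule ip_by_parts[OF w12[OF t] c1_deriv_mult[OF g_c1(1)[OF t] w12[OF t]]]) (intro sq sqint_add sq_g t)+
  also have "ip (w t 1) (\<lambda>x. g1 t x * w t 1 x + g t x * w t 2 x) = ip (w t 1) (\<lambda>x. g1 t x * w t 1 x) + ip (w t 1) (\<lambda>x. g t x * w t 2 x)"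
    by (rule ip_add_right) (intro sq sq_g t)+
  also have "ip (w t 1) (\<lambda>x. g t x * w t 2 x) = ip (w t 2) (\<lambda>x. g t x * w t 1 x)" by (simp add: ip_def mult_ac)
  finally have 5: "2 * ip (w t 2) (\<lambda>x. g t x * w t 1 x) = - ip (w t 1) (\<lambda>x. g1 t x * w t 1 x)" by simp
  have X2: "nrm (w t i) * (?d * nrm (w t j)) \<le> ?d * (nrm (w t i) * nrm (w t j))" for i j by simp
  have b1: "\<bar>ip (w t 1) (\<lambda>x. g2 t x * w t 0 x + g1 t x * w t 1 x)\<bar> \<le> ?d * (X t)\<^sup>2"
  proof -
    have "\<bar>ip (w t 1) (\<lambda>x. g2 t x * w t 0 x + g1 t x * w t 1 x)\<bar> \<le> nrm (w t 1) * nrm (\<lambda>x. g2 t x * w t 0 x + g1 t x * w t 1 x)"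
      by (rule ip_le) (intro sq sqint_add sq_g t)+
    also have "\<dots> \<le> X t * (?d * X t)"
    proof (intro mult_mono w0_le_X)
      have "nrm (\<lambda>x. g2 t x * w t 0 x + g1 t x * w t 1 x) \<le> nrm (\<lambda>x. g2 t x * w t 0 x) + nrm (\<lambda>x. g1 t x * w t 1 x)"
        by (intro nrm_triangle sq_g t sq)
      also have "\<dots> \<le> ?d * nrm (w t 0) + ?d * nrm (w t 1)" by (intro add_mono sq_g t sq)
      finally show "nrm (\<lambda>x. g2 t x * w t 0 x + g1 t x * w t 1 x) \<le> ?d * X t" by (simp add: X_def distrib_left)
    qed (use X_nonneg in auto)
    finally show ?thesis by (simp add: power2_eq_square mult_ac)
  qed
  have b2: "\<bar>ip (w t 1) (\<lambda>x. g1 t x * w t 1 x)\<bar> \<le> ?d * (X t)\<^sup>2"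
  proof -
    have "\<bar>ip (w t 1) (\<lambda>x. g1 t x * w t 1 x)\<bar> \<le> nrm (w t 1) * nrm (\<lambda>x. g1 t x * w t 1 x)" by (rule ip_le) (intro sq sq_g t)+
    also have "\<dots> \<le> X t * (?d * X t)"
      by (intro mult_mono w0_le_X order_trans[OF sq_g(5)[OF t sq(2)]] mult_left_mono d0) (use X_nonneg in auto)
    finally show ?thesis by (simp add: power2_eq_square mult_ac)
  qed
  have b3: "\<bar>ip (\<lambda>x. V x * w t 0 x) (gw1 t)\<bar> \<le> CV * (?d * (X t)\<^sup>2)"
  proof -
    have "\<bar>ip (\<lambda>x. V x * w t 0 x) (gw1 t)\<bar> \<le> nrm (\<lambda>x. V x * w t 0 x) * nrm (gw1 t)"
      by (rule ip_le[OF sqint_V[OF sq(1)] gw1_sq[OF t]])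
    also have "\<dots> \<le> (CV * X t) * (?d * X t)"
    proof (rule mult_mono)
      show "nrm (\<lambda>x. V x * w t 0 x) \<le> CV * X t"
        by (rule order_trans[OF nrm_V[OF sq(1)]]) (intro mult_left_mono w0_le_X; use CV_pos in simp)
    qed (use gw1_le[OF t] CV_pos X_nonneg in auto)
    finally show ?thesis by (simp add: power2_eq_square mult_ac)
  qed
  have z: "0 \<le> ?d * (X t)\<^sup>2" using d0 by simp
  have "\<bar>ip (F t) (LW t)\<bar> \<le> ?d * (X t)\<^sup>2 + ?d * (X t)\<^sup>2 + CV * (?d * (X t)\<^sup>2)"
    using 1 2 3 4 5 b1 b2 b3 z by linarith
  also have "\<dots> = (2 + CV) * K * exp (- e0 * t) * (X t)\<^sup>2" by (simp add: algebra_simps)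
  finally show ?thesis .
qed

lemma X_sq_le: "decay S M \<Longrightarrow> S \<le> t \<Longrightarrow> (X t)\<^sup>2 \<le> M\<^sup>2 * exp (- 4 * e0 * t)"
proof -
  assume d: "decay S M" "S \<le> t"
  have "(X t)\<^sup>2 \<le> (M * exp (- 2 * e0 * t))\<^sup>2" by (intro power_mono decayD(1)[OF d] X_nonneg)
  also have "\<dots> = M\<^sup>2 * (exp (- 2 * e0 * t) * exp (- 2 * e0 * t))" by (simp add: power_mult_distrib power2_eq_square)
  also have "exp (- 2 * e0 * t) * exp (- 2 * e0 * t) = exp (- 4 * e0 * t)" unfolding exp_mult_exp by simp
  finally show ?thesis .
qed

text \<open>The energy is constant up to the perturbation g: its derivative is of size exp(-e0 t)
  X^2, so this is the case l = 0, where decay at infinity fixes the constant of integration.\<close>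

lemma en_decay:
  obtains C where "0 \<le> C" "\<And>S M t. decay S M \<Longrightarrow> S \<le> t \<Longrightarrow> \<bar>en (w t 0) (w t 1)\<bar> \<le> C * M\<^sup>2 * exp (- 5 * e0 * t)"
proof -
  define R where "R = 2 * ((2 + CV) * K)"
  have R0: "0 \<le> R" using CV_pos K_nonneg by (simp add: R_def)
  have main: "\<bar>en (w t 0) (w t 1)\<bar> \<le> (R * M\<^sup>2) / (0 + 5 * e0) * exp (- (5 * e0) * t)" if dec: "decay S M" and t: "S \<le> t" for S M t
  proof (rule ode_decay[where l = 0 and r = "\<lambda>t. 2 * ip (F t) (LW t)" and T = S])
    have TT: "T0 \<le> S" using dec by (simp add: decay_def)
    show "((\<lambda>t. en (w t 0) (w t 1)) has_real_derivative 0 * en (w t 0) (w t 1) + 2 * ip (F t) (LW t)) (at t within {S..})"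
      if "S \<le> t" for t
      using has_deriv_subset[OF deriv_en TT, of t] that TT by simp
    show "\<bar>2 * ip (F t) (LW t)\<bar> \<le> R * M\<^sup>2 * exp (- (5 * e0) * t)" if "S \<le> t" for t
    proof -
      have t0: "T0 \<le> t" using that TT by simp
      have "\<bar>ip (F t) (LW t)\<bar> \<le> (2 + CV) * K * exp (- e0 * t) * (M\<^sup>2 * exp (- 4 * e0 * t))"
        by (rule order_trans[OF ip_F_LW_le[OF t0]])
           (intro mult_left_mono X_sq_le[OF dec that]; use CV_pos K_nonneg in simp)
      also have "\<dots> = (2 + CV) * K * M\<^sup>2 * (exp (- 1 * e0 * t) * exp (- 4 * e0 * t))" by simp
      also have "exp (- 1 * e0 * t) * exp (- 4 * e0 * t) = exp (- (5 * e0) * t)" unfolding exp_mult_exp by simp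
      finally show ?thesis by (simp add: R_def)
    qed
    show "0 < 0 + 5 * e0" using e0 by simp
    show "((\<lambda>t. exp (- 0 * t) * en (w t 0) (w t 1)) \<longlongrightarrow> 0) at_top"
    proof (rule Lim_null_comparison)
      show "\<forall>\<^sub>F t in at_top. norm (exp (- 0 * t) * en (w t 0) (w t 1)) \<le> (1 + CV) * M\<^sup>2 * exp (- 4 * e0 * t)"
        using eventually_ge_at_top[of S]
      proof eventually_elim
        case (elim t)
        have t0: "T0 \<le> t" using elim TT by simp
        have "\<bar>en (w t 0) (w t 1)\<bar> \<le> (nrm (w t 1))\<^sup>2 + CV * (nrm (w t 0))\<^sup>2"
          by (rule en_abs_le) (use w_sq[OF t0] in auto)
        also have "\<dots> \<le> (X t)\<^sup>2 + CV * (X t)\<^sup>2"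
          using CV_pos by (intro add_mono mult_left_mono power_mono w0_le_X) auto
        also have "\<dots> = (1 + CV) * (X t)\<^sup>2" by (simp add: distrib_right)
        also have "\<dots> \<le> (1 + CV) * (M\<^sup>2 * exp (- 4 * e0 * t))"
          using CV_pos by (intro mult_left_mono X_sq_le[OF dec elim]) auto
        finally show ?case by simp
      qed
      show "((\<lambda>t. (1 + CV) * M\<^sup>2 * exp (- 4 * e0 * t)) \<longlongrightarrow> 0) at_top" using e0 by real_asymp
    qed
  qed (use t in simp)
  show thesis
  proof (rule that[of "R / (5 * e0)"])
    show "0 \<le> R / (5 * e0)" using R0 e0 by simp
    show "\<bar>en (w t 0) (w t 1)\<bar> \<le> R / (5 * e0) * M\<^sup>2 * exp (- 5 * e0 * t)" if "decay S M" "S \<le> t" for S M t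
      using main[OF that] by simp
  qed
qed

section \<open>Removing the unstable direction\<close>

definition b where "b t = w t 0 0 / Y 0"
definition z where "z t = (\<lambda>x. w t 0 x - b t * Y x)"
definition z1 where "z1 t = (\<lambda>x. w t 1 x - b t * Y1 x)"
text \<open>The square root of the energy bound M^2 exp(-5 e0 t); it gains exp(-e0 t/2) over the
  bound in \<open>decay\<close>.\<close>

definition rate where "rate M t = M * exp (- (5 / 2) * e0 * t)"

lemma rate_nonneg: "0 \<le> M \<Longrightarrow> 0 \<le> rate M t" by (simp add: rate_def)

lemma z_admissible: "T0 \<le> t \<Longrightarrow> admissible (z t) (z1 t)"
proof -
  assume t: "T0 \<le> t"
  have sq: "sqint (w t 0)" "sqint (w t 1)" using w_sq[OF t] by auto
  have "z t 0 = 0" using Y_0 by (simp add: z_def b_def)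
  moreover have "c1_deriv (z t) (z1 t)" unfolding z_def z1_def by (intro c1_deriv_diff c1_deriv_cmult w01 t Y_c1)
  moreover have "sqint (z t)" "sqint (z1 t)" unfolding z_def z1_def by (intro sqint_diff sqint_cmult sq Y_sq)+
  ultimately show ?thesis by (simp add: admissible_def)
qed

lemma b_le: "decay S M \<Longrightarrow> S \<le> t \<Longrightarrow> \<bar>b t\<bar> \<le> M * exp (- 2 * e0 * t) / \<bar>Y 0\<bar>"
proof -
  assume d: "decay S M" "S \<le> t"
  have t0: "T0 \<le> t" by (rule decayD(2)[OF d])
  have "\<bar>w t 0 0\<bar> \<le> X t" unfolding X_def by (rule sqint_sup_le[OF w01[OF t0]]) (use w_sq[OF t0] in auto)
  also have "\<dots> \<le> M * exp (- 2 * e0 * t)" by (rule decayD(1)[OF d])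
  finally show ?thesis unfolding b_def abs_divide by (rule divide_right_mono) simp
qed

lemma en_z: "T0 \<le> t \<Longrightarrow> en (z t) (z1 t) = en (w t 0) (w t 1) - 2 * b t * ip (w t 0) LY"
proof -
  assume t: "T0 \<le> t"
  have sq: "sqint (w t 0)" "sqint (w t 1)" using w_sq[OF t] by auto
  have L: "Lop (\<lambda>x. - b t * Y x) (\<lambda>x. - b t * Y2 x) = (\<lambda>x. - b t * LY x)"
    by (simp add: Lop_def fun_eq_iff algebra_simps)
  have "en (\<lambda>x. - b t * Y x) (\<lambda>x. - b t * Y1 x) = (b t)\<^sup>2 * en Y Y1"
    unfolding en_def by (subst integral_mult_right_zero[symmetric]) (simp add: power_mult_distrib algebra_simps)
  hence 0: "en (\<lambda>x. - b t * Y x) (\<lambda>x. - b t * Y1 x) = 0" by (simp only: en_Y mult_zero_right)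
  have "en (\<lambda>x. - b t * Y x + w t 0 x) (\<lambda>x. - b t * Y1 x + w t 1 x) =
      en (\<lambda>x. - b t * Y x) (\<lambda>x. - b t * Y1 x) + 2 * ip (Lop (\<lambda>x. - b t * Y x) (\<lambda>x. - b t * Y2 x)) (w t 0) + en (w t 0) (w t 1)"
    by (rule en_add) (intro c1_deriv_cmult Y_c1 sqint_cmult Y_sq w01 t sq)+
  moreover have "(\<lambda>x. - b t * Y x + w t 0 x) = z t" "(\<lambda>x. - b t * Y1 x + w t 1 x) = z1 t"
    by (auto simp: z_def z1_def)
  ultimately show ?thesis unfolding L 0 ip_cmult_left ip_commute[of LY] by simp
qed

text \<open>Only the cross term 2 b (w, L Y) distinguishes the energies of z and w. It has the right
  order because 2 + 3 = 5: b inherits exp(-2 e0 t) from the sup norm of w, and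
  \<open>alpha_decay\<close> supplies exp(-3 e0 t).\<close>

lemma sqrt_en_z_decay:
  obtains C where "0 \<le> C" "\<And>S M t. decay S M \<Longrightarrow> S \<le> t \<Longrightarrow> sqrt (en (z t) (z1 t)) \<le> C * rate M t"
proof -
  obtain C1 where C1: "0 \<le> C1" "\<And>S M t. decay S M \<Longrightarrow> S \<le> t \<Longrightarrow> \<bar>ip (w t 0) LY\<bar> \<le> C1 * M * exp (- 3 * e0 * t)"
    using alpha_decay by blast
  obtain C2 where C2: "0 \<le> C2" "\<And>S M t. decay S M \<Longrightarrow> S \<le> t \<Longrightarrow> \<bar>en (w t 0) (w t 1)\<bar> \<le> C2 * M\<^sup>2 * exp (- 5 * e0 * t)"
    using en_decay by blast
  define C where "C = C2 + 2 * (C1 / \<bar>Y 0\<bar>)"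
  have C0: "0 \<le> C" using C1 C2 by (simp add: C_def)
  show thesis
  proof (rule that[of "sqrt C"])
    show "0 \<le> sqrt C" using C0 by simp
    fix S M t assume d: "decay S M" "S \<le> t"
    have M0: "0 \<le> M" by (rule decayD(3)[OF d(1)])
    have "\<bar>b t * ip (w t 0) LY\<bar> \<le> (M * exp (- 2 * e0 * t) / \<bar>Y 0\<bar>) * (C1 * M * exp (- 3 * e0 * t))"
      unfolding abs_mult using M0 by (intro mult_mono b_le[OF d] C1(2)[OF d]) auto
    also have "\<dots> = C1 / \<bar>Y 0\<bar> * M\<^sup>2 * (exp (- 2 * e0 * t) * exp (- 3 * e0 * t))"
      by (simp add: power2_eq_square)
    also have "exp (- 2 * e0 * t) * exp (- 3 * e0 * t) = exp (- 5 * e0 * t)" unfolding exp_mult_exp by simp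
    finally have "en (z t) (z1 t) \<le> C2 * M\<^sup>2 * exp (- 5 * e0 * t) + 2 * (C1 / \<bar>Y 0\<bar> * M\<^sup>2 * exp (- 5 * e0 * t))"
      unfolding en_z[OF decayD(2)[OF d]] using C2(2)[OF d] by linarith
    also have "\<dots> = C * (M\<^sup>2 * exp (- 5 * e0 * t))" by (simp add: C_def algebra_simps)
    also have "M\<^sup>2 * exp (- 5 * e0 * t) = (rate M t)\<^sup>2"
    proof -
      have "(rate M t)\<^sup>2 = M\<^sup>2 * (exp (- (5 / 2) * e0 * t) * exp (- (5 / 2) * e0 * t))"
        by (simp add: rate_def power2_eq_square)
      also have "exp (- (5 / 2) * e0 * t) * exp (- (5 / 2) * e0 * t) = exp (- 5 * e0 * t)" unfolding exp_mult_exp by simp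
      finally show ?thesis ..
    qed
    finally have "sqrt (en (z t) (z1 t)) \<le> sqrt (C * (rate M t)\<^sup>2)" by (rule real_sqrt_le_mono)
    also have "\<dots> = sqrt C * rate M t" using rate_nonneg[OF M0, of t] by (simp add: real_sqrt_mult)
    finally show "sqrt (en (z t) (z1 t)) \<le> sqrt C * rate M t" .
  qed
qed

text \<open>On compact subsets of a half line, \<^term>\<open>w t 0\<close> is close to the span of \<^term>\<open>Y\<close> and \<^term>\<open>Q'\<close>, so the pairing
  with a test function supported there satisfies a closed ordinary differential equation up to errors of size \<^term>\<open>rate\<close>.\<close>

lemma test_dynamics:
  assumes \<phi>: "\<phi> \<in> test_functions" "\<And>x. x \<notin> {lo..hi} \<Longrightarrow> \<phi> x = 0"
    and near: "\<And>t x. T0 \<le> t \<Longrightarrow> lo \<le> x \<Longrightarrow> x \<le> hi \<Longrightarrow> \<bar>z t x - c t * Q' x\<bar> \<le> Cn * sqrt (en (z t) (z1 t))"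
  obtains C where "0 \<le> C"
    "\<And>S M t. decay S M \<Longrightarrow> S \<le> t \<Longrightarrow> \<bar>ip (w t 0) \<phi> - b t * ip Y \<phi> - c t * ip Q' \<phi>\<bar> \<le> C * rate M t"
    "\<And>S M t. decay S M \<Longrightarrow> S \<le> t \<Longrightarrow> \<bar>ip (F t) \<phi> + e0 * b t * ip Y \<phi>\<bar> \<le> C * rate M t"
proof -
  obtain Cs where Cs: "0 \<le> Cs" "\<And>S M t. decay S M \<Longrightarrow> S \<le> t \<Longrightarrow> sqrt (en (z t) (z1 t)) \<le> Cs * rate M t"
    using sqrt_en_z_decay by blast
  note \<phi>1 = test_deriv[OF \<phi>(1)] note \<phi>2 = test_deriv[OF \<phi>1] note \<phi>3 = test_deriv[OF \<phi>2]
  have 3: "(deriv ^^ 3) \<phi> = deriv (deriv (deriv \<phi>))" by (simp add: numeral_3_eq_3)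
  \<comment> \<open>L applied to the derivative of \<phi>, so that (L w)' paired with \<phi> is -(w,
    \<psi>). The pairing of \<psi> with \<open>Q'\<close> vanishes and that with Y is e0 (Y,
    \<phi>); hence the coefficient c drops out of the time derivative.\<close>
  define \<psi> where "\<psi> = (\<lambda>x. - (deriv ^^ 3) \<phi> x + V x * deriv \<phi> x)"
  have out: "deriv f x = 0" if "\<And>x. x \<notin> {lo..hi} \<Longrightarrow> f x = 0" "x \<notin> {lo..hi}" for f :: "real \<Rightarrow> real" and x
    by (rule deriv_eq_0_outside[where S = "- {lo..hi}"]) (use that in auto)
  have \<phi>1_0: "deriv \<phi> x = 0" if "x \<notin> {lo..hi}" for x using out[OF \<phi>(2) that] .
  have \<phi>2_0: "deriv (deriv \<phi>) x = 0" if "x \<notin> {lo..hi}" for x using out[OF \<phi>1_0 that] .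
  have \<phi>3_0: "deriv (deriv (deriv \<phi>)) x = 0" if "x \<notin> {lo..hi}" for x using out[OF \<phi>2_0 that] .
  have \<psi>_0: "\<psi> x = 0" if "x \<notin> {lo..hi}" for x using \<phi>1_0[OF that] \<phi>3_0[OF that] by (simp add: \<psi>_def 3)
  have \<phi>_int: "integrable lborel (\<lambda>x. f x * \<phi> x)" if "continuous_on UNIV f" for f
    by (rule continuous_test_integrable[OF \<phi>(1) that])
  have \<psi>_int: "integrable lborel (\<lambda>x. f x * \<psi> x)" if f: "continuous_on UNIV f" for f
  proof -
    have "continuous_on UNIV (\<lambda>x. f x * V x)" by (intro continuous_intros f c1_deriv_cont[OF c1_V])
    hence "integrable lborel (\<lambda>x. - (f x * deriv (deriv (deriv \<phi>)) x) + (f x * V x) * deriv \<phi> x)"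
      by (intro Bochner_Integration.integrable_add integrable_minus continuous_test_integrable[OF \<phi>3 f] continuous_test_integrable[OF \<phi>1])
    thus ?thesis by (rule back_subst[of "integrable lborel"]) (simp add: \<psi>_def 3 fun_eq_iff algebra_simps)
  qed
  have pair: "\<bar>ip (w t 0) \<theta> - b t * ip Y \<theta> - c t * ip Q' \<theta>\<bar> \<le> \<bar>Cn\<bar> * Cs * (LINT x|lborel. \<bar>\<theta> x\<bar>) * rate M t"
    if \<theta>: "\<And>x. x \<notin> {lo..hi} \<Longrightarrow> \<theta> x = 0" "\<And>f. continuous_on UNIV f \<Longrightarrow> integrable lborel (\<lambda>x. f x * \<theta> x)"
      and d: "decay S M" "S \<le> t" for \<theta> S M t
  proof -
    have t0: "T0 \<le> t" by (rule decayD(2)[OF d])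
    note i = \<theta>(2)[OF c1_deriv_cont(1)[OF w01[OF t0]]] \<theta>(2)[OF c1_deriv_cont(1)[OF Y_c1(1)]] \<theta>(2)[OF Q'_cont]
    have zc: "continuous_on UNIV (\<lambda>x. z t x - c t * Q' x)"
      unfolding z_def
      by (rule continuous_on_diff[OF continuous_on_diff[OF c1_deriv_cont(1)[OF w01[OF t0]] continuous_on_mult_left[OF c1_deriv_cont(1)[OF Y_c1(1)]]]
            continuous_on_mult_left[OF Q'_cont]])
    have \<theta>i: "integrable lborel \<theta>" using \<theta>(2)[of "\<lambda>x. 1"] by simp
    have "ip (w t 0) \<theta> - b t * ip Y \<theta> - c t * ip Q' \<theta> = (LINT x|lborel. w t 0 x * \<theta> x - b t * (Y x * \<theta> x) - c t * (Q' x * \<theta> x))"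
      unfolding ip_def using i
      by (simp only: Bochner_Integration.integral_diff integral_mult_right_zero integrable_mult_right Bochner_Integration.integrable_diff)
    also have "\<dots> = (LINT x|lborel. (z t x - c t * Q' x) * \<theta> x)"
      by (intro Bochner_Integration.integral_cong) (auto simp: z_def algebra_simps)
    finally have "\<bar>ip (w t 0) \<theta> - b t * ip Y \<theta> - c t * ip Q' \<theta>\<bar> \<le> (LINT x|lborel. \<bar>(z t x - c t * Q' x) * \<theta> x\<bar>)"
      by (simp only: integral_abs_bound)
    also have "\<dots> \<le> (LINT x|lborel. \<bar>Cn\<bar> * Cs * rate M t * \<bar>\<theta> x\<bar>)"
    proof (rule integral_mono)
      show "integrable lborel (\<lambda>x. \<bar>(z t x - c t * Q' x) * \<theta> x\<bar>)" by (rule integrable_abs[OF \<theta>(2)[OF zc]])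
      show "integrable lborel (\<lambda>x. \<bar>Cn\<bar> * Cs * rate M t * \<bar>\<theta> x\<bar>)" by (rule integrable_mult_right[OF integrable_abs[OF \<theta>i]])
      fix x
      show "\<bar>(z t x - c t * Q' x) * \<theta> x\<bar> \<le> \<bar>Cn\<bar> * Cs * rate M t * \<bar>\<theta> x\<bar>"
      proof (cases "x \<in> {lo..hi}")
        case True
        have "\<bar>z t x - c t * Q' x\<bar> \<le> Cn * sqrt (en (z t) (z1 t))" by (rule near[OF t0]) (use True in auto)
        also have "\<dots> \<le> \<bar>Cn\<bar> * sqrt (en (z t) (z1 t))"
          using en_half_le_en(3)[OF z_admissible[OF t0]] by (intro mult_right_mono) auto
        also have "\<dots> \<le> \<bar>Cn\<bar> * (Cs * rate M t)" by (intro mult_left_mono Cs(2)[OF d]) simp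
        finally show ?thesis by (simp only: abs_mult mult.assoc[symmetric] mult_right_mono abs_ge_zero)
      next
        case False
        show ?thesis using \<theta>(1)[OF False] by simp
      qed
    qed
    also have "\<dots> = \<bar>Cn\<bar> * Cs * (LINT x|lborel. \<bar>\<theta> x\<bar>) * rate M t" by simp
    finally show ?thesis .
  qed
  have Q\<psi>: "ip Q' \<psi> = 0"
  proof -
    have "ip Q' \<psi> = (LINT x|lborel. Lop Q' (\<lambda>x. V x * Q' x) x * deriv \<phi> x)"
      unfolding ip_def \<psi>_def by (rule integral_Lop_test[OF c1_Q' c1_Q'' \<phi>(1)])
    thus ?thesis by (simp add: Lop_def)
  qed
  have Y\<psi>: "ip Y \<psi> = e0 * ip Y \<phi>"
  proof -
    have "ip Y \<psi> = (LINT x|lborel. LY x * deriv \<phi> x)"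
      unfolding ip_def \<psi>_def by (rule integral_Lop_test[OF Y_c1 \<phi>(1)])
    also have "\<dots> = - (LINT x|lborel. - e0 * Y x * \<phi> x)" using integral_by_parts_test[OF LY_c1 \<phi>(1)] by simp
    also have "\<dots> = e0 * ip Y \<phi>" by (simp add: ip_def mult.assoc)
    finally show ?thesis .
  qed
  define I where "I = (LINT x|lborel. \<bar>\<phi> x\<bar>) + (LINT x|lborel. \<bar>\<psi> x\<bar>)"
  define C where "C = \<bar>Cn\<bar> * Cs * I + K * nrm (deriv \<phi>)"
  have I0: "0 \<le> (LINT x|lborel. \<bar>\<phi> x\<bar>)" "0 \<le> (LINT x|lborel. \<bar>\<psi> x\<bar>)" by auto
  have Kn: "0 \<le> K * nrm (deriv \<phi>)" using K_nonneg by simp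
  have cc: "0 \<le> \<bar>Cn\<bar> * Cs" using Cs by simp
  show thesis
  proof (rule that[of C])
    show "0 \<le> C" unfolding C_def I_def by (intro add_nonneg_nonneg[OF mult_nonneg_nonneg[OF cc add_nonneg_nonneg[OF I0]] Kn])
    fix S M t assume d: "decay S M" "S \<le> t"
    have t0: "T0 \<le> t" by (rule decayD(2)[OF d])
    have M0: "0 \<le> M" by (rule decayD(3)[OF d(1)])
    have r0: "0 \<le> rate M t" by (rule rate_nonneg[OF M0])
    have "\<bar>Cn\<bar> * Cs * (LINT x|lborel. \<bar>\<phi> x\<bar>) \<le> C"
      unfolding C_def I_def distrib_left using mult_nonneg_nonneg[OF cc I0(2)] Kn by linarith
    thus "\<bar>ip (w t 0) \<phi> - b t * ip Y \<phi> - c t * ip Q' \<phi>\<bar> \<le> C * rate M t"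
      by (intro order_trans[OF pair[OF \<phi>(2) \<phi>_int d]] mult_right_mono r0)
    have 1: "\<bar>ip (w t 0) \<psi> - b t * (e0 * ip Y \<phi>)\<bar> \<le> \<bar>Cn\<bar> * Cs * (LINT x|lborel. \<bar>\<psi> x\<bar>) * rate M t"
      using pair[OF \<psi>_0 \<psi>_int d] unfolding Q\<psi> Y\<psi> by simp
    have 2: "\<bar>ip (gw t) (deriv \<phi>)\<bar> \<le> K * nrm (deriv \<phi>) * rate M t"
    proof -
      have sq: "sqint (w t 0)" using w_sq[OF t0, of 0] by simp
      have "\<bar>ip (gw t) (deriv \<phi>)\<bar> \<le> nrm (gw t) * nrm (deriv \<phi>)" by (rule ip_le[OF gw_sq[OF t0] test_sqint[OF \<phi>1]])
      also have "nrm (gw t) \<le> K * rate M t"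
      proof -
        have "nrm (gw t) \<le> K * exp (- e0 * t) * nrm (w t 0)" unfolding gw_def by (rule sq_g(4)[OF t0 sq])
        also have "\<dots> \<le> K * exp (- e0 * t) * (M * exp (- 2 * e0 * t))"
          using K_nonneg order_trans[OF w0_le_X(1) decayD(1)[OF d]] by (intro mult_left_mono) auto
        also have "\<dots> = K * M * (exp (- 1 * e0 * t) * exp (- 2 * e0 * t))" by simp
        \<comment> \<open>1 + 2 = 1/2 + 5/2; the surplus exp(-e0 t/2) is at most 1 and is dropped to
          reach \<open>rate\<close>.\<close>
        also have "exp (- 1 * e0 * t) * exp (- 2 * e0 * t) = exp (- (1 / 2) * e0 * t) * exp (- (5 / 2) * e0 * t)"
          unfolding exp_mult_exp by simp
        also have "\<dots> \<le> 1 * exp (- (5 / 2) * e0 * t)"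
          by (intro mult_right_mono exp_le_1[OF t0]) auto
        finally show ?thesis using K_nonneg M0 by (simp add: rate_def mult.assoc mult_left_mono)
      qed
      finally show ?thesis by (simp add: mult_ac mult_right_mono)
    qed
    have "ip (F t) \<phi> = - ip (w t 0) \<psi> + ip (gw t) (deriv \<phi>)"
      using F_test[OF t0 \<phi>(1)] unfolding \<psi>_def ip_def by simp
    hence "\<bar>ip (F t) \<phi> + e0 * b t * ip Y \<phi>\<bar> \<le> \<bar>Cn\<bar> * Cs * (LINT x|lborel. \<bar>\<psi> x\<bar>) * rate M t + K * nrm (deriv \<phi>) * rate M t"
      using 1 2 unfolding mult.left_commute[of "b t" e0] mult.assoc[of e0 "b t"] by linarith
    also have "\<bar>Cn\<bar> * Cs * (LINT x|lborel. \<bar>\<psi> x\<bar>) * rate M t + K * nrm (deriv \<phi>) * rate M t = (\<bar>Cn\<bar> * Cs * (LINT x|lborel. \<bar>\<psi> x\<bar>) + K * nrm (deriv \<phi>)) * rate M t" by (rule distrib_right[symmetric])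
    also have "\<dots> \<le> C * rate M t"
      unfolding C_def I_def distrib_left using mult_nonneg_nonneg[OF cc I0(1)] by (intro mult_right_mono r0) linarith
    finally show "\<bar>ip (F t) \<phi> + e0 * b t * ip Y \<phi>\<bar> \<le> C * rate M t" .
  qed
qed

lemma near_right:
  assumes "0 < a" "a \<le> 1" "1 \<le> d"
  obtains C where "\<And>t x. T0 \<le> t \<Longrightarrow> a \<le> x \<Longrightarrow> x \<le> d \<Longrightarrow> \<bar>z t x - z t 1 / Q' 1 * Q' x\<bar> \<le> C * sqrt (en (z t) (z1 t))"
proof (rule near_kernel_right[OF assms])
  fix C assume "0 \<le> C" and *: "\<And>f f' x. admissible f f' \<Longrightarrow> a \<le> x \<Longrightarrow> x \<le> d \<Longrightarrow> \<bar>f x - f 1 / Q' 1 * Q' x\<bar> \<le> C * sqrt (en f f')"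
  from that[OF *[OF z_admissible]] show thesis .
qed

lemma near_left:
  assumes "0 < a" "a \<le> 1" "1 \<le> d"
  obtains C where "\<And>t x. T0 \<le> t \<Longrightarrow> - d \<le> x \<Longrightarrow> x \<le> - a \<Longrightarrow> \<bar>z t x - z t (- 1) / Q' (- 1) * Q' x\<bar> \<le> C * sqrt (en (z t) (z1 t))"
proof (rule near_kernel_left[OF assms])
  fix C assume "0 \<le> C" and *: "\<And>f f' x. admissible f f' \<Longrightarrow> - d \<le> x \<Longrightarrow> x \<le> - a \<Longrightarrow> \<bar>f x - f (- 1) / Q' (- 1) * Q' x\<bar> \<le> C * sqrt (en f f')"
  from that[OF *[OF z_admissible]] show thesis .
qed

lemma ip_w_tendsto:
  assumes dec: "decay S M" and \<phi>: "sqint \<phi>" and l: "- 2 * e0 < l"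
  shows "((\<lambda>t. exp (- l * t) * ip (w t 0) \<phi>) \<longlongrightarrow> 0) at_top"
proof (rule Lim_null_comparison)
  show "\<forall>\<^sub>F t in at_top. norm (exp (- l * t) * ip (w t 0) \<phi>) \<le> M * nrm \<phi> * exp (- (l + 2 * e0) * t)"
    using eventually_ge_at_top[of S]
  proof eventually_elim
    case (elim t)
    have t0: "T0 \<le> t" by (rule decayD(2)[OF dec elim])
    have "\<bar>ip (w t 0) \<phi>\<bar> \<le> nrm (w t 0) * nrm \<phi>" by (rule ip_le[OF w_sq[OF t0] \<phi>]) simp
    also have "\<dots> \<le> (M * exp (- 2 * e0 * t)) * nrm \<phi>"
      by (intro mult_right_mono order_trans[OF w0_le_X(1) decayD(1)[OF dec elim]]) simp
    finally have "exp (- l * t) * \<bar>ip (w t 0) \<phi>\<bar> \<le> exp (- l * t) * ((M * exp (- 2 * e0 * t)) * nrm \<phi>)"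
      by (intro mult_left_mono) auto
    also have "\<dots> = M * nrm \<phi> * (exp (- l * t) * exp (- 2 * e0 * t))" by simp
    also have "exp (- l * t) * exp (- 2 * e0 * t) = exp (- (l + 2 * e0) * t)"
      unfolding exp_add[symmetric] by (simp add: algebra_simps)
    finally show ?case by (simp add: abs_mult)
  qed
  have "0 < l + 2 * e0" using l by simp
  thus "((\<lambda>t. M * nrm \<phi> * exp (- (l + 2 * e0) * t)) \<longlongrightarrow> 0) at_top" by (rule exp_decay_tendsto)
qed

text \<open>For the dual test function the pairing \<beta> = (w, \<phi>) equals b up to
  \<open>rate\<close>, and its derivative equals - e0 b up to \<open>rate\<close>, so \<beta>' = -
  e0 \<beta> with an error of that size. The homogeneous solution exp(-e0 t) decays too slowly to be
  compatible with w = O(exp(-2 e0 t)), so \<beta>, and with it b, inherits the size of the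
  error.\<close>

lemma b_decay:
  obtains C where "0 \<le> C" "\<And>S M t. decay S M \<Longrightarrow> S \<le> t \<Longrightarrow> \<bar>b t\<bar> \<le> C * rate M t"
proof -
  obtain \<phi> a d where \<phi>: "\<phi> \<in> test_functions" "0 < a" "a \<le> 1" "1 \<le> d" "\<And>x. x \<notin> {a..d} \<Longrightarrow> \<phi> x = 0"
    "ip Q' \<phi> = 0" "ip Y \<phi> = 1"
    using dual_test_function by blast
  obtain Cn where Cn: "\<And>t x. T0 \<le> t \<Longrightarrow> a \<le> x \<Longrightarrow> x \<le> d \<Longrightarrow> \<bar>z t x - z t 1 / Q' 1 * Q' x\<bar> \<le> Cn * sqrt (en (z t) (z1 t))"
    using near_right[OF \<phi>(2-4)] by blast
  obtain C where C: "0 \<le> C"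
    "\<And>S M t. decay S M \<Longrightarrow> S \<le> t \<Longrightarrow> \<bar>ip (w t 0) \<phi> - b t * ip Y \<phi> - z t 1 / Q' 1 * ip Q' \<phi>\<bar> \<le> C * rate M t"
    "\<And>S M t. decay S M \<Longrightarrow> S \<le> t \<Longrightarrow> \<bar>ip (F t) \<phi> + e0 * b t * ip Y \<phi>\<bar> \<le> C * rate M t"
    using test_dynamics[OF \<phi>(1,5) Cn] by blast
  define R where "R = C + e0 * C"
  have main: "\<bar>ip (w t 0) \<phi>\<bar> \<le> (R * M) / (- e0 + 5 / 2 * e0) * exp (- (5 / 2 * e0) * t)" if dec: "decay S M" and t: "S \<le> t" for S M t
  proof (rule ode_decay[where l = "- e0" and r = "\<lambda>t. ip (F t) \<phi> + e0 * ip (w t 0) \<phi>" and T = S])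
    have TT: "T0 \<le> S" using dec by (simp add: decay_def)
    show "((\<lambda>t. ip (w t 0) \<phi>) has_real_derivative - e0 * ip (w t 0) \<phi> + (ip (F t) \<phi> + e0 * ip (w t 0) \<phi>)) (at t within {S..})"
      if "S \<le> t" for t
      using has_deriv_subset[OF deriv_ip[OF _ test_sqint[OF \<phi>(1)]] TT, of t] that TT by simp
    show "\<bar>ip (F t) \<phi> + e0 * ip (w t 0) \<phi>\<bar> \<le> R * M * exp (- (5 / 2 * e0) * t)" if "S \<le> t" for t
    proof -
      have "\<bar>ip (w t 0) \<phi> - b t\<bar> \<le> C * rate M t" using C(2)[OF dec that] by (simp add: \<phi>)
      hence "e0 * \<bar>ip (w t 0) \<phi> - b t\<bar> \<le> e0 * (C * rate M t)" using e0 by (intro mult_left_mono) auto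
      hence "\<bar>e0 * ip (w t 0) \<phi> - e0 * b t\<bar> \<le> e0 * (C * rate M t)" using e0 by (simp add: abs_mult flip: right_diff_distrib)
      moreover have "\<bar>ip (F t) \<phi> + e0 * b t\<bar> \<le> C * rate M t" using C(3)[OF dec that] by (simp add: \<phi>)
      ultimately have "\<bar>ip (F t) \<phi> + e0 * ip (w t 0) \<phi>\<bar> \<le> C * rate M t + e0 * (C * rate M t)" by linarith
      thus ?thesis by (simp add: R_def rate_def algebra_simps)
    qed
    show "0 < - e0 + 5 / 2 * e0" using e0 by simp
    show "((\<lambda>t. exp (- (- e0) * t) * ip (w t 0) \<phi>) \<longlongrightarrow> 0) at_top"
      by (rule ip_w_tendsto[OF dec test_sqint[OF \<phi>(1)]]) (use e0 in simp)
  qed (use t in simp)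
  show thesis
  proof (rule that[of "R / (3 / 2 * e0) + C"])
    have "0 \<le> R" using C(1) e0 by (simp add: R_def)
    thus "0 \<le> R / (3 / 2 * e0) + C" using C(1) e0 by simp
    fix S M t assume d: "decay S M" "S \<le> t"
    have "\<bar>ip (w t 0) \<phi>\<bar> \<le> R / (3 / 2 * e0) * rate M t" using main[OF d] by (simp add: rate_def mult.assoc)
    moreover have "\<bar>ip (w t 0) \<phi> - b t\<bar> \<le> C * rate M t" using C(2)[OF d] by (simp add: \<phi>)
    ultimately show "\<bar>b t\<bar> \<le> (R / (3 / 2 * e0) + C) * rate M t" unfolding distrib_right by linarith
  qed
qed

text \<open>\<open>Q'\<close> does not contribute to the derivative of (w, \<phi>), so once b is of
  size \<open>rate\<close> that derivative is too. Integrating from infinity bounds (w, \<phi>), and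
  c follows on dividing by the nonzero pairing of \<open>Q'\<close> with \<phi>.\<close>

lemma kernel_coefficient_decay:
  assumes \<phi>: "\<phi> \<in> test_functions" "\<And>x. x \<notin> {lo..hi} \<Longrightarrow> \<phi> x = 0" "ip Q' \<phi> \<noteq> 0"
    and near: "\<And>t x. T0 \<le> t \<Longrightarrow> lo \<le> x \<Longrightarrow> x \<le> hi \<Longrightarrow> \<bar>z t x - c t * Q' x\<bar> \<le> Cn * sqrt (en (z t) (z1 t))"
  obtains C where "0 \<le> C" "\<And>S M t. decay S M \<Longrightarrow> S \<le> t \<Longrightarrow> \<bar>c t\<bar> \<le> C * rate M t"
proof -
  obtain Cb where Cb: "0 \<le> Cb" "\<And>S M t. decay S M \<Longrightarrow> S \<le> t \<Longrightarrow> \<bar>b t\<bar> \<le> Cb * rate M t" using b_decay by blast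
  obtain C where C: "0 \<le> C"
    "\<And>S M t. decay S M \<Longrightarrow> S \<le> t \<Longrightarrow> \<bar>ip (w t 0) \<phi> - b t * ip Y \<phi> - c t * ip Q' \<phi>\<bar> \<le> C * rate M t"
    "\<And>S M t. decay S M \<Longrightarrow> S \<le> t \<Longrightarrow> \<bar>ip (F t) \<phi> + e0 * b t * ip Y \<phi>\<bar> \<le> C * rate M t"
    using test_dynamics[OF \<phi>(1,2) near] by blast
  define y where "y = \<bar>ip Y \<phi>\<bar>"
  have by_le: "\<bar>b t * ip Y \<phi>\<bar> \<le> Cb * y * rate M t" if "decay S M" "S \<le> t" for S M t
    using mult_right_mono[OF Cb(2)[OF that], of y] by (simp add: y_def abs_mult mult_ac)
  define R where "R = C + e0 * (Cb * y)"
  have main: "\<bar>ip (w t 0) \<phi>\<bar> \<le> (R * M) / (0 + 5 / 2 * e0) * exp (- (5 / 2 * e0) * t)" if dec: "decay S M" and t: "S \<le> t" for S M t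
  proof (rule ode_decay[where l = 0 and r = "\<lambda>t. ip (F t) \<phi>" and T = S])
    have TT: "T0 \<le> S" using dec by (simp add: decay_def)
    show "((\<lambda>t. ip (w t 0) \<phi>) has_real_derivative 0 * ip (w t 0) \<phi> + ip (F t) \<phi>) (at t within {S..})"
      if "S \<le> t" for t
      using has_deriv_subset[OF deriv_ip[OF _ test_sqint[OF \<phi>(1)]] TT, of t] that TT by simp
    show "\<bar>ip (F t) \<phi>\<bar> \<le> R * M * exp (- (5 / 2 * e0) * t)" if "S \<le> t" for t
    proof -
      have "e0 * \<bar>b t * ip Y \<phi>\<bar> \<le> e0 * (Cb * y * rate M t)" using e0 by_le[OF dec that] by (intro mult_left_mono) auto
      hence "\<bar>e0 * b t * ip Y \<phi>\<bar> \<le> e0 * (Cb * y * rate M t)" using e0 by (simp add: abs_mult mult_ac)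
      hence "\<bar>ip (F t) \<phi>\<bar> \<le> C * rate M t + e0 * (Cb * y * rate M t)" using C(3)[OF dec that] by linarith
      thus ?thesis by (simp add: R_def rate_def algebra_simps)
    qed
    show "0 < 0 + 5 / 2 * e0" using e0 by simp
    show "((\<lambda>t. exp (- 0 * t) * ip (w t 0) \<phi>) \<longlongrightarrow> 0) at_top"
      by (rule ip_w_tendsto[OF dec test_sqint[OF \<phi>(1)]]) (use e0 in simp)
  qed (use t in simp)
  define D where "D = (R / (5 / 2 * e0) + Cb * y + C) / \<bar>ip Q' \<phi>\<bar>"
  show thesis
  proof (rule that[of D])
    have R0: "0 \<le> R" "0 \<le> Cb * y" using C(1) e0 Cb(1) by (simp_all add: R_def y_def)
    show "0 \<le> D" unfolding D_def using R0 C(1) e0 by (intro divide_nonneg_nonneg add_nonneg_nonneg) auto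
    fix S M t assume d: "decay S M" "S \<le> t"
    have "\<bar>ip (w t 0) \<phi>\<bar> \<le> R / (5 / 2 * e0) * rate M t" using main[OF d] by (simp add: rate_def mult.assoc)
    hence "\<bar>c t * ip Q' \<phi>\<bar> \<le> R / (5 / 2 * e0) * rate M t + Cb * y * rate M t + C * rate M t"
      using C(2)[OF d] by_le[OF d] by linarith
    hence "\<bar>c t\<bar> * \<bar>ip Q' \<phi>\<bar> \<le> (R / (5 / 2 * e0) + Cb * y + C) * rate M t" by (simp only: abs_mult distrib_right)
    thus "\<bar>c t\<bar> \<le> D * rate M t" using \<phi>(3) by (simp add: D_def pos_le_divide_eq)
  qed
qed

text \<open>\<open>Q'\<close> has a strict sign on each open half line and the bump is positive
  inside its support; s corrects the sign.\<close>

lemma ip_Q'_bump: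
  assumes "0 < e" "0 \<le> a \<or> a + e \<le> 0"
  shows "ip Q' (bump a e) \<noteq> 0"
proof
  assume 0: "ip Q' (bump a e) = 0"
  define s :: real where "s = (if 0 \<le> a then - 1 else 1)"
  have s: "0 < s * Q' x" if "a < x" "x < a + e" for x
    using Q'_neg[of x] Q'_neg[of "- x"] Q'_reflect[of x] that assms by (auto simp: s_def)
  have np: "0 \<le> s * (Q' x * bump a e x)" for x
    using s[of x] bump_nonneg[OF assms(1), of a x] bump_0[OF assms(1), of x a]
    by (cases "a < x \<and> x < a + e") (auto simp: mult.assoc[symmetric] intro: less_imp_le)
  have "(LINT x|lborel. s * (Q' x * bump a e x)) = 0" using 0 by (simp add: ip_def)
  hence "AE x in lborel. s * (Q' x * bump a e x) = 0"
    using continuous_test_integrable[OF bump_test[OF assms(1)] Q'_cont] np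
    by (subst (asm) integral_nonneg_eq_0_iff_AE) auto
  hence "AE x :: real in lborel. x \<notin> {a<..<a + e}"
  proof eventually_elim
    case (elim x)
    thus ?case using bump_pos[OF assms(1), of a x] s[of x] by auto
  qed
  hence "{a<..<a + e} \<in> null_sets lborel" by (subst AE_iff_null_sets) auto
  thus False using assms by (simp add: null_sets_def)
qed

text \<open>Coercivity for z, with the values at 1 and -1 equal to \<open>Q'\<close> there times the
  two kernel coefficients; then w = z + b Y. The resulting bound is linear in M with a constant that
  does not depend on M.\<close>

lemma X_improved:
  obtains C where "0 \<le> C" "\<And>S M t. decay S M \<Longrightarrow> S \<le> t \<Longrightarrow> X t \<le> C * rate M t"
proof -
  obtain Cb where Cb: "0 \<le> Cb" "\<And>S M t. decay S M \<Longrightarrow> S \<le> t \<Longrightarrow> \<bar>b t\<bar> \<le> Cb * rate M t" using b_decay by blast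
  obtain Cs where Cs: "0 \<le> Cs" "\<And>S M t. decay S M \<Longrightarrow> S \<le> t \<Longrightarrow> sqrt (en (z t) (z1 t)) \<le> Cs * rate M t"
    using sqrt_en_z_decay by blast
  obtain Cr where Cr: "\<And>t x. T0 \<le> t \<Longrightarrow> 1 \<le> x \<Longrightarrow> x \<le> 2 \<Longrightarrow> \<bar>z t x - z t 1 / Q' 1 * Q' x\<bar> \<le> Cr * sqrt (en (z t) (z1 t))"
    by (rule near_right[of 1 2]) auto
  obtain Cp where Cp: "0 \<le> Cp" "\<And>S M t. decay S M \<Longrightarrow> S \<le> t \<Longrightarrow> \<bar>z t 1 / Q' 1\<bar> \<le> Cp * rate M t"
  proof (rule kernel_coefficient_decay[of "bump 1 1" 1 2 "\<lambda>t. z t 1 / Q' 1" Cr])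
    show "bump 1 1 \<in> test_functions" by (rule bump_test) simp
    show "bump 1 1 x = 0" if "x \<notin> {1..2}" for x by (rule bump_0) (use that in auto)
    show "ip Q' (bump 1 1) \<noteq> 0" by (rule ip_Q'_bump) auto
  qed (use Cr in auto)
  obtain Cl where Cl: "\<And>t x. T0 \<le> t \<Longrightarrow> - 2 \<le> x \<Longrightarrow> x \<le> - 1 \<Longrightarrow> \<bar>z t x - z t (- 1) / Q' (- 1) * Q' x\<bar> \<le> Cl * sqrt (en (z t) (z1 t))"
    by (rule near_left[of 1 2]) auto
  obtain Cm where Cm: "0 \<le> Cm" "\<And>S M t. decay S M \<Longrightarrow> S \<le> t \<Longrightarrow> \<bar>z t (- 1) / Q' (- 1)\<bar> \<le> Cm * rate M t"
  proof (rule kernel_coefficient_decay[of "bump (- 2) 1" "- 2" "- 1" "\<lambda>t. z t (- 1) / Q' (- 1)" Cl])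
    show "bump (- 2) 1 \<in> test_functions" by (rule bump_test) simp
    show "bump (- 2) 1 x = 0" if "x \<notin> {- 2..- 1}" for x by (rule bump_0) (use that in auto)
    show "ip Q' (bump (- 2) 1) \<noteq> 0" by (rule ip_Q'_bump) auto
  qed (use Cl in auto)
  obtain Ce where Ce: "0 \<le> Ce"
    "\<And>f f'. admissible f f' \<Longrightarrow> (nrm f)\<^sup>2 + (nrm f')\<^sup>2 \<le> Ce * ((f 1)\<^sup>2 + (f (- 1))\<^sup>2 + en f f')"
    using en_coercive by blast
  define D where "D = Ce * ((CV * Cp)\<^sup>2 + (CV * Cm)\<^sup>2 + Cs\<^sup>2)"
  have D0: "0 \<le> D" using Ce by (simp add: D_def)
  show thesis
  proof (rule that[of "2 * sqrt D + Cb * (nrm Y + nrm Y1)"])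
    show "0 \<le> 2 * sqrt D + Cb * (nrm Y + nrm Y1)" using D0 Cb by simp
    fix S M t assume d: "decay S M" "S \<le> t"
    have t0: "T0 \<le> t" by (rule decayD(2)[OF d])
    have r0: "0 \<le> rate M t" by (rule rate_nonneg[OF decayD(3)[OF d(1)]])
    have ad: "admissible (z t) (z1 t)" by (rule z_admissible[OF t0])
    have en0: "0 \<le> en (z t) (z1 t)" by (rule en_half_le_en(3)[OF ad])
    have "\<bar>z t 1\<bar> = \<bar>Q' 1\<bar> * \<bar>z t 1 / Q' 1\<bar>" using Q'_neg[of 1] by (simp add: abs_divide)
    also have "\<dots> \<le> CV * (Cp * rate M t)" using CV_pos Q'_le[of 1] Cp(2)[OF d] by (intro mult_mono) auto
    finally have p1: "(z t 1)\<^sup>2 \<le> (CV * Cp * rate M t)\<^sup>2"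
      using power_mono[of "\<bar>z t 1\<bar>" "CV * (Cp * rate M t)" 2] by (simp add: mult.assoc)
    have "\<bar>z t (- 1)\<bar> = \<bar>Q' (- 1)\<bar> * \<bar>z t (- 1) / Q' (- 1)\<bar>"
      using Q'_neg[of 1] Q'_reflect[of 1] by (simp add: abs_divide)
    also have "\<dots> \<le> CV * (Cm * rate M t)" using CV_pos Q'_le[of "- 1"] Cm(2)[OF d] by (intro mult_mono) auto
    finally have m1: "(z t (- 1))\<^sup>2 \<le> (CV * Cm * rate M t)\<^sup>2"
      using power_mono[of "\<bar>z t (- 1)\<bar>" "CV * (Cm * rate M t)" 2] by (simp add: mult.assoc)
    have e1: "en (z t) (z1 t) \<le> (Cs * rate M t)\<^sup>2"
      using power_mono[OF Cs(2)[OF d], of 2] en0 by simp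
    have "(nrm (z t))\<^sup>2 + (nrm (z1 t))\<^sup>2 \<le> Ce * ((CV * Cp * rate M t)\<^sup>2 + (CV * Cm * rate M t)\<^sup>2 + (Cs * rate M t)\<^sup>2)"
      by (rule order_trans[OF Ce(2)[OF ad]]) (intro mult_left_mono add_mono p1 m1 e1 Ce)
    also have "\<dots> = D * (rate M t)\<^sup>2" unfolding D_def power_mult_distrib by (simp add: algebra_simps)
    finally have z2: "(nrm (z t))\<^sup>2 + (nrm (z1 t))\<^sup>2 \<le> D * (rate M t)\<^sup>2" .
    have le: "x \<le> sqrt D * rate M t" if "x\<^sup>2 \<le> D * (rate M t)\<^sup>2" for x
      using real_le_rsqrt[OF that] r0 by (simp add: real_sqrt_mult)
    have zz: "nrm (z t) \<le> sqrt D * rate M t" "nrm (z1 t) \<le> sqrt D * rate M t"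
      using z2 zero_le_power2[of "nrm (z t)"] zero_le_power2[of "nrm (z1 t)"] by (intro le; linarith)+
    have sq: "sqint (z t)" "sqint (z1 t)" using ad by (auto simp: admissible_def)
    have w: "w t 0 = (\<lambda>x. z t x + b t * Y x)" "w t 1 = (\<lambda>x. z1 t x + b t * Y1 x)" by (auto simp: z_def z1_def)
    have "nrm (w t 0) \<le> nrm (z t) + \<bar>b t\<bar> * nrm Y"
      unfolding w(1) nrm_cmult[symmetric] by (intro nrm_triangle sq sqint_cmult Y_sq)
    moreover have "nrm (w t 1) \<le> nrm (z1 t) + \<bar>b t\<bar> * nrm Y1"
      unfolding w(2) nrm_cmult[symmetric] by (intro nrm_triangle sq sqint_cmult Y_sq)
    moreover have "\<bar>b t\<bar> * nrm Y \<le> Cb * rate M t * nrm Y" "\<bar>b t\<bar> * nrm Y1 \<le> Cb * rate M t * nrm Y1"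
      by (intro mult_right_mono Cb(2)[OF d]; simp)+
    ultimately have "X t \<le> 2 * (sqrt D * rate M t) + (Cb * rate M t * nrm Y + Cb * rate M t * nrm Y1)"
      unfolding X_def using zz by linarith
    also have "\<dots> = (2 * sqrt D + Cb * (nrm Y + nrm Y1)) * rate M t" by (simp add: algebra_simps)
    finally show "X t \<le> (2 * sqrt D + Cb * (nrm Y + nrm Y1)) * rate M t" .
  qed
qed

text \<open>Each pass multiplies the bound by C exp(-e0 t/2), which is below 1/2 from a time S on
  that does not depend on M. So M can be halved indefinitely without moving S.\<close>

theorem flow_eventually_0: "\<exists>S\<ge>T0. \<forall>t\<ge>S. \<forall>x. w t 0 x = 0"
proof -
  obtain C where C: "0 \<le> C" "\<And>S M t. decay S M \<Longrightarrow> S \<le> t \<Longrightarrow> X t \<le> C * rate M t" using X_improved by blast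
  have "((\<lambda>t. C * exp (- (1 / 2) * e0 * t)) \<longlongrightarrow> 0) at_top"
    using exp_decay_tendsto[of "1 / 2 * e0" C] e0 by simp
  hence "\<forall>\<^sub>F t in at_top. C * exp (- (1 / 2) * e0 * t) < 1 / 2" by (rule order_tendstoD) simp
  then obtain T1 where T1: "\<And>t. T1 \<le> t \<Longrightarrow> C * exp (- (1 / 2) * e0 * t) < 1 / 2"
    by (auto simp: eventually_at_top_linorder)
  define S where "S = max T0 T1"
  \<comment> \<open>The start 2 K reflects that X is the sum of two norms, each at most K exp(-2 e0
    t).\<close>
  have dec: "decay S (2 * K / 2 ^ n)" for n
  proof (induction n)
    case 0
    have "X t \<le> 2 * K * exp (- 2 * e0 * t)" if "S \<le> t" for t
      using w_le[of t 0] w_le[of t 1] that by (simp add: X_def S_def)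
    thus ?case using K_nonneg by (simp add: decay_def S_def)
  next
    case (Suc n)
    let ?M = "2 * K / 2 ^ n"
    have M0: "0 \<le> ?M" using K_nonneg by simp
    have "X t \<le> ?M / 2 * exp (- 2 * e0 * t)" if t: "S \<le> t" for t
    proof -
      have "X t \<le> C * rate ?M t" by (rule C(2)[OF Suc t])
      also have "\<dots> = ?M * exp (- 2 * e0 * t) * (C * exp (- (1 / 2) * e0 * t))"
      proof -
        have "exp (- (5 / 2) * e0 * t) = exp (- 2 * e0 * t) * exp (- (1 / 2) * e0 * t)" unfolding exp_mult_exp by simp
        thus ?thesis by (simp add: rate_def)
      qed
      also have "\<dots> \<le> ?M * exp (- 2 * e0 * t) * (1 / 2)"
        using K_nonneg T1[of t] t by (intro mult_left_mono) (auto simp: S_def)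
      finally show ?thesis by simp
    qed
    thus ?case using M0 by (simp add: decay_def S_def)
  qed
  have X0: "X t = 0" if t: "S \<le> t" for t
  proof -
    have "(\<lambda>n. 2 * K / 2 ^ n * exp (- 2 * e0 * t)) \<longlonglongrightarrow> 0" by real_asymp
    hence "X t \<le> 0" by (rule tendsto_lowerbound) (use decayD(1)[OF dec t] in auto)
    thus ?thesis using X_nonneg[of t] by simp
  qed
  have "w t 0 x = 0" if t: "S \<le> t" for t x
  proof -
    have t0: "T0 \<le> t" using t by (simp add: S_def)
    have "\<bar>w t 0 x\<bar> \<le> X t" unfolding X_def by (rule sqint_sup_le[OF w01[OF t0]]) (use w_sq[OF t0] in auto)
    thus ?thesis using X0[OF t] by simp
  qed
  thus ?thesis by (intro exI[of _ S]) (auto simp: S_def)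
qed

end

section \<open>The moving frame\<close>

lemma has_deriv_quadratic:
  fixes f :: "real \<Rightarrow> real"
  assumes q: "\<And>s. s \<in> S \<Longrightarrow> \<bar>s - t\<bar> \<le> 1 \<Longrightarrow> \<bar>f s - f t - D * (s - t)\<bar> \<le> K * (s - t)\<^sup>2"
  shows "(f has_real_derivative D) (at t within S)"
proof -
  have "((\<lambda>s. (f s - f t) / (s - t) - D) \<longlongrightarrow> 0) (at t within S)"
  proof (rule Lim_null_comparison)
    have "\<forall>\<^sub>F s in at t within S. s \<in> S \<and> s \<noteq> t" by (auto simp: eventually_at_filter)
    moreover have "\<forall>\<^sub>F s in at t within S. dist s t < 1" by (rule eventually_at_ball'[of 1, THEN eventually_mono]) (auto simp: dist_commute)
    ultimately show "\<forall>\<^sub>F s in at t within S. norm ((f s - f t) / (s - t) - D) \<le> K * \<bar>s - t\<bar>"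
    proof eventually_elim
      case (elim s)
      have "norm ((f s - f t) / (s - t) - D) * \<bar>s - t\<bar> = \<bar>f s - f t - D * (s - t)\<bar>"
        using elim by (simp add: field_simps flip: abs_mult)
      also have "\<dots> \<le> K * (s - t)\<^sup>2" by (rule q) (use elim in \<open>auto simp: dist_real_def\<close>)
      also have "\<dots> = (K * \<bar>s - t\<bar>) * \<bar>s - t\<bar>" by (simp add: power2_eq_square)
      finally show ?case using elim by (simp add: mult_le_cancel_right)
    qed
    have "((\<lambda>s. K * \<bar>s - t\<bar>) \<longlongrightarrow> K * \<bar>t - t\<bar>) (at t within S)" by (intro tendsto_intros)
    thus "((\<lambda>s. K * \<bar>s - t\<bar>) \<longlongrightarrow> 0) (at t within S)" by simp
  qed
  thus ?thesis unfolding has_field_derivative_iff by (rule LIM_zero_cancel)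
qed

lemma integral_mult_support_bound:
  fixes f g :: "real \<Rightarrow> real"
  assumes f: "f \<in> borel_measurable borel" "AE x in lborel. \<bar>f x\<bar> \<le> B" and B: "0 \<le> B"
    and g: "g \<in> borel_measurable borel" "\<And>x. \<bar>g x\<bar> \<le> c" "\<And>x. x \<notin> {a..b} \<Longrightarrow> g x = 0"
  shows "integrable lborel (\<lambda>x. f x * g x)" "a \<le> b \<Longrightarrow> \<bar>LINT x|lborel. f x * g x\<bar> \<le> B * c * (b - a)"
proof -
  have c: "0 \<le> c" using g(2)[of 0] by linarith
  have i: "integrable lborel (\<lambda>x. B * c * indicator {a..b} x)" by (intro integrable_mult_right) (simp add: emeasure_lborel_Icc_eq)
  have le: "AE x in lborel. norm (f x * g x) \<le> B * c * indicator {a..b} x"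
    using f(2)
  proof eventually_elim
    case (elim x)
    show ?case
    proof (cases "x \<in> {a..b}")
      case True
      thus ?thesis using mult_mono[OF elim g(2)[of x] B abs_ge_zero] by (simp add: abs_mult)
    next
      case False
      thus ?thesis using g(3)[OF False] by simp
    qed
  qed
  show I: "integrable lborel (\<lambda>x. f x * g x)"
    by (rule Bochner_Integration.integrable_bound[OF i]) (use f(1) g(1) le c B in \<open>auto elim!: eventually_mono\<close>)
  assume "a \<le> b"
  have "\<bar>LINT x|lborel. f x * g x\<bar> \<le> (LINT x|lborel. \<bar>f x * g x\<bar>)" by (rule integral_abs_bound)
  also have "\<dots> \<le> (LINT x|lborel. B * c * indicator {a..b} x)"
    by (rule integral_mono_AE[OF integrable_abs[OF I] i]) (use le in simp)
  also have "\<dots> = B * c * (b - a)" using \<open>a \<le> b\<close> by simp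
  finally show "\<bar>LINT x|lborel. f x * g x\<bar> \<le> B * c * (b - a)" .
qed

section \<open>Finite differences of test functions\<close>

lemma deriv_diff_test:
  "\<phi> \<in> test_functions \<Longrightarrow> \<psi> \<in> test_functions \<Longrightarrow> deriv (\<lambda>x. \<phi> x - \<psi> x) = (\<lambda>x. deriv \<phi> x - deriv \<psi> x)"
  by (rule ext, rule DERIV_imp_deriv, rule DERIV_diff) (rule test_has_deriv; assumption)+

lemma test_deriv3: "\<phi> \<in> test_functions \<Longrightarrow> (deriv ^^ 3) \<phi> \<in> test_functions"
  by (simp add: numeral_3_eq_3 test_deriv)

lemma deriv3_shift: "\<phi> \<in> test_functions \<Longrightarrow> (deriv ^^ 3) (\<lambda>x. \<phi> (x - c)) = (\<lambda>x. (deriv ^^ 3) \<phi> (x - c))"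
  by (simp add: numeral_3_eq_3 deriv_shift test_deriv)

lemma deriv3_diff_test:
  "\<phi> \<in> test_functions \<Longrightarrow> \<psi> \<in> test_functions \<Longrightarrow>
    (deriv ^^ 3) (\<lambda>x. \<phi> x - \<psi> x) = (\<lambda>x. (deriv ^^ 3) \<phi> x - (deriv ^^ 3) \<psi> x)"
  by (simp add: numeral_3_eq_3 deriv_diff_test test_deriv)

lemma test_translation_bounds:
  assumes \<phi>: "\<phi> \<in> test_functions"
  obtains R M where "0 < R" "0 \<le> M"
    "\<And>h y. \<bar>\<phi> (y - h) - \<phi> y\<bar> \<le> M * \<bar>h\<bar>"
    "\<And>h y. \<bar>\<phi> (y - h) - \<phi> y + h * deriv \<phi> y\<bar> \<le> M * h\<^sup>2"
    "\<And>h y. \<bar>h\<bar> \<le> 1 \<Longrightarrow> y \<notin> {-R..R} \<Longrightarrow> \<phi> (y - h) = 0"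
    "\<And>y. y \<notin> {-R..R} \<Longrightarrow> deriv \<phi> y = 0"
proof -
  note \<phi>1 = test_deriv[OF \<phi>] note \<phi>2 = test_deriv[OF \<phi>1]
  obtain R where R: "0 < R" "\<And>x. R \<le> \<bar>x\<bar> \<Longrightarrow> \<phi> x = 0" using test_support[OF \<phi>] by blast
  obtain R1 where R1: "0 < R1" "\<And>x. R1 \<le> \<bar>x\<bar> \<Longrightarrow> deriv \<phi> x = 0" using test_support[OF \<phi>1] by blast
  obtain M1 where M1: "0 < M1" "\<And>x. \<bar>deriv \<phi> x\<bar> \<le> M1" using test_bounded[OF \<phi>1] by blast
  obtain M2 where M2: "0 < M2" "\<And>x. \<bar>deriv (deriv \<phi>) x\<bar> \<le> M2" using test_bounded[OF \<phi>2] by blast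
  have lip: "\<bar>f (y - h) - f y\<bar> \<le> C * \<bar>h\<bar>" if "f \<in> test_functions" "\<And>x. \<bar>deriv f x\<bar> \<le> C" for f C and h y :: real
    using field_differentiable_bound[of UNIV f "deriv f" C "y - h" y] test_has_deriv[OF that(1)] that(2) by simp
  show thesis
  \<comment> \<open>The extra 1 makes room for translations with |h| <= 1.\<close>
  proof (rule that[of "max R R1 + 1" "max M1 M2"])
    show "0 < max R R1 + 1" "0 \<le> max M1 M2" using R(1) M1(1) by auto
    fix h y :: real
    show "\<bar>\<phi> (y - h) - \<phi> y\<bar> \<le> max M1 M2 * \<bar>h\<bar>"
      by (rule lip[OF \<phi>]) (rule order_trans[OF M1(2)], simp)
    have "norm ((\<phi> (y - h) + h * deriv \<phi> y) - (\<phi> (y - 0) + 0 * deriv \<phi> y)) \<le> M2 * \<bar>h\<bar> * norm (h - 0)"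
    proof (rule field_differentiable_bound[where S = "{-\<bar>h\<bar>..\<bar>h\<bar>}" and f' = "\<lambda>r. deriv \<phi> y - deriv \<phi> (y - r)"])
      fix r :: real
      have "((\<lambda>r. \<phi> (y - r)) has_real_derivative deriv \<phi> (y - r) * (0 - 1)) (at r within {-\<bar>h\<bar>..\<bar>h\<bar>})"
        by (rule DERIV_chain2[OF test_has_deriv[OF \<phi>] DERIV_diff[OF DERIV_const DERIV_ident]])
      from DERIV_add[OF this DERIV_cmult_right[OF DERIV_ident, where c = "deriv \<phi> y"]]
      show "((\<lambda>r. \<phi> (y - r) + r * deriv \<phi> y) has_real_derivative deriv \<phi> y - deriv \<phi> (y - r)) (at r within {-\<bar>h\<bar>..\<bar>h\<bar>})"
        by simp
      assume "r \<in> {-\<bar>h\<bar>..\<bar>h\<bar>}"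
      hence "M2 * \<bar>r\<bar> \<le> M2 * \<bar>h\<bar>" using M2(1) by (intro mult_left_mono) auto
      thus "norm (deriv \<phi> y - deriv \<phi> (y - r)) \<le> M2 * \<bar>h\<bar>"
        using lip[OF \<phi>1 M2(2), of y r] by (simp add: abs_minus_commute)
    qed auto
    hence "\<bar>\<phi> (y - h) - \<phi> y + h * deriv \<phi> y\<bar> \<le> M2 * h\<^sup>2" by (simp add: power2_eq_square algebra_simps)
    also have "\<dots> \<le> max M1 M2 * h\<^sup>2" by (intro mult_right_mono) auto
    finally show "\<bar>\<phi> (y - h) - \<phi> y + h * deriv \<phi> y\<bar> \<le> max M1 M2 * h\<^sup>2" .
    show "\<phi> (y - h) = 0" if "\<bar>h\<bar> \<le> 1" "y \<notin> {- (max R R1 + 1)..max R R1 + 1}"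
      by (rule R(2)) (use that in auto)
    show "deriv \<phi> y = 0" if "y \<notin> {- (max R R1 + 1)..max R R1 + 1}"
      by (rule R1(2)) (use that in auto)
  qed
qed

lemma lborel_integral_shift: "(LINT x|lborel. f (x + c) * g x) = (LINT y|lborel. f y * g (y - c))" for f g :: "real \<Rightarrow> real"
  using lborel_integral_real_affine[of 1 "\<lambda>y. f y * g (y - c)" c] by (simp add: add.commute)

text \<open>The product rule applies although \<^term>\<open>u\<close> is only differentiable in time in the sense of distributions:
  the equation tested with \<open>\<phi>(\<cdot> - s) - \<phi>(\<cdot> - t)\<close> bounds the mixed increment by a multiple of \<open>(s - t)\<^sup>2\<close>.\<close>

theorem moving_frame:
  fixes u :: "real \<Rightarrow> real \<Rightarrow> real"
  assumes eq: "\<And>\<phi> t. \<phi> \<in> test_functions \<Longrightarrow> T \<le> t \<Longrightarrow>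
      ((\<lambda>s. LINT x|lborel. u s x * \<phi> x) has_real_derivative
        (LINT x|lborel. u t x * (deriv ^^ 3) \<phi> x + u t x ^ p * deriv \<phi> x)) (at t within {T..})"
    and meas: "\<And>t. T \<le> t \<Longrightarrow> u t \<in> borel_measurable borel"
    and bd: "\<And>t. T \<le> t \<Longrightarrow> AE x in lborel. \<bar>u t x\<bar> \<le> B" and B: "0 \<le> B"
    and \<phi>: "\<phi> \<in> test_functions" and t: "T \<le> t"
  shows "((\<lambda>s. LINT x|lborel. u s (x + s) * \<phi> x) has_real_derivative
      (LINT x|lborel. u t (x + t) * (deriv ^^ 3) \<phi> x + u t (x + t) ^ p * deriv \<phi> x - u t (x + t) * deriv \<phi> x))
      (at t within {T..})"
proof -
  define \<psi> where "\<psi> = (\<lambda>s y. \<phi> (y - s) - \<phi> (y - t))"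
  define \<eta> where "\<eta> = (\<lambda>y. \<phi> (y - t))"
  have \<eta>: "\<eta> \<in> test_functions" unfolding \<eta>_def by (rule test_shift[OF \<phi>])
  have \<psi>: "\<psi> s \<in> test_functions" for s unfolding \<psi>_def by (intro test_diff test_shift \<phi>)
  note \<phi>1 = test_deriv[OF \<phi>] and \<phi>3 = test_deriv3[OF \<phi>]
  have \<psi>1: "deriv (\<psi> s) = (\<lambda>y. deriv \<phi> (y - s) - deriv \<phi> (y - t))" for s
    unfolding \<psi>_def by (simp add: deriv_diff_test[OF test_shift[OF \<phi>] test_shift[OF \<phi>]] deriv_shift[OF \<phi>])
  have \<psi>3: "(deriv ^^ 3) (\<psi> s) = (\<lambda>y. (deriv ^^ 3) \<phi> (y - s) - (deriv ^^ 3) \<phi> (y - t))" for s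
    unfolding \<psi>_def by (simp add: deriv3_diff_test[OF test_shift[OF \<phi>] test_shift[OF \<phi>]] deriv3_shift[OF \<phi>])
  have up: "(\<lambda>x. u r x ^ p) \<in> borel_measurable borel" "AE x in lborel. \<bar>u r x ^ p\<bar> \<le> B ^ p" "0 \<le> B ^ p" if "T \<le> r" for r
  proof -
    show "(\<lambda>x. u r x ^ p) \<in> borel_measurable borel" using meas[OF that] by measurable
    show "AE x in lborel. \<bar>u r x ^ p\<bar> \<le> B ^ p"
      using bd[OF that] by eventually_elim (simp add: power_abs power_mono)
    show "0 \<le> B ^ p" using B by simp
  qed
  have int: "integrable lborel (\<lambda>x. f x * \<theta> x)"
    if f: "f \<in> borel_measurable borel" "AE x in lborel. \<bar>f x\<bar> \<le> C" "0 \<le> C" and \<theta>: "\<theta> \<in> test_functions" for f \<theta> C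
  proof -
    obtain L where L: "0 < L" "\<And>x. L \<le> \<bar>x\<bar> \<Longrightarrow> \<theta> x = 0" using test_support[OF \<theta>] by blast
    obtain M where M: "0 < M" "\<And>x. \<bar>\<theta> x\<bar> \<le> M" using test_bounded[OF \<theta>] by blast
    show ?thesis
      by (rule integral_mult_support_bound(1)[OF f test_measurable[OF \<theta>] M(2), of "- L" L]) (use L in auto)
  qed
  note uint = int[OF meas bd B] and upint = int[OF up(1,2) zero_le_power[OF B]]
  obtain R M where M: "0 < R" "0 \<le> M"
    "\<And>h y. \<bar>\<phi> (y - h) - \<phi> y\<bar> \<le> M * \<bar>h\<bar>"
    "\<And>h y. \<bar>\<phi> (y - h) - \<phi> y + h * deriv \<phi> y\<bar> \<le> M * h\<^sup>2"
    "\<And>h y. \<bar>h\<bar> \<le> 1 \<Longrightarrow> y \<notin> {-R..R} \<Longrightarrow> \<phi> (y - h) = 0"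
    "\<And>y. y \<notin> {-R..R} \<Longrightarrow> deriv \<phi> y = 0"
    using test_translation_bounds[OF \<phi>] by blast
  obtain R1 M1 where M1: "0 < R1" "0 \<le> M1"
    "\<And>h y. \<bar>deriv \<phi> (y - h) - deriv \<phi> y\<bar> \<le> M1 * \<bar>h\<bar>"
    "\<And>h y. \<bar>deriv \<phi> (y - h) - deriv \<phi> y + h * deriv (deriv \<phi>) y\<bar> \<le> M1 * h\<^sup>2"
    "\<And>h y. \<bar>h\<bar> \<le> 1 \<Longrightarrow> y \<notin> {-R1..R1} \<Longrightarrow> deriv \<phi> (y - h) = 0"
    "\<And>y. y \<notin> {-R1..R1} \<Longrightarrow> deriv (deriv \<phi>) y = 0"
    using test_translation_bounds[OF \<phi>1] by blast
  obtain R3 M3 where M3: "0 < R3" "0 \<le> M3"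
    "\<And>h y. \<bar>(deriv ^^ 3) \<phi> (y - h) - (deriv ^^ 3) \<phi> y\<bar> \<le> M3 * \<bar>h\<bar>"
    "\<And>h y. \<bar>(deriv ^^ 3) \<phi> (y - h) - (deriv ^^ 3) \<phi> y + h * deriv ((deriv ^^ 3) \<phi>) y\<bar> \<le> M3 * h\<^sup>2"
    "\<And>h y. \<bar>h\<bar> \<le> 1 \<Longrightarrow> y \<notin> {-R3..R3} \<Longrightarrow> (deriv ^^ 3) \<phi> (y - h) = 0"
    "\<And>y. y \<notin> {-R3..R3} \<Longrightarrow> deriv ((deriv ^^ 3) \<phi>) y = 0"
    using test_translation_bounds[OF \<phi>3] by blast
  \<comment> \<open>The pairing with the moving test function splits into three terms: here only u
    moves, in \<open>b\<close> only the test function moves, and \<open>c\<close> is the mixed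
    increment.\<close>
  have a: "((\<lambda>s. LINT x|lborel. u s x * \<eta> x) has_real_derivative
      (LINT x|lborel. u t x * (deriv ^^ 3) \<eta> x + u t x ^ p * deriv \<eta> x)) (at t within {T..})"
    by (rule eq[OF \<eta> t])
  \<comment> \<open>Source of the transport term in the moving frame: a Taylor expansion of the
    translate of \<phi>, with u frozen at time t.\<close>
  have b: "((\<lambda>s. LINT x|lborel. u t x * \<psi> s x) has_real_derivative - (LINT x|lborel. u t x * deriv \<eta> x)) (at t within {T..})"
  proof (rule has_deriv_quadratic)
    fix s assume "\<bar>s - t\<bar> \<le> 1"
    define h where "h = s - t"
    have h: "\<bar>h\<bar> \<le> 1" "y - s = (y - t) - h" for y using \<open>\<bar>s - t\<bar> \<le> 1\<close> by (auto simp: h_def)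
    have \<eta>1: "deriv \<eta> = (\<lambda>y. deriv \<phi> (y - t))" unfolding \<eta>_def by (rule deriv_shift[OF \<phi>])
    let ?g = "\<lambda>y. \<phi> (y - t - h) - \<phi> (y - t) + h * deriv \<phi> (y - t)"
    have "(LINT x|lborel. u t x * \<psi> s x) - (LINT x|lborel. u t x * \<psi> t x) - - (LINT x|lborel. u t x * deriv \<eta> x) * (s - t)
      = (LINT x|lborel. u t x * \<psi> s x) + (LINT x|lborel. h * (u t x * deriv \<eta> x))"
      by (simp add: \<psi>_def h_def)
    also have "\<dots> = (LINT x|lborel. u t x * \<psi> s x + h * (u t x * deriv \<eta> x))"
      by (rule Bochner_Integration.integral_add[symmetric]) (intro integrable_mult_right uint t \<psi> test_deriv \<eta>)+
    also have "\<dots> = (LINT x|lborel. u t x * ?g x)"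
      by (rule Bochner_Integration.integral_cong) (simp_all add: \<psi>_def \<eta>1 h(2) algebra_simps)
    finally have e: "(LINT x|lborel. u t x * \<psi> s x) - (LINT x|lborel. u t x * \<psi> t x) - - (LINT x|lborel. u t x * deriv \<eta> x) * (s - t)
      = (LINT x|lborel. u t x * ?g x)" .
    have "\<bar>LINT x|lborel. u t x * ?g x\<bar> \<le> B * (M * h\<^sup>2) * ((t + R) - (t - R))"
    proof (rule integral_mult_support_bound(2)[OF meas[OF t] bd[OF t] B])
      have "(\<lambda>y. \<psi> s y + h * deriv \<eta> y) \<in> test_functions" by (intro test_add test_cmult \<psi> test_deriv \<eta>)
      from test_measurable[OF this] show "?g \<in> borel_measurable borel" by (simp add: \<psi>_def \<eta>1 h(2))
      show "?g y = 0" if "y \<notin> {t - R..t + R}" for y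
      proof -
        have y: "y - t \<notin> {-R..R}" using that by auto
        show ?thesis using M(5)[OF h(1) y] M(5)[OF _ y, of 0] M(6)[OF y] by simp
      qed
    qed (use M in auto)
    also have "\<dots> = B * M * (2 * R) * (s - t)\<^sup>2" by (simp add: h_def)
    finally show "\<bar>(LINT x|lborel. u t x * \<psi> s x) - (LINT x|lborel. u t x * \<psi> t x) - - (LINT x|lborel. u t x * deriv \<eta> x) * (s - t)\<bar>
      \<le> B * M * (2 * R) * (s - t)\<^sup>2" unfolding e .
  qed
  define K where "K = B * M3 * (2 * R3) + B ^ p * M1 * (2 * R1)"
  \<comment> \<open>The test function \<psi> s has size |s - t| together with its derivatives, and
    the time increment of u gives a second such factor by the mean value inequality.\<close>
  have c: "((\<lambda>s. (LINT x|lborel. u s x * \<psi> s x) - (LINT x|lborel. u t x * \<psi> s x)) has_real_derivative 0) (at t within {T..})"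
  proof (rule has_deriv_quadratic)
    fix s assume s: "s \<in> {T..}" and "\<bar>s - t\<bar> \<le> 1"
    define h where "h = s - t"
    have h: "\<bar>h\<bar> \<le> 1" "y - s = (y - t) - h" for y using \<open>\<bar>s - t\<bar> \<le> 1\<close> by (auto simp: h_def)
    have "norm ((LINT x|lborel. u s x * \<psi> s x) - (LINT x|lborel. u t x * \<psi> s x)) \<le> (K * \<bar>h\<bar>) * norm (s - t)"
    proof (rule field_differentiable_bound[where S = "{T..}"])
      fix r assume "r \<in> {T..}"
      hence r: "T \<le> r" by simp
      show "((\<lambda>r. LINT x|lborel. u r x * \<psi> s x) has_real_derivative
          (LINT x|lborel. u r x * (deriv ^^ 3) (\<psi> s) x + u r x ^ p * deriv (\<psi> s) x)) (at r within {T..})"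
        by (rule eq[OF \<psi> r])
      have "(LINT x|lborel. u r x * (deriv ^^ 3) (\<psi> s) x + u r x ^ p * deriv (\<psi> s) x) =
          (LINT x|lborel. u r x * (deriv ^^ 3) (\<psi> s) x) + (LINT x|lborel. u r x ^ p * deriv (\<psi> s) x)"
        by (rule Bochner_Integration.integral_add) (intro uint upint r test_deriv3 test_deriv \<psi>)+
      moreover have "\<bar>LINT x|lborel. u r x * (deriv ^^ 3) (\<psi> s) x\<bar> \<le> B * (M3 * \<bar>h\<bar>) * ((t + R3) - (t - R3))"
      proof (rule integral_mult_support_bound(2)[OF meas[OF r] bd[OF r] B test_measurable[OF test_deriv3[OF \<psi>]]])
        show "\<bar>(deriv ^^ 3) (\<psi> s) y\<bar> \<le> M3 * \<bar>h\<bar>" for y unfolding \<psi>3 h(2) by (rule M3(3))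
        show "(deriv ^^ 3) (\<psi> s) y = 0" if "y \<notin> {t - R3..t + R3}" for y
        proof -
          have y: "y - t \<notin> {-R3..R3}" using that by auto
          show ?thesis unfolding \<psi>3 h(2) using M3(5)[OF h(1) y] M3(5)[OF _ y, of 0] by simp
        qed
      qed (use M3 in auto)
      moreover have "\<bar>LINT x|lborel. u r x ^ p * deriv (\<psi> s) x\<bar> \<le> B ^ p * (M1 * \<bar>h\<bar>) * ((t + R1) - (t - R1))"
      proof (rule integral_mult_support_bound(2)[OF up[OF r] test_measurable[OF test_deriv[OF \<psi>]]])
        show "\<bar>deriv (\<psi> s) y\<bar> \<le> M1 * \<bar>h\<bar>" for y unfolding \<psi>1 h(2) by (rule M1(3))
        show "deriv (\<psi> s) y = 0" if "y \<notin> {t - R1..t + R1}" for y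
        proof -
          have y: "y - t \<notin> {-R1..R1}" using that by auto
          show ?thesis unfolding \<psi>1 h(2) using M1(5)[OF h(1) y] M1(5)[OF _ y, of 0] by simp
        qed
      qed (use M1 in auto)
      moreover have "B * (M3 * \<bar>h\<bar>) * ((t + R3) - (t - R3)) + B ^ p * (M1 * \<bar>h\<bar>) * ((t + R1) - (t - R1)) = K * \<bar>h\<bar>"
        by (simp add: K_def algebra_simps)
      ultimately show "norm (LINT x|lborel. u r x * (deriv ^^ 3) (\<psi> s) x + u r x ^ p * deriv (\<psi> s) x) \<le> K * \<bar>h\<bar>"
        unfolding real_norm_def by linarith
    qed (use s t in auto)
    thus "\<bar>((LINT x|lborel. u s x * \<psi> s x) - (LINT x|lborel. u t x * \<psi> s x)) -
        ((LINT x|lborel. u t x * \<psi> t x) - (LINT x|lborel. u t x * \<psi> t x)) - 0 * (s - t)\<bar> \<le> K * (s - t)\<^sup>2"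
      by (simp add: h_def power2_eq_square mult.assoc)
  qed
  have split: "(LINT x|lborel. u s x * \<eta> x) + (LINT x|lborel. u t x * \<psi> s x) +
      ((LINT x|lborel. u s x * \<psi> s x) - (LINT x|lborel. u t x * \<psi> s x)) = (LINT x|lborel. u s (x + s) * \<phi> x)" if s: "T \<le> s" for s
  proof -
    have "(LINT x|lborel. u s x * \<eta> x) + (LINT x|lborel. u s x * \<psi> s x) = (LINT x|lborel. u s x * \<eta> x + u s x * \<psi> s x)"
      by (rule Bochner_Integration.integral_add[symmetric]) (intro uint s \<psi> \<eta>)+
    also have "\<dots> = (LINT x|lborel. u s x * \<phi> (x - s))"
      by (rule Bochner_Integration.integral_cong) (simp_all add: \<psi>_def \<eta>_def algebra_simps)
    finally show ?thesis unfolding lborel_integral_shift[of "u s" s \<phi>] by linarith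
  qed
  have "(LINT x|lborel. u t (x + t) * (deriv ^^ 3) \<phi> x + u t (x + t) ^ p * deriv \<phi> x - u t (x + t) * deriv \<phi> x) =
      (LINT x|lborel. u t x * (deriv ^^ 3) \<eta> x + u t x ^ p * deriv \<eta> x - u t x * deriv \<eta> x)"
    using lborel_integral_real_affine[of 1 "\<lambda>x. u t x * (deriv ^^ 3) \<eta> x + u t x ^ p * deriv \<eta> x - u t x * deriv \<eta> x" t]
    by (simp add: \<eta>_def deriv3_shift[OF \<phi>] deriv_shift[OF \<phi>] add.commute)
  also have "\<dots> = (LINT x|lborel. u t x * (deriv ^^ 3) \<eta> x + u t x ^ p * deriv \<eta> x) - (LINT x|lborel. u t x * deriv \<eta> x)"
    by (rule Bochner_Integration.integral_diff)
       (intro Bochner_Integration.integrable_add uint upint t test_deriv3 test_deriv \<eta>)+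
  finally have D: "(LINT x|lborel. u t x * (deriv ^^ 3) \<eta> x + u t x ^ p * deriv \<eta> x) + - (LINT x|lborel. u t x * deriv \<eta> x) + 0 =
      (LINT x|lborel. u t (x + t) * (deriv ^^ 3) \<phi> x + u t (x + t) ^ p * deriv \<phi> x - u t (x + t) * deriv \<phi> x)" by simp
  show ?thesis
    unfolding D[symmetric]
    by (rule has_field_derivative_transform_within[OF DERIV_add[OF DERIV_add[OF a b] c], where d = 1]) (use t split in auto)
qed

section \<open>Asymptotic profiles determine solutions\<close>

definition fam_bound :: "real \<Rightarrow> real \<Rightarrow> real \<Rightarrow> (real \<Rightarrow> real \<Rightarrow> real) \<Rightarrow> (real \<Rightarrow> real \<Rightarrow> real) \<Rightarrow> (real \<Rightarrow> real \<Rightarrow> real) \<Rightarrow> bool" where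
  "fam_bound T a K f f1 f2 \<longleftrightarrow> 0 \<le> K \<and> (\<forall>t\<ge>T. c1_deriv (f t) (f1 t) \<and> c1_deriv (f1 t) (f2 t) \<and>
     (\<forall>x. \<bar>f t x\<bar> \<le> K * exp (- a * t) \<and> \<bar>f1 t x\<bar> \<le> K * exp (- a * t) \<and> \<bar>f2 t x\<bar> \<le> K * exp (- a * t)))"

text \<open>A calculus for C^2 families with exponential bounds uniform in x: sums keep the
  exponent, products add exponents. Hiding the derivatives and the constant behind existential
  quantifiers lets polynomial expressions in the solutions be estimated without tracking
  them.\<close>

definition fam :: "real \<Rightarrow> real \<Rightarrow> (real \<Rightarrow> real \<Rightarrow> real) \<Rightarrow> bool" where
  "fam T a f \<longleftrightarrow> (\<exists>K f1 f2. fam_bound T a K f f1 f2)"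

lemma famI:
  assumes "\<And>t. T \<le> t \<Longrightarrow> c1_deriv (f t) (f1 t)" "\<And>t. T \<le> t \<Longrightarrow> c1_deriv (f1 t) (f2 t)"
    "\<And>t x. T \<le> t \<Longrightarrow> \<bar>f t x\<bar> \<le> K * exp (- a * t)" "\<And>t x. T \<le> t \<Longrightarrow> \<bar>f1 t x\<bar> \<le> K * exp (- a * t)"
    "\<And>t x. T \<le> t \<Longrightarrow> \<bar>f2 t x\<bar> \<le> K * exp (- a * t)"
  shows "fam T a f"
proof -
  have "0 \<le> K * exp (- a * T)" using assms(3)[of T 0] by linarith
  hence "fam_bound T a K f f1 f2" using assms by (simp add: fam_bound_def zero_le_mult_iff)
  thus ?thesis unfolding fam_def by blast
qed

lemma fam_boundD:
  assumes "fam_bound T a K f f1 f2"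
  shows "0 \<le> K" "\<And>t. T \<le> t \<Longrightarrow> c1_deriv (f t) (f1 t)" "\<And>t. T \<le> t \<Longrightarrow> c1_deriv (f1 t) (f2 t)"
    "\<And>t x. T \<le> t \<Longrightarrow> \<bar>f t x\<bar> \<le> K * exp (- a * t)" "\<And>t x. T \<le> t \<Longrightarrow> \<bar>f1 t x\<bar> \<le> K * exp (- a * t)"
    "\<And>t x. T \<le> t \<Longrightarrow> \<bar>f2 t x\<bar> \<le> K * exp (- a * t)"
  using assms by (simp_all add: fam_bound_def)

lemma fam_mono:
  assumes "fam T a f" "b \<le> a" "0 \<le> T" shows "fam T b f"
proof -
  obtain K f1 f2 where "fam_bound T a K f f1 f2" using assms(1) unfolding fam_def by blast
  note f = fam_boundD[OF this]
  have "K * exp (- a * t) \<le> K * exp (- b * t)" if "T \<le> t" for t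
  proof -
    have "0 \<le> t" using assms(3) that by simp
    hence "b * t \<le> a * t" by (rule mult_right_mono[OF assms(2)])
    thus ?thesis using f(1) by (simp add: mult_left_mono)
  qed
  note le = order_trans[OF _ this]
  show ?thesis
    by (rule famI[of T f f1 f2 K]) (rule f(2,3) le[OF f(4)] le[OF f(5)] le[OF f(6)]; assumption)+
qed

lemma fam_add:
  assumes "fam T a f" "fam T a g" shows "fam T a (\<lambda>t x. f t x + g t x)"
proof -
  obtain K f1 f2 where "fam_bound T a K f f1 f2" using assms(1) unfolding fam_def by blast
  note f = fam_boundD[OF this]
  obtain L g1 g2 where "fam_bound T a L g g1 g2" using assms(2) unfolding fam_def by blast
  note g = fam_boundD[OF this]
  show ?thesis
  proof (rule famI[of T _ "\<lambda>t x. f1 t x + g1 t x" "\<lambda>t x. f2 t x + g2 t x" "K + L"])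
    fix t x assume t: "T \<le> t"
    show "c1_deriv (\<lambda>x. f t x + g t x) (\<lambda>x. f1 t x + g1 t x)" "c1_deriv (\<lambda>x. f1 t x + g1 t x) (\<lambda>x. f2 t x + g2 t x)"
      by (intro c1_deriv_add f g t)+
    show "\<bar>f t x + g t x\<bar> \<le> (K + L) * exp (- a * t)" "\<bar>f1 t x + g1 t x\<bar> \<le> (K + L) * exp (- a * t)"
      "\<bar>f2 t x + g2 t x\<bar> \<le> (K + L) * exp (- a * t)"
      unfolding distrib_right
      by (intro order_trans[OF abs_triangle_ineq] add_mono f g t)+
  qed
qed

lemma fam_mult:
  assumes "fam T a f" "fam T b g" shows "fam T (a + b) (\<lambda>t x. f t x * g t x)"
proof -
  obtain K f1 f2 where "fam_bound T a K f f1 f2" using assms(1) unfolding fam_def by blast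
  note f = fam_boundD[OF this]
  obtain L g1 g2 where "fam_bound T b L g g1 g2" using assms(2) unfolding fam_def by blast
  note g = fam_boundD[OF this]
  show ?thesis
  proof (rule famI[of T _ "\<lambda>t x. f1 t x * g t x + f t x * g1 t x"
        "\<lambda>t x. (f2 t x * g t x + f1 t x * g1 t x) + (f1 t x * g1 t x + f t x * g2 t x)" "4 * (K * L)"])
    fix t x assume t: "T \<le> t"
    show "c1_deriv (\<lambda>x. f t x * g t x) (\<lambda>x. f1 t x * g t x + f t x * g1 t x)"
      by (rule c1_deriv_mult[OF f(2)[OF t] g(2)[OF t]])
    show "c1_deriv (\<lambda>x. f1 t x * g t x + f t x * g1 t x)
        (\<lambda>x. (f2 t x * g t x + f1 t x * g1 t x) + (f1 t x * g1 t x + f t x * g2 t x))"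
      by (rule c1_deriv_add[OF c1_deriv_mult[OF f(3)[OF t] g(2)[OF t]] c1_deriv_mult[OF f(2)[OF t] g(3)[OF t]]])
    define E where "E = K * L * exp (- (a + b) * t)"
    have E0: "0 \<le> E" using f(1) g(1) by (simp add: E_def)
    have "exp (- a * t) * exp (- b * t) = exp (- (a + b) * t)"
      unfolding exp_add[symmetric] by (simp add: algebra_simps)
    hence E: "(K * exp (- a * t)) * (L * exp (- b * t)) = E" by (simp add: E_def)
    have *: "\<bar>y * z\<bar> \<le> E" if "\<bar>y\<bar> \<le> K * exp (- a * t)" "\<bar>z\<bar> \<le> L * exp (- b * t)" for y z
      unfolding abs_mult E[symmetric] by (rule mult_mono[OF that]) (use f(1) in auto)
    \<comment> \<open>The second derivative of a product is written with four summands, each at most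
      E.\<close>
    have "4 * (K * L) * exp (- (a + b) * t) = (E + E) + (E + E)" by (simp add: E_def)
    moreover have "\<bar>f t x * g t x\<bar> \<le> E" by (rule *[OF f(4)[OF t] g(4)[OF t]])
    moreover have "\<bar>f1 t x * g t x + f t x * g1 t x\<bar> \<le> E + E"
      by (rule order_trans[OF abs_triangle_ineq add_mono[OF *[OF f(5)[OF t] g(4)[OF t]] *[OF f(4)[OF t] g(5)[OF t]]]])
    moreover have "\<bar>(f2 t x * g t x + f1 t x * g1 t x) + (f1 t x * g1 t x + f t x * g2 t x)\<bar> \<le> (E + E) + (E + E)"
      by (intro order_trans[OF abs_triangle_ineq] add_mono *[OF f(6)[OF t] g(4)[OF t]] *[OF f(5)[OF t] g(5)[OF t]] *[OF f(4)[OF t] g(6)[OF t]])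
    ultimately show "\<bar>f t x * g t x\<bar> \<le> 4 * (K * L) * exp (- (a + b) * t)"
      "\<bar>f1 t x * g t x + f t x * g1 t x\<bar> \<le> 4 * (K * L) * exp (- (a + b) * t)"
      "\<bar>(f2 t x * g t x + f1 t x * g1 t x) + (f1 t x * g1 t x + f t x * g2 t x)\<bar> \<le> 4 * (K * L) * exp (- (a + b) * t)"
      using E0 by simp_all
  qed
qed

lemma fam_const: "fam T 0 (\<lambda>t x. c)"
  by (rule famI[of T _ "\<lambda>t x. 0" "\<lambda>t x. 0" "\<bar>c\<bar>"]) (auto simp: c1_deriv_def)

lemma fam_zero: "fam T a (\<lambda>t x. 0)"
  by (rule famI[of T _ "\<lambda>t x. 0" "\<lambda>t x. 0" 0]) (auto simp: c1_deriv_def)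

lemma fam_power: "fam T 0 f \<Longrightarrow> fam T 0 (\<lambda>t x. f t x ^ n)"
proof (induction n)
  case (Suc n)
  show ?case using fam_mult[OF Suc.prems Suc.IH[OF Suc.prems]] by simp
qed (simp add: fam_const)

lemma fam_sum: "(\<And>i. i \<in> I \<Longrightarrow> fam T a (f i)) \<Longrightarrow> fam T a (\<lambda>t x. \<Sum>i\<in>I. f i t x)"
proof (induction I rule: infinite_finite_induct)
  case (insert i I)
  thus ?case by (simp add: fam_add)
qed (simp_all add: fam_zero)

lemma fam_mult0: "fam T a f \<Longrightarrow> fam T 0 g \<Longrightarrow> fam T a (\<lambda>t x. f t x * g t x)"
  using fam_mult[of T a f 0 g] by simp

lemma fam_power_diff:
  assumes f: "fam T 0 f" and g: "fam T 0 g" and d: "fam T a (\<lambda>t x. f t x - g t x)"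
  shows "fam T a (\<lambda>t x. f t x ^ n - g t x ^ n)"
proof (induction n)
  case (Suc n)
  have "fam T a (\<lambda>t x. (f t x ^ n - g t x ^ n) * f t x + (f t x - g t x) * g t x ^ n)"
    by (intro fam_add fam_mult0 Suc f d fam_power g)
  thus ?case by (rule back_subst[of "fam T a"]) (simp add: fun_eq_iff algebra_simps)
qed (simp add: fam_zero)

context eigen
begin

text \<open>A solution in the moving frame with its expansion up to exp(-2 e0 t). The decomposition
  holds at every x and not merely almost everywhere, and the remainder carries three derivatives as
  separate functions, the amount of regularity that \<open>flow\<close> asks for. The last term of
  the equation is the transport term of the frame.\<close>

definition asymptotic :: "real \<Rightarrow> real \<Rightarrow> (real \<Rightarrow> real \<Rightarrow> real) \<Rightarrow> bool" where
  "asymptotic A S v \<longleftrightarrow> (\<exists>\<rho> C. \<forall>t\<ge>S.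
     (\<forall>i\<le>2. c1_deriv (\<rho> t i) (\<rho> t (Suc i))) \<and>
     (\<forall>i\<le>3. sqint (\<rho> t i) \<and> nrm (\<rho> t i) \<le> C * exp (- 2 * e0 * t)) \<and>
     (\<forall>x. v t x = Q p x + A * exp (- e0 * t) * Y x + \<rho> t 0 x) \<and>
     (\<forall>\<phi>\<in>test_functions. ((\<lambda>s. LINT x|lborel. v s x * \<phi> x) has_real_derivative
        (LINT x|lborel. v t x * (deriv ^^ 3) \<phi> x + v t x ^ p * deriv \<phi> x - v t x * deriv \<phi> x)) (at t within {S..})))"

lemma asymptotic_shift:
  assumes "asymptotic A S v" shows "asymptotic (A * exp (- e0 * \<tau>)) (S - \<tau>) (\<lambda>t. v (t + \<tau>))"
proof -
  obtain \<rho> C where \<rho>: "\<And>t i. S \<le> t \<Longrightarrow> i \<le> 2 \<Longrightarrow> c1_deriv (\<rho> t i) (\<rho> t (Suc i))"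
    "\<And>t i. S \<le> t \<Longrightarrow> i \<le> 3 \<Longrightarrow> sqint (\<rho> t i)" "\<And>t i. S \<le> t \<Longrightarrow> i \<le> 3 \<Longrightarrow> nrm (\<rho> t i) \<le> C * exp (- 2 * e0 * t)"
    "\<And>t x. S \<le> t \<Longrightarrow> v t x = Q p x + A * exp (- e0 * t) * Y x + \<rho> t 0 x"
    "\<And>t \<phi>. S \<le> t \<Longrightarrow> \<phi> \<in> test_functions \<Longrightarrow> ((\<lambda>s. LINT x|lborel. v s x * \<phi> x) has_real_derivative
        (LINT x|lborel. v t x * (deriv ^^ 3) \<phi> x + v t x ^ p * deriv \<phi> x - v t x * deriv \<phi> x)) (at t within {S..})"
    using assms unfolding asymptotic_def by blast
  have E: "exp (- c * e0 * (t + \<tau>)) = exp (- c * e0 * \<tau>) * exp (- c * e0 * t)" for c t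
    unfolding exp_add[symmetric] by (simp add: algebra_simps)
  show ?thesis
    unfolding asymptotic_def
  proof (intro exI[of _ "\<lambda>t. \<rho> (t + \<tau>)"] exI[of _ "C * exp (- 2 * e0 * \<tau>)"] allI impI conjI ballI)
    fix t assume "S - \<tau> \<le> t"
    hence t: "S \<le> t + \<tau>" by simp
    show "c1_deriv (\<rho> (t + \<tau>) i) (\<rho> (t + \<tau>) (Suc i))" if "i \<le> 2" for i by (rule \<rho>(1)[OF t that])
    show "sqint (\<rho> (t + \<tau>) i)" "nrm (\<rho> (t + \<tau>) i) \<le> C * exp (- 2 * e0 * \<tau>) * exp (- 2 * e0 * t)" if "i \<le> 3" for i
      using \<rho>(2,3)[OF t that] E[of 2 t] by (simp_all add: mult.assoc)
    show "v (t + \<tau>) x = Q p x + A * exp (- e0 * \<tau>) * exp (- e0 * t) * Y x + \<rho> (t + \<tau>) 0 x" for x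
      using \<rho>(4)[OF t, of x] E[of 1 t] by (simp add: mult.assoc)
    fix \<phi> :: "real \<Rightarrow> real" assume \<phi>: "\<phi> \<in> test_functions"
    have im: "(\<lambda>s. s + \<tau>) ` {S - \<tau>..} = {S..}"
    proof (rule set_eqI)
      fix x
      show "x \<in> (\<lambda>s. s + \<tau>) ` {S - \<tau>..} \<longleftrightarrow> x \<in> {S..}"
        using image_eqI[of x "\<lambda>s. s + \<tau>" "x - \<tau>" "{S - \<tau>..}"] by auto
    qed
    have d: "((\<lambda>s. s + \<tau>) has_real_derivative 1) (at t within {S - \<tau>..})"
      by (auto intro!: derivative_eq_intros)
    show "((\<lambda>s. LINT x|lborel. v (s + \<tau>) x * \<phi> x) has_real_derivative
        (LINT x|lborel. v (t + \<tau>) x * (deriv ^^ 3) \<phi> x + v (t + \<tau>) x ^ p * deriv \<phi> x - v (t + \<tau>) x * deriv \<phi> x))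
        (at t within {S - \<tau>..})"
      using DERIV_image_chain[where g = "\<lambda>s. s + \<tau>" and s = "{S - \<tau>..}", unfolded im, OF \<rho>(5)[OF t \<phi>] d] by (simp only: o_def mult_1_right)
  qed
qed

lemma asymptotic_mono:
  assumes "asymptotic A S v" "S \<le> R" shows "asymptotic A R v"
proof -
  have le: "S \<le> t" if "R \<le> t" for t using assms(2) that by simp
  have sub: "{R..} \<subseteq> {S..}" using assms(2) by simp
  obtain \<rho> C where \<rho>: "\<And>t. S \<le> t \<Longrightarrow>
     (\<forall>i\<le>2. c1_deriv (\<rho> t i) (\<rho> t (Suc i))) \<and>
     (\<forall>i\<le>3. sqint (\<rho> t i) \<and> nrm (\<rho> t i) \<le> C * exp (- 2 * e0 * t)) \<and>
     (\<forall>x. v t x = Q p x + A * exp (- e0 * t) * Y x + \<rho> t 0 x) \<and>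
     (\<forall>\<phi>\<in>test_functions. ((\<lambda>s. LINT x|lborel. v s x * \<phi> x) has_real_derivative
        (LINT x|lborel. v t x * (deriv ^^ 3) \<phi> x + v t x ^ p * deriv \<phi> x - v t x * deriv \<phi> x)) (at t within {S..}))"
    using assms(1) unfolding asymptotic_def by blast
  show ?thesis
    unfolding asymptotic_def
  proof (intro exI[of _ \<rho>] exI[of _ C] allI impI)
    fix t assume "R \<le> t"
    from \<rho>[OF le[OF this]] show "(\<forall>i\<le>2. c1_deriv (\<rho> t i) (\<rho> t (Suc i))) \<and>
     (\<forall>i\<le>3. sqint (\<rho> t i) \<and> nrm (\<rho> t i) \<le> C * exp (- 2 * e0 * t)) \<and>
     (\<forall>x. v t x = Q p x + A * exp (- e0 * t) * Y x + \<rho> t 0 x) \<and>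
     (\<forall>\<phi>\<in>test_functions. ((\<lambda>s. LINT x|lborel. v s x * \<phi> x) has_real_derivative
        (LINT x|lborel. v t x * (deriv ^^ 3) \<phi> x + v t x ^ p * deriv \<phi> x - v t x * deriv \<phi> x)) (at t within {R..}))"
      using DERIV_subset[OF _ sub] by blast
  qed
qed

text \<open>Stationarity in the moving frame: Q^p - Q = - \<open>Q''\<close>, and two integrations
  by parts cancel this against the third derivative of the test function.\<close>

lemma soliton_asymptotic: "asymptotic 0 S (\<lambda>t. Q p)"
  unfolding asymptotic_def
proof (intro exI[of _ "\<lambda>t i x. 0"] exI[of _ 0] allI impI conjI ballI)
  fix t and \<phi> :: "real \<Rightarrow> real" assume \<phi>: "\<phi> \<in> test_functions"
  note \<phi>1 = test_deriv[OF \<phi>] note \<phi>2 = test_deriv[OF \<phi>1] note \<phi>3 = test_deriv[OF \<phi>2]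
  have 3: "(deriv ^^ 3) \<phi> = deriv (deriv (deriv \<phi>))" by (simp add: numeral_3_eq_3)
  have Qp: "Q p x ^ p = W x * Q p x" for x
    using power_Suc[of "Q p x" "p - 1"] p_gt unfolding Q_power by (simp add: mult.commute)
  have eq: "Q p x ^ p - Q p x = - Q'' x" for x unfolding Qp Q''_def by simp
  have "(LINT x|lborel. Q p x * (deriv ^^ 3) \<phi> x + Q p x ^ p * deriv \<phi> x - Q p x * deriv \<phi> x) =
     (LINT x|lborel. Q p x * deriv (deriv (deriv \<phi>)) x - Q'' x * deriv \<phi> x)"
    unfolding 3 add_diff_eq[symmetric] left_diff_distrib[symmetric] eq by simp
  also have "\<dots> = (LINT x|lborel. Q p x * deriv (deriv (deriv \<phi>)) x) - (LINT x|lborel. Q'' x * deriv \<phi> x)"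
    by (intro Bochner_Integration.integral_diff continuous_test_integrable \<phi>1 \<phi>3 Q_cont Q''_cont)
  also have "\<dots> = 0"
    using integral_by_parts_test[OF c1_Q \<phi>2] integral_by_parts_test[OF c1_Q' \<phi>1] by simp
  finally show "((\<lambda>s. LINT x|lborel. Q p x * \<phi> x) has_real_derivative
      (LINT x|lborel. Q p x * (deriv ^^ 3) \<phi> x + Q p x ^ p * deriv \<phi> x - Q p x * deriv \<phi> x)) (at t within {S..})"
    by simp
qed (auto simp: c1_deriv_def sqint_zero nrm_def)

text \<open>A sup bound for Y'' cannot come from \<open>sqint_sup_le\<close> directly, as no
  derivative of Y'' is given. It is read off from Y'' = V Y - L Y, where L Y is differentiable by
  the eigenvalue equation.\<close>

lemma Y_fam: "fam S e0 (\<lambda>t x. A * exp (- e0 * t) * Y x)"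
proof -
  define M where "M = nrm Y + nrm Y1 + (nrm Y1 + nrm Y2) + (CV * (nrm Y + nrm Y1) + (nrm LY + nrm (\<lambda>x. - e0 * Y x)))"
  have b: "\<bar>Y x\<bar> \<le> nrm Y + nrm Y1" "\<bar>Y1 x\<bar> \<le> nrm Y1 + nrm Y2" "\<bar>LY x\<bar> \<le> nrm LY + nrm (\<lambda>x. - e0 * Y x)" for x
    by (intro sqint_sup_le Y_c1 LY_c1 Y_sq LY_sq sqint_cmult)+
  have b2: "\<bar>Y2 x\<bar> \<le> CV * (nrm Y + nrm Y1) + (nrm LY + nrm (\<lambda>x. - e0 * Y x))" for x
  proof -
    have "Y2 x = V x * Y x - LY x" by (simp add: Lop_def)
    moreover have "\<bar>V x * Y x\<bar> \<le> CV * (nrm Y + nrm Y1)"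
      unfolding abs_mult using CV_pos by (intro mult_mono V_bound b) auto
    ultimately show ?thesis using b(3)[of x] by linarith
  qed
  have n: "0 \<le> nrm Y" "0 \<le> nrm Y1" "0 \<le> nrm Y2" "0 \<le> nrm LY" "0 \<le> nrm (\<lambda>x. - e0 * Y x)" by auto
  have "0 \<le> CV * (nrm Y + nrm Y1)" using CV_pos by simp
  hence M: "\<bar>Y x\<bar> \<le> M" "\<bar>Y1 x\<bar> \<le> M" "\<bar>Y2 x\<bar> \<le> M" for x
    unfolding M_def using b[of x] b2[of x] n by linarith+
  have *: "\<bar>A * exp (- e0 * t) * y\<bar> \<le> (\<bar>A\<bar> * M) * exp (- e0 * t)" if "\<bar>y\<bar> \<le> M" for t y
    using mult_left_mono[OF that, of "\<bar>A\<bar> * exp (- e0 * t)"] by (simp add: abs_mult mult_ac)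
  show ?thesis
    by (rule famI[of S _ "\<lambda>t x. A * exp (- e0 * t) * Y1 x" "\<lambda>t x. A * exp (- e0 * t) * Y2 x" "\<bar>A\<bar> * M"])
       (intro c1_deriv_cmult Y_c1 * M)+
qed

lemma fam_Q: "fam S 0 (\<lambda>t. Q p)"
proof (rule famI[of S _ "\<lambda>t. Q'" "\<lambda>t. Q''" "CV * CV"])
  have c: "CV \<le> CV * CV" using CV_pos by simp
  show "\<bar>Q p x\<bar> \<le> CV * CV * exp (- 0 * t)" "\<bar>Q' x\<bar> \<le> CV * CV * exp (- 0 * t)" "\<bar>Q'' x\<bar> \<le> CV * CV * exp (- 0 * t)" for t x
    using Q_pos[of x] order_trans[OF Q_le[of x] c] order_trans[OF Q'_le[of x] c] Q''_le[of x] by auto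
qed (rule c1_Q c1_Q')+

text \<open>The Sobolev embedding turns the L^2 bounds of the remainder and its three derivatives
  into sup bounds of its first two; the factor 2 comes from the two norms in
  \<open>sqint_sup_le\<close>.\<close>

lemma asymptotic_fam:
  assumes "asymptotic A S v" "0 \<le> S"
  shows "fam S e0 (\<lambda>t x. v t x - Q p x)" "fam S 0 v"
proof -
  obtain \<rho> C where \<rho>: "\<And>t i. S \<le> t \<Longrightarrow> i \<le> 2 \<Longrightarrow> c1_deriv (\<rho> t i) (\<rho> t (Suc i))"
    "\<And>t i. S \<le> t \<Longrightarrow> i \<le> 3 \<Longrightarrow> sqint (\<rho> t i)" "\<And>t i. S \<le> t \<Longrightarrow> i \<le> 3 \<Longrightarrow> nrm (\<rho> t i) \<le> C * exp (- 2 * e0 * t)"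
    "\<And>t x. S \<le> t \<Longrightarrow> v t x = Q p x + A * exp (- e0 * t) * Y x + \<rho> t 0 x"
    using assms unfolding asymptotic_def by blast
  have "fam S (2 * e0) (\<lambda>t. \<rho> t 0)"
  proof (rule famI[of S _ "\<lambda>t. \<rho> t 1" "\<lambda>t. \<rho> t 2" "2 * C"])
    have "\<bar>\<rho> t i x\<bar> \<le> 2 * C * exp (- (2 * e0) * t)" if "S \<le> t" "i \<le> 2" for t i x
      using sqint_sup_le[OF \<rho>(1)[OF that] \<rho>(2)[OF that(1)] \<rho>(2)[OF that(1)], of x]
        \<rho>(3)[OF that(1), of i] \<rho>(3)[OF that(1), of "Suc i"] that(2) by simp
    thus "\<bar>\<rho> t 0 x\<bar> \<le> 2 * C * exp (- (2 * e0) * t)" "\<bar>\<rho> t 1 x\<bar> \<le> 2 * C * exp (- (2 * e0) * t)"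
      "\<bar>\<rho> t 2 x\<bar> \<le> 2 * C * exp (- (2 * e0) * t)" if "S \<le> t" for t x using that by auto
  qed (use \<rho>(1)[of _ 0] \<rho>(1)[of _ 1] in \<open>auto simp: numeral_2_eq_2\<close>)
  hence "fam S e0 (\<lambda>t. \<rho> t 0)" by (rule fam_mono) (use e0 assms(2) in auto)
  from fam_add[OF Y_fam this] obtain K f1 f2 where "fam_bound S e0 K (\<lambda>t x. A * exp (- e0 * t) * Y x + \<rho> t 0 x) f1 f2"
    unfolding fam_def by blast
  note f = fam_boundD[OF this]
  have v: "v t x - Q p x = A * exp (- e0 * t) * Y x + \<rho> t 0 x" if "S \<le> t" for t x
    using \<rho>(4)[OF that, of x] by simp
  show 1: "fam S e0 (\<lambda>t x. v t x - Q p x)"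
    by (rule famI[of S _ f1 f2 K]) (simp_all only: v f)
  have "fam S 0 (\<lambda>t x. (v t x - Q p x) + Q p x)"
    by (rule fam_add[OF fam_mono[OF 1] fam_Q]) (use e0 assms(2) in auto)
  thus "fam S 0 v" by simp
qed

text \<open>With equal A the leading terms cancel in v1 - v2, which leaves the difference of the
  remainders, of size exp(-2 e0 t). It satisfies the hypotheses of \<open>flow\<close>, whose
  conclusion then gives equality for large times.\<close>

theorem asymptotic_unique:
  assumes v1: "asymptotic A S v1" and v2: "asymptotic A S v2" and S: "0 \<le> S"
  shows "\<exists>R\<ge>S. \<forall>t\<ge>R. \<forall>x. v1 t x = v2 t x"
proof -
  obtain \<rho>1 C1 where \<rho>1: "\<And>t i. S \<le> t \<Longrightarrow> i \<le> 2 \<Longrightarrow> c1_deriv (\<rho>1 t i) (\<rho>1 t (Suc i))"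
    "\<And>t i. S \<le> t \<Longrightarrow> i \<le> 3 \<Longrightarrow> sqint (\<rho>1 t i)" "\<And>t i. S \<le> t \<Longrightarrow> i \<le> 3 \<Longrightarrow> nrm (\<rho>1 t i) \<le> C1 * exp (- 2 * e0 * t)"
    "\<And>t x. S \<le> t \<Longrightarrow> v1 t x = Q p x + A * exp (- e0 * t) * Y x + \<rho>1 t 0 x"
    "\<And>t \<phi>. S \<le> t \<Longrightarrow> \<phi> \<in> test_functions \<Longrightarrow> ((\<lambda>s. LINT x|lborel. v1 s x * \<phi> x) has_real_derivative
        (LINT x|lborel. v1 t x * (deriv ^^ 3) \<phi> x + v1 t x ^ p * deriv \<phi> x - v1 t x * deriv \<phi> x)) (at t within {S..})"
    using v1 unfolding asymptotic_def by blast
  obtain \<rho>2 C2 where \<rho>2: "\<And>t i. S \<le> t \<Longrightarrow> i \<le> 2 \<Longrightarrow> c1_deriv (\<rho>2 t i) (\<rho>2 t (Suc i))"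
    "\<And>t i. S \<le> t \<Longrightarrow> i \<le> 3 \<Longrightarrow> sqint (\<rho>2 t i)" "\<And>t i. S \<le> t \<Longrightarrow> i \<le> 3 \<Longrightarrow> nrm (\<rho>2 t i) \<le> C2 * exp (- 2 * e0 * t)"
    "\<And>t x. S \<le> t \<Longrightarrow> v2 t x = Q p x + A * exp (- e0 * t) * Y x + \<rho>2 t 0 x"
    "\<And>t \<phi>. S \<le> t \<Longrightarrow> \<phi> \<in> test_functions \<Longrightarrow> ((\<lambda>s. LINT x|lborel. v2 s x * \<phi> x) has_real_derivative
        (LINT x|lborel. v2 t x * (deriv ^^ 3) \<phi> x + v2 t x ^ p * deriv \<phi> x - v2 t x * deriv \<phi> x)) (at t within {S..})"
    using v2 unfolding asymptotic_def by blast
  \<comment> \<open>The divided difference of the nonlinearity: v1^p - v2^p = (v1 - v2) \<sigma>. At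
    v1 = v2 = Q it equals p Q^(p-1) = p W, so \<sigma> - p W is the coefficient g, of size exp(-e0
    t) because v1 and v2 are that close to Q.\<close>
  define \<sigma> where "\<sigma> = (\<lambda>t x. \<Sum>i<p. v1 t x ^ i * v2 t x ^ (p - Suc i))"
  have "fam S e0 (\<lambda>t x. \<Sum>i<p. v1 t x ^ i * v2 t x ^ (p - Suc i) - Q p x ^ i * Q p x ^ (p - Suc i))"
  proof (rule fam_sum)
    fix i
    have "fam S e0 (\<lambda>t x. (v1 t x ^ i - Q p x ^ i) * v2 t x ^ (p - Suc i) + (v2 t x ^ (p - Suc i) - Q p x ^ (p - Suc i)) * Q p x ^ i)"
      by (intro fam_add fam_mult0 fam_power fam_power_diff asymptotic_fam[OF v1 S] asymptotic_fam[OF v2 S] fam_Q)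
    thus "fam S e0 (\<lambda>t x. v1 t x ^ i * v2 t x ^ (p - Suc i) - Q p x ^ i * Q p x ^ (p - Suc i))"
      by (rule back_subst[of "fam S e0"]) (simp add: fun_eq_iff algebra_simps)
  qed
  then obtain K g1 g2 where "fam_bound S e0 K (\<lambda>t x. \<Sum>i<p. v1 t x ^ i * v2 t x ^ (p - Suc i) - Q p x ^ i * Q p x ^ (p - Suc i)) g1 g2"
    unfolding fam_def by blast
  moreover have "(\<lambda>t x. \<Sum>i<p. v1 t x ^ i * v2 t x ^ (p - Suc i) - Q p x ^ i * Q p x ^ (p - Suc i)) = (\<lambda>t x. \<sigma> t x - real p * W x)"
  proof (intro ext)
    fix t x
    have "(\<Sum>i<p. Q p x ^ i * Q p x ^ (p - Suc i)) = (\<Sum>i<p. W x)"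
      by (rule sum.cong) (auto simp: Q_power[symmetric] power_add[symmetric])
    thus "(\<Sum>i<p. v1 t x ^ i * v2 t x ^ (p - Suc i) - Q p x ^ i * Q p x ^ (p - Suc i)) = \<sigma> t x - real p * W x"
      by (simp add: sum_subtractf \<sigma>_def)
  qed
  ultimately have "fam_bound S e0 K (\<lambda>t x. \<sigma> t x - real p * W x) g1 g2" by simp
  note g = fam_boundD[OF this]
  define w where "w = (\<lambda>t i x. \<rho>1 t i x - \<rho>2 t i x)"
  have w0: "v1 t x - v2 t x = w t 0 x" if "S \<le> t" for t x using \<rho>1(4)[OF that] \<rho>2(4)[OF that] by (simp add: w_def)
  have cont: "continuous_on UNIV (v t)" if v: "asymptotic A S v" and t: "S \<le> t" for v t
  proof -
    obtain L h1 h2 where "fam_bound S 0 L v h1 h2" using asymptotic_fam(2)[OF v S] unfolding fam_def by blast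
    from fam_boundD(2)[OF this t] show ?thesis by (rule c1_deriv_cont(1))
  qed
  \<comment> \<open>One constant for both kinds of bounds in \<open>flow\<close>: K for the
    coefficient, C1 + C2 for the difference of the remainders.\<close>
  define M where "M = max K (C1 + C2)"
  have KM: "K * exp (- e0 * t) \<le> M * exp (- e0 * t)" for t by (intro mult_right_mono) (auto simp: M_def)
  interpret flow p e0 Y Y1 Y2 S M w "\<lambda>t x. \<sigma> t x - real p * W x" g1 g2
  proof
    show "0 \<le> S" by (rule S)
    fix t assume t: "S \<le> t"
    show "c1_deriv (w t i) (w t (Suc i))" if "i \<le> 2" for i
      unfolding w_def by (rule c1_deriv_diff[OF \<rho>1(1)[OF t that] \<rho>2(1)[OF t that]])
    show "sqint (w t i)" if "i \<le> 3" for i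
      unfolding w_def by (rule sqint_diff[OF \<rho>1(2)[OF t that] \<rho>2(2)[OF t that]])
    show "nrm (w t i) \<le> M * exp (- 2 * e0 * t)" if "i \<le> 3" for i
    proof -
      have "nrm (w t i) \<le> nrm (\<rho>1 t i) + nrm (\<rho>2 t i)"
        unfolding w_def by (rule nrm_triangle_diff[OF \<rho>1(2)[OF t that] \<rho>2(2)[OF t that]])
      also have "\<dots> \<le> (C1 + C2) * exp (- 2 * e0 * t)" unfolding distrib_right by (intro add_mono \<rho>1(3) \<rho>2(3) t that)
      also have "\<dots> \<le> M * exp (- 2 * e0 * t)" by (intro mult_right_mono) (auto simp: M_def)
      finally show ?thesis .
    qed
    show "c1_deriv (\<lambda>x. \<sigma> t x - real p * W x) (g1 t)" "c1_deriv (g1 t) (g2 t)" by (rule g(2)[OF t], rule g(3)[OF t])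
    show "\<bar>\<sigma> t x - real p * W x\<bar> \<le> M * exp (- e0 * t)" "\<bar>g1 t x\<bar> \<le> M * exp (- e0 * t)" "\<bar>g2 t x\<bar> \<le> M * exp (- e0 * t)" for x
      by (rule order_trans[OF g(4)[OF t] KM], rule order_trans[OF g(5)[OF t] KM], rule order_trans[OF g(6)[OF t] KM])
    fix \<phi> :: "real \<Rightarrow> real" assume \<phi>: "\<phi> \<in> test_functions"
    note \<phi>1 = test_deriv[OF \<phi>] and \<phi>3 = test_deriv3[OF \<phi>]
    have int: "integrable lborel (\<lambda>x. v t x * (deriv ^^ 3) \<phi> x + v t x ^ p * deriv \<phi> x - v t x * deriv \<phi> x)"
      if "asymptotic A S v" for v
      by (intro Bochner_Integration.integrable_add Bochner_Integration.integrable_diff continuous_test_integrable \<phi>1 \<phi>3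
          cont[OF that t] continuous_on_power)
    have "((\<lambda>s. (LINT x|lborel. v1 s x * \<phi> x) - (LINT x|lborel. v2 s x * \<phi> x)) has_real_derivative
        (LINT x|lborel. v1 t x * (deriv ^^ 3) \<phi> x + v1 t x ^ p * deriv \<phi> x - v1 t x * deriv \<phi> x) -
        (LINT x|lborel. v2 t x * (deriv ^^ 3) \<phi> x + v2 t x ^ p * deriv \<phi> x - v2 t x * deriv \<phi> x)) (at t within {S..})"
      by (rule DERIV_diff[OF \<rho>1(5)[OF t \<phi>] \<rho>2(5)[OF t \<phi>]])
    also have "(LINT x|lborel. v1 t x * (deriv ^^ 3) \<phi> x + v1 t x ^ p * deriv \<phi> x - v1 t x * deriv \<phi> x) -
        (LINT x|lborel. v2 t x * (deriv ^^ 3) \<phi> x + v2 t x ^ p * deriv \<phi> x - v2 t x * deriv \<phi> x) =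
        (LINT x|lborel. (v1 t x * (deriv ^^ 3) \<phi> x + v1 t x ^ p * deriv \<phi> x - v1 t x * deriv \<phi> x) -
          (v2 t x * (deriv ^^ 3) \<phi> x + v2 t x ^ p * deriv \<phi> x - v2 t x * deriv \<phi> x))"
      by (rule Bochner_Integration.integral_diff[symmetric, OF int[OF v1] int[OF v2]])
    also have "\<dots> = (LINT x|lborel. w t 0 x * (deriv ^^ 3) \<phi> x - (V x - (\<sigma> t x - real p * W x)) * w t 0 x * deriv \<phi> x)"
    proof (rule Bochner_Integration.integral_cong[OF refl])
      fix x
      have "v1 t x ^ p - v2 t x ^ p = (v1 t x - v2 t x) * \<sigma> t x"
        unfolding \<sigma>_def power_diff_sumr2 by (simp add: mult.commute)
      hence 1: "v1 t x ^ p = v2 t x ^ p + (v1 t x - v2 t x) * \<sigma> t x" by simp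
      show "(v1 t x * (deriv ^^ 3) \<phi> x + v1 t x ^ p * deriv \<phi> x - v1 t x * deriv \<phi> x) -
          (v2 t x * (deriv ^^ 3) \<phi> x + v2 t x ^ p * deriv \<phi> x - v2 t x * deriv \<phi> x) =
          w t 0 x * (deriv ^^ 3) \<phi> x - (V x - (\<sigma> t x - real p * W x)) * w t 0 x * deriv \<phi> x"
        unfolding w0[OF t, symmetric] V_def 1 by (simp only: algebra_simps)
    qed
    finally show "((\<lambda>s. LINT x|lborel. w s 0 x * \<phi> x) has_real_derivative
        (LINT x|lborel. w t 0 x * (deriv ^^ 3) \<phi> x - (V x - (\<sigma> t x - real p * W x)) * w t 0 x * deriv \<phi> x)) (at t within {S..})"
    proof (rule has_field_derivative_transform_within[where d = 1])
      fix s assume "s \<in> {S..}"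
      hence s: "S \<le> s" by simp
      have "(LINT x|lborel. v1 s x * \<phi> x) - (LINT x|lborel. v2 s x * \<phi> x) = (LINT x|lborel. v1 s x * \<phi> x - v2 s x * \<phi> x)"
        by (rule Bochner_Integration.integral_diff[symmetric]) (intro continuous_test_integrable \<phi> cont[OF v1 s] cont[OF v2 s])+
      also have "\<dots> = (LINT x|lborel. w s 0 x * \<phi> x)"
        unfolding w0[OF s, symmetric] left_diff_distrib ..
      finally show "(LINT x|lborel. v1 s x * \<phi> x) - (LINT x|lborel. v2 s x * \<phi> x) = (LINT x|lborel. w s 0 x * \<phi> x)" .
    qed (use t in auto)
  qed
  obtain R where R: "S \<le> R" "\<And>t x. R \<le> t \<Longrightarrow> w t 0 x = 0" using flow_eventually_0 by blast
  have "v1 t x = v2 t x" if "R \<le> t" for t x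
    using w0[of t x] R(2)[OF that, of x] R(1) that by simp
  thus ?thesis using R(1) by blast
qed

end

section \<open>The special solutions\<close>

lemma AE_lborel_shift:
  fixes c :: real
  assumes "AE x in lborel. P x" shows "AE x in lborel. P (x + c)"
proof -
  obtain N where N: "N \<in> null_sets lborel" "{x. \<not> P x} \<subseteq> N" using assms unfolding eventually_ae_filter by auto
  have "AE x in lborel. c + 1 * x \<notin> N"
    by (rule AE_borel_affine[OF _ _ AE_not_in[OF N(1)]]) (use N(1) in \<open>auto simp: null_sets_def\<close>)
  thus ?thesis by eventually_elim (use N(2) in \<open>auto simp: add.commute\<close>)
qed

context eigen
begin

text \<open>The order 5 is what \<open>sob_rep_c1\<close> asks for to differentiate
  \<open>sob_rep 3\<close>. Since u is determined only almost everywhere, the statement passes to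
  the continuous function v; the sup bound of v, carried back to u, is what
  \<open>moving_frame\<close> requires.\<close>

lemma special_solution_asymptotic:
  assumes u: "gkdv_solution p s0 u" and YY: "AE x in lborel. Yp x = Y x"
    and r: "\<And>t. s0 \<le> t \<Longrightarrow> cplx (\<lambda>x. u t (x + t) - Q p x - A * exp (- e0 * t) * Yp x) \<in> Sob 5"
      "\<And>t. s0 \<le> t \<Longrightarrow> Sob_norm 5 (cplx (\<lambda>x. u t (x + t) - Q p x - A * exp (- e0 * t) * Yp x)) \<le> C * exp (- 2 * e0 * t)"
  obtains S v where "0 \<le> S" "asymptotic A S v" "\<And>t. S \<le> t \<Longrightarrow> AE x in lborel. u t (x + t) = v t x"
proof -
  \<comment> \<open>At nonnegative times all the exponentials involved are at most 1.\<close>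
  define S where "S = max s0 0"
  have S: "0 \<le> S" and s0: "S \<le> t \<Longrightarrow> s0 \<le> t" for t by (auto simp: S_def)
  define h where "h = (\<lambda>t x. u t (x + t) - Q p x - A * exp (- e0 * t) * Yp x)"
  define \<rho> where "\<rho> = (\<lambda>t i. sob_rep i (cplx (h t)))"
  have h: "cplx (h t) \<in> Sob 5" "Sob_norm 5 (cplx (h t)) \<le> C * exp (- 2 * e0 * t)" if "S \<le> t" for t
    using r[OF s0[OF that]] by (simp_all add: h_def)
  have \<rho>: "c1_deriv (\<rho> t i) (\<rho> t (Suc i))" "sqint (\<rho> t i)" "nrm (\<rho> t i) \<le> C * exp (- 2 * e0 * t)" if "S \<le> t" "i \<le> 3" for t i
    unfolding \<rho>_def
    by (rule sob_rep_c1[OF h(1)[OF that(1)]], use that in simp, rule sob_rep_sqint[OF h(1)[OF that(1)]], use that in simp,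
        rule order_trans[OF sob_rep_sqint(2)[OF h(1)[OF that(1)]] h(2)[OF that(1)]], use that in simp)
  define v where "v = (\<lambda>t x. Q p x + A * exp (- e0 * t) * Y x + \<rho> t 0 x)"
  have uv: "AE x in lborel. u t (x + t) = v t x" if "S \<le> t" for t
  proof -
    have "AE x in lborel. h t x = \<rho> t 0 x" unfolding \<rho>_def by (rule sob_rep_AE[OF h(1)[OF that]]) simp
    thus ?thesis using YY by eventually_elim (simp add: h_def v_def)
  qed
  have sup: "\<bar>\<rho> t 0 x\<bar> \<le> 2 * C * exp (- 2 * e0 * t)" if "S \<le> t" for t x
    using sqint_sup_le[OF \<rho>(1)[OF that] \<rho>(2)[OF that] \<rho>(2)[OF that], of 0 x] \<rho>(3)[OF that, of 0] \<rho>(3)[OF that, of 1] by simp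
  obtain KY f1 f2 where KY: "fam_bound S e0 KY (\<lambda>t x. A * exp (- e0 * t) * Y x) f1 f2" using Y_fam unfolding fam_def by blast
  have C0: "0 \<le> C"
  proof -
    have "0 \<le> 2 * C * exp (- 2 * e0 * S)" using sup[of S 0] by linarith
    thus ?thesis by (simp add: zero_le_mult_iff)
  qed
  \<comment> \<open>Bounds for Q, for the term with Y and for the remainder.\<close>
  define B where "B = CV + KY + 2 * C"
  have B0: "0 \<le> B" using CV_pos fam_boundD(1)[OF KY] C0 by (simp add: B_def)
  have vB: "\<bar>v t x\<bar> \<le> B" if t: "S \<le> t" for t x
  proof -
    have e: "exp (- c * t) \<le> 1" if "0 \<le> c" for c using S t that by (simp add: mult_nonneg_nonneg)
    have "\<bar>A * exp (- e0 * t) * Y x\<bar> \<le> KY * 1"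
      using fam_boundD(4)[OF KY t, of x] mult_left_mono[OF e[of e0] fam_boundD(1)[OF KY]] e0 by linarith
    moreover have "\<bar>\<rho> t 0 x\<bar> \<le> 2 * C * 1"
      using sup[OF t, of x] mult_left_mono[OF e[of "2 * e0"], of "2 * C"] C0 e0 by simp
    ultimately show ?thesis unfolding v_def B_def using Q_le[of x] Q_pos[of x] by linarith
  qed
  have vc: "continuous_on UNIV (v t)" if "S \<le> t" for t
    unfolding v_def using \<rho>(1)[OF that, of 0] Y_c1(1)
    by (intro continuous_on_add Q_cont continuous_on_mult_left) (auto intro: c1_deriv_cont)
  have vm: "v t \<in> borel_measurable borel" if "S \<le> t" for t by (rule borel_measurable_continuous_onI[OF vc[OF that]])
  have um: "u t \<in> borel_measurable borel" if "S \<le> t" for t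
  proof -
    have "cplx (u t) \<in> L2" using u s0[OF that] by (simp add: gkdv_solution_def Sob_def)
    hence "(\<lambda>x. Re (cplx (u t) x)) \<in> borel_measurable borel" by (intro measurable_compose[OF L2_meas borel_measurable_Re])
    thus ?thesis by simp
  qed
  have um': "(\<lambda>x. u t (x + t)) \<in> borel_measurable borel" if "S \<le> t" for t
    by (rule measurable_compose[OF _ um[OF that]]) simp
  have bd: "AE x in lborel. \<bar>u t x\<bar> \<le> B" if "S \<le> t" for t
  proof -
    have "AE x in lborel. \<bar>u t (x + t)\<bar> \<le> B" using uv[OF that] by eventually_elim (simp add: vB[OF that])
    from AE_lborel_shift[OF this, of "- t"] show ?thesis by simp
  qed
  have "asymptotic A S v"
    unfolding asymptotic_def
  proof (intro exI[of _ \<rho>] exI[of _ C] allI impI conjI ballI)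
    fix t assume t: "S \<le> t"
    show "c1_deriv (\<rho> t i) (\<rho> t (Suc i))" if "i \<le> 2" for i by (rule \<rho>(1)[OF t]) (use that in simp)
    show "sqint (\<rho> t i)" "nrm (\<rho> t i) \<le> C * exp (- 2 * e0 * t)" if "i \<le> 3" for i
      by (rule \<rho>(2)[OF t that], rule \<rho>(3)[OF t that])
    show "v t x = Q p x + A * exp (- e0 * t) * Y x + \<rho> t 0 x" for x by (simp add: v_def)
    fix \<phi> :: "real \<Rightarrow> real" assume \<phi>: "\<phi> \<in> test_functions"
    note tm[measurable] = test_measurable[OF \<phi>] test_measurable[OF test_deriv[OF \<phi>]] test_measurable[OF test_deriv3[OF \<phi>]]
      and vm[OF t, measurable] um'[OF t, measurable]
    have "((\<lambda>s. LINT x|lborel. u s (x + s) * \<phi> x) has_real_derivative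
      (LINT x|lborel. u t (x + t) * (deriv ^^ 3) \<phi> x + u t (x + t) ^ p * deriv \<phi> x - u t (x + t) * deriv \<phi> x)) (at t within {S..})"
    proof (rule moving_frame[OF _ um bd B0 \<phi> t])
      fix \<psi> and s :: real assume "\<psi> \<in> test_functions" "S \<le> s"
      hence "((\<lambda>s. LINT x|lborel. u s x * \<psi> x) has_real_derivative
          (LINT x|lborel. u s x * (deriv ^^ 3) \<psi> x + u s x ^ p * deriv \<psi> x)) (at s within {s0..})"
        using u s0[of s] by (simp add: gkdv_solution_def)
      thus "((\<lambda>s. LINT x|lborel. u s x * \<psi> x) has_real_derivative
          (LINT x|lborel. u s x * (deriv ^^ 3) \<psi> x + u s x ^ p * deriv \<psi> x)) (at s within {S..})"
        by (rule DERIV_subset) (simp add: S_def)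
    qed
    also have "(LINT x|lborel. u t (x + t) * (deriv ^^ 3) \<phi> x + u t (x + t) ^ p * deriv \<phi> x - u t (x + t) * deriv \<phi> x) =
        (LINT x|lborel. v t x * (deriv ^^ 3) \<phi> x + v t x ^ p * deriv \<phi> x - v t x * deriv \<phi> x)"
    proof (rule integral_cong_AE)
      show "AE x in lborel. u t (x + t) * (deriv ^^ 3) \<phi> x + u t (x + t) ^ p * deriv \<phi> x - u t (x + t) * deriv \<phi> x =
          v t x * (deriv ^^ 3) \<phi> x + v t x ^ p * deriv \<phi> x - v t x * deriv \<phi> x"
        using uv[OF t] by eventually_elim simp
    qed (measurable; fail)+
    finally show "((\<lambda>s. LINT x|lborel. v s x * \<phi> x) has_real_derivative
        (LINT x|lborel. v t x * (deriv ^^ 3) \<phi> x + v t x ^ p * deriv \<phi> x - v t x * deriv \<phi> x)) (at t within {S..})"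
    proof (rule has_field_derivative_transform_within[where d = 1])
      fix s assume "s \<in> {S..}"
      hence s: "S \<le> s" by simp
      note vm[OF s, measurable] um'[OF s, measurable]
      show "(LINT x|lborel. u s (x + s) * \<phi> x) = (LINT x|lborel. v s x * \<phi> x)"
      proof (rule integral_cong_AE)
        show "AE x in lborel. u s (x + s) * \<phi> x = v s x * \<phi> x" using uv[OF s] by eventually_elim simp
      qed (measurable; fail)+
    qed (use t in auto)
  qed
  from that[OF S this uv] show thesis .
qed

end

theorem proposition4p11:
  fixes p :: nat and e0 :: real and Yp :: "real \<Rightarrow> real"
    and t0 :: "real \<Rightarrow> real" and U :: "real \<Rightarrow> real \<Rightarrow> real \<Rightarrow> real"
  assumes "p > 5"
    and "e0 > 0"
    and "lin_spectrum p \<inter> \<real> = {- complex_of_real e0, 0, complex_of_real e0}"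
    and "simple_eigenvalue p (complex_of_real e0)"
    and "eigenfunction p (complex_of_real e0) (cplx Yp)"
    and "special_family p e0 Yp t0 U"
  shows "(\<forall>A>0. \<exists>tA. \<forall>\<^sub>F t in at_top. AE x in lborel. U A t x = U 1 (t + tA) (x + tA)) \<and>
         (\<forall>\<^sub>F t in at_top. AE x in lborel. U 0 t x = Q p (x - t)) \<and>
         (\<forall>A<0. \<exists>tA. \<forall>\<^sub>F t in at_top. AE x in lborel. U A t x = U (-1) (t + tA) (x + tA))"
proof -
  interpret soliton p by unfold_locales (rule assms(1))
  obtain Y Y1 Y2 where Y: "c1_deriv Y Y1" "c1_deriv Y1 Y2" "sqint Y" "sqint Y1" "sqint Y2"
    "AE x in lborel. Yp x = Y x" "c1_deriv (Lop Y Y2) (\<lambda>x. - e0 * Y x)" "\<exists>x. Y x \<noteq> 0"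
    by (rule eigenfunction_regular[OF assms(5)])
  interpret eigen p e0 Y Y1 Y2
    by unfold_locales (fact assms(2) Y)+
  have profile: "\<exists>S v. 0 \<le> S \<and> asymptotic A S v \<and> (\<forall>t\<ge>S. AE x in lborel. U A t (x + t) = v t x)" for A
  proof -
    obtain C where C: "\<And>t. t0 A \<le> t \<Longrightarrow> cplx (\<lambda>x. U A t (x + t) - Q p x - A * exp (- e0 * t) * Yp x) \<in> Sob 5 \<and>
      Sob_norm 5 (cplx (\<lambda>x. U A t (x + t) - Q p x - A * exp (- e0 * t) * Yp x)) \<le> C * exp (- 2 * e0 * t)"
      using assms(6) unfolding special_family_def Let_def by blast
    have g: "gkdv_solution p (t0 A) (U A)" using assms(6) unfolding special_family_def by blast
    show ?thesis
      by (rule special_solution_asymptotic[OF g Y(6), of A C]) (use C in blast)+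
  qed
  have transfer: "\<exists>R. \<forall>t\<ge>R. \<forall>x. v t x = v' (t + \<tau>) x"
    if "asymptotic A S v" "asymptotic A' S' v'" "A = A' * exp (- e0 * \<tau>)" for A A' S S' v v' \<tau>
  proof -
    define R where "R = max 0 (max S (S' - \<tau>))"
    have "asymptotic A R v" by (rule asymptotic_mono[OF that(1)]) (simp add: R_def)
    moreover have "asymptotic A R (\<lambda>t. v' (t + \<tau>))"
      using asymptotic_mono[OF asymptotic_shift[OF that(2), of \<tau>], of R] by (simp add: R_def that(3))
    ultimately show ?thesis using asymptotic_unique[of A R v "\<lambda>t. v' (t + \<tau>)"] by (auto simp: R_def)
  qed
  have translate: "\<exists>\<tau>. \<forall>\<^sub>F t in at_top. AE x in lborel. U A t x = U A' (t + \<tau>) (x + \<tau>)" if A: "0 < A / A'" for A A'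
  proof -
    \<comment> \<open>Solves A = A' exp(- e0 \<tau>). Only the ratio A / A' enters, so the cases A'
      = 1 and A' = -1 are treated together.\<close>
    define \<tau> where "\<tau> = - ln (A / A') / e0"
    have "- e0 * \<tau> = ln (A / A')" using assms(2) by (simp add: \<tau>_def)
    hence e: "A = A' * exp (- e0 * \<tau>)" using A by (cases "A' = 0") auto
    obtain S v where v: "asymptotic A S v" "\<And>t. S \<le> t \<Longrightarrow> AE x in lborel. U A t (x + t) = v t x" using profile by blast
    obtain S' v' where v': "asymptotic A' S' v'" "\<And>t. S' \<le> t \<Longrightarrow> AE x in lborel. U A' t (x + t) = v' t x" using profile by blast
    obtain R where R: "\<And>t x. R \<le> t \<Longrightarrow> v t x = v' (t + \<tau>) x" using transfer[OF v(1) v'(1) e] by blast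
    have "AE x in lborel. U A t x = U A' (t + \<tau>) (x + \<tau>)" if t: "max R (max S (S' - \<tau>)) \<le> t" for t
    proof -
      have "AE x in lborel. U A t (x + t) = v t x" by (rule v(2)) (use t in simp)
      moreover have "AE x in lborel. U A' (t + \<tau>) (x + (t + \<tau>)) = v' (t + \<tau>) x" by (rule v'(2)) (use t in simp)
      ultimately have "AE x in lborel. U A t (x + t) = U A' (t + \<tau>) (x + (t + \<tau>))"
      proof eventually_elim
        case (elim x)
        thus ?case using R[of t x] t by simp
      qed
      \<comment> \<open>Leaving the frame subtracts t in space on both sides, while the second
        solution is centred at t + \<tau>; the surplus \<tau> is the space translation, equal to the
        time shift because the soliton has speed 1.\<close>
      from AE_lborel_shift[OF this, of "- t"] show ?thesis by simp
    qed
    thus ?thesis unfolding eventually_at_top_linorder by blast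
  qed
  have zero: "\<forall>\<^sub>F t in at_top. AE x in lborel. U 0 t x = Q p (x - t)"
  proof -
    obtain S v where v: "asymptotic 0 S v" "\<And>t. S \<le> t \<Longrightarrow> AE x in lborel. U 0 t (x + t) = v t x" using profile by blast
    obtain R where R: "\<And>t x. R \<le> t \<Longrightarrow> v t x = Q p x" using transfer[OF v(1) soliton_asymptotic, of 0] by auto
    have "AE x in lborel. U 0 t x = Q p (x - t)" if t: "max R S \<le> t" for t
    proof -
      have "AE x in lborel. U 0 t (x + t) = v t x" by (rule v(2)) (use t in simp)
      hence "AE x in lborel. U 0 t (x + t) = Q p x"
        by eventually_elim (use R t in simp)
      from AE_lborel_shift[OF this, of "- t"] show ?thesis by simp
    qed
    thus ?thesis unfolding eventually_at_top_linorder by blast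
  qed
  show ?thesis using translate[of _ 1] translate[of _ "- 1"] zero by simp
qed

end
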